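(* There exist a regular local ring $S$ of unramified mixed characteristic $p>0$ with residue field $K$, and an ideal $I$ of $S$ with $p\in I$, such that for some $i,j\in\mathbb{N}$, $$\dim_K\operatorname{Ext}^{j}_S\left(K,H^{i}_{I}(S)\right)\neq\dim_K\operatorname{Ext}^{j}_{S/pS}\left(K,H^{i-1}_{I S/pS}(S/pS)\right).$$
   Context: $\mathbb{N}$ includes $0$. $H^k_I(-)$ denotes local cohomology with support in $I$ (zero for $k<0$). A regular local ring $(S,\eta)$ of mixed characteristic with residue characteristic $p>0$ is unramified if $p\notin\eta^2$. *)

theory Defs
  imports
    "Jordan_Normal_Form.Missing_VectorSpace"
    "HOL-Library.Extended_Nat"
    "HOL-Algebra.QuotRing"
    "HOL-Algebra.Ideal_Product"
    "HOL-Algebra.Ring_Divisibility"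
begin

section \<open>Regular local rings of unramified mixed characteristic\<close>

definition ring_char :: "('a, 'r) ring_scheme \<Rightarrow> nat"
  where "ring_char R =
    (if \<exists>n::nat. 0 < n \<and> [n] \<cdot>\<^bsub>R\<^esub> \<one>\<^bsub>R\<^esub> = \<zero>\<^bsub>R\<^esub>
     then LEAST n::nat. 0 < n \<and> [n] \<cdot>\<^bsub>R\<^esub> \<one>\<^bsub>R\<^esub> = \<zero>\<^bsub>R\<^esub> else 0)"

definition krull_dim :: "('a, 'r) ring_scheme \<Rightarrow> enat"
  where "krull_dim R =
    Sup {enat n | n. \<exists>P. (\<forall>i\<le>n. primeideal (P i) R) \<and> (\<forall>i<n. P i \<subset> P (Suc i))}"

definition local_ring :: "('a, 'r) ring_scheme \<Rightarrow> 'a set \<Rightarrow> bool"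
  where "local_ring R \<eta> \<longleftrightarrow>
    cring R \<and> maximalideal \<eta> R \<and> (\<forall>J. maximalideal J R \<longrightarrow> J = \<eta>)"

definition regular_local_ring :: "('a, 'r) ring_scheme \<Rightarrow> 'a set \<Rightarrow> bool"
  where "regular_local_ring R \<eta> \<longleftrightarrow>
    noetherian_ring R \<and> local_ring R \<eta> \<and>
    (\<exists>A \<subseteq> carrier R. finite A \<and> \<eta> = genideal R A \<and> enat (card A) = krull_dim R)"

definition unramified_mixed_char :: "('a, 'r) ring_scheme \<Rightarrow> 'a set \<Rightarrow> nat \<Rightarrow> bool"
  where "unramified_mixed_char R \<eta> p \<longleftrightarrow>
    ring_char R = 0 \<and> ring_char (R Quot \<eta>) = p \<and> 0 < p \<and>
    [p] \<cdot>\<^bsub>R\<^esub> \<one>\<^bsub>R\<^esub> \<notin> ideal_prod R \<eta> \<eta>"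


section \<open>Modules and cohomology\<close>

text \<open>Module records inherit the fields \<open>mult\<close> and \<open>one\<close> from rings; the notion of module
  ignores them, and they are left \<open>undefined\<close>.\<close>

text \<open>The ring \<open>B\<close> as a module over the source of the ring homomorphism \<open>\<phi>\<close> into \<open>B\<close>.\<close>
definition module_via :: "('a \<Rightarrow> 'b) \<Rightarrow> ('b, 'r) ring_scheme \<Rightarrow> ('a, 'b) module"
  where "module_via \<phi> B =
    \<lparr>carrier = carrier B, monoid.mult = undefined, monoid.one = undefined,
     ring.zero = \<zero>\<^bsub>B\<^esub>, ring.add = ring.add B,
     module.smult = (\<lambda>a b. \<phi> a \<otimes>\<^bsub>B\<^esub> b)\<rparr>"

abbreviation self_module :: "('a, 'r) ring_scheme \<Rightarrow> ('a, 'a) module"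
  where "self_module R \<equiv> module_via (\<lambda>a. a) R"

definition quotient_module :: "('a, 'b) module \<Rightarrow> 'b set \<Rightarrow> ('a, 'b set) module"
  where "quotient_module M N =
    \<lparr>carrier = a_rcosets\<^bsub>M\<^esub> N, monoid.mult = undefined, monoid.one = undefined,
     ring.zero = N, ring.add = set_add M,
     module.smult = (\<lambda>a Y. \<Union>x\<in>Y. N +>\<^bsub>M\<^esub> (a \<odot>\<^bsub>M\<^esub> x))\<rparr>"

text \<open>\<open>hom_module R M N\<close> is \<open>Hom\<^sub>R(M, N)\<close>; its elements are extensional outside \<open>carrier M\<close>,
  so that equality of homomorphisms is equality of functions.\<close>
definition hom_module ::
    "('a, 'r) ring_scheme \<Rightarrow> ('a, 'b) module \<Rightarrow> ('a, 'c) module \<Rightarrow> ('a, 'b \<Rightarrow> 'c) module"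
  where "hom_module R M N =
    \<lparr>carrier = LinearCombinations.module_hom R M N \<inter> extensional (carrier M), monoid.mult = undefined, monoid.one = undefined,
     ring.zero = (\<lambda>x\<in>carrier M. \<zero>\<^bsub>N\<^esub>),
     ring.add = (\<lambda>f g. \<lambda>x\<in>carrier M. f x \<oplus>\<^bsub>N\<^esub> g x),
     module.smult = (\<lambda>a f. \<lambda>x\<in>carrier M. a \<odot>\<^bsub>N\<^esub> f x)\<rparr>"

text \<open>The complexes here are \<open>0 \<rightarrow> C 0 \<rightarrow> C 1 \<rightarrow> \<dots>\<close> with \<open>d n : C n \<rightarrow> C (n + 1)\<close>.\<close>

fun coboundaries :: "(nat \<Rightarrow> ('a, 'c) module) \<Rightarrow> (nat \<Rightarrow> 'c \<Rightarrow> 'c) \<Rightarrow> nat \<Rightarrow> 'c set"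
  where
    "coboundaries C d 0 = {\<zero>\<^bsub>C 0\<^esub>}"
  | "coboundaries C d (Suc n) = d n ` carrier (C n)"

definition cohomology ::
    "(nat \<Rightarrow> ('a, 'c) module) \<Rightarrow> (nat \<Rightarrow> 'c \<Rightarrow> 'c) \<Rightarrow> nat \<Rightarrow> ('a, 'c set) module"
  where "cohomology C d n =
    quotient_module ((C n)\<lparr>carrier := a_kernel (C n) (C (Suc n)) (d n)\<rparr>) (coboundaries C d n)"


section \<open>Ext\<close>

definition free_module :: "('a, 'r) ring_scheme \<Rightarrow> ('a, 'b) module \<Rightarrow> bool"
  where "free_module R F \<longleftrightarrow>
    Module.module R F \<and>
    (\<exists>B \<subseteq> carrier F. \<not> LinearCombinations.module.lin_dep R F B \<and> LinearCombinations.module.span R F B = carrier F)"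

text \<open>\<open>\<dots> \<rightarrow> F 1 \<rightarrow> F 0 \<rightarrow> N \<rightarrow> 0\<close> exact, with \<open>d n : F (n + 1) \<rightarrow> F n\<close> and augmentation \<open>\<epsilon>\<close>.\<close>
definition free_resolution ::
    "('a, 'r) ring_scheme \<Rightarrow> ('a, 'b) module \<Rightarrow>
     (nat \<Rightarrow> ('a, 'c) module) \<Rightarrow> (nat \<Rightarrow> 'c \<Rightarrow> 'c) \<Rightarrow> ('c \<Rightarrow> 'b) \<Rightarrow> bool"
  where "free_resolution R N F d \<epsilon> \<longleftrightarrow>
    (\<forall>n. free_module R (F n)) \<and>
    \<epsilon> \<in> LinearCombinations.module_hom R (F 0) N \<and> \<epsilon> ` carrier (F 0) = carrier N \<and>
    (\<forall>n. d n \<in> LinearCombinations.module_hom R (F (Suc n)) (F n)) \<and>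
    d 0 ` carrier (F 1) = a_kernel (F 0) N \<epsilon> \<and>
    (\<forall>n. d (Suc n) ` carrier (F (Suc (Suc n))) = a_kernel (F (Suc n)) (F n) (d n))"

text \<open>\<open>Ext R N M j\<close> is \<open>Ext\<^sup>j\<^sub>R(N, M)\<close>. Up to isomorphism it does not depend on the chosen free
  resolution. The resolution is carried by the type \<open>'a set\<close>, \<open>'a\<close> being the type of the ring
  elements: if \<open>'a\<close> is infinite, this type accommodates a free resolution of every module with
  at most as many elements as \<open>'a set\<close>.\<close>
definition Ext ::
    "('a, 'r) ring_scheme \<Rightarrow> ('a, 'b) module \<Rightarrow> ('a, 'c) module \<Rightarrow> nat \<Rightarrow>
     ('a, ('a set \<Rightarrow> 'c) set) module"
  where "Ext R N M j =
    (case SOME (F, d). \<exists>\<epsilon>. free_resolution R N F d \<epsilon> of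
      (F :: nat \<Rightarrow> ('a, 'a set) module, d) \<Rightarrow>
        cohomology (\<lambda>n. hom_module R (F n) M)
          (\<lambda>n f. restrict (f \<circ> d n) (carrier (F (Suc n)))) j)"


section \<open>Local cohomology\<close>

text \<open>The extension property is required for submodules \<open>N\<close> of modules \<open>M\<close> whose elements
  have the type \<open>'a\<close> of the ring elements, since a definition cannot quantify over types. These
  \<open>M\<close> include \<open>R\<close> itself, so by Baer's criterion this entails the property for all modules.\<close>
definition injective_module :: "('a, 'r) ring_scheme \<Rightarrow> ('a, 'e) module \<Rightarrow> bool"
  where "injective_module R E \<longleftrightarrow>
    Module.module R E \<and>
    (\<forall>(M :: ('a, 'a) module) N g.
       Module.module R M \<and> Module.submodule N R M \<and> g \<in> LinearCombinations.module_hom R (M\<lparr>carrier := N\<rparr>) E \<longrightarrow>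
       (\<exists>h \<in> LinearCombinations.module_hom R M E. \<forall>x\<in>N. h x = g x))"

text \<open>\<open>0 \<rightarrow> M \<rightarrow> E 0 \<rightarrow> E 1 \<rightarrow> \<dots>\<close> exact, with \<open>d n : E n \<rightarrow> E (n + 1)\<close> and coaugmentation \<open>\<epsilon>\<close>.\<close>
definition injective_resolution ::
    "('a, 'r) ring_scheme \<Rightarrow> ('a, 'b) module \<Rightarrow>
     (nat \<Rightarrow> ('a, 'e) module) \<Rightarrow> (nat \<Rightarrow> 'e \<Rightarrow> 'e) \<Rightarrow> ('b \<Rightarrow> 'e) \<Rightarrow> bool"
  where "injective_resolution R M E d \<epsilon> \<longleftrightarrow>
    (\<forall>n. injective_module R (E n)) \<and>
    \<epsilon> \<in> LinearCombinations.module_hom R M (E 0) \<and> inj_on \<epsilon> (carrier M) \<and>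
    (\<forall>n. d n \<in> LinearCombinations.module_hom R (E n) (E (Suc n))) \<and>
    \<epsilon> ` carrier M = a_kernel (E 0) (E 1) (d 0) \<and>
    (\<forall>n. d n ` carrier (E n) = a_kernel (E (Suc n)) (E (Suc (Suc n))) (d (Suc n)))"

text \<open>\<open>\<Gamma>\<^sub>I(M)\<close>, the elements killed by a power of \<open>I\<close>.\<close>
definition torsion :: "('a, 'r) ring_scheme \<Rightarrow> 'a set \<Rightarrow> ('a, 'b) module \<Rightarrow> ('a, 'b) module"
  where "torsion R I M =
    M\<lparr>carrier :=
      {x \<in> carrier M. \<exists>n::nat. \<forall>a \<in> I [^]\<^bsub>ideals_set R\<^esub> n. a \<odot>\<^bsub>M\<^esub> x = \<zero>\<^bsub>M\<^esub>}\<rparr>"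

text \<open>\<open>H\<^sup>k\<^sub>I(M)\<close> as the right derived functor of \<open>\<Gamma>\<^sub>I\<close>, and the zero module if \<open>k < 0\<close>. Up to
  isomorphism it does not depend on the chosen injective resolution. The latter is carried by
  \<open>'a set\<close>: if \<open>'a\<close> is infinite, every module \<open>M\<close> with at most as many elements as \<open>'a set\<close>
  embeds into \<open>Hom\<^sub>\<int>(R, D)\<close>, with \<open>D\<close> a divisible hull of the group \<open>M\<close>, which is injective and
  subject to the same bound; hence \<open>M\<close> has an injective resolution of this kind.\<close>
definition local_cohomology ::
    "('a, 'r) ring_scheme \<Rightarrow> 'a set \<Rightarrow> ('a, 'b) module \<Rightarrow> int \<Rightarrow> ('a, 'a set set) module"
  where "local_cohomology R I M k =
    (case SOME (E, d). \<exists>\<epsilon>. injective_resolution R M E d \<epsilon> of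
      (E :: nat \<Rightarrow> ('a, 'a set) module, d) \<Rightarrow>
        let H = cohomology (\<lambda>n. torsion R I (E n)) d (nat k)
        in if k < 0 then H\<lparr>carrier := {\<zero>\<^bsub>H\<^esub>}\<rparr> else H)"


section \<open>Dimension over the residue field\<close>

text \<open>An \<open>R\<close>-module \<open>V\<close> killed by the kernel of a surjective ring homomorphism \<open>\<phi>\<close> from \<open>R\<close>
  to \<open>K\<close>, regarded as a \<open>K\<close>-module.\<close>
definition descend ::
    "('a, 'r) ring_scheme \<Rightarrow> ('a \<Rightarrow> 'k) \<Rightarrow> ('a, 'b) module \<Rightarrow> ('k, 'b) module"
  where "descend R \<phi> V =
    \<lparr>carrier = carrier V, monoid.mult = undefined, monoid.one = undefined,
     ring.zero = \<zero>\<^bsub>V\<^esub>, ring.add = ring.add V,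
     module.smult = (\<lambda>c x. THE y. \<exists>a \<in> carrier R. \<phi> a = c \<and> y = a \<odot>\<^bsub>V\<^esub> x)\<rparr>"

text \<open>Infinite cardinals are not distinguished: every infinite dimension is \<open>\<infinity>\<close>.\<close>
definition vdim :: "('k, 'r) ring_scheme \<Rightarrow> ('k, 'b) module \<Rightarrow> enat"
  where "vdim K V =
    (if VectorSpace.vectorspace.fin_dim K V then enat (VectorSpace.vectorspace.dim K V) else \<infinity>)"

text \<open>\<open>dim\<^sub>K Ext\<^sup>j\<^sub>R(K, M)\<close> for a field \<open>K\<close> and a surjective ring homomorphism \<open>\<phi>\<close> from \<open>R\<close> to
  \<open>K\<close>; the kernel of \<open>\<phi>\<close> kills \<open>K\<close>, hence also the Ext module.\<close>
definition dim_Ext ::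
    "('a, 'r) ring_scheme \<Rightarrow> ('a \<Rightarrow> 'k) \<Rightarrow> ('k, 's) ring_scheme \<Rightarrow> ('a, 'b) module \<Rightarrow> nat \<Rightarrow> enat"
  where "dim_Ext R \<phi> K M j = vdim K (descend R \<phi> (Ext R (module_via \<phi> K) M j))"

text \<open>An existential statement about rings has to fix the type of the ring elements. Only the
  cardinality of the type matters, as carriers are arbitrary subsets with arbitrary operations;
  this one has the cardinality of the continuum, which suffices for power series rings in
  finitely many variables over the \<open>p\<close>-adic integers.\<close>
type_synonym ring_elt = "nat set"

end

theory Submission
  imports Defs
    "HOL-Library.Poly_Mapping"
    "HOL-Library.Z2"
    "HOL-Algebra.IntRing"
    "HOL-Computational_Algebra.Computational_Algebra"
begin

text \<open>
  The witness has \<open>p = 2\<close>, \<open>i = 5\<close> and \<open>j = 0\<close>. The ring \<open>S\<close> is the localization of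
  \<open>\<int>[a, b, c, A, B, C]\<close> at the prime \<open>(2, a, b, c, A, B, C)\<close>, and \<open>I\<close> is generated by \<open>2\<close> and the
  four cubics
  \<open>q\<^sub>0 = abc\<close>, \<open>q\<^sub>1 = bcA + caB + abC\<close>, \<open>q\<^sub>2 = aCA + bAB + cBC\<close>, \<open>q\<^sub>3 = aAB + bBC + cCA\<close>.
  Their ten monomials are the minimal nonfaces of the six-vertex triangulation of the real projective plane, and the
  cubics are the sums over the orbits of the rotation \<open>a \<rightarrow> b \<rightarrow> c \<rightarrow> a\<close>, \<open>A \<rightarrow> B \<rightarrow> C \<rightarrow> A\<close>.
  That the projective plane has 2-torsion in its homology is the reason to expect a difference at \<open>p = 2\<close>.

  Since \<open>Ext\<^sup>0(K, N) = Hom(K, N)\<close> consists of the elements of \<open>N\<close> killed by the maximal ideal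
  (\<open>dim_Ext_0\<close>), it suffices that \<open>H\<^sup>5\<^sub>I(S) = 0\<close>, whereas \<open>H\<^sup>4\<close> of \<open>S/2S\<close> with support in
  \<open>(q\<^sub>0, q\<^sub>1, q\<^sub>2, q\<^sub>3)\<close> has a nonzero element killed by the maximal ideal.

  Both are top local cohomology modules: the degree is the number \<open>r\<close> of generators \<open>g\<^sub>i\<close> of the support.
  Such a module consists of symbols \<open>[m / (g\<^sub>1 \<dots> g\<^sub>r)\<^sup>t]\<close>, and a symbol is zero iff
  \<open>(g\<^sub>1 \<dots> g\<^sub>r)\<^sup>s m \<in> (g\<^sub>1\<^sup>t\<^sup>+\<^sup>s, \<dots>, g\<^sub>r\<^sup>t\<^sup>+\<^sup>s)\<close> for some \<open>s\<close> (\<open>symbol_zero_iff\<close>).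
  This is read off from an injective resolution, by taking the torsion with respect to one generator after the other
  (\<open>top_symbols_step\<close>). The resolutions that the definitions refer to exist: injective modules come
  from divisible groups by coinduction (\<open>injective_resolution_exists\<close>), free modules from finitely supported
  functions (\<open>free_resolution_exists\<close>), and both fit into the prescribed types.

  Let \<open>F = q\<^sub>0 q\<^sub>1 q\<^sub>2 q\<^sub>3\<close> and \<open>v = b\<^sup>2c\<^sup>2BC\<close>.

  Vanishing over \<open>S\<close> (\<open>cubics_colon\<close>). The element \<open>2v\<close> lies in \<open>(q\<^sub>0, \<dots>, q\<^sub>3)\<close>. The substitution of \<open>Q\<close>-th powers
  of the variables, \<open>Q = 2\<^sup>e\<close>, takes \<open>q\<^sub>i\<close> to \<open>q\<^sub>i\<^sup>Q\<close> modulo 2, and yields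
  \<open>2 F\<^sup>Q v\<^sup>Q \<in> (4, q\<^sub>i\<^sup>2\<^sup>Q)\<close>; likewise for the two rotations \<open>v'\<close>, \<open>v''\<close> of \<open>v\<close>. On the other hand
  \<open>F\<^sup>7 \<in> (2, q\<^sub>i\<^sup>8, v\<^sup>8, v'\<^sup>8, v''\<^sup>8)\<close>, and 7 is less than 8. The two facts give
  \<open>2 F\<^sup>1\<^sup>5\<^sup>Q \<in> (4, q\<^sub>i\<^sup>1\<^sup>6\<^sup>Q)\<close> for arbitrarily large \<open>Q\<close>, and iteration replaces 4 by any power of 2.

  Nonvanishing over \<open>S/2S\<close> (\<open>series_nonmember\<close>). Modulo 2, taking the coefficients at odd exponents is an
  additive map \<open>T\<close> with \<open>T(x\<^sup>2y) = x T(y)\<close>, and \<open>T(Fv) = v\<close>. Therefore \<open>F\<^sup>Q\<^sup>-\<^sup>1v \<in> (q\<^sub>i\<^sup>Q)\<close> for some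
  \<open>Q = 2\<^sup>e\<close> would imply \<open>v \<in> (q\<^sub>i)\<close>, which is not the case. Since each variable multiplies \<open>v\<close> into
  \<open>(2, q\<^sub>0, \<dots>, q\<^sub>3)\<close>, the symbol \<open>[v / F]\<close> is killed by the maximal ideal.

  That \<open>S\<close> is regular of dimension 7 follows from Hilbert's basis theorem, an explicit chain of primes, and an upper bound
  for the length of chains of primes in \<open>\<int>[a, b, c, A, B, C]\<close>, which is obtained by counting polynomials of
  bounded degree and coefficients (\<open>growth_chain_bound\<close>).
\<close>

section \<open>Symbols in the top degree of a complex\<close>

definition ptorsion :: "('a, 'r) ring_scheme \<Rightarrow> 'a \<Rightarrow> ('a, 'e) module \<Rightarrow> ('a, 'e) module"
  where "ptorsion R g M =
    M\<lparr>carrier := {x \<in> carrier M. \<exists>t::nat. (g [^]\<^bsub>R\<^esub> t) \<odot>\<^bsub>M\<^esub> x = \<zero>\<^bsub>M\<^esub>}\<rparr>"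

text \<open>A substitute for divisibility by \<open>g\<close> that holds in every injective module over a noetherian ring, also if \<open>g\<close> is a zero divisor.\<close>
definition pow_divisible :: "('a, 'r) ring_scheme \<Rightarrow> 'a \<Rightarrow> ('a, 'e) module \<Rightarrow> bool"
  where "pow_divisible R g M \<longleftrightarrow>
    (\<forall>e \<in> carrier M. \<exists>e' \<in> carrier M. \<exists>s::nat. (g [^]\<^bsub>R\<^esub> Suc s) \<odot>\<^bsub>M\<^esub> e' = (g [^]\<^bsub>R\<^esub> s) \<odot>\<^bsub>M\<^esub> e)"

lemma ptorsion_simps [simp]:
  "\<zero>\<^bsub>ptorsion R g M\<^esub> = \<zero>\<^bsub>M\<^esub>" "x \<oplus>\<^bsub>ptorsion R g M\<^esub> y = x \<oplus>\<^bsub>M\<^esub> y"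
  "a \<odot>\<^bsub>ptorsion R g M\<^esub> x = a \<odot>\<^bsub>M\<^esub> x"
  by (auto simp: ptorsion_def)

lemma ptorsion_iff:
  "x \<in> carrier (ptorsion R g M) \<longleftrightarrow> x \<in> carrier M \<and> (\<exists>t::nat. (g [^]\<^bsub>R\<^esub> t) \<odot>\<^bsub>M\<^esub> x = \<zero>\<^bsub>M\<^esub>)"
  by (auto simp: ptorsion_def)

lemma module_homD:
  assumes "f \<in> LinearCombinations.module_hom R M N"
  shows "x \<in> carrier M \<Longrightarrow> f x \<in> carrier N"
    "\<lbrakk>x \<in> carrier M; y \<in> carrier M\<rbrakk> \<Longrightarrow> f (x \<oplus>\<^bsub>M\<^esub> y) = f x \<oplus>\<^bsub>N\<^esub> f y"
    "\<lbrakk>a \<in> carrier R; x \<in> carrier M\<rbrakk> \<Longrightarrow> f (a \<odot>\<^bsub>M\<^esub> x) = a \<odot>\<^bsub>N\<^esub> f x"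
  using assms by (auto simp: LinearCombinations.module_hom_def)

lemma module_homI:
  assumes "\<And>x. x \<in> carrier M \<Longrightarrow> f x \<in> carrier N"
    "\<And>x y. \<lbrakk>x \<in> carrier M; y \<in> carrier M\<rbrakk> \<Longrightarrow> f (x \<oplus>\<^bsub>M\<^esub> y) = f x \<oplus>\<^bsub>N\<^esub> f y"
    "\<And>a x. \<lbrakk>a \<in> carrier R; x \<in> carrier M\<rbrakk> \<Longrightarrow> f (a \<odot>\<^bsub>M\<^esub> x) = a \<odot>\<^bsub>N\<^esub> f x"
  shows "f \<in> LinearCombinations.module_hom R M N"
  using assms by (auto simp: LinearCombinations.module_hom_def)

lemma module_hom_zero:
  assumes "Module.module R M" "Module.module R N" "f \<in> LinearCombinations.module_hom R M N"
  shows "f \<zero>\<^bsub>M\<^esub> = \<zero>\<^bsub>N\<^esub>"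
  using assms mod_hom.f0_is_0 by (metis mod_hom.intro mod_hom_axioms.intro)

lemma module_hom_minus:
  assumes M: "Module.module R M" and N: "Module.module R N"
    and f: "f \<in> LinearCombinations.module_hom R M N"
    and xy: "x \<in> carrier M" "y \<in> carrier M"
  shows "f (x \<ominus>\<^bsub>M\<^esub> y) = f x \<ominus>\<^bsub>N\<^esub> f y"
proof -
  interpret M: Module.module R M by (rule M)
  interpret N: Module.module R N by (rule N)
  have "f (x \<ominus>\<^bsub>M\<^esub> y) \<oplus>\<^bsub>N\<^esub> f y = f ((x \<ominus>\<^bsub>M\<^esub> y) \<oplus>\<^bsub>M\<^esub> y)"
    using xy by (simp add: module_homD(2)[OF f])
  also have "(x \<ominus>\<^bsub>M\<^esub> y) \<oplus>\<^bsub>M\<^esub> y = x"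
    using xy by (simp add: M.minus_eq M.a_assoc M.l_neg)
  finally have "f (x \<ominus>\<^bsub>M\<^esub> y) \<oplus>\<^bsub>N\<^esub> f y = f x" .
  then show ?thesis
    using xy module_homD(1)[OF f] N.add.inv_solve_right
    by (simp add: N.minus_eq)
qed

locale cochain_complex = cring R for R (structure) +
  fixes C :: "nat \<Rightarrow> ('a, 'e) module" and d :: "nat \<Rightarrow> 'e \<Rightarrow> 'e"
  assumes mod: "Module.module R (C n)"
    and d_hom: "d n \<in> LinearCombinations.module_hom R (C n) (C (Suc n))"
    and dd: "x \<in> carrier (C n) \<Longrightarrow> d (Suc n) (d n x) = \<zero>\<^bsub>C (Suc (Suc n))\<^esub>"
begin

definition cocycles :: "nat \<Rightarrow> 'e set"
  where "cocycles n = {x \<in> carrier (C n). d n x = \<zero>\<^bsub>C (Suc n)\<^esub>}"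

lemma d_closed [simp, intro]: "x \<in> carrier (C n) \<Longrightarrow> d n x \<in> carrier (C (Suc n))"
  using module_homD(1)[OF d_hom] .

lemma d_add: "\<lbrakk>x \<in> carrier (C n); y \<in> carrier (C n)\<rbrakk> \<Longrightarrow> d n (x \<oplus>\<^bsub>C n\<^esub> y) = d n x \<oplus>\<^bsub>C (Suc n)\<^esub> d n y"
  using module_homD(2)[OF d_hom] .

lemma d_smult: "\<lbrakk>a \<in> carrier R; x \<in> carrier (C n)\<rbrakk> \<Longrightarrow> d n (a \<odot>\<^bsub>C n\<^esub> x) = a \<odot>\<^bsub>C (Suc n)\<^esub> d n x"
  using module_homD(3)[OF d_hom] .

lemma d_minus: "\<lbrakk>x \<in> carrier (C n); y \<in> carrier (C n)\<rbrakk> \<Longrightarrow> d n (x \<ominus>\<^bsub>C n\<^esub> y) = d n x \<ominus>\<^bsub>C (Suc n)\<^esub> d n y"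
  using module_hom_minus[OF mod mod d_hom] .

lemma d_zero: "d n \<zero>\<^bsub>C n\<^esub> = \<zero>\<^bsub>C (Suc n)\<^esub>"
  using module_hom_zero[OF mod mod d_hom] .

end

lemma (in cring) ptorsion_submodule:
  assumes M: "Module.module R M" and g: "g \<in> carrier R"
  shows "Module.submodule (carrier (ptorsion R g M)) R M"
proof -
  interpret M: Module.module R M by (rule M)
  have up: "(g [^] (t + k)) \<odot>\<^bsub>M\<^esub> x = \<zero>\<^bsub>M\<^esub>"
    if "x \<in> carrier M" "(g [^] t) \<odot>\<^bsub>M\<^esub> x = \<zero>\<^bsub>M\<^esub>" for x and t k :: nat
  proof -
    have "(g [^] (t + k)) \<odot>\<^bsub>M\<^esub> x = (g [^] k) \<odot>\<^bsub>M\<^esub> ((g [^] t) \<odot>\<^bsub>M\<^esub> x)"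
      using that g M.smult_assoc1[of "g [^] k" "g [^] t" x] by (simp add: nat_pow_mult add.commute)
    then show ?thesis using that g by simp
  qed
  show ?thesis
  proof (rule M.submoduleI)
    show "carrier (ptorsion R g M) \<subseteq> carrier M" by (auto simp: ptorsion_def)
    show "\<zero>\<^bsub>M\<^esub> \<in> carrier (ptorsion R g M)" using g by (auto simp: ptorsion_def)
  next
    fix a assume "a \<in> carrier (ptorsion R g M)"
    then obtain t :: nat where a: "a \<in> carrier M" "(g [^] t) \<odot>\<^bsub>M\<^esub> a = \<zero>\<^bsub>M\<^esub>"
      by (auto simp: ptorsion_def)
    then have "(g [^] t) \<odot>\<^bsub>M\<^esub> (\<ominus>\<^bsub>M\<^esub> a) = \<zero>\<^bsub>M\<^esub>"
      using g by (simp add: M.smult_r_minus)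
    then show "\<ominus>\<^bsub>M\<^esub> a \<in> carrier (ptorsion R g M)" using a by (auto simp: ptorsion_def)
  next
    fix a b assume "a \<in> carrier (ptorsion R g M)" "b \<in> carrier (ptorsion R g M)"
    then obtain t u :: nat where a: "a \<in> carrier M" "(g [^] t) \<odot>\<^bsub>M\<^esub> a = \<zero>\<^bsub>M\<^esub>"
      and b: "b \<in> carrier M" "(g [^] u) \<odot>\<^bsub>M\<^esub> b = \<zero>\<^bsub>M\<^esub>"
      by (auto simp: ptorsion_def)
    have "(g [^] (t + u)) \<odot>\<^bsub>M\<^esub> (a \<oplus>\<^bsub>M\<^esub> b) = \<zero>\<^bsub>M\<^esub>"
      using up[OF a, of u] up[OF b, of t] a b g by (simp add: M.smult_r_distr add.commute)
    then show "a \<oplus>\<^bsub>M\<^esub> b \<in> carrier (ptorsion R g M)" using a b by (auto simp: ptorsion_def)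
  next
    fix a x assume a: "a \<in> carrier R" and "x \<in> carrier (ptorsion R g M)"
    then obtain t :: nat where x: "x \<in> carrier M" "(g [^] t) \<odot>\<^bsub>M\<^esub> x = \<zero>\<^bsub>M\<^esub>"
      by (auto simp: ptorsion_def)
    have "(g [^] t) \<odot>\<^bsub>M\<^esub> (a \<odot>\<^bsub>M\<^esub> x) = a \<odot>\<^bsub>M\<^esub> ((g [^] t) \<odot>\<^bsub>M\<^esub> x)"
      using a x(1) g M.smult_assoc1[of a "g [^] t" x] M.smult_assoc1[of "g [^] t" a x]
      by (simp add: m_comm)
    then show "a \<odot>\<^bsub>M\<^esub> x \<in> carrier (ptorsion R g M)" using a x by (auto simp: ptorsion_def)
  qed
qed

lemma (in cring) ptorsion_module:
  assumes M: "Module.module R M" and g: "g \<in> carrier R"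
  shows "Module.module R (ptorsion R g M)"
  using Module.submodule.submodule_is_module[OF ptorsion_submodule[OF assms] M]
  by (simp add: ptorsion_def)

lemma (in cochain_complex) cochain_complex_ptorsion:
  assumes g: "g \<in> carrier R"
  shows "cochain_complex R (\<lambda>n. ptorsion R g (C n)) d"
proof (intro cochain_complex.intro cochain_complex_axioms.intro, goal_cases)
  case 1 show ?case by (rule is_cring)
next
  case (2 n) show ?case by (rule ptorsion_module[OF mod g])
next
  case (3 n)
  show ?case
  proof (rule module_homI)
    fix x assume "x \<in> carrier (ptorsion R g (C n))"
    then obtain t :: nat where x: "x \<in> carrier (C n)" "(g [^] t) \<odot>\<^bsub>C n\<^esub> x = \<zero>\<^bsub>C n\<^esub>"
      by (auto simp: ptorsion_def)
    have "(g [^] t) \<odot>\<^bsub>C (Suc n)\<^esub> d n x = \<zero>\<^bsub>C (Suc n)\<^esub>"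
      using x g d_smult[of "g [^] t" x n] by (simp add: d_zero)
    then show "d n x \<in> carrier (ptorsion R g (C (Suc n)))" using x by (auto simp: ptorsion_def)
  next
    fix x y assume "x \<in> carrier (ptorsion R g (C n))" "y \<in> carrier (ptorsion R g (C n))"
    then have "x \<in> carrier (C n)" "y \<in> carrier (C n)" by (auto simp: ptorsion_iff)
    then show "d n (x \<oplus>\<^bsub>ptorsion R g (C n)\<^esub> y) = d n x \<oplus>\<^bsub>ptorsion R g (C (Suc n))\<^esub> d n y"
      by (simp only: ptorsion_simps d_add)
  next
    fix a x assume "a \<in> carrier R" "x \<in> carrier (ptorsion R g (C n))"
    then have "a \<in> carrier R" "x \<in> carrier (C n)" by (auto simp: ptorsion_iff)
    then show "d n (a \<odot>\<^bsub>ptorsion R g (C n)\<^esub> x) = a \<odot>\<^bsub>ptorsion R g (C (Suc n))\<^esub> d n x"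
      by (simp only: ptorsion_simps d_smult)
  qed
next
  case (4 x n) then show ?case by (auto simp: ptorsion_iff dd)
qed

text \<open>A complex without cohomology above degree \<open>r\<close> whose cohomology in degree \<open>r\<close> consists of symbols
  \<open>[m / F\<^sup>t]\<close>: \<open>rep m t x\<close> says that the cocycle \<open>x\<close> represents the symbol, and \<open>zr m t\<close> that the symbol is zero.
  A symbol is a class of cocycles, so \<open>rep\<close> is a relation and not a function.\<close>
locale top_symbols = cochain_complex R C d
  for R (structure) and C :: "nat \<Rightarrow> ('a, 'e) module" and d +
  fixes r :: nat and F :: 'a and rep :: "'a \<Rightarrow> nat \<Rightarrow> 'e \<Rightarrow> bool" and zr :: "'a \<Rightarrow> nat \<Rightarrow> bool"
  assumes F_closed [simp, intro]: "F \<in> carrier R"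
    and exact_above: "r < j \<Longrightarrow> cocycles j \<subseteq> coboundaries C d j"
    and rep_closed: "rep m t x \<Longrightarrow> m \<in> carrier R \<and> x \<in> cocycles r"
    and rep_surj: "x \<in> cocycles r \<Longrightarrow> \<exists>m t. rep m t x"
    and rep_ex: "m \<in> carrier R \<Longrightarrow> \<exists>x. rep m t x"
    and rep_zero: "rep m t x \<Longrightarrow> x \<in> coboundaries C d r \<longleftrightarrow> zr m t"
    and rep_add: "\<lbrakk>rep m t x; rep m' t x'\<rbrakk> \<Longrightarrow> rep (m \<oplus> m') t (x \<oplus>\<^bsub>C r\<^esub> x')"
    and rep_smult: "\<lbrakk>rep m t x; a \<in> carrier R\<rbrakk> \<Longrightarrow> rep (a \<otimes> m) t (a \<odot>\<^bsub>C r\<^esub> x)"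
    and rep_shift: "rep m t x \<Longrightarrow> rep (F [^] s \<otimes> m) (t + s) x"
begin

lemma rep_minus:
  assumes "rep m t x" "rep m' t x'"
  shows "rep (m \<ominus> m') t (x \<ominus>\<^bsub>C r\<^esub> x')"
proof -
  interpret M: Module.module R "C r" by (rule mod)
  have c: "m' \<in> carrier R" "x' \<in> carrier (C r)" "m \<in> carrier R" "x \<in> carrier (C r)"
    using rep_closed assms by (auto simp: cocycles_def)
  have "rep (m \<oplus> (\<ominus> \<one> \<otimes> m')) t (x \<oplus>\<^bsub>C r\<^esub> ((\<ominus> \<one>) \<odot>\<^bsub>C r\<^esub> x'))"
    using assms by (intro rep_add rep_smult) auto
  then show ?thesis using c by (simp add: minus_eq M.minus_eq l_minus M.smult_l_minus)
qed

end

lemma (in cochain_complex) minus_zero: "x \<in> carrier (C n) \<Longrightarrow> x \<ominus>\<^bsub>C n\<^esub> \<zero>\<^bsub>C n\<^esub> = x"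
proof -
  interpret M: Module.module R "C n" by (rule mod)
  show "x \<in> carrier (C n) \<Longrightarrow> x \<ominus>\<^bsub>C n\<^esub> \<zero>\<^bsub>C n\<^esub> = x" by (simp add: M.minus_eq)
qed

lemma (in cochain_complex) pow_smult:
  assumes "g \<in> carrier R" "x \<in> carrier (C n)"
  shows "g [^] (i + j) \<odot>\<^bsub>C n\<^esub> x = g [^] (i::nat) \<odot>\<^bsub>C n\<^esub> (g [^] (j::nat) \<odot>\<^bsub>C n\<^esub> x)"
  using assms Module.module.smult_assoc1[OF mod, of "g [^] i" "g [^] j" x n] by (simp add: nat_pow_mult)

text \<open>Iterated division by \<open>g\<close>; the factor \<open>g\<^sup>k\<close> that accumulates on both sides is why \<open>rep_step\<close> carries such a factor.\<close>
lemma (in cochain_complex) divide_pow: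
  assumes g: "g \<in> carrier R" and div: "pow_divisible R g (C n)" and e: "e \<in> carrier (C n)"
  shows "\<exists>e' \<in> carrier (C n). \<exists>k. g [^] (k + t) \<odot>\<^bsub>C n\<^esub> e' = g [^] (k::nat) \<odot>\<^bsub>C n\<^esub> e"
proof -
  interpret M: Module.module R "C n" by (rule mod)
  show ?thesis
  proof (induction t)
    case 0 then show ?case using e by auto
  next
    case (Suc t)
    then obtain e' k where e': "e' \<in> carrier (C n)" "g [^] (k + t) \<odot>\<^bsub>C n\<^esub> e' = g [^] (k::nat) \<odot>\<^bsub>C n\<^esub> e"
      by blast
    obtain e'' s where e'': "e'' \<in> carrier (C n)" "(g [^] Suc s) \<odot>\<^bsub>C n\<^esub> e'' = (g [^] (s::nat)) \<odot>\<^bsub>C n\<^esub> e'"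
      using div e'(1) unfolding pow_divisible_def by blast
    have "g [^] ((s + k) + Suc t) \<odot>\<^bsub>C n\<^esub> e'' = g [^] (k + t) \<odot>\<^bsub>C n\<^esub> (g [^] Suc s \<odot>\<^bsub>C n\<^esub> e'')"
      using pow_smult[OF g e''(1), of "k + t" "Suc s"] by (simp add: ac_simps del: nat_pow_Suc)
    also have "\<dots> = g [^] s \<odot>\<^bsub>C n\<^esub> (g [^] (k + t) \<odot>\<^bsub>C n\<^esub> e')"
      unfolding e''(2) using pow_smult[OF g e'(1), of "k + t" s] pow_smult[OF g e'(1), of s "k + t"]
      by (simp add: ac_simps)
    also have "\<dots> = g [^] (s + k) \<odot>\<^bsub>C n\<^esub> e"
      unfolding e'(2) using pow_smult[OF g e] by simp
    finally show ?case using e'' by blast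
  qed
qed


text \<open>The connecting map of the sequence \<open>0 \<rightarrow> \<Gamma>\<^sub>g C \<rightarrow> C \<rightarrow> C\<^sub>g \<rightarrow> 0\<close>, without the localization \<open>C\<^sub>g\<close>: a cocycle of
  \<open>C\<^sub>g\<close> is \<open>x / g\<^sup>t\<close>, it is lifted to an element \<open>e\<close> of \<open>C\<close> with \<open>g\<^sup>t e = x\<close> up to \<open>g\<close>-torsion, and \<open>d e\<close> is \<open>g\<close>-torsion.
  The class \<open>[m / F\<^sup>t] / g\<^sup>t\<close> is taken to \<open>[m / (F g)\<^sup>t]\<close>.\<close>
definition rep_step :: "('a, 'r) ring_scheme \<Rightarrow> (nat \<Rightarrow> ('a, 'e) module) \<Rightarrow> (nat \<Rightarrow> 'e \<Rightarrow> 'e) \<Rightarrow> nat \<Rightarrow>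
    'a \<Rightarrow> ('a \<Rightarrow> nat \<Rightarrow> 'e \<Rightarrow> bool) \<Rightarrow> 'a \<Rightarrow> nat \<Rightarrow> 'e \<Rightarrow> bool"
  where "rep_step R C d r g rep m t x' \<longleftrightarrow>
    (\<exists>x e k. rep m t x \<and> e \<in> carrier (C r) \<and> x' = d r e \<and>
       (g [^]\<^bsub>R\<^esub> (k + t)) \<odot>\<^bsub>C r\<^esub> e = (g [^]\<^bsub>R\<^esub> (k::nat)) \<odot>\<^bsub>C r\<^esub> x)"

text \<open>\<open>[m / (F g)\<^sup>t] = 0\<close> means that \<open>[m / F\<^sup>t] / g\<^sup>t\<close> comes from a symbol \<open>[m' / F\<^sup>t\<^sup>+\<^sup>a]\<close> over \<open>C\<close>, up to \<open>g\<close>-torsion.\<close>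
definition zero_step :: "('a, 'r) ring_scheme \<Rightarrow> 'a \<Rightarrow> 'a \<Rightarrow> ('a \<Rightarrow> nat \<Rightarrow> bool) \<Rightarrow> 'a \<Rightarrow> nat \<Rightarrow> bool"
  where "zero_step R F g zr m t \<longleftrightarrow>
    (\<exists>s a. \<exists>m' \<in> carrier R. zr ((F [^]\<^bsub>R\<^esub> a \<otimes>\<^bsub>R\<^esub> (g [^]\<^bsub>R\<^esub> s \<otimes>\<^bsub>R\<^esub> m)) \<ominus>\<^bsub>R\<^esub> (g [^]\<^bsub>R\<^esub> (s + t) \<otimes>\<^bsub>R\<^esub> m')) (t + (a::nat)))"

context top_symbols
begin

lemma pow_raise:
  assumes g: "g \<in> carrier R" and xy: "x \<in> carrier (C n)" "y \<in> carrier (C n)"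
    and eq: "g [^] (k + t) \<odot>\<^bsub>C n\<^esub> x = g [^] (k::nat) \<odot>\<^bsub>C n\<^esub> y"
  shows "g [^] ((l + k) + t) \<odot>\<^bsub>C n\<^esub> x = g [^] (l + k) \<odot>\<^bsub>C n\<^esub> y"
  using pow_smult[OF g xy(1), of l "k + t"] pow_smult[OF g xy(2), of l k] eq by (simp add: add.assoc)

text \<open>Above degree \<open>r\<close> the complex is exact, so \<open>g\<^sup>t e\<close>, being a cocycle, is a coboundary \<open>d w\<close>. Dividing \<open>w\<close> by \<open>g\<^sup>t\<close> gives an element
  whose coboundary corrects \<open>e\<close> to a \<open>g\<close>-torsion element with the same differential.\<close>
lemma cocycles_above:
  assumes g: "g \<in> carrier R" and div: "\<And>n. pow_divisible R g (C n)" and j: "r < n"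
    and e: "e \<in> carrier (C n)" and t: "g [^] (t::nat) \<odot>\<^bsub>C (Suc n)\<^esub> d n e = \<zero>\<^bsub>C (Suc n)\<^esub>"
  shows "\<exists>y \<in> carrier (ptorsion R g (C n)). d n y = d n e"
proof -
  interpret M: Module.module R "C n" by (rule mod)
  interpret M': Module.module R "C (Suc n)" by (rule mod)
  obtain n' where n': "n = Suc n'" using j by (cases n) auto
  have gt: "g [^] i \<in> carrier R" for i :: nat using g by simp
  have "g [^] t \<odot>\<^bsub>C n\<^esub> e \<in> cocycles n"
    using e g t by (auto simp: cocycles_def d_smult)
  then obtain w where w: "w \<in> carrier (C n')" "g [^] t \<odot>\<^bsub>C n\<^esub> e = d n' w"
    using exact_above[OF j] n' by auto
  obtain w' k where w': "w' \<in> carrier (C n')" "g [^] (k + t) \<odot>\<^bsub>C n'\<^esub> w' = g [^] (k::nat) \<odot>\<^bsub>C n'\<^esub> w"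
    using divide_pow[OF g div w(1), of t] by blast
  define y where "y = e \<ominus>\<^bsub>C n\<^esub> d n' w'"
  have dw: "d n' w' \<in> carrier (C n)" "d n' w \<in> carrier (C n)" using w w' n' by auto
  have "g [^] (k + t) \<odot>\<^bsub>C n\<^esub> d n' w' = g [^] k \<odot>\<^bsub>C n\<^esub> d n' w"
    using w w' n' g by (metis d_smult gt)
  also have "\<dots> = g [^] (k + t) \<odot>\<^bsub>C n\<^esub> e"
    using w(2) pow_smult[OF g e] by simp
  finally have "g [^] (k + t) \<odot>\<^bsub>C n\<^esub> y = \<zero>\<^bsub>C n\<^esub>"
    unfolding y_def using e dw gt
    by (simp add: M.minus_eq M.smult_r_distr M.smult_r_minus M.r_neg)
  moreover have "y \<in> carrier (C n)" using e dw by (simp add: y_def)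
  moreover have "d n y = d n e"
    using dd[OF w'(1)] d_minus[OF e dw(1)] d_closed[OF e] n' by (simp add: y_def minus_zero)
  ultimately have "y \<in> carrier (ptorsion R g (C n)) \<and> d n y = d n e"
    unfolding ptorsion_iff by (intro conjI exI[of _ "k + t"])
  then show ?thesis by (intro bexI[of _ y]) simp_all
qed

text \<open>Taking \<open>g\<close>-torsion shifts the top degree by one and multiplies the denominator by \<open>g\<close>. It is the long exact
  cohomology sequence of \<open>\<Gamma>\<^sub>g C \<rightarrow> C \<rightarrow> C\<^sub>g\<close> in elements: surjectivity of \<open>C \<rightarrow> C\<^sub>g\<close> is the divisibility of \<open>C\<close>.\<close>
theorem top_symbols_step:
  assumes g: "g \<in> carrier R" and div: "\<And>n. pow_divisible R g (C n)"
  shows "top_symbols R (\<lambda>n. ptorsion R g (C n)) d (Suc r) (F \<otimes> g)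
    (rep_step R C d r g rep) (zero_step R F g zr)"
proof -
  interpret T: cochain_complex R "\<lambda>n. ptorsion R g (C n)" d by (rule cochain_complex_ptorsion[OF g])
  interpret M: Module.module R "C r" by (rule mod)
  interpret M': Module.module R "C (Suc r)" by (rule mod)
  have gt [simp, intro]: "g [^] i \<in> carrier R" for i :: nat using g by simp
  have rc: "m \<in> carrier R" "x \<in> carrier (C r)" "d r x = \<zero>\<^bsub>C (Suc r)\<^esub>" if "rep m t x" for m t x
    using rep_closed[OF that] by (auto simp: cocycles_def)
  have Tcoc: "x \<in> T.cocycles n \<longleftrightarrow> x \<in> carrier (ptorsion R g (C n)) \<and> d n x = \<zero>\<^bsub>C (Suc n)\<^esub>" for x n
    by (simp add: T.cocycles_def)
  show ?thesis
  proof (unfold_locales, goal_cases)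
    case 1 then show ?case using g by simp
  next
    case (2 j)
    then obtain j' where j': "j = Suc j'" "r < j'" by (cases j) auto
    show ?case
    proof
      fix x assume "x \<in> T.cocycles j"
      then obtain t :: nat where x: "x \<in> carrier (C j)" "d j x = \<zero>\<^bsub>C (Suc j)\<^esub>" "g [^] t \<odot>\<^bsub>C j\<^esub> x = \<zero>\<^bsub>C j\<^esub>"
        by (auto simp: Tcoc ptorsion_iff)
      then have "x \<in> cocycles j" by (simp add: cocycles_def)
      then obtain e where e: "e \<in> carrier (C j')" "x = d j' e"
        using exact_above[of j] j' by auto
      then obtain y where "y \<in> carrier (ptorsion R g (C j'))" "d j' y = x"
        using cocycles_above[OF g div j'(2) e(1)] x(3) j'(1) by metis
      then show "x \<in> coboundaries (\<lambda>n. ptorsion R g (C n)) d j" using j'(1) by auto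
    qed
  next
    case (3 m t x')
    then obtain x e k where *: "rep m t x" "e \<in> carrier (C r)" "x' = d r e"
       "g [^] (k + t) \<odot>\<^bsub>C r\<^esub> e = g [^] (k::nat) \<odot>\<^bsub>C r\<^esub> x" by (auto simp: rep_step_def)
    have "g [^] (k + t) \<odot>\<^bsub>C (Suc r)\<^esub> d r e = d r (g [^] k \<odot>\<^bsub>C r\<^esub> x)"
      using * d_smult[of "g [^] (k + t)" e r] by simp
    also have "\<dots> = \<zero>\<^bsub>C (Suc r)\<^esub>" using rc[OF *(1)] by (simp add: d_smult)
    finally show ?case using * rc[OF *(1)] by (auto simp: Tcoc ptorsion_iff dd)
  next
    case (4 x')
    then obtain t :: nat where x': "x' \<in> carrier (C (Suc r))" "d (Suc r) x' = \<zero>\<^bsub>C (Suc (Suc r))\<^esub>"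
       "g [^] t \<odot>\<^bsub>C (Suc r)\<^esub> x' = \<zero>\<^bsub>C (Suc r)\<^esub>"
      by (auto simp: Tcoc ptorsion_iff)
    then have "x' \<in> cocycles (Suc r)" by (simp add: cocycles_def)
    then obtain e where e: "e \<in> carrier (C r)" "x' = d r e"
      using exact_above[of "Suc r"] by auto
    have "g [^] t \<odot>\<^bsub>C r\<^esub> e \<in> cocycles r" using e x' by (auto simp: cocycles_def d_smult)
    then obtain m t' where m: "rep m t' (g [^] t \<odot>\<^bsub>C r\<^esub> e)" using rep_surj by blast
    have "rep (F [^] t \<otimes> (g [^] t' \<otimes> m)) (t' + t) (g [^] t' \<odot>\<^bsub>C r\<^esub> (g [^] t \<odot>\<^bsub>C r\<^esub> e))"
      using m by (intro rep_shift rep_smult) auto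
    moreover have "g [^] (0 + (t' + t)) \<odot>\<^bsub>C r\<^esub> e = g [^] (0::nat) \<odot>\<^bsub>C r\<^esub> (g [^] t' \<odot>\<^bsub>C r\<^esub> (g [^] t \<odot>\<^bsub>C r\<^esub> e))"
      using pow_smult[OF g e(1), of t' t] e(1) by simp
    ultimately have "rep_step R C d r g rep (F [^] t \<otimes> (g [^] t' \<otimes> m)) (t' + t) x'"
      unfolding rep_step_def using e
      by (intro exI[of _ "g [^] t' \<odot>\<^bsub>C r\<^esub> (g [^] t \<odot>\<^bsub>C r\<^esub> e)"] exI[of _ e] exI[of _ 0]) simp
    then show ?case by blast
  next
    case (5 m t)
    then obtain x where x: "rep m t x" using rep_ex by blast
    obtain e k where "e \<in> carrier (C r)" "g [^] (k + t) \<odot>\<^bsub>C r\<^esub> e = g [^] (k::nat) \<odot>\<^bsub>C r\<^esub> x"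
      using divide_pow[OF g div rc(2)[OF x], of t] by blast
    then have "rep_step R C d r g rep m t (d r e)"
      unfolding rep_step_def using x by (intro exI[of _ x] exI[of _ e] exI[of _ k]) simp
    then show ?case by (rule exI)
  next
    case (6 m t x')
    then obtain x e k where *: "rep m t x" "e \<in> carrier (C r)" "x' = d r e"
       "g [^] (k + t) \<odot>\<^bsub>C r\<^esub> e = g [^] (k::nat) \<odot>\<^bsub>C r\<^esub> x" by (auto simp: rep_step_def)
    note x = rc[OF *(1)]
    show ?case
    proof
      assume "x' \<in> coboundaries (\<lambda>n. ptorsion R g (C n)) d (Suc r)"
      then obtain y u where y: "y \<in> carrier (C r)" "d r y = d r e" "g [^] (u::nat) \<odot>\<^bsub>C r\<^esub> y = \<zero>\<^bsub>C r\<^esub>"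
        using * by (auto simp: ptorsion_iff)
      define z where "z = e \<ominus>\<^bsub>C r\<^esub> y"
      have z: "z \<in> carrier (C r)" using * y by (simp add: z_def)
      have "d r z = \<zero>\<^bsub>C (Suc r)\<^esub>" using * y by (simp add: z_def d_minus M'.minus_eq M'.r_neg)
      then have "z \<in> cocycles r" using z by (simp add: cocycles_def)
      then obtain m' t' where m': "rep m' t' z" using rep_surj by blast
      define s where "s = u + k"
      have "g [^] (s + t) \<odot>\<^bsub>C r\<^esub> y = \<zero>\<^bsub>C r\<^esub>"
        using pow_smult[OF g y(1), of "k + t" u] y by (simp add: s_def ac_simps)
      then have "g [^] (s + t) \<odot>\<^bsub>C r\<^esub> z = g [^] (s + t) \<odot>\<^bsub>C r\<^esub> e"
        using * y by (simp add: z_def M.minus_eq M.smult_r_distr M.smult_r_minus)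
      also have "\<dots> = g [^] s \<odot>\<^bsub>C r\<^esub> x"
        using pow_raise[OF g *(2) x(2) *(4), of u] by (simp add: s_def)
      finally have eq: "g [^] (s + t) \<odot>\<^bsub>C r\<^esub> z = g [^] s \<odot>\<^bsub>C r\<^esub> x" .
      have r1: "rep (F [^] t' \<otimes> (g [^] s \<otimes> m)) (t + t') (g [^] s \<odot>\<^bsub>C r\<^esub> x)"
        using * by (intro rep_shift rep_smult) auto
      have r2: "rep (g [^] (s + t) \<otimes> (F [^] t \<otimes> m')) (t' + t) (g [^] (s + t) \<odot>\<^bsub>C r\<^esub> z)"
        using m' by (intro rep_shift rep_smult) auto
      have "rep (F [^] t' \<otimes> (g [^] s \<otimes> m) \<ominus> g [^] (s + t) \<otimes> (F [^] t \<otimes> m')) (t + t')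
          (g [^] s \<odot>\<^bsub>C r\<^esub> x \<ominus>\<^bsub>C r\<^esub> g [^] (s + t) \<odot>\<^bsub>C r\<^esub> z)"
        using rep_minus[OF r1] r2 by (simp add: add.commute)
      moreover have "g [^] s \<odot>\<^bsub>C r\<^esub> x \<ominus>\<^bsub>C r\<^esub> g [^] (s + t) \<odot>\<^bsub>C r\<^esub> z = \<zero>\<^bsub>C r\<^esub>"
        using eq x by (simp add: M.minus_eq M.r_neg)
      moreover have "\<zero>\<^bsub>C r\<^esub> \<in> coboundaries C d r"
      proof (cases r)
        case (Suc r')
        interpret M'': Module.module R "C r'" by (rule mod)
        show ?thesis using d_zero[of r'] Suc by (auto intro!: image_eqI[where x = "\<zero>\<^bsub>C r'\<^esub>"])
      qed auto
      ultimately have "zr (F [^] t' \<otimes> (g [^] s \<otimes> m) \<ominus> g [^] (s + t) \<otimes> (F [^] t \<otimes> m')) (t + t')"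
        using rep_zero by metis
      moreover have "F [^] t \<otimes> m' \<in> carrier R" using rc[OF m'] by simp
      ultimately show "zero_step R F g zr m t" unfolding zero_step_def by blast
    next
      assume "zero_step R F g zr m t"
      then obtain s a m' where m': "m' \<in> carrier R"
        and zr: "zr (F [^] a \<otimes> (g [^] s \<otimes> m) \<ominus> g [^] (s + t) \<otimes> m') (t + a)"
        unfolding zero_step_def by blast
      obtain z where z: "rep m' (t + a) z" using rep_ex m' by blast
      note zc = rc[OF z]
      have r1: "rep (F [^] a \<otimes> (g [^] s \<otimes> m)) (t + a) (g [^] s \<odot>\<^bsub>C r\<^esub> x)"
        using * by (intro rep_shift rep_smult) auto
      have r2: "rep (g [^] (s + t) \<otimes> m') (t + a) (g [^] (s + t) \<odot>\<^bsub>C r\<^esub> z)"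
        using z by (intro rep_smult) auto
      define b where "b = g [^] s \<odot>\<^bsub>C r\<^esub> x \<ominus>\<^bsub>C r\<^esub> g [^] (s + t) \<odot>\<^bsub>C r\<^esub> z"
      have "b \<in> coboundaries C d r"
        using rep_zero[OF rep_minus[OF r1 r2]] zr by (simp add: b_def)
      then have "\<exists>c l. c \<in> carrier (C r) \<and> d r c = \<zero>\<^bsub>C (Suc r)\<^esub> \<and> g [^] (l + (s + t)) \<odot>\<^bsub>C r\<^esub> c = g [^] (l::nat) \<odot>\<^bsub>C r\<^esub> b"
      proof (cases r)
        case 0
        then have "b = \<zero>\<^bsub>C r\<^esub>" using \<open>b \<in> coboundaries C d r\<close> by simp
        then show ?thesis by (intro exI[of _ "\<zero>\<^bsub>C r\<^esub>"]) (simp add: d_zero)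
      next
        case (Suc r')
        then obtain w where w: "w \<in> carrier (C r')" "b = d r' w"
          using \<open>b \<in> coboundaries C d r\<close> by auto
        obtain w' l where w': "w' \<in> carrier (C r')" "g [^] (l + (s + t)) \<odot>\<^bsub>C r'\<^esub> w' = g [^] (l::nat) \<odot>\<^bsub>C r'\<^esub> w"
          using divide_pow[OF g div w(1), of "s + t"] by blast
        have "g [^] (l + (s + t)) \<odot>\<^bsub>C r\<^esub> d r' w' = g [^] l \<odot>\<^bsub>C r\<^esub> b"
          using w w' Suc by (metis d_smult gt)
        then show ?thesis using w' dd[of w' r'] Suc by blast
      qed
      then obtain c l where c: "c \<in> carrier (C r)" "d r c = \<zero>\<^bsub>C (Suc r)\<^esub>"
        "g [^] (l + (s + t)) \<odot>\<^bsub>C r\<^esub> c = g [^] (l::nat) \<odot>\<^bsub>C r\<^esub> b" by blast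
      define y where "y = e \<ominus>\<^bsub>C r\<^esub> (z \<oplus>\<^bsub>C r\<^esub> c)"
      have bc: "b \<in> carrier (C r)" using x zc by (simp add: b_def)
      have b_eq: "b \<oplus>\<^bsub>C r\<^esub> g [^] (s + t) \<odot>\<^bsub>C r\<^esub> z = g [^] s \<odot>\<^bsub>C r\<^esub> x"
        using x zc by (simp add: b_def M.minus_eq M.a_assoc M.l_neg)
      define n where "n = (l + k) + (s + t)"
      have e1: "g [^] n \<odot>\<^bsub>C r\<^esub> e = g [^] (l + k) \<odot>\<^bsub>C r\<^esub> (g [^] s \<odot>\<^bsub>C r\<^esub> x)"
        using pow_raise[OF g *(2) x(2) *(4), of "l + s"] pow_smult[OF g x(2), of "l + k" s]
        by (simp add: n_def ac_simps)
      have e2: "g [^] n \<odot>\<^bsub>C r\<^esub> c = g [^] (l + k) \<odot>\<^bsub>C r\<^esub> b"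
        using pow_raise[OF g c(1) bc c(3), of k] by (simp add: n_def ac_simps)
      have e3: "g [^] n \<odot>\<^bsub>C r\<^esub> z = g [^] (l + k) \<odot>\<^bsub>C r\<^esub> (g [^] (s + t) \<odot>\<^bsub>C r\<^esub> z)"
        using pow_smult[OF g zc(2)] by (simp add: n_def)
      have "g [^] n \<odot>\<^bsub>C r\<^esub> (z \<oplus>\<^bsub>C r\<^esub> c) = g [^] n \<odot>\<^bsub>C r\<^esub> e"
      proof -
        have "g [^] n \<odot>\<^bsub>C r\<^esub> (z \<oplus>\<^bsub>C r\<^esub> c) = g [^] (l + k) \<odot>\<^bsub>C r\<^esub> (b \<oplus>\<^bsub>C r\<^esub> g [^] (s + t) \<odot>\<^bsub>C r\<^esub> z)"
          using zc c bc by (simp add: M.smult_r_distr e2 e3 M.a_comm)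
        then show ?thesis using e1 b_eq by simp
      qed
      then have "g [^] n \<odot>\<^bsub>C r\<^esub> y = \<zero>\<^bsub>C r\<^esub>"
        unfolding y_def using * zc c
        by (simp add: M.minus_eq M.smult_r_distr[of _ e] M.smult_r_minus M.r_neg)
      moreover have "y \<in> carrier (C r)" using * zc c by (simp add: y_def)
      moreover have "d r y = d r e" using * zc c by (simp add: y_def d_minus d_add M'.minus_eq)
      ultimately show "x' \<in> coboundaries (\<lambda>n. ptorsion R g (C n)) d (Suc r)"
        using * by (auto simp: ptorsion_iff intro!: image_eqI[where x = y])
    qed
  next
    case (7 m t x1 m' x2)
    then obtain x e k y f l where *: "rep m t x" "e \<in> carrier (C r)" "x1 = d r e"
       "g [^] (k + t) \<odot>\<^bsub>C r\<^esub> e = g [^] (k::nat) \<odot>\<^bsub>C r\<^esub> x"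
       "rep m' t y" "f \<in> carrier (C r)" "x2 = d r f"
       "g [^] (l + t) \<odot>\<^bsub>C r\<^esub> f = g [^] (l::nat) \<odot>\<^bsub>C r\<^esub> y" by (auto simp: rep_step_def)
    note x = rc[OF *(1)] and y = rc[OF *(5)]
    have "g [^] ((l + k) + t) \<odot>\<^bsub>C r\<^esub> (e \<oplus>\<^bsub>C r\<^esub> f) = g [^] (l + k) \<odot>\<^bsub>C r\<^esub> (x \<oplus>\<^bsub>C r\<^esub> y)"
      using pow_raise[OF g *(2) x(2) *(4), of l] pow_raise[OF g *(6) y(2) *(8), of k] x y *
      by (simp add: M.smult_r_distr add.commute)
    then show ?case using * rep_add[OF *(1) *(5)] unfolding rep_step_def
      by (intro exI[of _ "x \<oplus>\<^bsub>C r\<^esub> y"] exI[of _ "e \<oplus>\<^bsub>C r\<^esub> f"] exI[of _ "l + k"]) (simp add: d_add)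
  next
    case (8 m t x1 a)
    then obtain x e k where *: "rep m t x" "e \<in> carrier (C r)" "x1 = d r e"
       "g [^] (k + t) \<odot>\<^bsub>C r\<^esub> e = g [^] (k::nat) \<odot>\<^bsub>C r\<^esub> x" by (auto simp: rep_step_def)
    note x = rc[OF *(1)]
    have comm: "b \<odot>\<^bsub>C r\<^esub> (a \<odot>\<^bsub>C r\<^esub> w) = a \<odot>\<^bsub>C r\<^esub> (b \<odot>\<^bsub>C r\<^esub> w)"
      if "b \<in> carrier R" "w \<in> carrier (C r)" for b w
      using that 8 by (simp add: M.smult_assoc1[symmetric] m_comm)
    have "g [^] (k + t) \<odot>\<^bsub>C r\<^esub> (a \<odot>\<^bsub>C r\<^esub> e) = g [^] k \<odot>\<^bsub>C r\<^esub> (a \<odot>\<^bsub>C r\<^esub> x)"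
      using * x by (simp add: comm)
    then show ?case using * rep_smult[OF *(1) 8(2)] 8 unfolding rep_step_def
      by (intro exI[of _ "a \<odot>\<^bsub>C r\<^esub> x"] exI[of _ "a \<odot>\<^bsub>C r\<^esub> e"] exI[of _ k]) (simp add: d_smult)
  next
    case (9 m t x1 s)
    then obtain x e k where *: "rep m t x" "e \<in> carrier (C r)" "x1 = d r e"
       "g [^] (k + t) \<odot>\<^bsub>C r\<^esub> e = g [^] (k::nat) \<odot>\<^bsub>C r\<^esub> x" by (auto simp: rep_step_def)
    note x = rc[OF *(1)]
    have "rep (F [^] s \<otimes> (g [^] s \<otimes> m)) (t + s) (g [^] s \<odot>\<^bsub>C r\<^esub> x)"
      using * by (intro rep_shift rep_smult) auto
    moreover have "F [^] s \<otimes> (g [^] s \<otimes> m) = (F \<otimes> g) [^] s \<otimes> m"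
      using x g by (simp add: nat_pow_distrib m_assoc)
    moreover have "g [^] (k + (t + s)) \<odot>\<^bsub>C r\<^esub> e = g [^] k \<odot>\<^bsub>C r\<^esub> (g [^] s \<odot>\<^bsub>C r\<^esub> x)"
      using pow_raise[OF g *(2) x(2) *(4), of s] pow_smult[OF g x(2), of k s] by (simp add: ac_simps)
    ultimately show ?case using * unfolding rep_step_def
      by (intro exI[of _ "g [^] s \<odot>\<^bsub>C r\<^esub> x"] exI[of _ e] exI[of _ k]) simp
  qed
qed

end

primrec ptorsions :: "('a, 'r) ring_scheme \<Rightarrow> 'a list \<Rightarrow> ('a, 'e) module \<Rightarrow> ('a, 'e) module"
  where
    "ptorsions R [] M = M"
  | "ptorsions R (g # gs) M = ptorsion R g (ptorsions R gs M)"

primrec lprod :: "('a, 'r) ring_scheme \<Rightarrow> 'a list \<Rightarrow> 'a"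
  where
    "lprod R [] = \<one>\<^bsub>R\<^esub>"
  | "lprod R (g # gs) = lprod R gs \<otimes>\<^bsub>R\<^esub> g"

primrec pideal :: "('a, 'r) ring_scheme \<Rightarrow> 'a list \<Rightarrow> nat \<Rightarrow> 'a set"
  where
    "pideal R [] n = {\<zero>\<^bsub>R\<^esub>}"
  | "pideal R (g # gs) n = {y \<oplus>\<^bsub>R\<^esub> g [^]\<^bsub>R\<^esub> n \<otimes>\<^bsub>R\<^esub> c | y c. y \<in> pideal R gs n \<and> c \<in> carrier R}"

primrec symbol :: "('a, 'r) ring_scheme \<Rightarrow> (nat \<Rightarrow> ('a, 'e) module) \<Rightarrow> (nat \<Rightarrow> 'e \<Rightarrow> 'e) \<Rightarrow> ('a \<Rightarrow> 'e) \<Rightarrow>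
    'a list \<Rightarrow> 'a \<Rightarrow> nat \<Rightarrow> 'e \<Rightarrow> bool"
  where
    "symbol R E d \<epsilon> [] = (\<lambda>m t x. m \<in> carrier R \<and> x = \<epsilon> m)"
  | "symbol R E d \<epsilon> (g # gs) =
      rep_step R (\<lambda>n. ptorsions R gs (E n)) d (length gs) g (symbol R E d \<epsilon> gs)"

text \<open>The criterion that the iteration of \<open>zero_step\<close> produces; \<open>symbol_zero_iff\<close> brings it into closed form. In degree 0,
  where the list is empty, the symbols are the ring elements, and \<open>\<epsilon>\<close> represents them.\<close>
primrec symbol_zero :: "('a, 'r) ring_scheme \<Rightarrow> 'a list \<Rightarrow> 'a \<Rightarrow> nat \<Rightarrow> bool"
  where
    "symbol_zero R [] = (\<lambda>m t. m = \<zero>\<^bsub>R\<^esub>)"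
  | "symbol_zero R (g # gs) = zero_step R (lprod R gs) g (symbol_zero R gs)"

context cring
begin

lemma lprod_closed [simp, intro]: "set gs \<subseteq> carrier R \<Longrightarrow> lprod R gs \<in> carrier R"
  by (induction gs) auto

lemma pideal_ideal: "set gs \<subseteq> carrier R \<Longrightarrow> ideal (pideal R gs n) R"
proof (induction gs)
  case Nil then show ?case by (simp add: zeroideal)
next
  case (Cons g gs)
  then interpret I: ideal "pideal R gs n" R by simp
  have g: "g [^] n \<in> carrier R" using Cons by simp
  interpret J: ideal "PIdl (g [^] n)" R by (rule cgenideal_ideal[OF g])
  have "pideal R (g # gs) n = pideal R gs n <+> PIdl (g [^] n)"
    unfolding set_add_def' cgenideal_def using g by (auto simp: m_comm) (metis m_comm)+
  then show ?case using add_ideals[OF I.is_ideal J.is_ideal] by simp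
qed

lemma pideal_pow_mem: "\<lbrakk>set gs \<subseteq> carrier R; g \<in> set gs\<rbrakk> \<Longrightarrow> g [^] n \<in> pideal R gs n"
proof (induction gs)
  case (Cons h gs)
  interpret I: ideal "pideal R gs n" R using pideal_ideal Cons by simp
  show ?case
  proof (cases "g = h")
    case True
    have "h [^] n = \<zero> \<oplus> h [^] n \<otimes> \<one>" using Cons by simp
    then show ?thesis unfolding True pideal.simps using I.zero_closed by blast
  next
    case False
    then have "g [^] n \<in> pideal R gs n" using Cons by simp
    moreover have "g [^] n = g [^] n \<oplus> h [^] n \<otimes> \<zero>" using Cons by auto
    ultimately show ?thesis unfolding pideal.simps using zero_closed by blast
  qed
qed simp

lemma pideal_minimal:
  assumes "ideal J R" "\<And>g. g \<in> set gs \<Longrightarrow> g [^] n \<in> J"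
  shows "pideal R gs n \<subseteq> J"
  using assms(2)
proof (induction gs)
  case Nil
  interpret ideal J R by fact
  show ?case by simp
next
  case (Cons g gs)
  interpret ideal J R by fact
  show ?case using Cons by (auto intro!: I_r_closed)
qed

text \<open>One factor of the product \<open>g\<^sub>1 \<dots> g\<^sub>r\<close> raises the exponent of its generator, the others are absorbed by the ideal.\<close>
lemma pideal_shift:
  assumes "set gs \<subseteq> carrier R" "y \<in> pideal R gs n"
  shows "lprod R gs [^] k \<otimes> y \<in> pideal R gs (n + k)"
  using assms
proof (induction gs arbitrary: y)
  case (Cons g gs)
  interpret I: ideal "pideal R gs n" R using pideal_ideal Cons by simp
  interpret I': ideal "pideal R gs (n + k)" R using pideal_ideal Cons by simp
  obtain z c where y: "y = z \<oplus> g [^] n \<otimes> c" "z \<in> pideal R gs n" "c \<in> carrier R"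
    using Cons by auto
  have g: "g \<in> carrier R" "lprod R gs \<in> carrier R" "z \<in> carrier R" using Cons y I.Icarr by auto
  have "lprod R (g # gs) [^] k \<otimes> y =
      g [^] k \<otimes> (lprod R gs [^] k \<otimes> z) \<oplus> g [^] (n + k) \<otimes> (lprod R gs [^] k \<otimes> c)"
    using g y by (simp add: y nat_pow_distrib r_distr nat_pow_mult[symmetric] m_ac)
  moreover have "g [^] k \<otimes> (lprod R gs [^] k \<otimes> z) \<in> pideal R gs (n + k)"
    using Cons.IH[OF _ y(2)] Cons.prems g by (auto intro!: I'.I_l_closed)
  ultimately show ?case using g y by auto
qed auto

lemma symbol_zero_iff:
  assumes "set gs \<subseteq> carrier R" "m \<in> carrier R"
  shows "symbol_zero R gs m t \<longleftrightarrow> (\<exists>s. lprod R gs [^] s \<otimes> m \<in> pideal R gs (t + s))"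
  using assms
proof (induction gs arbitrary: m t)
  case Nil then show ?case by auto
next
  case (Cons g gs)
  let ?F = "lprod R gs"
  have g: "g \<in> carrier R" "?F \<in> carrier R" using Cons by auto
  have gs: "set gs \<subseteq> carrier R" using Cons by simp
  show ?case
  proof
    assume "symbol_zero R (g # gs) m t"
    then obtain s a m' where m': "m' \<in> carrier R"
      and z: "symbol_zero R gs (?F [^] a \<otimes> (g [^] s \<otimes> m) \<ominus> g [^] (s + t) \<otimes> m') (t + a)"
      by (auto simp: zero_step_def)
    then obtain b where b: "?F [^] b \<otimes> (?F [^] a \<otimes> (g [^] s \<otimes> m) \<ominus> g [^] (s + t) \<otimes> m') \<in> pideal R gs (t + a + b)"
      using Cons g by auto
    define n where "n = a + b + s"
    interpret I: ideal "pideal R gs (t + n)" R using pideal_ideal[OF gs] .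
    let ?z = "g [^] (a + b) \<otimes> (?F [^] s \<otimes> (?F [^] b \<otimes> (?F [^] a \<otimes> (g [^] s \<otimes> m) \<ominus> g [^] (s + t) \<otimes> m')))"
    have "?F [^] s \<otimes> (?F [^] b \<otimes> (?F [^] a \<otimes> (g [^] s \<otimes> m) \<ominus> g [^] (s + t) \<otimes> m')) \<in> pideal R gs (t + n)"
      using pideal_shift[OF gs b, of s] by (simp add: n_def ac_simps)
    then have z: "?z \<in> pideal R gs (t + n)"
      using g by (rule_tac I.I_l_closed) auto
    have "?z = (?F \<otimes> g) [^] n \<otimes> m \<ominus> g [^] (t + n) \<otimes> (?F [^] (s + b) \<otimes> m')"
      using g m' Cons by (simp add: n_def nat_pow_distrib nat_pow_mult[symmetric] minus_eq r_distr r_minus m_ac)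
    then have "(?F \<otimes> g) [^] n \<otimes> m = ?z \<oplus> g [^] (t + n) \<otimes> (?F [^] (s + b) \<otimes> m')"
      using g m' Cons by (simp add: minus_eq a_assoc l_neg)
    then have "lprod R (g # gs) [^] n \<otimes> m \<in> pideal R (g # gs) (t + n)"
      using z g m' unfolding pideal.simps lprod.simps by blast
    then show "\<exists>s. lprod R (g # gs) [^] s \<otimes> m \<in> pideal R (g # gs) (t + s)" by blast
  next
    assume "\<exists>s. lprod R (g # gs) [^] s \<otimes> m \<in> pideal R (g # gs) (t + s)"
    then obtain s z c where z: "z \<in> pideal R gs (t + s)" "c \<in> carrier R"
      "(?F \<otimes> g) [^] s \<otimes> m = z \<oplus> g [^] (t + s) \<otimes> c" by auto
    interpret I: ideal "pideal R gs (t + s)" R using pideal_ideal[OF gs] .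
    have "z = ?F [^] s \<otimes> (g [^] s \<otimes> m) \<ominus> g [^] (s + t) \<otimes> c"
    proof -
      have "z = (z \<oplus> g [^] (t + s) \<otimes> c) \<ominus> g [^] (t + s) \<otimes> c"
        using z g I.Icarr by (simp add: minus_eq a_assoc r_neg)
      then show ?thesis unfolding z(3)[symmetric] using g Cons by (simp add: nat_pow_distrib m_assoc add.commute)
    qed
    then have "symbol_zero R gs (?F [^] s \<otimes> (g [^] s \<otimes> m) \<ominus> g [^] (s + t) \<otimes> c) (t + s)"
      using Cons.IH[OF gs, of z "t + s"] z I.Icarr by (auto intro!: exI[of _ 0])
    then show "symbol_zero R (g # gs) m t" using z by (auto simp: zero_step_def)
  qed
qed

lemma ptorsions_carrier:
  assumes M: "Module.module R M" and gs: "set gs \<subseteq> carrier R"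
  shows "Module.module R (ptorsions R gs M) \<and>
    ptorsions R gs M = M\<lparr>carrier := {x \<in> carrier M. \<exists>t::nat. \<forall>g \<in> set gs. g [^] t \<odot>\<^bsub>M\<^esub> x = \<zero>\<^bsub>M\<^esub>}\<rparr>"
  using gs
proof (induction gs)
  case Nil then show ?case using M by simp
next
  case (Cons g gs)
  interpret M: Module.module R M by (rule M)
  let ?P = "ptorsions R gs M"
  have P: "?P = M\<lparr>carrier := {x \<in> carrier M. \<exists>t::nat. \<forall>g \<in> set gs. g [^] t \<odot>\<^bsub>M\<^esub> x = \<zero>\<^bsub>M\<^esub>}\<rparr>"
    and mP: "Module.module R ?P"
    using Cons by auto
  have up: "h [^] (t + k) \<odot>\<^bsub>M\<^esub> x = \<zero>\<^bsub>M\<^esub>"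
    if "x \<in> carrier M" "h [^] t \<odot>\<^bsub>M\<^esub> x = \<zero>\<^bsub>M\<^esub>" "h \<in> carrier R" for h x and t k :: nat
    using that M.smult_assoc1[of "h [^] k" "h [^] t" x] by (simp add: nat_pow_mult add.commute)
  have "(\<exists>t::nat. \<forall>h\<in>set gs. h [^] t \<odot>\<^bsub>M\<^esub> x = \<zero>\<^bsub>M\<^esub>) \<and> (\<exists>t::nat. g [^] t \<odot>\<^bsub>M\<^esub> x = \<zero>\<^bsub>M\<^esub>) \<longleftrightarrow>
     (\<exists>t::nat. \<forall>h\<in>set (g # gs). h [^] t \<odot>\<^bsub>M\<^esub> x = \<zero>\<^bsub>M\<^esub>)" if "x \<in> carrier M" for x
  proof
    assume "(\<exists>t::nat. \<forall>h\<in>set gs. h [^] t \<odot>\<^bsub>M\<^esub> x = \<zero>\<^bsub>M\<^esub>) \<and> (\<exists>t::nat. g [^] t \<odot>\<^bsub>M\<^esub> x = \<zero>\<^bsub>M\<^esub>)"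
    then obtain t u :: nat where "\<forall>h\<in>set gs. h [^] t \<odot>\<^bsub>M\<^esub> x = \<zero>\<^bsub>M\<^esub>" "g [^] u \<odot>\<^bsub>M\<^esub> x = \<zero>\<^bsub>M\<^esub>" by blast
    then show "\<exists>t::nat. \<forall>h\<in>set (g # gs). h [^] t \<odot>\<^bsub>M\<^esub> x = \<zero>\<^bsub>M\<^esub>"
      using up[OF that, of _ t u] up[OF that, of _ u t] Cons.prems by (intro exI[of _ "t + u"]) (auto simp: add.commute)
  qed auto
  then show ?case using ptorsion_module[OF mP, of g] Cons.prems
    unfolding ptorsions.simps ptorsion_def P by (auto intro!: arg_cong[where f = "\<lambda>c. M\<lparr>carrier := c\<rparr>"])
qed


text \<open>The ascending chain of the ideals \<open>(I : g\<^sup>s)\<close> stops.\<close>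
lemma colon_stable:
  assumes N: "noetherian_ring R" and I: "ideal I R" and g: "g \<in> carrier R"
  shows "\<exists>s::nat. \<forall>r \<in> carrier R. g [^] Suc s \<otimes> r \<in> I \<longrightarrow> g [^] s \<otimes> r \<in> I"
proof -
  interpret N: noetherian_ring R by (rule N)
  interpret I: ideal I R by (rule I)
  define J where "J s = {r \<in> carrier R. g [^] (s::nat) \<otimes> r \<in> I}" for s
  have idl: "ideal (J s) R" for s
  proof (rule idealI)
    show "ring R" by (rule ring_axioms)
    show "subgroup (J s) (add_monoid R)"
      using g by (intro add.subgroupI) (auto simp: J_def r_distr r_minus I.a_closed I.a_inv_closed[simplified] intro: exI[of _ \<zero>])
  next
    fix a x assume "a \<in> J s" "x \<in> carrier R"
    then have "a \<in> carrier R" "g [^] s \<otimes> a \<otimes> x \<in> I" "x \<in> carrier R"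
      by (auto simp: J_def I.I_r_closed)
    then show "x \<otimes> a \<in> J s" "a \<otimes> x \<in> J s" using g by (auto simp: J_def m_assoc m_comm[of x a])
  qed
  have mono: "J s \<subseteq> J (s + k)" for s k
  proof
    fix r assume r: "r \<in> J s"
    then have "g [^] k \<otimes> (g [^] s \<otimes> r) \<in> I" using g by (auto simp: J_def I.I_l_closed)
    moreover have "g [^] k \<otimes> (g [^] s \<otimes> r) = g [^] (s + k) \<otimes> r"
      using r g by (simp add: J_def m_assoc[symmetric] nat_pow_mult add.commute)
    ultimately show "r \<in> J (s + k)" using r by (simp add: J_def)
  qed
  have "subset.chain {I. ideal I R} (range J)"
  proof (rule subset.chainI)
    show "range J \<subseteq> {I. ideal I R}" using idl by auto
    fix X Y assume "X \<in> range J" "Y \<in> range J"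
    then obtain s t where XY: "X = J s" "Y = J t" by auto
    then have "X \<subseteq> Y \<or> Y \<subseteq> X"
      using mono[of s "t - s"] mono[of t "s - t"] by (cases "s \<le> t") auto
    then show "(\<subset>)\<^sup>=\<^sup>= X Y \<or> (\<subset>)\<^sup>=\<^sup>= Y X" by auto
  qed
  then have "\<Union>(range J) \<in> range J" by (intro N.ideal_chain_is_trivial) auto
  then obtain s where s: "\<Union>(range J) = J s" by auto
  then have "J (Suc s) \<subseteq> J s" by blast
  then show ?thesis by (intro exI[of _ s]) (auto simp: J_def)
qed

lemma self_module_simps [simp]:
  "carrier (module_via f B) = carrier B" "\<zero>\<^bsub>module_via f B\<^esub> = \<zero>\<^bsub>B\<^esub>"
  "x \<oplus>\<^bsub>module_via f B\<^esub> y = x \<oplus>\<^bsub>B\<^esub> y" "a \<odot>\<^bsub>module_via f B\<^esub> x = f a \<otimes>\<^bsub>B\<^esub> x"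
  by (auto simp: module_via_def)

end

lemma module_via_module:
  assumes R: "cring R" and B: "cring B" and f: "f \<in> ring_hom R B"
  shows "Module.module R (module_via f B)"
proof -
  interpret R: cring R by fact
  interpret B: cring B by fact
  have "abelian_group (module_via f B)"
  proof (rule abelian_groupI)
    fix x assume "x \<in> carrier (module_via f B)"
    then show "\<exists>y\<in>carrier (module_via f B). y \<oplus>\<^bsub>module_via f B\<^esub> x = \<zero>\<^bsub>module_via f B\<^esub>"
      by (auto intro!: bexI[of _ "\<ominus>\<^bsub>B\<^esub> x"] simp: R.self_module_simps B.l_neg)
  qed (auto simp: R.self_module_simps B.a_ac)
  then show ?thesis
    using f by (intro moduleI R)
      (auto simp: R.self_module_simps ring_hom_closed ring_hom_add ring_hom_mult ring_hom_one B.l_distr B.r_distr B.m_assoc)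
qed

context cring
begin

lemma self_module: "Module.module R (self_module R)"
  by (rule module_via_module) (auto simp: is_cring intro: ring_hom_memI)

lemma ideal_submodule:
  assumes "ideal I R" shows "Module.submodule I R (self_module R)"
proof -
  interpret I: ideal I R by fact
  interpret S: Module.module R "self_module R" by (rule self_module)
  have inv: "\<ominus>\<^bsub>self_module R\<^esub> a = \<ominus> a" if "a \<in> carrier R" for a
    using S.minus_equality[of "\<ominus> a" a] that by (simp add: l_neg)
  show ?thesis
    by (rule S.submoduleI) (use inv I.Icarr in \<open>auto simp: I.a_inv_closed[simplified] I.I_l_closed\<close>)
qed

lemma diff_cancel:
  assumes "z \<in> carrier R" "x \<in> carrier R" "y \<in> carrier R"
  shows "(z \<oplus> x) \<ominus> (z \<oplus> y) = x \<ominus> y"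
proof -
  have "(z \<oplus> x) \<ominus> (z \<oplus> y) = (x \<oplus> z) \<oplus> (\<ominus> z \<oplus> \<ominus> y)"
    using assms by (simp add: minus_eq minus_add a_comm)
  also have "\<dots> = x \<oplus> (z \<oplus> (\<ominus> z \<oplus> \<ominus> y))" using assms by (intro a_assoc) auto
  also have "z \<oplus> (\<ominus> z \<oplus> \<ominus> y) = \<ominus> y" using assms by (intro r_neg2) auto
  finally show ?thesis by (simp add: minus_eq)
qed

text \<open>Let \<open>e\<close> be killed by the ideal \<open>a\<close> of \<open>t\<close>-th powers of the \<open>gs\<close>. With \<open>s\<close> from \<open>colon_stable\<close>, the assignment
  \<open>g\<^sup>s\<^sup>+\<^sup>1 r \<mapsto> g\<^sup>s r e\<close>, and \<open>0\<close> on \<open>a\<close>, is well defined on \<open>a + (g\<^sup>s\<^sup>+\<^sup>1)\<close>; it extends to \<open>R\<close> by injectivity. The image of 1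
  is the element \<open>e'\<close>, and it is again killed by \<open>a\<close>, hence torsion.\<close>
lemma injective_pow_divisible:
  fixes E :: "('a, 'e) module"
  assumes N: "noetherian_ring R" and E: "injective_module R E"
    and gs: "set gs \<subseteq> carrier R" and g: "g \<in> carrier R"
  shows "pow_divisible R g (ptorsions R gs E)"
  unfolding pow_divisible_def
proof
  interpret E: Module.module R E using E by (simp add: injective_module_def)
  have P: "ptorsions R gs E = E\<lparr>carrier := {x \<in> carrier E. \<exists>t::nat. \<forall>g \<in> set gs. g [^] t \<odot>\<^bsub>E\<^esub> x = \<zero>\<^bsub>E\<^esub>}\<rparr>"
    using ptorsions_carrier[OF E.module_axioms gs] by simp
  fix e assume "e \<in> carrier (ptorsions R gs E)"
  then obtain t :: nat where e: "e \<in> carrier E" and t: "\<And>h. h \<in> set gs \<Longrightarrow> h [^] t \<odot>\<^bsub>E\<^esub> e = \<zero>\<^bsub>E\<^esub>"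
    by (auto simp: P)
  let ?a = "pideal R gs t"
  interpret A: ideal ?a R by (rule pideal_ideal[OF gs])
  have "ideal {r \<in> carrier R. r \<odot>\<^bsub>E\<^esub> e = \<zero>\<^bsub>E\<^esub>} R"
  proof (rule idealI)
    show "ring R" by (rule ring_axioms)
    show "subgroup {r \<in> carrier R. r \<odot>\<^bsub>E\<^esub> e = \<zero>\<^bsub>E\<^esub>} (add_monoid R)"
      using e by (intro add.subgroupI) (auto simp: E.smult_l_distr E.smult_l_minus intro: exI[of _ \<zero>])
  next
    fix a x assume "a \<in> {r \<in> carrier R. r \<odot>\<^bsub>E\<^esub> e = \<zero>\<^bsub>E\<^esub>}" "x \<in> carrier R"
    then have ax: "a \<in> carrier R" "a \<odot>\<^bsub>E\<^esub> e = \<zero>\<^bsub>E\<^esub>" "x \<in> carrier R" by auto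
    then show "x \<otimes> a \<in> {r \<in> carrier R. r \<odot>\<^bsub>E\<^esub> e = \<zero>\<^bsub>E\<^esub>}" using e by (simp add: E.smult_assoc1)
    then show "a \<otimes> x \<in> {r \<in> carrier R. r \<odot>\<^bsub>E\<^esub> e = \<zero>\<^bsub>E\<^esub>}" using ax by (simp add: m_comm)
  qed
  then have "?a \<subseteq> {r \<in> carrier R. r \<odot>\<^bsub>E\<^esub> e = \<zero>\<^bsub>E\<^esub>}"
    using gs t by (intro pideal_minimal) auto
  then have a_e: "r \<odot>\<^bsub>E\<^esub> e = \<zero>\<^bsub>E\<^esub>" if "r \<in> ?a" for r using that by auto
  obtain s :: nat where s: "\<And>r. r \<in> carrier R \<Longrightarrow> g [^] Suc s \<otimes> r \<in> ?a \<Longrightarrow> g [^] s \<otimes> r \<in> ?a"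
    using colon_stable[OF N A.is_ideal g] by blast
  let ?u = "g [^] Suc s"
  have u: "?u \<in> carrier R" "g [^] s \<in> carrier R" using g by auto
  define b where "b = ?a <+>\<^bsub>R\<^esub> PIdl ?u"
  have b_ideal: "ideal b R" unfolding b_def by (rule add_ideals[OF A.is_ideal cgenideal_ideal[OF u(1)]])
  interpret b: ideal b R by (rule b_ideal)
  have b_iff: "y \<in> b \<longleftrightarrow> (\<exists>a r. a \<in> ?a \<and> r \<in> carrier R \<and> y = a \<oplus> ?u \<otimes> r)" for y
    unfolding b_def set_add_def' cgenideal_def using u by (auto simp: m_comm simp del: nat_pow_Suc) (metis m_comm u(1))+
  define q where "q y = (SOME r. r \<in> carrier R \<and> (\<exists>a \<in> ?a. y = a \<oplus> ?u \<otimes> r))" for y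
  define f where "f y = (g [^] s \<otimes> q y) \<odot>\<^bsub>E\<^esub> e" for y
  have f_eq: "f (a \<oplus> ?u \<otimes> r) = (g [^] s \<otimes> r) \<odot>\<^bsub>E\<^esub> e" if ar: "a \<in> ?a" "r \<in> carrier R" for a r
  proof -
    let ?y = "a \<oplus> ?u \<otimes> r"
    have "q ?y \<in> carrier R \<and> (\<exists>a \<in> ?a. ?y = a \<oplus> ?u \<otimes> q ?y)"
      unfolding q_def by (rule someI[of _ r]) (use ar in auto)
    then obtain a' where a': "a' \<in> ?a" "q ?y \<in> carrier R" "?y = a' \<oplus> ?u \<otimes> q ?y" by blast
    have c: "a \<in> carrier R" "a' \<in> carrier R" using ar a' A.Icarr by auto
    have "?u \<otimes> (q ?y \<ominus> r) = (a' \<oplus> ?u \<otimes> q ?y) \<ominus> (a' \<oplus> ?u \<otimes> r)"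
      using c a'(2) ar u diff_cancel[of a' "?u \<otimes> q ?y" "?u \<otimes> r"]
      by (simp add: minus_eq r_distr r_minus del: nat_pow_Suc)
    also have "\<dots> = (a \<oplus> ?u \<otimes> r) \<ominus> (a' \<oplus> ?u \<otimes> r)" using a'(3) by simp
    also have "\<dots> = a \<ominus> a'"
      using c ar u diff_cancel[of "?u \<otimes> r" a a'] by (simp add: a_comm del: nat_pow_Suc)
    finally have "?u \<otimes> (q ?y \<ominus> r) \<in> ?a"
      using ar a' by (simp add: minus_eq A.a_closed A.a_inv_closed[simplified] del: nat_pow_Suc)
    then have "g [^] s \<otimes> (q ?y \<ominus> r) \<in> ?a" using s a'(2) ar by simp
    then have "(g [^] s \<otimes> (q ?y \<ominus> r)) \<odot>\<^bsub>E\<^esub> e = \<zero>\<^bsub>E\<^esub>" by (rule a_e)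
    moreover have "g [^] s \<otimes> q ?y = g [^] s \<otimes> (q ?y \<ominus> r) \<oplus> g [^] s \<otimes> r"
      using a'(2) ar u by (simp add: minus_eq r_distr r_minus a_assoc l_neg)
    ultimately show ?thesis using a'(2) ar u e unfolding f_def by (simp add: E.smult_l_distr)
  qed
  have "f \<in> LinearCombinations.module_hom R ((self_module R)\<lparr>carrier := b\<rparr>) E"
  proof (rule module_homI)
    fix x assume "x \<in> carrier ((self_module R)\<lparr>carrier := b\<rparr>)"
    then have x: "x \<in> b" by simp
    obtain a r where "a \<in> ?a" "r \<in> carrier R" "x = a \<oplus> ?u \<otimes> r"
      using x unfolding b_iff by (elim exE conjE) (rule that)
    then show "f x \<in> carrier E" using f_eq u e by simp
  next
    fix x y assume "x \<in> carrier ((self_module R)\<lparr>carrier := b\<rparr>)" "y \<in> carrier ((self_module R)\<lparr>carrier := b\<rparr>)"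
    then have xy: "x \<in> b" "y \<in> b" by simp_all
    obtain a r where *: "a \<in> ?a" "r \<in> carrier R" "x = a \<oplus> ?u \<otimes> r"
      using xy(1) unfolding b_iff by (elim exE conjE) (rule that)
    obtain a' r' where **: "a' \<in> ?a" "r' \<in> carrier R" "y = a' \<oplus> ?u \<otimes> r'"
      using xy(2) unfolding b_iff by (elim exE conjE) (rule that)
    have "x \<oplus> y = (a \<oplus> a') \<oplus> ?u \<otimes> (r \<oplus> r')"
      using * ** A.Icarr u by (simp add: r_distr a_ac del: nat_pow_Suc)
    moreover have "f \<dots> = f x \<oplus>\<^bsub>E\<^esub> f y"
    proof -
      have "f ((a \<oplus> a') \<oplus> ?u \<otimes> (r \<oplus> r')) = (g [^] s \<otimes> (r \<oplus> r')) \<odot>\<^bsub>E\<^esub> e"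
        by (rule f_eq) (use * ** in \<open>auto intro: A.a_closed\<close>)
      also have "\<dots> = f x \<oplus>\<^bsub>E\<^esub> f y"
        using * ** u e by (simp only: f_eq r_distr E.smult_l_distr m_closed)
      finally show ?thesis .
    qed
    ultimately show "f (x \<oplus>\<^bsub>(self_module R)\<lparr>carrier := b\<rparr>\<^esub> y) = f x \<oplus>\<^bsub>E\<^esub> f y"
      by (simp add: module_via_def)
  next
    fix c x assume c: "c \<in> carrier R" and "x \<in> carrier ((self_module R)\<lparr>carrier := b\<rparr>)"
    then have x: "x \<in> b" by simp
    obtain a r where *: "a \<in> ?a" "r \<in> carrier R" "x = a \<oplus> ?u \<otimes> r"
      using x unfolding b_iff by (elim exE conjE) (rule that)
    have "c \<otimes> x = c \<otimes> a \<oplus> ?u \<otimes> (c \<otimes> r)"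
      using * A.Icarr c u by (simp add: r_distr m_lcomm del: nat_pow_Suc)
    moreover have "f \<dots> = c \<odot>\<^bsub>E\<^esub> f x"
    proof -
      have "f (c \<otimes> a \<oplus> ?u \<otimes> (c \<otimes> r)) = (g [^] s \<otimes> (c \<otimes> r)) \<odot>\<^bsub>E\<^esub> e"
        by (rule f_eq) (use * c in \<open>auto intro: A.I_l_closed\<close>)
      also have "\<dots> = (c \<otimes> (g [^] s \<otimes> r)) \<odot>\<^bsub>E\<^esub> e"
        using * u c by (simp add: m_lcomm)
      also have "\<dots> = c \<odot>\<^bsub>E\<^esub> f x"
        using * u e c by (simp only: f_eq E.smult_assoc1 m_closed)
      finally show ?thesis .
    qed
    ultimately show "f (c \<odot>\<^bsub>(self_module R)\<lparr>carrier := b\<rparr>\<^esub> x) = c \<odot>\<^bsub>E\<^esub> f x"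
      by (simp add: module_via_def)
  qed
  then obtain h where h: "h \<in> LinearCombinations.module_hom R (self_module R) E" "\<And>x. x \<in> b \<Longrightarrow> h x = f x"
    using E ideal_submodule[OF b_ideal] self_module unfolding injective_module_def by blast
  define e' where "e' = h \<one>"
  have e': "e' \<in> carrier E" using module_homD(1)[OF h(1), of \<one>] by (simp add: e'_def)
  have he': "h r = r \<odot>\<^bsub>E\<^esub> e'" if "r \<in> carrier R" for r
    using module_homD(3)[OF h(1), of r \<one>] that by (simp add: e'_def)
  have "?u \<odot>\<^bsub>E\<^esub> e' = g [^] s \<odot>\<^bsub>E\<^esub> e"
  proof -
    have "?u = \<zero> \<oplus> ?u \<otimes> \<one>" using u by (simp del: nat_pow_Suc)
    then have "?u \<in> b" "f ?u = (g [^] s \<otimes> \<one>) \<odot>\<^bsub>E\<^esub> e"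
      using b_iff f_eq[of \<zero> \<one>] by (metis A.zero_closed one_closed)+
    then show ?thesis using h(2) he' u by simp
  qed
  moreover have "e' \<in> carrier (ptorsions R gs E)"
  proof -
    have "h' [^] t \<odot>\<^bsub>E\<^esub> e' = \<zero>\<^bsub>E\<^esub>" if "h' \<in> set gs" for h'
    proof -
      have m: "h' [^] t \<in> ?a" using pideal_pow_mem[OF gs that] .
      then have "h' [^] t = h' [^] t \<oplus> ?u \<otimes> \<zero>" using u A.Icarr by (simp del: nat_pow_Suc)
      then have "h' [^] t \<in> b" "f (h' [^] t) = (g [^] s \<otimes> \<zero>) \<odot>\<^bsub>E\<^esub> e"
        using b_iff f_eq[OF m, of \<zero>] m by (metis zero_closed)+
      then show ?thesis using h(2) he' u e A.Icarr[OF m] by simp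
    qed
    then show ?thesis using e' by (auto simp: P)
  qed
  moreover have "c \<odot>\<^bsub>ptorsions R gs E\<^esub> x = c \<odot>\<^bsub>E\<^esub> x" for c x by (simp add: P)
  ultimately show "\<exists>e'\<in>carrier (ptorsions R gs E). \<exists>s::nat. g [^] Suc s \<odot>\<^bsub>ptorsions R gs E\<^esub> e' = g [^] s \<odot>\<^bsub>ptorsions R gs E\<^esub> e"
    by metis
qed

text \<open>Induction on the generators. Without generators the symbols are the elements of \<open>R\<close>, the only cohomology of the resolution.\<close>
theorem top_symbols_injective_resolution:
  assumes N: "noetherian_ring R" and E: "injective_resolution R (self_module R) E d \<epsilon>"
    and gs: "set gs \<subseteq> carrier R"
  shows "top_symbols R (\<lambda>n. ptorsions R gs (E n)) d (length gs) (lprod R gs) (symbol R E d \<epsilon> gs) (symbol_zero R gs)"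
  using gs
proof (induction gs)
  case Nil
  have mods: "Module.module R (E n)" for n using E by (auto simp: injective_resolution_def injective_module_def)
  have eps: "\<epsilon> \<in> LinearCombinations.module_hom R (self_module R) (E 0)" "inj_on \<epsilon> (carrier R)"
    "\<epsilon> ` carrier R = a_kernel (E 0) (E 1) (d 0)" using E by (auto simp: injective_resolution_def)
  have ex: "d n ` carrier (E n) = a_kernel (E (Suc n)) (E (Suc (Suc n))) (d (Suc n))" for n
    using E by (auto simp: injective_resolution_def)
  interpret C: cochain_complex R E d
    using E mods ex unfolding injective_resolution_def a_kernel_def'
    by (intro cochain_complex.intro cochain_complex_axioms.intro is_cring) auto
  have e0: "\<epsilon> \<zero> = \<zero>\<^bsub>E 0\<^esub>" using module_hom_zero[OF self_module mods eps(1)] by simp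
  have top: "top_symbols_axioms R E d 0 \<one> (\<lambda>m t x. m \<in> carrier R \<and> x = \<epsilon> m) (\<lambda>m t. m = \<zero>)"
  proof (rule top_symbols_axioms.intro, goal_cases)
    case (2 j)
    then obtain j' where "j = Suc j'" by (cases j) auto
    then show ?case using ex[of j'] by (auto simp: C.cocycles_def a_kernel_def')
  next
    case (3 m t x)
    then show ?case using eps(3) by (auto simp: C.cocycles_def a_kernel_def')
  next
    case (4 x)
    then show ?case using eps(3) by (auto simp: C.cocycles_def a_kernel_def')
  next
    case (6 m t x)
    then show ?case using eps(2) e0 by (auto dest: inj_onD[of _ _ m \<zero>])
  next
    case (7 m t x m' x') then show ?case using module_homD(2)[OF eps(1)] by simp
  next
    case (8 m t x a) then show ?case using module_homD(3)[OF eps(1)] by simp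
  qed auto
  show ?case using C.cochain_complex_axioms top by (simp add: top_symbols_def)
next
  case (Cons g gs)
  then interpret T: top_symbols R "\<lambda>n. ptorsions R gs (E n)" d "length gs" "lprod R gs" "symbol R E d \<epsilon> gs" "symbol_zero R gs"
    by simp
  have "pow_divisible R g (ptorsions R gs (E n))" for n
    using E Cons by (intro injective_pow_divisible[OF N]) (auto simp: injective_resolution_def)
  then show ?case using T.top_symbols_step[of g] Cons by simp
qed

end

section \<open>Injective resolutions\<close>

definition divisible_group :: "('d, 'x) monoid_scheme \<Rightarrow> bool"
  where "divisible_group D \<longleftrightarrow> (\<forall>x \<in> carrier D. \<forall>n::nat. 0 < n \<longrightarrow> (\<exists>y \<in> carrier D. y [^]\<^bsub>D\<^esub> n = x))"

lemma DirProd_nat_pow: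
  assumes G: "group G" and D: "group D"
  shows "(a, b) [^]\<^bsub>G \<times>\<times> D\<^esub> (n::nat) = (a [^]\<^bsub>G\<^esub> n, b [^]\<^bsub>D\<^esub> n)"
proof -
  interpret G: group G by fact
  interpret D: group D by fact
  interpret P: group "G \<times>\<times> D" by (rule DirProd_group[OF G D])
  show ?thesis
  proof (induction n)
    case 0 show ?case by (simp only: P.nat_pow_0 G.nat_pow_0 D.nat_pow_0 one_DirProd)
  next
    case (Suc n) show ?case by (simp only: P.nat_pow_Suc G.nat_pow_Suc D.nat_pow_Suc Suc mult_DirProd)
  qed
qed

lemma DirProd_int_pow:
  assumes "group G" "group D" "a \<in> carrier G" "b \<in> carrier D"
  shows "(a, b) [^]\<^bsub>G \<times>\<times> D\<^esub> (k::int) = (a [^]\<^bsub>G\<^esub> k, b [^]\<^bsub>D\<^esub> k)"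
proof -
  interpret G: group G by fact
  interpret D: group D by fact
  have "inv\<^bsub>G \<times>\<times> D\<^esub> (a [^]\<^bsub>G\<^esub> n, b [^]\<^bsub>D\<^esub> n) = (inv\<^bsub>G\<^esub> (a [^]\<^bsub>G\<^esub> n), inv\<^bsub>D\<^esub> (b [^]\<^bsub>D\<^esub> n))" for n :: nat
    using assms by (intro inv_DirProd) auto
  then show ?thesis unfolding int_pow_def2 DirProd_nat_pow[OF assms(1,2)] by presburger
qed

text \<open>Partial homomorphisms are represented by their graphs, so that the union of a chain is an upper bound for Zorn's lemma.\<close>
definition partial_homs :: "('g, 'x) monoid_scheme \<Rightarrow> ('d, 'y) monoid_scheme \<Rightarrow> ('g \<times> 'd) set set"
  where "partial_homs G D = {H. subgroup H (G \<times>\<times> D) \<and> (\<forall>y. (\<one>\<^bsub>G\<^esub>, y) \<in> H \<longrightarrow> y = \<one>\<^bsub>D\<^esub>)}"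

text \<open>The value at the new element \<open>x\<close>: if some multiple of \<open>x\<close> lies in the domain, let \<open>n\<close> be the least positive one and divide the
  value at \<open>n x\<close> by \<open>n\<close>; otherwise any value will do.\<close>
lemma partial_hom_extend:
  assumes G: "comm_group G" and D: "comm_group D" and div: "divisible_group D"
    and H: "H \<in> partial_homs G D" and x: "x \<in> carrier G"
  shows "\<exists>H' \<in> partial_homs G D. H \<subseteq> H' \<and> x \<in> fst ` H'"
proof -
  interpret G: comm_group G by fact
  interpret D: comm_group D by fact
  interpret P: comm_group "G \<times>\<times> D"
    by (intro group.group_comm_groupI DirProd_group G.is_group D.is_group)
      (auto simp: G.m_comm D.m_comm)
  have sub: "subgroup H (G \<times>\<times> D)" and inj: "\<And>y. (\<one>\<^bsub>G\<^esub>, y) \<in> H \<Longrightarrow> y = \<one>\<^bsub>D\<^esub>"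
    using H by (auto simp: partial_homs_def)
  interpret H: subgroup H "G \<times>\<times> D" by (rule sub)
  have Hc: "a \<in> carrier G" "b \<in> carrier D" if "(a, b) \<in> H" for a b using H.subset that by auto
  have uniq: "b = b'" if "(a, b) \<in> H" "(a, b') \<in> H" for a b b'
  proof -
    have "(a, b) \<otimes>\<^bsub>G \<times>\<times> D\<^esub> inv\<^bsub>G \<times>\<times> D\<^esub> (a, b') \<in> H" using that by simp
    then have "b \<otimes>\<^bsub>D\<^esub> inv\<^bsub>D\<^esub> b' = \<one>\<^bsub>D\<^esub>" using that Hc by (intro inj) (simp add: inv_DirProd G.is_group D.is_group)
    then show ?thesis using that Hc by (metis D.inv_equality D.inv_inv D.inv_closed)
  qed
  define I where "I = {k::int. x [^]\<^bsub>G\<^esub> k \<in> fst ` H}"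
  have "\<exists>y \<in> carrier D. \<forall>k b. (x [^]\<^bsub>G\<^esub> (k::int), b) \<in> H \<longrightarrow> y [^]\<^bsub>D\<^esub> k = b"
  proof (cases "\<exists>n::nat. 0 < n \<and> int n \<in> I")
    case False
    have "k = 0" if "(x [^]\<^bsub>G\<^esub> (k::int), b) \<in> H" for k b
    proof (rule ccontr)
      assume "k \<noteq> 0"
      have "inv\<^bsub>G \<times>\<times> D\<^esub> (x [^]\<^bsub>G\<^esub> k, b) \<in> H" using that by simp
      then have "(x [^]\<^bsub>G\<^esub> (-k), inv\<^bsub>D\<^esub> b) \<in> H"
        using that Hc x by (simp add: inv_DirProd G.is_group D.is_group G.int_pow_neg)
      then have "int (nat \<bar>k\<bar>) \<in> I" using that by (cases "k > 0") (force simp: I_def)+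
      moreover have "0 < nat \<bar>k\<bar>" using \<open>k \<noteq> 0\<close> by simp
      ultimately show False using False by blast
    qed
    then show ?thesis using inj by (intro bexI[of _ "\<one>\<^bsub>D\<^esub>"] allI impI) (force, simp)
  next
    case True
    define n where "n = (LEAST n::nat. 0 < n \<and> int n \<in> I)"
    have n: "0 < n" "int n \<in> I" using LeastI_ex[OF True] by (auto simp: n_def)
    have least: "n \<le> m" if "0 < m" "int m \<in> I" for m using that by (auto simp: n_def intro: Least_le)
    obtain b where b: "(x [^]\<^bsub>G\<^esub> int n, b) \<in> H" using n by (auto simp: I_def)
    obtain y where y: "y \<in> carrier D" "y [^]\<^bsub>D\<^esub> n = b"
      using div n Hc[OF b] by (auto simp: divisible_group_def)
    have pw: "(x [^]\<^bsub>G\<^esub> (int n * q), y [^]\<^bsub>D\<^esub> (int n * q)) \<in> H" for q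
    proof -
      have "(x [^]\<^bsub>G\<^esub> int n, b) [^]\<^bsub>G \<times>\<times> D\<^esub> q \<in> H"
        using b P.subgroup_int_pow_closed[OF sub] by blast
      moreover have "(x [^]\<^bsub>G\<^esub> int n, b) [^]\<^bsub>G \<times>\<times> D\<^esub> q = ((x [^]\<^bsub>G\<^esub> int n) [^]\<^bsub>G\<^esub> q, b [^]\<^bsub>D\<^esub> q)"
        by (rule DirProd_int_pow[OF G.is_group D.is_group Hc[OF b]])
      moreover have "(x [^]\<^bsub>G\<^esub> int n) [^]\<^bsub>G\<^esub> q = x [^]\<^bsub>G\<^esub> (int n * q)" using x by (rule G.int_pow_pow)
      moreover have "b [^]\<^bsub>D\<^esub> q = y [^]\<^bsub>D\<^esub> (int n * q)"
        using D.int_pow_pow[OF y(1), of "int n" q] y(2) by (simp add: int_pow_int)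
      ultimately show ?thesis by simp
    qed
    have "y [^]\<^bsub>D\<^esub> k = c" if k: "(x [^]\<^bsub>G\<^esub> (k::int), c) \<in> H" for k c
    proof -
      define q where "q = k div int n"
      define r where "r = k mod int n"
      have kr: "k = int n * q + r" "0 \<le> r" "r < int n" using n by (auto simp: q_def r_def)
      have "(x [^]\<^bsub>G\<^esub> k, c) \<otimes>\<^bsub>G \<times>\<times> D\<^esub> (x [^]\<^bsub>G\<^esub> (int n * (-q)), y [^]\<^bsub>D\<^esub> (int n * (-q))) \<in> H"
        using k pw by (intro H.m_closed)
      then have r: "(x [^]\<^bsub>G\<^esub> r, c \<otimes>\<^bsub>D\<^esub> y [^]\<^bsub>D\<^esub> (int n * (-q))) \<in> H"
        using x kr G.int_pow_mult[OF x, of k "int n * (-q)"] by simp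
      have "r = 0"
      proof (rule ccontr)
        assume "r \<noteq> 0"
        then have "nat r > 0" "int (nat r) \<in> I" using kr r by (auto simp: I_def image_iff intro: bexI[OF _ r])
        then show False using least[of "nat r"] kr by linarith
      qed
      then have "k = int n * q" using kr by simp
      then show ?thesis using uniq[OF k] pw[of q] by simp
    qed
    then show ?thesis using y by blast
  qed
  then obtain y where y: "y \<in> carrier D" and yk: "\<And>k b. (x [^]\<^bsub>G\<^esub> (k::int), b) \<in> H \<Longrightarrow> y [^]\<^bsub>D\<^esub> k = b"
    by blast
  define H' where "H' = {(a \<otimes>\<^bsub>G\<^esub> x [^]\<^bsub>G\<^esub> (k::int), b \<otimes>\<^bsub>D\<^esub> y [^]\<^bsub>D\<^esub> k) | a b k. (a, b) \<in> H}"
  have oneH: "(\<one>\<^bsub>G\<^esub>, \<one>\<^bsub>D\<^esub>) \<in> H" using H.one_closed by simp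
  have "subgroup H' (G \<times>\<times> D)"
  proof (rule P.subgroupI)
    show "H' \<subseteq> carrier (G \<times>\<times> D)" using Hc x y by (auto simp: H'_def)
    show "H' \<noteq> {}" using oneH unfolding H'_def by blast
  next
    fix z assume "z \<in> H'"
    then obtain a b k where z: "z = (a \<otimes>\<^bsub>G\<^esub> x [^]\<^bsub>G\<^esub> (k::int), b \<otimes>\<^bsub>D\<^esub> y [^]\<^bsub>D\<^esub> k)" "(a, b) \<in> H"
      by (auto simp: H'_def)
    have "inv\<^bsub>G \<times>\<times> D\<^esub> (a, b) \<in> H" using z by simp
    then have i: "(inv\<^bsub>G\<^esub> a, inv\<^bsub>D\<^esub> b) \<in> H" using Hc[OF z(2)] by (simp add: inv_DirProd G.is_group D.is_group)
    have "inv\<^bsub>G \<times>\<times> D\<^esub> z = (inv\<^bsub>G\<^esub> a \<otimes>\<^bsub>G\<^esub> x [^]\<^bsub>G\<^esub> (-k), inv\<^bsub>D\<^esub> b \<otimes>\<^bsub>D\<^esub> y [^]\<^bsub>D\<^esub> (-k))"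
      using Hc[OF z(2)] x y z
      by (simp add: inv_DirProd G.is_group D.is_group G.inv_mult D.inv_mult G.int_pow_neg D.int_pow_neg)
    then show "inv\<^bsub>G \<times>\<times> D\<^esub> z \<in> H'" using i by (auto simp: H'_def)
  next
    fix z w assume "z \<in> H'" "w \<in> H'"
    then obtain a b k a' b' k' where z: "z = (a \<otimes>\<^bsub>G\<^esub> x [^]\<^bsub>G\<^esub> (k::int), b \<otimes>\<^bsub>D\<^esub> y [^]\<^bsub>D\<^esub> k)" "(a, b) \<in> H"
      and w: "w = (a' \<otimes>\<^bsub>G\<^esub> x [^]\<^bsub>G\<^esub> (k'::int), b' \<otimes>\<^bsub>D\<^esub> y [^]\<^bsub>D\<^esub> k')" "(a', b') \<in> H"
      by (auto simp: H'_def)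
    have "(a \<otimes>\<^bsub>G\<^esub> a', b \<otimes>\<^bsub>D\<^esub> b') \<in> H" using H.m_closed[OF z(2) w(2)] by simp
    moreover have "z \<otimes>\<^bsub>G \<times>\<times> D\<^esub> w = ((a \<otimes>\<^bsub>G\<^esub> a') \<otimes>\<^bsub>G\<^esub> x [^]\<^bsub>G\<^esub> (k + k'), (b \<otimes>\<^bsub>D\<^esub> b') \<otimes>\<^bsub>D\<^esub> y [^]\<^bsub>D\<^esub> (k + k'))"
      using Hc[OF z(2)] Hc[OF w(2)] x y z w by (simp add: G.int_pow_mult D.int_pow_mult G.m_ac D.m_ac)
    ultimately show "z \<otimes>\<^bsub>G \<times>\<times> D\<^esub> w \<in> H'" by (auto simp: H'_def)
  qed
  moreover have "v = \<one>\<^bsub>D\<^esub>" if vH: "(\<one>\<^bsub>G\<^esub>, v) \<in> H'" for v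
  proof -
    obtain a b k where *: "\<one>\<^bsub>G\<^esub> = a \<otimes>\<^bsub>G\<^esub> x [^]\<^bsub>G\<^esub> (k::int)" "v = b \<otimes>\<^bsub>D\<^esub> y [^]\<^bsub>D\<^esub> k" "(a, b) \<in> H"
      using vH unfolding H'_def by blast
    note c = Hc[OF *(3)]
    have "x [^]\<^bsub>G\<^esub> (-k) = a" using * c x G.inv_equality[of a "x [^]\<^bsub>G\<^esub> k"] by (simp add: G.int_pow_neg)
    then have "y [^]\<^bsub>D\<^esub> (-k) = b" using yk * by simp
    then have "b = inv\<^bsub>D\<^esub> (y [^]\<^bsub>D\<^esub> k)" by (simp add: D.int_pow_neg[OF y])
    then show ?thesis using *(2) y by simp
  qed
  moreover have "H \<subseteq> H'"
  proof
    fix z assume z: "z \<in> H"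
    then have "z = (fst z \<otimes>\<^bsub>G\<^esub> x [^]\<^bsub>G\<^esub> (0::int), snd z \<otimes>\<^bsub>D\<^esub> y [^]\<^bsub>D\<^esub> (0::int))"
      using Hc[of "fst z" "snd z"] by auto
    then show "z \<in> H'" unfolding H'_def using z by (metis (mono_tags, lifting) mem_Collect_eq prod.collapse)
  qed
  moreover have "x \<in> fst ` H'"
  proof -
    have "(\<one>\<^bsub>G\<^esub> \<otimes>\<^bsub>G\<^esub> x [^]\<^bsub>G\<^esub> (1::int), \<one>\<^bsub>D\<^esub> \<otimes>\<^bsub>D\<^esub> y [^]\<^bsub>D\<^esub> (1::int)) \<in> H'"
      unfolding H'_def using oneH by blast
    then show ?thesis using x by (force simp: image_iff)
  qed
  ultimately show ?thesis unfolding partial_homs_def by blast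
qed

text \<open>Baer's theorem for abelian groups: divisible groups are injective.\<close>
theorem divisible_group_extension:
  assumes G: "comm_group G" and D: "comm_group D" and div: "divisible_group D"
    and N: "subgroup N G" and g: "g \<in> hom (G\<lparr>carrier := N\<rparr>) D"
  shows "\<exists>h \<in> hom G D. \<forall>x \<in> N. h x = g x"
proof -
  interpret G: comm_group G by fact
  interpret D: comm_group D by fact
  interpret N: subgroup N G by fact
  interpret P: group "G \<times>\<times> D" by (intro DirProd_group G.is_group D.is_group)
  interpret gh: group_hom "G\<lparr>carrier := N\<rparr>" D g
    using g N.subgroup_is_group[OF G.is_group] by (simp add: group_hom_def group_hom_axioms_def D.is_group)
  define H0 where "H0 = (\<lambda>x. (x, g x)) ` N"
  define A where "A = {H \<in> partial_homs G D. H0 \<subseteq> H}"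
  have g1: "g \<one>\<^bsub>G\<^esub> = \<one>\<^bsub>D\<^esub>" using gh.hom_one by simp
  have ginv: "g (inv\<^bsub>G\<^esub> x) = inv\<^bsub>D\<^esub> g x" if "x \<in> N" for x
    using gh.hom_inv[of x] that G.m_inv_consistent[OF N that] by simp
  have "subgroup H0 (G \<times>\<times> D)"
  proof (rule P.subgroupI)
    show "H0 \<subseteq> carrier (G \<times>\<times> D)" using gh.hom_closed N.subset by (auto simp: H0_def)
    show "H0 \<noteq> {}" using N.one_closed unfolding H0_def by blast
  next
    fix a assume "a \<in> H0"
    then obtain x where x: "x \<in> N" "a = (x, g x)" by (auto simp: H0_def)
    then show "inv\<^bsub>G \<times>\<times> D\<^esub> a \<in> H0"
      using gh.hom_closed[of x] N.mem_carrier[OF x(1)]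
      by (auto simp: H0_def inv_DirProd G.is_group D.is_group ginv intro!: image_eqI[where x = "inv\<^bsub>G\<^esub> x"])
  next
    fix a b assume "a \<in> H0" "b \<in> H0"
    then obtain x y where x: "x \<in> N" "a = (x, g x)" and y: "y \<in> N" "b = (y, g y)" by (auto simp: H0_def)
    then show "a \<otimes>\<^bsub>G \<times>\<times> D\<^esub> b \<in> H0"
      using gh.hom_mult[of x y] by (auto simp: H0_def intro!: image_eqI[where x = "x \<otimes>\<^bsub>G\<^esub> y"])
  qed
  then have H0: "H0 \<in> A" using g1 by (auto simp: A_def partial_homs_def H0_def)
  have "\<exists>M\<in>A. \<forall>X\<in>A. M \<subseteq> X \<longrightarrow> X = M"
  proof (rule subset_Zorn_nonempty)
    show "A \<noteq> {}" using H0 by blast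
  next
    fix \<C> assume C: "\<C> \<noteq> {}" "subset.chain A \<C>"
    then have CA: "\<And>X. X \<in> \<C> \<Longrightarrow> X \<in> A" and lin: "\<And>X Y. X \<in> \<C> \<Longrightarrow> Y \<in> \<C> \<Longrightarrow> X \<subseteq> Y \<or> Y \<subseteq> X"
      by (auto simp: subset_chain_def)
    have sg: "subgroup X (G \<times>\<times> D)" if "X \<in> \<C>" for X using CA[OF that] by (auto simp: A_def partial_homs_def)
    have "subgroup (\<Union>\<C>) (G \<times>\<times> D)"
    proof (rule P.subgroupI)
      show "\<Union>\<C> \<subseteq> carrier (G \<times>\<times> D)" using sg subgroup.subset by blast
      show "\<Union>\<C> \<noteq> {}"
      proof -
        obtain X where X: "X \<in> \<C>" using C by blast
        then show ?thesis using subgroup.one_closed[OF sg[OF X]] by blast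
      qed
    next
      fix a assume "a \<in> \<Union>\<C>"
      then obtain X where X: "X \<in> \<C>" "a \<in> X" by blast
      then show "inv\<^bsub>G \<times>\<times> D\<^esub> a \<in> \<Union>\<C>" using subgroup.m_inv_closed[OF sg[OF X(1)] X(2)] by blast
    next
      fix a b assume "a \<in> \<Union>\<C>" "b \<in> \<Union>\<C>"
      then obtain X where X: "X \<in> \<C>" "a \<in> X" "b \<in> X" using lin by blast
      then show "a \<otimes>\<^bsub>G \<times>\<times> D\<^esub> b \<in> \<Union>\<C>" using subgroup.m_closed[OF sg[OF X(1)] X(2,3)] by blast
    qed
    then show "\<Union>\<C> \<in> A" using CA C by (auto simp: A_def partial_homs_def)
  qed
  then obtain H where H: "H \<in> A" "\<And>X. X \<in> A \<Longrightarrow> H \<subseteq> X \<Longrightarrow> X = H" by metis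
  then have Hp: "H \<in> partial_homs G D" "H0 \<subseteq> H" unfolding A_def by blast+
  have sub: "subgroup H (G \<times>\<times> D)" and inj: "\<And>y. (\<one>\<^bsub>G\<^esub>, y) \<in> H \<Longrightarrow> y = \<one>\<^bsub>D\<^esub>"
    using Hp by (auto simp: partial_homs_def)
  interpret H: subgroup H "G \<times>\<times> D" by (rule sub)
  have Hc: "a \<in> carrier G" "b \<in> carrier D" if "(a, b) \<in> H" for a b using H.subset that by auto
  have uniq: "b = b'" if "(a, b) \<in> H" "(a, b') \<in> H" for a b b'
  proof -
    have "(a, b) \<otimes>\<^bsub>G \<times>\<times> D\<^esub> inv\<^bsub>G \<times>\<times> D\<^esub> (a, b') \<in> H" using that by simp
    then have "b \<otimes>\<^bsub>D\<^esub> inv\<^bsub>D\<^esub> b' = \<one>\<^bsub>D\<^esub>" using that Hc by (intro inj) (simp add: inv_DirProd G.is_group D.is_group)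
    then show ?thesis using that Hc by (metis D.inv_equality D.inv_inv D.inv_closed)
  qed
  have tot: "\<exists>b. (x, b) \<in> H" if x: "x \<in> carrier G" for x
  proof -
    obtain H' where "H' \<in> partial_homs G D" "H \<subseteq> H'" "x \<in> fst ` H'"
      using partial_hom_extend[OF G D div Hp(1) x] by blast
    then have "H' = H" using H(2)[of H'] Hp by (auto simp: A_def)
    then show ?thesis using \<open>x \<in> fst ` H'\<close> by auto
  qed
  define h where "h x = (THE b. (x, b) \<in> H)" for x
  have h: "(x, h x) \<in> H" if "x \<in> carrier G" for x
    unfolding h_def using tot[OF that] uniq by (metis theI)
  have hh: "h x = b" if "(x, b) \<in> H" for x b using that uniq h Hc by blast
  have "h \<in> hom G D"
  proof (rule homI)
    show "\<And>x. x \<in> carrier G \<Longrightarrow> h x \<in> carrier D" using h Hc by blast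
    fix x y assume "x \<in> carrier G" "y \<in> carrier G"
    then have "(x, h x) \<otimes>\<^bsub>G \<times>\<times> D\<^esub> (y, h y) \<in> H" using h by (intro H.m_closed)
    then show "h (x \<otimes>\<^bsub>G\<^esub> y) = h x \<otimes>\<^bsub>D\<^esub> h y" using hh by simp
  qed
  moreover have "\<forall>x \<in> N. h x = g x" using hh Hp(2) by (auto simp: H0_def)
  ultimately show ?thesis by blast
qed


text \<open>The quotient module has representatives as its elements, and not cosets, so that it is carried by the same type.\<close>
definition coset_rep :: "('a, 'b) module \<Rightarrow> 'b set \<Rightarrow> 'b \<Rightarrow> 'b"
  where "coset_rep M N x = (SOME y. y \<in> carrier M \<and> x \<ominus>\<^bsub>M\<^esub> y \<in> N)"

definition rep_quotient :: "('a, 'b) module \<Rightarrow> 'b set \<Rightarrow> ('a, 'b) module"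
  where "rep_quotient M N =
    \<lparr>carrier = coset_rep M N ` carrier M, monoid.mult = undefined, monoid.one = undefined,
     ring.zero = coset_rep M N \<zero>\<^bsub>M\<^esub>, ring.add = (\<lambda>x y. coset_rep M N (x \<oplus>\<^bsub>M\<^esub> y)),
     module.smult = (\<lambda>a x. coset_rep M N (a \<odot>\<^bsub>M\<^esub> x))\<rparr>"

lemma rep_quotient_simps [simp]:
  "carrier (rep_quotient M N) = coset_rep M N ` carrier M"
  "\<zero>\<^bsub>rep_quotient M N\<^esub> = coset_rep M N \<zero>\<^bsub>M\<^esub>"
  "x \<oplus>\<^bsub>rep_quotient M N\<^esub> y = coset_rep M N (x \<oplus>\<^bsub>M\<^esub> y)"
  "a \<odot>\<^bsub>rep_quotient M N\<^esub> x = coset_rep M N (a \<odot>\<^bsub>M\<^esub> x)"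
  by (auto simp: rep_quotient_def)

lemma rep_quotient:
  assumes R: "cring R" and M: "Module.module R M" and N: "Module.submodule N R M"
  shows "Module.module R (rep_quotient M N)" (is ?mod)
    and "coset_rep M N \<in> LinearCombinations.module_hom R M (rep_quotient M N)" (is ?hom)
    and "\<lbrakk>x \<in> carrier M; y \<in> carrier M\<rbrakk> \<Longrightarrow> coset_rep M N x = coset_rep M N y \<longleftrightarrow> x \<ominus>\<^bsub>M\<^esub> y \<in> N"
    and "x \<in> carrier M \<Longrightarrow> coset_rep M N x = \<zero>\<^bsub>rep_quotient M N\<^esub> \<longleftrightarrow> x \<in> N"
    and "x \<in> carrier M \<Longrightarrow> coset_rep M N x \<in> carrier M"
proof -
  interpret M: Module.module R M by (rule M)
  let ?r = "coset_rep M N"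
  note sub = M.submoduleE[OF N]
  have N0: "\<zero>\<^bsub>M\<^esub> \<in> N" using sub M.submoduleE(1,2,4)[OF N] by (metis M.R.zero_closed M.smult_l_null ex_in_conv subsetD)
  have diff: "x \<ominus>\<^bsub>M\<^esub> z \<in> N" if "x \<ominus>\<^bsub>M\<^esub> y \<in> N" "y \<ominus>\<^bsub>M\<^esub> z \<in> N" "x \<in> carrier M" "y \<in> carrier M" "z \<in> carrier M" for x y z
  proof -
    have "x \<ominus>\<^bsub>M\<^esub> z = (x \<ominus>\<^bsub>M\<^esub> y) \<oplus>\<^bsub>M\<^esub> (y \<ominus>\<^bsub>M\<^esub> z)"
      using that by (simp add: M.minus_eq M.a_assoc M.r_neg1)
    then show ?thesis using sub(5) that by simp
  qed
  have sym: "y \<ominus>\<^bsub>M\<^esub> x \<in> N" if "x \<ominus>\<^bsub>M\<^esub> y \<in> N" "x \<in> carrier M" "y \<in> carrier M" for x y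
  proof -
    have "y \<ominus>\<^bsub>M\<^esub> x = \<ominus>\<^bsub>M\<^esub> (x \<ominus>\<^bsub>M\<^esub> y)" using that by (simp add: M.minus_eq M.minus_add M.a_comm)
    then show ?thesis using sub(3) that by simp
  qed
  have r: "?r x \<in> carrier M" "x \<ominus>\<^bsub>M\<^esub> ?r x \<in> N" if "x \<in> carrier M" for x
  proof -
    have "?r x \<in> carrier M \<and> x \<ominus>\<^bsub>M\<^esub> ?r x \<in> N"
      unfolding coset_rep_def by (rule someI[of _ x]) (use that N0 in \<open>simp add: M.minus_eq M.r_neg\<close>)
    then show "?r x \<in> carrier M" "x \<ominus>\<^bsub>M\<^esub> ?r x \<in> N" by auto
  qed
  have eq: "?r x = ?r y \<longleftrightarrow> x \<ominus>\<^bsub>M\<^esub> y \<in> N" if xy: "x \<in> carrier M" "y \<in> carrier M" for x y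
  proof
    assume "?r x = ?r y"
    then show "x \<ominus>\<^bsub>M\<^esub> y \<in> N"
      using r[OF xy(1)] r[OF xy(2)] diff[of x "?r x" y] sym[of y "?r y"] xy by simp
  next
    assume xyN: "x \<ominus>\<^bsub>M\<^esub> y \<in> N"
    have "(z \<in> carrier M \<and> x \<ominus>\<^bsub>M\<^esub> z \<in> N) = (z \<in> carrier M \<and> y \<ominus>\<^bsub>M\<^esub> z \<in> N)" for z
      using diff[of x y z] diff[of y x z] sym[OF xyN xy] xyN xy by blast
    then show "?r x = ?r y" unfolding coset_rep_def by simp
  qed
  have rr: "?r (?r x) = ?r x" if "x \<in> carrier M" for x
    using eq[of "?r x" x] r[OF that] sym[of x "?r x"] that by simp
  have radd: "?r (?r x \<oplus>\<^bsub>M\<^esub> y) = ?r (x \<oplus>\<^bsub>M\<^esub> y)" if "x \<in> carrier M" "y \<in> carrier M" for x y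
  proof -
    have "(?r x \<oplus>\<^bsub>M\<^esub> y) \<ominus>\<^bsub>M\<^esub> (x \<oplus>\<^bsub>M\<^esub> y) = ?r x \<ominus>\<^bsub>M\<^esub> x"
    proof -
      have "(?r x \<oplus>\<^bsub>M\<^esub> y) \<ominus>\<^bsub>M\<^esub> (x \<oplus>\<^bsub>M\<^esub> y) = ?r x \<oplus>\<^bsub>M\<^esub> (y \<oplus>\<^bsub>M\<^esub> (\<ominus>\<^bsub>M\<^esub> y \<oplus>\<^bsub>M\<^esub> \<ominus>\<^bsub>M\<^esub> x))"
        using that r by (simp add: M.minus_eq M.minus_add M.a_assoc M.a_comm[of x y])
      also have "\<dots> = ?r x \<ominus>\<^bsub>M\<^esub> x" using that r by (simp add: M.minus_eq M.r_neg2)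
      finally show ?thesis .
    qed
    then show ?thesis using eq that r sym by simp
  qed
  have radd2: "?r (x \<oplus>\<^bsub>M\<^esub> ?r y) = ?r (x \<oplus>\<^bsub>M\<^esub> y)" if "x \<in> carrier M" "y \<in> carrier M" for x y
    using radd[OF that(2,1)] r that by (simp add: M.a_comm)
  have rsm: "?r (a \<odot>\<^bsub>M\<^esub> ?r x) = ?r (a \<odot>\<^bsub>M\<^esub> x)" if "a \<in> carrier R" "x \<in> carrier M" for a x
  proof -
    have "a \<odot>\<^bsub>M\<^esub> ?r x \<ominus>\<^bsub>M\<^esub> a \<odot>\<^bsub>M\<^esub> x = a \<odot>\<^bsub>M\<^esub> (?r x \<ominus>\<^bsub>M\<^esub> x)"
      using that r by (simp add: M.minus_eq M.smult_r_distr M.smult_r_minus)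
    then show ?thesis using eq that r sym sub(4) by simp
  qed
  have "abelian_group (rep_quotient M N)"
  proof (rule abelian_groupI)
    fix x assume "x \<in> carrier (rep_quotient M N)"
    then obtain u where u: "u \<in> carrier M" "x = ?r u" by auto
    then show "\<exists>y\<in>carrier (rep_quotient M N). y \<oplus>\<^bsub>rep_quotient M N\<^esub> x = \<zero>\<^bsub>rep_quotient M N\<^esub>"
      by (intro bexI[of _ "?r (\<ominus>\<^bsub>M\<^esub> u)"]) (auto simp: radd radd2 r M.l_neg)
  qed (auto simp: radd radd2 r rr M.a_assoc, auto simp: M.a_comm r)
  then show ?mod
  proof (intro moduleI R)
    fix a b x assume ab: "a \<in> carrier R" "b \<in> carrier R" and "x \<in> carrier (rep_quotient M N)"
    then obtain u where u: "u \<in> carrier M" "x = ?r u" by auto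
    have "?r ((a \<oplus>\<^bsub>R\<^esub> b) \<odot>\<^bsub>M\<^esub> ?r u) = ?r ((a \<oplus>\<^bsub>R\<^esub> b) \<odot>\<^bsub>M\<^esub> u)" using rsm u ab by simp
    also have "\<dots> = ?r (?r (a \<odot>\<^bsub>M\<^esub> ?r u) \<oplus>\<^bsub>M\<^esub> ?r (b \<odot>\<^bsub>M\<^esub> ?r u))"
      using u ab by (simp only: rsm radd radd2 r M.smult_closed M.smult_l_distr)
    finally show "(a \<oplus>\<^bsub>R\<^esub> b) \<odot>\<^bsub>rep_quotient M N\<^esub> x = a \<odot>\<^bsub>rep_quotient M N\<^esub> x \<oplus>\<^bsub>rep_quotient M N\<^esub> b \<odot>\<^bsub>rep_quotient M N\<^esub> x"
      by (simp add: u)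
    have "?r ((a \<otimes>\<^bsub>R\<^esub> b) \<odot>\<^bsub>M\<^esub> ?r u) = ?r ((a \<otimes>\<^bsub>R\<^esub> b) \<odot>\<^bsub>M\<^esub> u)" using rsm u ab by simp
    also have "\<dots> = ?r (a \<odot>\<^bsub>M\<^esub> ?r (b \<odot>\<^bsub>M\<^esub> ?r u))"
      using u ab by (simp only: rsm r M.smult_closed M.smult_assoc1)
    finally show "(a \<otimes>\<^bsub>R\<^esub> b) \<odot>\<^bsub>rep_quotient M N\<^esub> x = a \<odot>\<^bsub>rep_quotient M N\<^esub> (b \<odot>\<^bsub>rep_quotient M N\<^esub> x)"
      by (simp add: u)
  qed (auto simp: radd radd2 rsm r rr M.smult_r_distr)
  show ?hom by (rule module_homI) (auto simp: radd radd2 rsm r)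
  show "\<lbrakk>x \<in> carrier M; y \<in> carrier M\<rbrakk> \<Longrightarrow> coset_rep M N x = coset_rep M N y \<longleftrightarrow> x \<ominus>\<^bsub>M\<^esub> y \<in> N" by (rule eq)
  show "x \<in> carrier M \<Longrightarrow> coset_rep M N x = \<zero>\<^bsub>rep_quotient M N\<^esub> \<longleftrightarrow> x \<in> N"
    using eq[of x "\<zero>\<^bsub>M\<^esub>"] M.minus_equality[of "\<zero>\<^bsub>M\<^esub>" "\<zero>\<^bsub>M\<^esub>"] by (simp add: M.minus_eq)
  show "x \<in> carrier M \<Longrightarrow> coset_rep M N x \<in> carrier M" by (rule r)
qed

text \<open>Only an isomorphic copy of a module, but carried by the type that the definitions of resolutions prescribe.\<close>
definition module_image :: "('b \<Rightarrow> 'c) \<Rightarrow> ('a, 'b) module \<Rightarrow> ('a, 'c) module"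
  where "module_image f M =
    \<lparr>carrier = f ` carrier M, monoid.mult = undefined, monoid.one = undefined,
     ring.zero = f \<zero>\<^bsub>M\<^esub>,
     ring.add = (\<lambda>x y. f (the_inv_into (carrier M) f x \<oplus>\<^bsub>M\<^esub> the_inv_into (carrier M) f y)),
     module.smult = (\<lambda>a x. f (a \<odot>\<^bsub>M\<^esub> the_inv_into (carrier M) f x))\<rparr>"

lemma module_image:
  assumes M: "Module.module R M" and f: "inj_on f (carrier M)"
  shows "Module.module R (module_image f M)" (is ?mod)
    and "f \<in> LinearCombinations.module_hom R M (module_image f M)" (is ?hom)
    and "the_inv_into (carrier M) f \<in> LinearCombinations.module_hom R (module_image f M) M" (is ?hom')
    and "carrier (module_image f M) = f ` carrier M"
    and "\<zero>\<^bsub>module_image f M\<^esub> = f \<zero>\<^bsub>M\<^esub>"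
proof -
  interpret M: Module.module R M by (rule M)
  have s [simp]: "carrier (module_image f M) = f ` carrier M" "\<zero>\<^bsub>module_image f M\<^esub> = f \<zero>\<^bsub>M\<^esub>"
    "x \<oplus>\<^bsub>module_image f M\<^esub> y = f (the_inv_into (carrier M) f x \<oplus>\<^bsub>M\<^esub> the_inv_into (carrier M) f y)"
    "a \<odot>\<^bsub>module_image f M\<^esub> x = f (a \<odot>\<^bsub>M\<^esub> the_inv_into (carrier M) f x)" for a x y
    by (auto simp: module_image_def)
  have g [simp]: "the_inv_into (carrier M) f (f x) = x" if "x \<in> carrier M" for x
    using the_inv_into_f_f[OF f that] .
  have "abelian_group (module_image f M)"
  proof (rule abelian_groupI)
    fix x assume "x \<in> carrier (module_image f M)"
    then obtain u where u: "u \<in> carrier M" "x = f u" by auto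
    then show "\<exists>y\<in>carrier (module_image f M). y \<oplus>\<^bsub>module_image f M\<^esub> x = \<zero>\<^bsub>module_image f M\<^esub>"
      by (intro bexI[of _ "f (\<ominus>\<^bsub>M\<^esub> u)"]) (auto simp: M.l_neg)
  qed (auto simp: M.a_assoc, auto simp: M.a_comm)
  then show ?mod
    by (intro moduleI M.R.is_cring) (auto simp: M.smult_l_distr M.smult_r_distr M.smult_assoc1)
  show ?hom ?hom' by (rule module_homI; auto)+
  show "carrier (module_image f M) = f ` carrier M" "\<zero>\<^bsub>module_image f M\<^esub> = f \<zero>\<^bsub>M\<^esub>" by auto
qed

lemma module_hom_comp:
  assumes "f \<in> LinearCombinations.module_hom R M N" "g \<in> LinearCombinations.module_hom R N P"
  shows "g \<circ> f \<in> LinearCombinations.module_hom R M P"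
  using module_homD[OF assms(1)] module_homD[OF assms(2)] by (intro module_homI) simp_all

lemma injective_module_image:
  fixes E :: "('a, 'e) module"
  assumes E: "injective_module R E" and f: "inj_on f (carrier E)"
  shows "injective_module R (module_image f E)"
  unfolding injective_module_def
proof (intro conjI allI impI)
  have mE: "Module.module R E" using E by (simp add: injective_module_def)
  note I = module_image[OF mE f]
  show "Module.module R (module_image f E)" by (rule I(1))
  fix M :: "('a, 'a) module" and N g
  assume *: "Module.module R M \<and> Module.submodule N R M \<and>
    g \<in> LinearCombinations.module_hom R (M\<lparr>carrier := N\<rparr>) (module_image f E)"
  let ?i = "the_inv_into (carrier E) f"
  have "?i \<circ> g \<in> LinearCombinations.module_hom R (M\<lparr>carrier := N\<rparr>) E"
    using module_hom_comp * I(3) by blast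
  then obtain h where h: "h \<in> LinearCombinations.module_hom R M E" "\<And>x. x \<in> N \<Longrightarrow> h x = ?i (g x)"
    using E * unfolding injective_module_def by (metis comp_apply)
  have "f (?i (g x)) = g x" if "x \<in> N" for x
  proof (rule f_the_inv_into_f[OF f])
    show "g x \<in> f ` carrier E" using module_homD(1)[of g R "M\<lparr>carrier := N\<rparr>"] * that I(4) by auto
  qed
  then show "\<exists>h\<in>LinearCombinations.module_hom R M (module_image f E). \<forall>x\<in>N. h x = g x"
    using h module_hom_comp[OF h(1) I(2)] by (intro bexI[of _ "f \<circ> h"]) auto
qed

definition rscale :: "rat \<Rightarrow> ('b \<Rightarrow>\<^sub>0 rat) \<Rightarrow> ('b \<Rightarrow>\<^sub>0 rat)"
  where "rscale c z = Poly_Mapping.map (\<lambda>q. c * q) z"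

lemma lookup_scale [simp]: "Poly_Mapping.lookup (rscale c z) m = c * Poly_Mapping.lookup z m"
  by (simp add: rscale_def Poly_Mapping.map.rep_eq when_def)

lemma keys_scale: "Poly_Mapping.keys (rscale c z) \<subseteq> Poly_Mapping.keys z"
  by (auto simp: in_keys_iff)

text \<open>The vector space over the rationals with the elements of \<open>M\<close> as basis; it maps onto the divisible hull.\<close>
definition rat_comb :: "('a, 'b) module \<Rightarrow> (int, 'b \<Rightarrow>\<^sub>0 rat) module"
  where "rat_comb M =
    \<lparr>carrier = {z. Poly_Mapping.keys z \<subseteq> carrier M}, monoid.mult = undefined, monoid.one = undefined,
     ring.zero = 0, ring.add = (+),
     module.smult = (\<lambda>k z. rscale (of_int k) z)\<rparr>"

definition int_eval :: "('a, 'b) module \<Rightarrow> ('b \<Rightarrow>\<^sub>0 rat) \<Rightarrow> 'b"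
  where "int_eval M z = (\<Oplus>\<^bsub>M\<^esub> m \<in> Poly_Mapping.keys z. [\<lfloor>Poly_Mapping.lookup z m\<rfloor>] \<cdot>\<^bsub>M\<^esub> m)"

text \<open>The relations among the elements of \<open>M\<close>: the kernel of the evaluation on integral combinations.\<close>
definition int_relations :: "('a, 'b) module \<Rightarrow> ('b \<Rightarrow>\<^sub>0 rat) set"
  where "int_relations M = {z. Poly_Mapping.keys z \<subseteq> carrier M \<and> (\<forall>m. Poly_Mapping.lookup z m \<in> \<int>) \<and> int_eval M z = \<zero>\<^bsub>M\<^esub>}"

lemma rat_comb_simps [simp]:
  "carrier (rat_comb M) = {z. Poly_Mapping.keys z \<subseteq> carrier M}" "\<zero>\<^bsub>rat_comb M\<^esub> = 0"
  "x \<oplus>\<^bsub>rat_comb M\<^esub> y = x + y" "k \<odot>\<^bsub>rat_comb M\<^esub> x = rscale (of_int k) x"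
  by (auto simp: rat_comb_def)

lemma keys_neg: "Poly_Mapping.keys (- x) = Poly_Mapping.keys (x :: 'b \<Rightarrow>\<^sub>0 rat)"
  by (auto simp: in_keys_iff)

lemma keys_add_subset: "Poly_Mapping.keys x \<subseteq> A \<Longrightarrow> Poly_Mapping.keys y \<subseteq> A \<Longrightarrow> Poly_Mapping.keys (x + y) \<subseteq> A"
  using Poly_Mapping.keys_add[of x y] by blast

lemma rat_comb_module: "Module.module \<Z> (rat_comb M)"
proof (rule moduleI)
  show "cring \<Z>" by (rule int_is_cring)
  show "abelian_group (rat_comb M)"
  proof (rule abelian_groupI)
    fix x assume "x \<in> carrier (rat_comb M)"
    then show "\<exists>y\<in>carrier (rat_comb M). y \<oplus>\<^bsub>rat_comb M\<^esub> x = \<zero>\<^bsub>rat_comb M\<^esub>"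
      by (intro bexI[of _ "- x"]) auto
  qed (auto simp: algebra_simps keys_add_subset)
qed (auto simp: poly_mapping_eq_iff fun_eq_iff lookup_scale lookup_add algebra_simps dest: keys_scale[THEN subsetD])

lemma int_eval_superset:
  assumes M: "abelian_group M" and A: "finite A" "Poly_Mapping.keys z \<subseteq> A" "A \<subseteq> carrier M"
  shows "int_eval M z = (\<Oplus>\<^bsub>M\<^esub> m \<in> A. [\<lfloor>Poly_Mapping.lookup z m\<rfloor>] \<cdot>\<^bsub>M\<^esub> m)"
proof -
  interpret M: abelian_group M by fact
  have z0: "[(0::int)] \<cdot>\<^bsub>M\<^esub> m = \<zero>\<^bsub>M\<^esub>" for m by (simp add: add_pow_def)
  show ?thesis unfolding int_eval_def using A
    by (intro M.add.finprod_mono_neutral_cong_left) (auto simp: in_keys_iff z0)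
qed

lemma int_eval_add:
  assumes M: "abelian_group M" and z: "Poly_Mapping.keys z \<subseteq> carrier M" "\<forall>m. Poly_Mapping.lookup z m \<in> \<int>"
    and w: "Poly_Mapping.keys w \<subseteq> carrier M"
  shows "int_eval M (z + w) = int_eval M z \<oplus>\<^bsub>M\<^esub> int_eval M w"
proof -
  interpret M: abelian_group M by fact
  let ?A = "Poly_Mapping.keys z \<union> Poly_Mapping.keys w"
  have A: "finite ?A" "?A \<subseteq> carrier M" "Poly_Mapping.keys (z + w) \<subseteq> ?A" using z w Poly_Mapping.keys_add[of z w] by auto
  have fl: "\<lfloor>Poly_Mapping.lookup (z + w) m\<rfloor> = \<lfloor>Poly_Mapping.lookup z m\<rfloor> + \<lfloor>Poly_Mapping.lookup w m\<rfloor>" for m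
  proof -
    obtain k where "Poly_Mapping.lookup z m = of_int k" using z(2) Ints_cases by metis
    then show ?thesis by (simp add: lookup_add)
  qed
  have "int_eval M (z + w) = (\<Oplus>\<^bsub>M\<^esub> m \<in> ?A. [\<lfloor>Poly_Mapping.lookup (z + w) m\<rfloor>] \<cdot>\<^bsub>M\<^esub> m)"
    using A by (intro int_eval_superset M)
  also have "\<dots> = (\<Oplus>\<^bsub>M\<^esub> m \<in> ?A. [\<lfloor>Poly_Mapping.lookup z m\<rfloor>] \<cdot>\<^bsub>M\<^esub> m \<oplus>\<^bsub>M\<^esub> [\<lfloor>Poly_Mapping.lookup w m\<rfloor>] \<cdot>\<^bsub>M\<^esub> m)"
    using A by (intro M.add.finprod_cong') (auto simp: fl M.add.int_pow_mult)
  also have "\<dots> = (\<Oplus>\<^bsub>M\<^esub> m \<in> ?A. [\<lfloor>Poly_Mapping.lookup z m\<rfloor>] \<cdot>\<^bsub>M\<^esub> m) \<oplus>\<^bsub>M\<^esub> (\<Oplus>\<^bsub>M\<^esub> m \<in> ?A. [\<lfloor>Poly_Mapping.lookup w m\<rfloor>] \<cdot>\<^bsub>M\<^esub> m)"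
    using A by (intro M.finsum_addf) auto
  also have "\<dots> = int_eval M z \<oplus>\<^bsub>M\<^esub> int_eval M w"
    using A int_eval_superset[OF M, of ?A z] int_eval_superset[OF M, of ?A w] by simp
  finally show ?thesis .
qed

lemma int_eval_closed:
  assumes M: "abelian_group M" and z: "Poly_Mapping.keys z \<subseteq> carrier M"
  shows "int_eval M z \<in> carrier M"
proof -
  interpret M: abelian_group M by fact
  show ?thesis unfolding int_eval_def using z by (intro M.finsum_closed) auto
qed

lemma int_eval_single:
  assumes M: "abelian_group M" and m: "m \<in> carrier M"
  shows "int_eval M (Poly_Mapping.single m 1) = m"
proof -
  interpret M: abelian_group M by fact
  show ?thesis using m by (simp add: int_eval_def)
qed

lemma int_relations_submodule:
  assumes M: "abelian_group M"
  shows "Module.submodule (int_relations M) \<Z> (rat_comb M)"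
proof -
  interpret M: abelian_group M by fact
  interpret F: Module.module \<Z> "rat_comb M" by (rule rat_comb_module)
  have e0: "int_eval M 0 = \<zero>\<^bsub>M\<^esub>" by (simp add: int_eval_def)
  have neg: "- z \<in> int_relations M" if z: "z \<in> int_relations M" for z
  proof -
    have "int_eval M (z + (- z)) = int_eval M z \<oplus>\<^bsub>M\<^esub> int_eval M (- z)"
      using z by (intro int_eval_add M) (auto simp: int_relations_def)
    moreover have "int_eval M z = \<zero>\<^bsub>M\<^esub>" "Poly_Mapping.keys (- z) \<subseteq> carrier M"
      using z by (auto simp: int_relations_def)
    ultimately have "int_eval M (- z) = \<zero>\<^bsub>M\<^esub>"
      using e0 int_eval_closed[OF M, of "- z"] by simp
    then show ?thesis using z by (auto simp: int_relations_def)
  qed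
  have add: "z + w \<in> int_relations M" if "z \<in> int_relations M" "w \<in> int_relations M" for z w
  proof -
    have "Poly_Mapping.keys (z + w) \<subseteq> carrier M" using that by (intro keys_add_subset) (auto simp: int_relations_def)
    then show ?thesis using that int_eval_add[OF M, of z w] by (simp add: int_relations_def lookup_add)
  qed
  have inv: "\<ominus>\<^bsub>rat_comb M\<^esub> z = - z" if "Poly_Mapping.keys z \<subseteq> carrier M" for z
    using F.minus_equality[of "- z" z] that by simp
  have nat: "rscale (of_nat n) z \<in> int_relations M" if "z \<in> int_relations M" for n z
  proof (induction n)
    case 0
    have "rscale (of_nat 0) z = 0"
      by (simp add: poly_mapping_eq_iff fun_eq_iff lookup_scale)
    then show ?case using e0 by (simp add: int_relations_def)
  next
    case (Suc n)
    have "rscale (of_nat (Suc n)) z = rscale (of_nat n) z + z"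
      by (simp only: poly_mapping_eq_iff fun_eq_iff lookup_scale lookup_add plus_poly_mapping.rep_eq) (simp add: algebra_simps)
    then show ?case using add[OF Suc that] by simp
  qed
  show ?thesis
  proof (rule F.submoduleI)
    show "int_relations M \<subseteq> carrier (rat_comb M)" by (auto simp: int_relations_def)
    show "\<zero>\<^bsub>rat_comb M\<^esub> \<in> int_relations M" using e0 by (simp add: int_relations_def)
    show "\<ominus>\<^bsub>rat_comb M\<^esub> a \<in> int_relations M" if "a \<in> int_relations M" for a
      using neg[OF that] inv[of a] that by (auto simp: int_relations_def)
    show "a \<oplus>\<^bsub>rat_comb M\<^esub> b \<in> int_relations M" if "a \<in> int_relations M" "b \<in> int_relations M" for a b
      using add that by simp
    fix k z assume z: "z \<in> int_relations M"
    show "k \<odot>\<^bsub>rat_comb M\<^esub> z \<in> int_relations M"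
    proof (cases "k \<ge> 0")
      case True then show ?thesis using nat[OF z, of "nat k"] by simp
    next
      case False
      then have "rscale (of_int k) z = - rscale (of_nat (nat (- k))) z"
        by (simp add: poly_mapping_eq_iff fun_eq_iff lookup_scale)
      then show ?thesis using neg[OF nat[OF z, of "nat (- k)"]] by simp
    qed
  qed
qed

text \<open>\<open>M = \<int>\<^sup>(\<^sup>M\<^sup>) / K\<close> embeds in \<open>\<rat>\<^sup>(\<^sup>M\<^sup>) / K\<close>, which is divisible as a quotient of a divisible group.\<close>
theorem divisible_hull:
  fixes M :: "('a, 'b) module"
  assumes M: "abelian_group M"
  shows "\<exists>(D :: (int, 'b \<Rightarrow>\<^sub>0 rat) module) j. Module.module \<Z> D \<and> divisible_group (add_monoid D) \<and>
    j \<in> hom (add_monoid M) (add_monoid D) \<and> inj_on j (carrier M)"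
proof (intro exI conjI)
  interpret M: abelian_group M by fact
  let ?F = "rat_comb M" and ?K = "int_relations M"
  let ?D = "rep_quotient ?F ?K" and ?r = "coset_rep ?F ?K"
  interpret F: Module.module \<Z> ?F by (rule rat_comb_module)
  note Q = rep_quotient[OF int_is_cring rat_comb_module int_relations_submodule[OF M]]
  interpret D: Module.module \<Z> ?D by (rule Q(1))
  show "Module.module \<Z> ?D" by (rule Q(1))
  have radd: "?r (x + y) = ?r x \<oplus>\<^bsub>?D\<^esub> ?r y" if "Poly_Mapping.keys x \<subseteq> carrier M" "Poly_Mapping.keys y \<subseteq> carrier M" for x y
    using module_homD(2)[OF Q(2), of x y] that by simp
  have rc: "?r x \<in> carrier ?D" if "Poly_Mapping.keys x \<subseteq> carrier M" for x using that by auto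
  have pow: "?r w [^]\<^bsub>add_monoid ?D\<^esub> n = ?r (rscale (of_nat n) w)"
    if w: "Poly_Mapping.keys w \<subseteq> carrier M" for w and n :: nat
  proof (induction n)
    case 0
    have "rscale (of_nat 0) w = 0"
      by (simp add: poly_mapping_eq_iff fun_eq_iff lookup_scale)
    then show ?case by simp
  next
    case (Suc n)
    have "rscale (of_nat (Suc n)) w = rscale (of_nat n) w + w"
      by (simp only: poly_mapping_eq_iff fun_eq_iff lookup_scale lookup_add plus_poly_mapping.rep_eq) (simp add: algebra_simps)
    moreover have "Poly_Mapping.keys (rscale (of_nat n) w) \<subseteq> carrier M"
      using keys_scale[of "of_nat n" w] w by (rule subset_trans)
    ultimately show ?case using Suc radd w by simp
  qed
  show "divisible_group (add_monoid ?D)"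
    unfolding divisible_group_def
  proof (intro ballI allI impI)
    fix x and n :: nat assume "x \<in> carrier (add_monoid ?D)" "0 < n"
    then obtain z where z: "Poly_Mapping.keys z \<subseteq> carrier M" "x = ?r z" by auto
    let ?w = "rscale (1 / of_nat n) z"
    have w: "Poly_Mapping.keys ?w \<subseteq> carrier M" using keys_scale[of "1 / of_nat n" z] z(1) by (rule subset_trans)
    have "rscale (of_nat n) ?w = z"
      using \<open>0 < n\<close> by (simp only: poly_mapping_eq_iff fun_eq_iff lookup_scale) simp
    then show "\<exists>y\<in>carrier (add_monoid ?D). y [^]\<^bsub>add_monoid ?D\<^esub> n = x"
      using pow[OF w, of n] z rc[OF w] by (intro bexI[of _ "?r ?w"]) auto
  qed
  let ?j = "\<lambda>m. ?r (Poly_Mapping.single m 1)"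
  have sub: "?r x = ?r y \<longleftrightarrow> x - y \<in> ?K" if "Poly_Mapping.keys x \<subseteq> carrier M" "Poly_Mapping.keys y \<subseteq> carrier M" for x y
  proof -
    have "\<ominus>\<^bsub>?F\<^esub> y = - y" using F.minus_equality[of "- y" y] that by simp
    then show ?thesis using Q(3)[of x y] that by (simp add: F.minus_eq)
  qed
  have neg: "int_eval M (- w) = \<ominus>\<^bsub>M\<^esub> int_eval M w" if "Poly_Mapping.keys w \<subseteq> carrier M" "\<forall>m. Poly_Mapping.lookup w m \<in> \<int>" for w
  proof -
    have "int_eval M ((- w) + w) = int_eval M (- w) \<oplus>\<^bsub>M\<^esub> int_eval M w" using that by (intro int_eval_add M) auto
    moreover have "int_eval M ((- w) + w) = \<zero>\<^bsub>M\<^esub>" by (simp add: int_eval_def)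
    ultimately have "\<ominus>\<^bsub>M\<^esub> int_eval M w = int_eval M (- w)"
      using int_eval_closed[OF M, of w] int_eval_closed[OF M, of "- w"] that by (intro M.minus_equality) simp_all
    then show ?thesis by simp
  qed
  have ints: "\<forall>k. Poly_Mapping.lookup (Poly_Mapping.single m (1::rat)) k \<in> \<int>" for m :: 'b
    by (simp add: lookup_single when_def)
  show "?j \<in> hom (add_monoid M) (add_monoid ?D)"
  proof (rule homI)
    fix x y assume "x \<in> carrier (add_monoid M)" "y \<in> carrier (add_monoid M)"
    then have xy: "x \<in> carrier M" "y \<in> carrier M" by auto
    let ?s = "\<lambda>m. Poly_Mapping.single m (1::rat)"
    have k: "Poly_Mapping.keys (?s x + ?s y) \<subseteq> carrier M" using xy by (intro keys_add_subset) auto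
    have "int_eval M (?s (x \<oplus>\<^bsub>M\<^esub> y) - (?s x + ?s y)) = int_eval M (?s (x \<oplus>\<^bsub>M\<^esub> y) + - (?s x + ?s y))"
      by (simp only: diff_conv_add_uminus)
    also have "\<dots> = int_eval M (?s (x \<oplus>\<^bsub>M\<^esub> y)) \<oplus>\<^bsub>M\<^esub> int_eval M (- (?s x + ?s y))"
    proof (rule int_eval_add[OF M])
      show "Poly_Mapping.keys (- (?s x + ?s y)) \<subseteq> carrier M" using k by (simp only: keys_neg)
    qed (use xy ints in auto)
    also have "\<dots> = (x \<oplus>\<^bsub>M\<^esub> y) \<oplus>\<^bsub>M\<^esub> \<ominus>\<^bsub>M\<^esub> (x \<oplus>\<^bsub>M\<^esub> y)"
      using xy k ints neg[OF k] int_eval_add[OF M, of "?s x" "?s y"]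
      by (simp add: int_eval_single[OF M] lookup_add)
    also have "\<dots> = \<zero>\<^bsub>M\<^esub>" using xy by (simp add: M.r_neg)
    finally have "?s (x \<oplus>\<^bsub>M\<^esub> y) - (?s x + ?s y) \<in> ?K"
    proof -
      have "Poly_Mapping.keys (?s (x \<oplus>\<^bsub>M\<^esub> y) - (?s x + ?s y)) \<subseteq> carrier M"
        unfolding diff_conv_add_uminus
      proof (rule keys_add_subset)
        show "Poly_Mapping.keys (- (?s x + ?s y)) \<subseteq> carrier M" using k by (simp only: keys_neg)
      qed (use xy in simp)
      then show "int_eval M (?s (x \<oplus>\<^bsub>M\<^esub> y) - (?s x + ?s y)) = \<zero>\<^bsub>M\<^esub> \<Longrightarrow> ?thesis"
        using ints by (auto simp: int_relations_def lookup_minus lookup_add)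
    qed
    then have "?r (?s (x \<oplus>\<^bsub>M\<^esub> y)) = ?r (?s x + ?s y)" using sub[of "?s (x \<oplus>\<^bsub>M\<^esub> y)" "?s x + ?s y"] xy k by simp
    then show "?j (x \<otimes>\<^bsub>add_monoid M\<^esub> y) = ?j x \<otimes>\<^bsub>add_monoid ?D\<^esub> ?j y" using radd xy by simp
  qed auto
  show "inj_on ?j (carrier M)"
  proof (rule inj_onI)
    fix x y assume xy: "x \<in> carrier M" "y \<in> carrier M" "?j x = ?j y"
    let ?s = "\<lambda>m. Poly_Mapping.single m (1::rat)"
    have "?s x - ?s y \<in> ?K" using sub[of "?s x" "?s y"] xy by simp
    then have "int_eval M (?s x + - ?s y) = \<zero>\<^bsub>M\<^esub>" by (simp add: int_relations_def)
    moreover have "int_eval M (?s x + - ?s y) = int_eval M (?s x) \<oplus>\<^bsub>M\<^esub> int_eval M (- ?s y)"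
      using xy ints by (intro int_eval_add M) auto
    ultimately have "x \<oplus>\<^bsub>M\<^esub> \<ominus>\<^bsub>M\<^esub> y = \<zero>\<^bsub>M\<^esub>"
      using neg[of "?s y"] xy ints by (simp add: int_eval_single[OF M])
    then have "\<ominus>\<^bsub>M\<^esub> (\<ominus>\<^bsub>M\<^esub> y) = x" using xy by (intro M.minus_equality) simp_all
    then show "x = y" using xy by simp
  qed
qed

text \<open>\<open>Hom\<^sub>\<int>(R, D)\<close>, on which \<open>a\<close> acts by \<open>(a f)(r) = f(a r)\<close>.\<close>
definition coinduced :: "('a, 'r) ring_scheme \<Rightarrow> (int, 'd) module \<Rightarrow> ('a, 'a \<Rightarrow> 'd) module"
  where "coinduced R D =
    \<lparr>carrier = hom (add_monoid R) (add_monoid D) \<inter> extensional (carrier R),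
     monoid.mult = undefined, monoid.one = undefined,
     ring.zero = (\<lambda>r\<in>carrier R. \<zero>\<^bsub>D\<^esub>), ring.add = (\<lambda>f g. \<lambda>r\<in>carrier R. f r \<oplus>\<^bsub>D\<^esub> g r),
     module.smult = (\<lambda>a f. \<lambda>r\<in>carrier R. f (r \<otimes>\<^bsub>R\<^esub> a))\<rparr>"

lemma coinduced_simps [simp]:
  "carrier (coinduced R D) = hom (add_monoid R) (add_monoid D) \<inter> extensional (carrier R)"
  "\<zero>\<^bsub>coinduced R D\<^esub> = (\<lambda>r\<in>carrier R. \<zero>\<^bsub>D\<^esub>)"
  "f \<oplus>\<^bsub>coinduced R D\<^esub> g = (\<lambda>r\<in>carrier R. f r \<oplus>\<^bsub>D\<^esub> g r)"
  "a \<odot>\<^bsub>coinduced R D\<^esub> f = (\<lambda>r\<in>carrier R. f (r \<otimes>\<^bsub>R\<^esub> a))"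
  by (auto simp: coinduced_def)

lemma coinduced_module:
  assumes R: "cring R" and D: "Module.module \<Z> D"
  shows "Module.module R (coinduced R D)"
proof -
  interpret R: cring R by fact
  interpret D: Module.module \<Z> D by fact
  have h: "f r \<in> carrier D" "f (r \<oplus>\<^bsub>R\<^esub> s) = f r \<oplus>\<^bsub>D\<^esub> f s"
    if "f \<in> hom (add_monoid R) (add_monoid D)" "r \<in> carrier R" "s \<in> carrier R" for f r s
    using that by (auto simp: hom_def)
  have "abelian_group (coinduced R D)"
  proof (rule abelian_groupI)
    fix f assume f: "f \<in> carrier (coinduced R D)"
    let ?g = "\<lambda>r\<in>carrier R. \<ominus>\<^bsub>D\<^esub> f r"
    have "?g \<in> carrier (coinduced R D)" using f by (auto simp: h D.minus_add intro!: homI)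
    then show "\<exists>y\<in>carrier (coinduced R D). y \<oplus>\<^bsub>coinduced R D\<^esub> f = \<zero>\<^bsub>coinduced R D\<^esub>"
      using f by (intro bexI[of _ ?g]) (auto simp: D.l_neg h cong: restrict_cong)
  qed (auto intro!: homI extensionalityI[of _ "carrier R"] simp: h D.a_ac)
  then show ?thesis
    by (intro moduleI R) (auto intro!: homI extensionalityI[of _ "carrier R"]
      simp: h D.a_ac R.l_distr R.r_distr R.m_assoc)
qed

text \<open>\<open>Hom\<^sub>R(M, Hom\<^sub>\<int>(R, D)) = Hom\<^sub>\<int>(M, D)\<close>, by evaluation at 1, and \<open>D\<close> is injective as a group.\<close>
theorem coinduced_injective:
  fixes R :: "('a, 'r) ring_scheme"
  assumes R: "cring R" and D: "Module.module \<Z> D" and div: "divisible_group (add_monoid D)"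
  shows "injective_module R (coinduced R D)"
  unfolding injective_module_def
proof (intro conjI allI impI)
  show "Module.module R (coinduced R D)" by (rule coinduced_module[OF R D])
  interpret R: cring R by fact
  interpret D: Module.module \<Z> D by fact
  fix M :: "('a, 'a) module" and N g
  assume "Module.module R M \<and> Module.submodule N R M \<and>
    g \<in> LinearCombinations.module_hom R (M\<lparr>carrier := N\<rparr>) (coinduced R D)"
  then have M: "Module.module R M" and N: "Module.submodule N R M"
    and g: "g \<in> LinearCombinations.module_hom R (M\<lparr>carrier := N\<rparr>) (coinduced R D)" by auto
  interpret M: Module.module R M by fact
  note gD = module_homD[OF g, simplified]
  have Nc: "x \<in> carrier M" if "x \<in> N" for x using M.submoduleE(1)[OF N] that by blast
  have "\<exists>h \<in> hom (add_monoid M) (add_monoid D). \<forall>x \<in> N. h x = g x \<one>\<^bsub>R\<^esub>"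
  proof (rule divisible_group_extension[OF M.a_comm_group D.a_comm_group div])
    show "subgroup N (add_monoid M)" using N by (simp add: Module.submodule_def)
    show "(\<lambda>x. g x \<one>\<^bsub>R\<^esub>) \<in> hom ((add_monoid M)\<lparr>carrier := N\<rparr>) (add_monoid D)"
    proof (rule homI)
      fix x assume "x \<in> carrier ((add_monoid M)\<lparr>carrier := N\<rparr>)"
      then have "g x \<in> hom (add_monoid R) (add_monoid D)" using gD(1) by simp
      then show "g x \<one>\<^bsub>R\<^esub> \<in> carrier (add_monoid D)" by (auto simp: hom_def)
    next
      fix x y assume "x \<in> carrier ((add_monoid M)\<lparr>carrier := N\<rparr>)" "y \<in> carrier ((add_monoid M)\<lparr>carrier := N\<rparr>)"
      then show "g (x \<otimes>\<^bsub>(add_monoid M)\<lparr>carrier := N\<rparr>\<^esub> y) \<one>\<^bsub>R\<^esub> = g x \<one>\<^bsub>R\<^esub> \<otimes>\<^bsub>add_monoid D\<^esub> g y \<one>\<^bsub>R\<^esub>"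
        using gD(2) by simp
    qed
  qed
  then obtain G where G: "G \<in> hom (add_monoid M) (add_monoid D)" "\<And>x. x \<in> N \<Longrightarrow> G x = g x \<one>\<^bsub>R\<^esub>" by blast
  have Gh: "G x \<in> carrier D" "G (x \<oplus>\<^bsub>M\<^esub> y) = G x \<oplus>\<^bsub>D\<^esub> G y" if "x \<in> carrier M" "y \<in> carrier M" for x y
    using G(1) that by (auto simp: hom_def)
  define h where "h x = (\<lambda>r\<in>carrier R. G (r \<odot>\<^bsub>M\<^esub> x))" for x
  have "h \<in> LinearCombinations.module_hom R M (coinduced R D)"
    by (rule module_homI)
      (auto simp: h_def Gh M.smult_l_distr M.smult_r_distr M.smult_assoc1 intro!: homI cong: restrict_cong)
  moreover have "h x = g x" if x: "x \<in> N" for x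
  proof (rule extensionalityI[of _ "carrier R"])
    show "h x \<in> extensional (carrier R)" by (simp add: h_def)
    show "g x \<in> extensional (carrier R)" using gD(1) x by simp
    fix r assume r: "r \<in> carrier R"
    then have "r \<odot>\<^bsub>M\<^esub> x \<in> N" using M.submoduleE(4)[OF N] x by simp
    then show "h x r = g x r" using r x G(2)[of "r \<odot>\<^bsub>M\<^esub> x"] gD(3)[of r x] by (simp add: h_def)
  qed
  ultimately show "\<exists>h\<in>LinearCombinations.module_hom R M (coinduced R D). \<forall>x\<in>N. h x = g x" by blast
qed

lemma coinduced_embedding:
  assumes R: "cring R" and D: "Module.module \<Z> D" and M: "Module.module R M"
    and j: "j \<in> hom (add_monoid M) (add_monoid D)" "inj_on j (carrier M)"
  shows "\<exists>\<epsilon> \<in> LinearCombinations.module_hom R M (coinduced R D). inj_on \<epsilon> (carrier M)"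
proof
  interpret R: cring R by fact
  interpret D: Module.module \<Z> D by fact
  interpret M: Module.module R M by fact
  have jh: "j x \<in> carrier D" "j (x \<oplus>\<^bsub>M\<^esub> y) = j x \<oplus>\<^bsub>D\<^esub> j y" if "x \<in> carrier M" "y \<in> carrier M" for x y
    using j(1) that by (auto simp: hom_def)
  define h where "h x = (\<lambda>r\<in>carrier R. j (r \<odot>\<^bsub>M\<^esub> x))" for x
  show "h \<in> LinearCombinations.module_hom R M (coinduced R D)"
    by (rule module_homI)
      (auto simp: h_def jh M.smult_l_distr M.smult_r_distr M.smult_assoc1 intro!: homI cong: restrict_cong)
  show "inj_on h (carrier M)"
  proof (rule inj_onI)
    fix x y assume xy: "x \<in> carrier M" "y \<in> carrier M" "h x = h y"
    then have "h x \<one>\<^bsub>R\<^esub> = h y \<one>\<^bsub>R\<^esub>" by simp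
    then show "x = y" using xy inj_onD[OF j(2)] by (simp add: h_def)
  qed
qed


lemma ex_inj_nat_nat_prod:
  assumes inf: "infinite (UNIV :: 'a set)"
  shows "\<exists>\<iota> :: nat \<times> nat \<times> 'a \<Rightarrow> 'a. inj \<iota>"
proof -
  obtain \<nu> :: "nat \<Rightarrow> 'a" where \<nu>: "inj \<nu>" using infinite_countable_subset[OF inf] by blast
  obtain \<pi> :: "'a \<times> 'a \<Rightarrow> 'a" where \<pi>: "inj \<pi>"
    using card_of_Times_same_infinite[OF inf] unfolding card_of_ordIso[symmetric] bij_betw_def by auto
  have "inj (\<lambda>t. \<pi> (\<nu> (fst t), \<pi> (\<nu> (fst (snd t)), snd (snd t))))"
    by (rule injI) (simp add: inj_eq[OF \<pi>] inj_eq[OF \<nu>] prod_eq_iff)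
  then show ?thesis by (rule exI[of inj])
qed

lemma ex_inj_functions:
  assumes inf: "infinite (UNIV :: 'a set)"
  shows "\<exists>\<theta> :: ('a \<Rightarrow> 'a set) \<Rightarrow> 'a set. inj \<theta>"
proof -
  obtain \<pi> :: "'a \<times> 'a \<Rightarrow> 'a" where \<pi>: "inj \<pi>"
    using card_of_Times_same_infinite[OF inf] unfolding card_of_ordIso[symmetric] bij_betw_def by auto
  have "inj (\<lambda>f. \<pi> ` {(x, y). y \<in> f x})"
  proof (rule injI)
    fix f g :: "'a \<Rightarrow> 'a set" assume "\<pi> ` {(x, y). y \<in> f x} = \<pi> ` {(x, y). y \<in> g x}"
    then have "{(x, y). y \<in> f x} = {(x, y). y \<in> g x}" using \<pi> by (simp add: inj_image_eq_iff)
    then show "f = g" by (auto simp: set_eq_iff fun_eq_iff)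
  qed
  then show ?thesis by (rule exI[of inj])
qed

text \<open>A function of finite support is coded by a list of its support and the values there. The tag in the middle tells
  support, values and length apart; the length has to be recorded because \<open>{}\<close> is a possible entry.\<close>
lemma ex_inj_finite_support:
  assumes inf: "infinite (UNIV :: 'a set)" and e: "inj (e :: 'c \<Rightarrow> 'a set)"
  shows "\<exists>\<theta> :: ('a set \<Rightarrow> 'c) \<Rightarrow> 'a set. inj_on \<theta> {z. finite {k. z k \<noteq> c0}}"
proof -
  obtain \<iota> :: "nat \<times> nat \<times> 'a \<Rightarrow> 'a" where \<iota>: "inj \<iota>" using ex_inj_nat_nat_prod[OF inf] by blast
  define xs where "xs z = (SOME xs. set xs = {k. z k \<noteq> c0})" for z :: "'a set \<Rightarrow> 'c"
  have xs: "set (xs z) = {k. z k \<noteq> c0}" if "finite {k. z k \<noteq> c0}" for z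
    unfolding xs_def using finite_list[OF that] by (rule someI_ex)
  define T where "T z = {(n, 0::nat, x) | n x. n < length (xs z) \<and> x \<in> xs z ! n} \<union>
    {(n, 1, x) | n x. n < length (xs z) \<and> x \<in> e (z (xs z ! n))} \<union> {(n, 2, x) | n x. n < length (xs z)}"
    for z :: "'a set \<Rightarrow> 'c"
  have inj: "inj_on T {z. finite {k. z k \<noteq> c0}}"
  proof (rule inj_onI)
    fix z w :: "'a set \<Rightarrow> 'c" assume fin: "z \<in> {z. finite {k. z k \<noteq> c0}}" "w \<in> {z. finite {k. z k \<noteq> c0}}" and T: "T z = T w"
    have len: "n < length (xs z) \<longleftrightarrow> n < length (xs w)" for n
    proof -
      have "n < length (xs u) \<longleftrightarrow> (n, 2, undefined) \<in> T u" for u by (auto simp: T_def)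
      then show ?thesis using T by simp
    qed
    have m0: "xs u ! n = {x. (n, 0, x) \<in> T u}" if "n < length (xs u)" for u n
      using that by (auto simp: T_def)
    have m1: "e (u (xs u ! n)) = {x. (n, 1, x) \<in> T u}" if "n < length (xs u)" for u n
      using that by (auto simp: T_def)
    have nth: "xs z ! n = xs w ! n" "z (xs z ! n) = w (xs z ! n)" if "n < length (xs z)" for n
    proof -
      show *: "xs z ! n = xs w ! n" using that m0[of n z] m0[of n w] len T by simp
      have "e (z (xs z ! n)) = e (w (xs w ! n))" using that m1[of n z] m1[of n w] len T by simp
      then show "z (xs z ! n) = w (xs z ! n)" using injD[OF e] * by simp
    qed
    have "length (xs z) = length (xs w)" using len by (meson linorder_neqE_nat less_irrefl)
    then have "xs z = xs w" using nth by (simp add: nth_equalityI)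
    then have supp: "{k. z k \<noteq> c0} = {k. w k \<noteq> c0}" using xs fin by (metis mem_Collect_eq)
    show "z = w"
    proof
      fix k
      show "z k = w k"
      proof (cases "z k = c0")
        case True then show ?thesis using supp by (auto simp: set_eq_iff)
      next
        case False
        then have "k \<in> set (xs z)" using xs[of z] fin by simp
        then obtain n where "n < length (xs z)" "xs z ! n = k" by (auto simp: in_set_conv_nth)
        then show ?thesis using nth(2)[of n] by simp
      qed
    qed
  qed
  have "inj_on (\<lambda>z. \<iota> ` T z) {z. finite {k. z k \<noteq> c0}}"
    using inj by (simp add: inj_on_def inj_image_eq_iff[OF \<iota>])
  then show ?thesis by (rule exI[of "\<lambda>\<theta>. inj_on \<theta> {z. finite {k. z k \<noteq> c0}}"])
qed

lemma ex_inj_coinduced: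
  assumes inf: "infinite (UNIV :: 'a set)"
  shows "\<exists>\<theta> :: ('a \<Rightarrow> ('a set \<Rightarrow>\<^sub>0 rat)) \<Rightarrow> 'a set. inj \<theta>"
proof -
  obtain \<nu> :: "nat \<Rightarrow> 'a" where \<nu>: "inj \<nu>" using infinite_countable_subset[OF inf] by blast
  have e: "inj (\<lambda>q::rat. {\<nu> (to_nat q)})" by (rule injI) (simp add: inj_eq[OF \<nu>])
  obtain \<theta> :: "('a set \<Rightarrow> rat) \<Rightarrow> 'a set" where \<theta>: "inj_on \<theta> {z. finite {k. z k \<noteq> 0}}"
    using ex_inj_finite_support[OF inf e, of 0] by (elim exE)
  have \<theta>': "z = w" if "\<theta> (Poly_Mapping.lookup z) = \<theta> (Poly_Mapping.lookup w)" for z w :: "'a set \<Rightarrow>\<^sub>0 rat"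
  proof -
    have mem: "Poly_Mapping.lookup u \<in> {z. finite {k. z k \<noteq> 0}}" for u :: "'a set \<Rightarrow>\<^sub>0 rat"
      by (simp only: mem_Collect_eq finite_lookup)
    have "Poly_Mapping.lookup z = Poly_Mapping.lookup w"
      using inj_on_eq_iff[where f = \<theta>, OF \<theta> mem mem] that by (rule iffD1)
    then show ?thesis by (simp only: poly_mapping_eq_iff)
  qed
  obtain \<psi> :: "('a \<Rightarrow> 'a set) \<Rightarrow> 'a set" where \<psi>: "inj \<psi>" using ex_inj_functions[OF inf] by (elim exE)
  have "inj (\<lambda>f. \<psi> (\<lambda>x. \<theta> (Poly_Mapping.lookup (f x))))"
  proof (rule injI)
    fix f g :: "'a \<Rightarrow> ('a set \<Rightarrow>\<^sub>0 rat)"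
    assume "\<psi> (\<lambda>x. \<theta> (Poly_Mapping.lookup (f x))) = \<psi> (\<lambda>x. \<theta> (Poly_Mapping.lookup (g x)))"
    then have "(\<lambda>x. \<theta> (Poly_Mapping.lookup (f x))) = (\<lambda>x. \<theta> (Poly_Mapping.lookup (g x)))" by (rule injD[OF \<psi>])
    then show "f = g" by (intro ext \<theta>') (rule fun_cong)
  qed
  then show ?thesis by (rule exI[of inj])
qed

theorem injective_embedding:
  fixes M :: "('a, 'a set) module"
  assumes inf: "infinite (UNIV :: 'a set)" and R: "cring R" and M: "Module.module R M"
  shows "\<exists>(E :: ('a, 'a set) module) \<epsilon>. injective_module R E \<and>
    \<epsilon> \<in> LinearCombinations.module_hom R M E \<and> inj_on \<epsilon> (carrier M)"
proof -
  have aM: "abelian_group M" using M by (simp add: Module.module_def)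
  obtain D :: "(int, 'a set \<Rightarrow>\<^sub>0 rat) module" and j where D: "Module.module \<Z> D" "divisible_group (add_monoid D)"
    "j \<in> hom (add_monoid M) (add_monoid D)" "inj_on j (carrier M)"
    using divisible_hull[OF aM] by blast
  obtain \<theta> :: "('a \<Rightarrow> ('a set \<Rightarrow>\<^sub>0 rat)) \<Rightarrow> 'a set" where "inj \<theta>" using ex_inj_coinduced[OF inf] by blast
  then have \<theta>: "inj_on \<theta> (carrier (coinduced R D))" by (rule inj_on_subset) simp
  obtain \<epsilon> where \<epsilon>: "\<epsilon> \<in> LinearCombinations.module_hom R M (coinduced R D)" "inj_on \<epsilon> (carrier M)"
    using coinduced_embedding[OF R D(1) M D(3,4)] by blast
  show ?thesis
  proof (intro exI conjI)
    show "injective_module R (module_image \<theta> (coinduced R D))"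
      by (rule injective_module_image[OF coinduced_injective[OF R D(1,2)] \<theta>])
    show "\<theta> \<circ> \<epsilon> \<in> LinearCombinations.module_hom R M (module_image \<theta> (coinduced R D))"
      by (rule module_hom_comp[OF \<epsilon>(1) module_image(2)[OF coinduced_module[OF R D(1)] \<theta>]])
    show "inj_on (\<theta> \<circ> \<epsilon>) (carrier M)"
      using \<epsilon>(2) \<open>inj \<theta>\<close> by (intro comp_inj_on) (auto intro: inj_on_subset)
  qed
qed

lemma module_hom_kernel_submodule:
  assumes M: "Module.module R M" and N: "Module.module R N" and f: "f \<in> LinearCombinations.module_hom R M N"
  shows "Module.submodule (a_kernel M N f) R M"
proof -
  interpret M: Module.module R M by fact
  interpret N: Module.module R N by fact
  note fD = module_homD[OF f] and f0 = module_hom_zero[OF M N f]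
  have "f (\<ominus>\<^bsub>M\<^esub> a) = \<ominus>\<^bsub>N\<^esub> f a" if "a \<in> carrier M" for a
  proof -
    have "f (\<ominus>\<^bsub>M\<^esub> a) \<oplus>\<^bsub>N\<^esub> f a = \<zero>\<^bsub>N\<^esub>" using that fD(2)[of "\<ominus>\<^bsub>M\<^esub> a" a] f0 by (simp add: M.l_neg)
    then have "\<ominus>\<^bsub>N\<^esub> f a = f (\<ominus>\<^bsub>M\<^esub> a)" using that by (intro N.minus_equality fD(1)) simp_all
    then show ?thesis by simp
  qed
  moreover have "\<ominus>\<^bsub>N\<^esub> \<zero>\<^bsub>N\<^esub> = \<zero>\<^bsub>N\<^esub>" using N.minus_equality[of "\<zero>\<^bsub>N\<^esub>" "\<zero>\<^bsub>N\<^esub>"] by simp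
  ultimately show ?thesis
    by (intro M.submoduleI) (auto simp: a_kernel_def' fD f0)
qed

lemma module_hom_image_submodule:
  assumes M: "Module.module R M" and N: "Module.module R N" and f: "f \<in> LinearCombinations.module_hom R M N"
  shows "Module.submodule (f ` carrier M) R N"
proof -
  interpret M: Module.module R M by fact
  interpret N: Module.module R N by fact
  note fD = module_homD[OF f] and f0 = module_hom_zero[OF M N f]
  have inv: "\<ominus>\<^bsub>N\<^esub> f a = f (\<ominus>\<^bsub>M\<^esub> a)" if "a \<in> carrier M" for a
  proof -
    have "f (\<ominus>\<^bsub>M\<^esub> a) \<oplus>\<^bsub>N\<^esub> f a = \<zero>\<^bsub>N\<^esub>" using that fD(2)[of "\<ominus>\<^bsub>M\<^esub> a" a] f0 by (simp add: M.l_neg)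
    then show ?thesis using that by (intro N.minus_equality fD(1)) simp_all
  qed
  show ?thesis
  proof (rule N.submoduleI)
    show "\<zero>\<^bsub>N\<^esub> \<in> f ` carrier M" using f0 by (metis M.zero_closed image_eqI)
    show "f ` carrier M \<subseteq> carrier N" using fD(1) by auto
    show "\<ominus>\<^bsub>N\<^esub> a \<in> f ` carrier M" if "a \<in> f ` carrier M" for a
      using that inv by auto
    show "a \<oplus>\<^bsub>N\<^esub> b \<in> f ` carrier M" if ab: "a \<in> f ` carrier M" "b \<in> f ` carrier M" for a b
    proof -
      obtain x y where "x \<in> carrier M" "y \<in> carrier M" "a = f x" "b = f y" using ab by blast
      then show ?thesis using fD(2)[of x y] M.a_closed[of x y] by (metis image_eqI)
    qed
    show "r \<odot>\<^bsub>N\<^esub> a \<in> f ` carrier M" if ra: "r \<in> carrier R" "a \<in> f ` carrier M" for r a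
    proof -
      obtain x where "x \<in> carrier M" "a = f x" using ra by blast
      then show ?thesis using fD(3)[of r x] M.smult_closed[of r x] ra by (metis image_eqI)
    qed
  qed
qed

text \<open>Embed, divide by the image, and repeat. All modules stay in the type \<open>'a set\<close>, by \<open>injective_embedding\<close> and the
  quotients on representatives.\<close>
theorem injective_resolution_exists:
  fixes M :: "('a, 'b) module" and c :: "'b \<Rightarrow> 'a set"
  assumes inf: "infinite (UNIV :: 'a set)" and R: "cring R" and M: "Module.module R M" and c: "inj_on c (carrier M)"
  shows "\<exists>(E :: nat \<Rightarrow> ('a, 'a set) module) d \<epsilon>. injective_resolution R M E d \<epsilon>"
proof -
  let ?M = "module_image c M"
  note I = module_image[OF M c]
  define emb :: "('a, 'a set) module \<Rightarrow> ('a, 'a set) module \<times> ('a set \<Rightarrow> 'a set)"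
    where "emb Q = (SOME (E, \<epsilon>). injective_module R E \<and>
    \<epsilon> \<in> LinearCombinations.module_hom R Q E \<and> inj_on \<epsilon> (carrier Q))" for Q
  define env where "env Q = fst (emb Q)" for Q
  define inc where "inc Q = snd (emb Q)" for Q
  define nxt where "nxt Q = rep_quotient (env Q) (inc Q ` carrier Q)" for Q
  define Q where "Q n = (nxt ^^ n) ?M" for n
  have emb: "injective_module R (env P)" "inc P \<in> LinearCombinations.module_hom R P (env P)" "inj_on (inc P) (carrier P)"
    if P: "Module.module R P" for P :: "('a, 'a set) module"
  proof -
    have "case emb P of (E, \<epsilon>) \<Rightarrow> injective_module R E \<and>
      \<epsilon> \<in> LinearCombinations.module_hom R P E \<and> inj_on \<epsilon> (carrier P)"
    proof -
      obtain E :: "('a, 'a set) module" and \<epsilon> where "injective_module R E"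
        "\<epsilon> \<in> LinearCombinations.module_hom R P E" "inj_on \<epsilon> (carrier P)"
        using injective_embedding[OF inf R P] by blast
      then have "\<exists>p. case p of (E :: ('a, 'a set) module, \<epsilon>) \<Rightarrow> injective_module R E \<and>
        \<epsilon> \<in> LinearCombinations.module_hom R P E \<and> inj_on \<epsilon> (carrier P)"
        by (intro exI[of _ "(E, \<epsilon>)"]) simp
      from someI_ex[OF this] show ?thesis unfolding emb_def .
    qed
    then show "injective_module R (env P)" "inc P \<in> LinearCombinations.module_hom R P (env P)" "inj_on (inc P) (carrier P)"
      by (auto simp: env_def inc_def split: prod.splits)
  qed
  have envm: "Module.module R (env P)" if "Module.module R P" for P :: "('a, 'a set) module"
    using emb(1)[OF that] by (simp add: injective_module_def)
  have subm: "Module.submodule (inc P ` carrier P) R (env P)" if "Module.module R P" for P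
    by (rule module_hom_image_submodule[OF that envm[OF that] emb(2)[OF that]])
  have Q0: "Q 0 = ?M" and QS: "Q (Suc n) = nxt (Q n)" for n by (simp_all add: Q_def)
  have Qm: "Module.module R (Q n)" for n
  proof (induction n)
    case 0 then show ?case using I(1) by (simp add: Q0)
  next
    case (Suc n) then show ?case
      unfolding QS nxt_def by (intro rep_quotient(1)[OF R envm subm])
  qed
  define pr where "pr n = coset_rep (env (Q n)) (inc (Q n) ` carrier (Q n))" for n
  have pr: "pr n \<in> LinearCombinations.module_hom R (env (Q n)) (Q (Suc n))"
    and pr_zero: "x \<in> carrier (env (Q n)) \<Longrightarrow> pr n x = \<zero>\<^bsub>Q (Suc n)\<^esub> \<longleftrightarrow> x \<in> inc (Q n) ` carrier (Q n)"
    and pr_surj: "pr n ` carrier (env (Q n)) = carrier (Q (Suc n))" for n x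
    using rep_quotient(2,4)[OF R envm[OF Qm[of n]] subm[OF Qm[of n]]] by (auto simp: pr_def QS nxt_def)
  define E where "E n = env (Q n)" for n
  define d where "d n = inc (Q (Suc n)) \<circ> pr n" for n
  define \<epsilon> where "\<epsilon> = inc (Q 0) \<circ> c"
  have d_zero: "d n x = \<zero>\<^bsub>E (Suc n)\<^esub> \<longleftrightarrow> x \<in> inc (Q n) ` carrier (Q n)" if x: "x \<in> carrier (E n)" for n x
  proof -
    have z: "inc (Q (Suc n)) \<zero>\<^bsub>Q (Suc n)\<^esub> = \<zero>\<^bsub>E (Suc n)\<^esub>"
      unfolding E_def by (rule module_hom_zero[OF Qm envm[OF Qm] emb(2)[OF Qm]])
    have "d n x = \<zero>\<^bsub>E (Suc n)\<^esub> \<longleftrightarrow> pr n x = \<zero>\<^bsub>Q (Suc n)\<^esub>"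
    proof -
      interpret QQ: Module.module R "Q (Suc n)" by (rule Qm)
      have "pr n x \<in> carrier (Q (Suc n))" using module_homD(1)[OF pr] x by (simp add: E_def)
      then show ?thesis unfolding d_def z[symmetric] using inj_onD[OF emb(3)[OF Qm]] by auto
    qed
    then show ?thesis using pr_zero x by (simp add: E_def)
  qed
  have ker: "a_kernel (E n) (E (Suc n)) (d n) = inc (Q n) ` carrier (Q n)" for n
    using d_zero[of _ n] module_homD(1)[OF emb(2)[OF Qm]] by (auto simp: a_kernel_def' E_def)
  have "injective_resolution R M E d \<epsilon>"
    unfolding injective_resolution_def
  proof (intro conjI allI)
    show "injective_module R (E n)" for n using emb(1)[OF Qm] by (simp add: E_def)
    show "\<epsilon> \<in> LinearCombinations.module_hom R M (E 0)"
      unfolding \<epsilon>_def E_def using module_hom_comp[OF I(2)] emb(2)[OF Qm, of 0] Q0 by metis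
    show "inj_on \<epsilon> (carrier M)"
      unfolding \<epsilon>_def using c emb(3)[OF Qm, of 0] I(4) by (intro comp_inj_on) (auto simp: Q0)
    show "d n \<in> LinearCombinations.module_hom R (E n) (E (Suc n))" for n
      unfolding d_def E_def by (rule module_hom_comp[OF pr emb(2)[OF Qm]])
    show "\<epsilon> ` carrier M = a_kernel (E 0) (E 1) (d 0)"
      using ker[of 0] I(4) by (simp add: \<epsilon>_def Q0 image_image)
    show "d n ` carrier (E n) = a_kernel (E (Suc n)) (E (Suc (Suc n))) (d (Suc n))" for n
      unfolding ker pr_surj[symmetric] by (simp add: d_def E_def image_image)
  qed
  then show ?thesis by blast
qed

section \<open>Free resolutions\<close>

text \<open>The free module on \<open>B\<close>. The functions are required to vanish outside \<open>B\<close>, so that equality is equality of functions.\<close>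
definition free_on :: "('a, 'r) ring_scheme \<Rightarrow> 'b set \<Rightarrow> ('a, 'b \<Rightarrow> 'a) module"
  where "free_on R B =
    \<lparr>carrier = {z. (\<forall>b. z b \<in> carrier R) \<and> finite {b. z b \<noteq> \<zero>\<^bsub>R\<^esub>} \<and> {b. z b \<noteq> \<zero>\<^bsub>R\<^esub>} \<subseteq> B},
     monoid.mult = undefined, monoid.one = undefined,
     ring.zero = (\<lambda>_. \<zero>\<^bsub>R\<^esub>), ring.add = (\<lambda>z w b. z b \<oplus>\<^bsub>R\<^esub> w b),
     module.smult = (\<lambda>a z b. a \<otimes>\<^bsub>R\<^esub> z b)\<rparr>"

definition unit_fun :: "('a, 'r) ring_scheme \<Rightarrow> 'b \<Rightarrow> 'b \<Rightarrow> 'a"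
  where "unit_fun R b = (\<lambda>c. if c = b then \<one>\<^bsub>R\<^esub> else \<zero>\<^bsub>R\<^esub>)"

lemma free_on_simps [simp]:
  "carrier (free_on R B) = {z. (\<forall>b. z b \<in> carrier R) \<and> finite {b. z b \<noteq> \<zero>\<^bsub>R\<^esub>} \<and> {b. z b \<noteq> \<zero>\<^bsub>R\<^esub>} \<subseteq> B}"
  "\<zero>\<^bsub>free_on R B\<^esub> = (\<lambda>_. \<zero>\<^bsub>R\<^esub>)" "z \<oplus>\<^bsub>free_on R B\<^esub> w = (\<lambda>b. z b \<oplus>\<^bsub>R\<^esub> w b)"
  "a \<odot>\<^bsub>free_on R B\<^esub> z = (\<lambda>b. a \<otimes>\<^bsub>R\<^esub> z b)"
  by (auto simp: free_on_def)

lemma free_on_module: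
  assumes R: "cring R" shows "Module.module R (free_on R B)"
proof -
  interpret R: cring R by fact
  have sum: "finite {b. z b \<oplus>\<^bsub>R\<^esub> w b \<noteq> \<zero>\<^bsub>R\<^esub>} \<and> {b. z b \<oplus>\<^bsub>R\<^esub> w b \<noteq> \<zero>\<^bsub>R\<^esub>} \<subseteq> B"
    if "finite {b. z b \<noteq> \<zero>\<^bsub>R\<^esub>}" "{b. z b \<noteq> \<zero>\<^bsub>R\<^esub>} \<subseteq> B" "finite {b. w b \<noteq> \<zero>\<^bsub>R\<^esub>}" "{b. w b \<noteq> \<zero>\<^bsub>R\<^esub>} \<subseteq> B"
    for z w
  proof -
    have "{b. z b \<oplus>\<^bsub>R\<^esub> w b \<noteq> \<zero>\<^bsub>R\<^esub>} \<subseteq> {b. z b \<noteq> \<zero>\<^bsub>R\<^esub>} \<union> {b. w b \<noteq> \<zero>\<^bsub>R\<^esub>}" by auto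
    then show ?thesis using that by (meson finite_Un finite_subset le_sup_iff subset_trans)
  qed
  have scale: "finite {b. a \<otimes>\<^bsub>R\<^esub> z b \<noteq> \<zero>\<^bsub>R\<^esub>} \<and> {b. a \<otimes>\<^bsub>R\<^esub> z b \<noteq> \<zero>\<^bsub>R\<^esub>} \<subseteq> B"
    if "finite {b. z b \<noteq> \<zero>\<^bsub>R\<^esub>}" "{b. z b \<noteq> \<zero>\<^bsub>R\<^esub>} \<subseteq> B" "a \<in> carrier R" for a z
  proof -
    have "{b. a \<otimes>\<^bsub>R\<^esub> z b \<noteq> \<zero>\<^bsub>R\<^esub>} \<subseteq> {b. z b \<noteq> \<zero>\<^bsub>R\<^esub>}" using that by auto
    then show ?thesis using that by (meson finite_subset subset_trans)
  qed
  have neg: "finite {b. \<ominus>\<^bsub>R\<^esub> z b \<noteq> \<zero>\<^bsub>R\<^esub>} \<and> {b. \<ominus>\<^bsub>R\<^esub> z b \<noteq> \<zero>\<^bsub>R\<^esub>} \<subseteq> B"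
    if "finite {b. z b \<noteq> \<zero>\<^bsub>R\<^esub>}" "{b. z b \<noteq> \<zero>\<^bsub>R\<^esub>} \<subseteq> B" for z
  proof -
    have "{b. \<ominus>\<^bsub>R\<^esub> z b \<noteq> \<zero>\<^bsub>R\<^esub>} \<subseteq> {b. z b \<noteq> \<zero>\<^bsub>R\<^esub>}" by auto
    then show ?thesis using that by (meson finite_subset subset_trans)
  qed
  have "abelian_group (free_on R B)"
  proof (rule abelian_groupI)
    fix z assume z: "z \<in> carrier (free_on R B)"
    then show "\<exists>y\<in>carrier (free_on R B). y \<oplus>\<^bsub>free_on R B\<^esub> z = \<zero>\<^bsub>free_on R B\<^esub>"
      using neg[of z] by (intro bexI[of _ "\<lambda>b. \<ominus>\<^bsub>R\<^esub> z b"]) (auto simp: R.l_neg)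
  next
    fix x y assume "x \<in> carrier (free_on R B)" "y \<in> carrier (free_on R B)"
    then show "x \<oplus>\<^bsub>free_on R B\<^esub> y \<in> carrier (free_on R B)" using sum[of x y] by simp
  qed (auto simp: R.a_ac)
  then show ?thesis
  proof (intro moduleI R)
    fix a x assume "a \<in> carrier R" "x \<in> carrier (free_on R B)"
    then show "a \<odot>\<^bsub>free_on R B\<^esub> x \<in> carrier (free_on R B)" using scale[of x a] by simp
  qed (auto simp: R.l_distr R.r_distr R.m_assoc)
qed

lemma unit_fun_carrier: "cring R \<Longrightarrow> b \<in> B \<Longrightarrow> unit_fun R b \<in> carrier (free_on R B)"
  by (auto simp: unit_fun_def cring.cring_simprules)

lemma free_on_finsum_apply:
  assumes R: "cring R" and fin: "finite A" and f: "f \<in> A \<rightarrow> carrier (free_on R B)"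
  shows "(\<Oplus>\<^bsub>free_on R B\<^esub> i\<in>A. f i) c = (\<Oplus>\<^bsub>R\<^esub> i\<in>A. f i c)"
proof -
  interpret R: cring R by fact
  interpret F: Module.module R "free_on R B" by (rule free_on_module[OF R])
  show ?thesis
    using fin f
  proof (induction A)
    case (insert i A)
    have c: "f i \<in> carrier (free_on R B)" "f \<in> A \<rightarrow> carrier (free_on R B)" using insert by auto
    have cc: "(\<lambda>i. f i c) \<in> A \<rightarrow> carrier R" "f i c \<in> carrier R" using insert by (auto simp: Pi_iff)
    show ?case using insert c cc by (simp add: F.finsum_insert R.finsum_insert del: free_on_simps(1))
  qed simp
qed

lemma free_on_expand:
  assumes R: "cring R" and z: "z \<in> carrier (free_on R B)" and A: "finite A" "{b. z b \<noteq> \<zero>\<^bsub>R\<^esub>} \<subseteq> A" "A \<subseteq> B"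
  shows "z = (\<Oplus>\<^bsub>free_on R B\<^esub> b\<in>A. z b \<odot>\<^bsub>free_on R B\<^esub> unit_fun R b)"
proof
  fix c
  interpret R: cring R by fact
  interpret F: Module.module R "free_on R B" by (rule free_on_module[OF R])
  have zc: "z b \<in> carrier R" for b using z by simp
  have mem: "(\<lambda>b. z b \<odot>\<^bsub>free_on R B\<^esub> unit_fun R b) \<in> A \<rightarrow> carrier (free_on R B)"
    using A(3) zc by (intro Pi_I F.smult_closed unit_fun_carrier[OF R]) auto
  have "(\<Oplus>\<^bsub>free_on R B\<^esub> b\<in>A. z b \<odot>\<^bsub>free_on R B\<^esub> unit_fun R b) c = (\<Oplus>\<^bsub>R\<^esub> b\<in>A. (z b \<odot>\<^bsub>free_on R B\<^esub> unit_fun R b) c)"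
    by (rule free_on_finsum_apply[OF R A(1) mem])
  also have "\<dots> = (\<Oplus>\<^bsub>R\<^esub> b\<in>A. if c = b then z b else \<zero>\<^bsub>R\<^esub>)"
    using zc by (intro R.finsum_cong') (auto simp: unit_fun_def)
  also have "\<dots> = z c"
  proof (cases "c \<in> A")
    case True
    then show ?thesis using R.finsum_singleton[OF True A(1), of z] zc by simp
  next
    case False
    then have "(\<Oplus>\<^bsub>R\<^esub> b\<in>A. if c = b then z b else \<zero>\<^bsub>R\<^esub>) = (\<Oplus>\<^bsub>R\<^esub> b\<in>A. \<zero>\<^bsub>R\<^esub>)" by (intro R.finsum_cong') auto
    moreover have "z c = \<zero>\<^bsub>R\<^esub>" using False A(2) by blast
    ultimately show ?thesis by simp
  qed
  finally show "z c = (\<Oplus>\<^bsub>free_on R B\<^esub> b\<in>A. z b \<odot>\<^bsub>free_on R B\<^esub> unit_fun R b) c" by simp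
qed

text \<open>The unit functions are a basis, and the bijection \<open>\<theta>\<close> carries them to a basis.\<close>
lemma free_module_image:
  fixes \<theta> :: "('b \<Rightarrow> 'a) \<Rightarrow> 'c"
  assumes R: "cring R" and \<theta>: "inj_on \<theta> (carrier (free_on R B))"
  shows "free_module R (module_image \<theta> (free_on R B))"
  unfolding free_module_def
proof (intro conjI exI)
  let ?F = "free_on R B" and ?I = "module_image \<theta> (free_on R B)"
  interpret R: cring R by fact
  interpret F: Module.module R ?F by (rule free_on_module[OF R])
  note I = module_image[OF free_on_module[OF R] \<theta>]
  interpret I: Module.module R ?I by (rule I(1))
  show "Module.module R ?I" by (rule I(1))
  let ?e = "\<lambda>b. \<theta> (unit_fun R b)"
  have e_carrier: "?e b \<in> carrier ?I" if "b \<in> B" for b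
    by (rule module_homD(1)[OF I(2) unit_fun_carrier[OF R that]])
  show "?e ` B \<subseteq> carrier ?I" by (rule image_subsetI) (rule e_carrier)
  have hom_sum: "\<theta> (\<Oplus>\<^bsub>?F\<^esub> i\<in>A. f i) = (\<Oplus>\<^bsub>?I\<^esub> i\<in>A. \<theta> (f i))" if "finite A" "f \<in> A \<rightarrow> carrier ?F" for A :: "'b set" and f
    using that
  proof (induction A)
    case empty then show ?case using I(5) by simp
  next
    case (insert i A)
    have c: "f i \<in> carrier ?F" "f \<in> A \<rightarrow> carrier ?F" using insert by auto
    have c': "\<theta> (f i) \<in> carrier ?I" "(\<lambda>i. \<theta> (f i)) \<in> A \<rightarrow> carrier ?I" using c module_homD(1)[OF I(2)] by (auto simp del: free_on_simps)
    have s: "(\<Oplus>\<^bsub>?F\<^esub> i\<in>A. f i) \<in> carrier ?F" by (rule F.finsum_closed[OF c(2)])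
    have "(\<Oplus>\<^bsub>?F\<^esub> j\<in>insert i A. f j) = f i \<oplus>\<^bsub>?F\<^esub> (\<Oplus>\<^bsub>?F\<^esub> j\<in>A. f j)"
      by (rule F.M.finsum_insert[OF insert.hyps c(2,1)])
    moreover have "(\<Oplus>\<^bsub>?I\<^esub> j\<in>insert i A. \<theta> (f j)) = \<theta> (f i) \<oplus>\<^bsub>?I\<^esub> (\<Oplus>\<^bsub>?I\<^esub> j\<in>A. \<theta> (f j))"
      by (rule I.M.finsum_insert[OF insert.hyps c'(2,1)])
    ultimately show ?case using insert.IH[OF c(2)] module_homD(2)[OF I(2) c(1) s] by (simp only:)
  qed
  have uinj: "inj_on ?e B" if one: "\<one>\<^bsub>R\<^esub> \<noteq> \<zero>\<^bsub>R\<^esub>"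
  proof (rule inj_onI)
    fix b c assume "b \<in> B" "c \<in> B" "?e b = ?e c"
    then have "unit_fun R b = unit_fun R c"
      using inj_on_eq_iff[where f = \<theta>, OF \<theta> unit_fun_carrier[OF R] unit_fun_carrier[OF R]] by (simp only:)
    then have "unit_fun R b b = unit_fun R c b" by simp
    then show "b = c" using one by (auto simp: unit_fun_def split: if_splits)
  qed
  have comb: "\<theta> z = LinearCombinations.module.lincomb ?I (\<lambda>v. z (the_inv_into B ?e v)) (?e ` A)"
    if one: "\<one>\<^bsub>R\<^esub> \<noteq> \<zero>\<^bsub>R\<^esub>" and z: "z \<in> carrier ?F" and A: "finite A" "{b. z b \<noteq> \<zero>\<^bsub>R\<^esub>} \<subseteq> A" "A \<subseteq> B" for z A
  proof -
    have zc: "z b \<in> carrier R" for b using z by simp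
    have mem: "(\<lambda>b. z b \<odot>\<^bsub>?F\<^esub> unit_fun R b) \<in> A \<rightarrow> carrier ?F"
    proof (rule Pi_I)
      fix b assume "b \<in> A"
      then have "b \<in> B" using A(3) by (rule_tac subsetD)
      then show "z b \<odot>\<^bsub>?F\<^esub> unit_fun R b \<in> carrier ?F"
        by (intro F.smult_closed zc unit_fun_carrier[OF R])
    qed
    have ie: "inj_on ?e A" by (rule inj_on_subset[OF uinj[OF one] A(3)])
    have "\<theta> z = \<theta> (\<Oplus>\<^bsub>?F\<^esub> b\<in>A. z b \<odot>\<^bsub>?F\<^esub> unit_fun R b)"
      by (rule arg_cong[where f = \<theta>, OF free_on_expand[OF R z A]])
    also have "\<dots> = (\<Oplus>\<^bsub>?I\<^esub> b\<in>A. \<theta> (z b \<odot>\<^bsub>?F\<^esub> unit_fun R b))" by (rule hom_sum[OF A(1) mem])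
    also have "\<dots> = (\<Oplus>\<^bsub>?I\<^esub> b\<in>A. z (the_inv_into B ?e (?e b)) \<odot>\<^bsub>?I\<^esub> ?e b)"
    proof (rule I.finsum_cong')
      fix b assume "b \<in> A"
      then have b: "b \<in> B" using A by blast
      then show "\<theta> (z b \<odot>\<^bsub>?F\<^esub> unit_fun R b) = z (the_inv_into B ?e (?e b)) \<odot>\<^bsub>?I\<^esub> ?e b"
        using module_homD(3)[OF I(2) zc unit_fun_carrier[OF R b]] the_inv_into_f_f[OF uinj[OF one] b] by simp
      
    next
      show "(\<lambda>b. z (the_inv_into B ?e (?e b)) \<odot>\<^bsub>?I\<^esub> ?e b) \<in> A \<rightarrow> carrier ?I"
        using A(3) zc e_carrier by (intro Pi_I I.smult_closed) auto
    qed simp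
    also have "\<dots> = (\<Oplus>\<^bsub>?I\<^esub> v\<in>?e ` A. z (the_inv_into B ?e v) \<odot>\<^bsub>?I\<^esub> v)"
    proof (rule I.finsum_reindex[OF _ ie, symmetric])
      show "(\<lambda>v. z (the_inv_into B ?e v) \<odot>\<^bsub>?I\<^esub> v) \<in> ?e ` A \<rightarrow> carrier ?I"
      proof
        fix v assume "v \<in> ?e ` A"
        then obtain b where "b \<in> B" "v = ?e b" using A by blast
        then have "v \<in> carrier ?I" using e_carrier by simp
        then show "z (the_inv_into B ?e v) \<odot>\<^bsub>?I\<^esub> v \<in> carrier ?I" using zc by (rule_tac I.smult_closed)
      qed
    qed
    finally show ?thesis by (simp add: LinearCombinations.module.lincomb_def[OF I(1)])
  qed
  show "\<not> LinearCombinations.module.lin_dep R ?I (?e ` B)"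
  proof
    assume "LinearCombinations.module.lin_dep R ?I (?e ` B)"
    then obtain A a v where A: "finite A" "A \<subseteq> ?e ` B" "a \<in> A \<rightarrow> carrier R"
      and l: "LinearCombinations.module.lincomb ?I a A = \<zero>\<^bsub>?I\<^esub>" and v: "v \<in> A" "a v \<noteq> \<zero>\<^bsub>R\<^esub>"
      unfolding LinearCombinations.module.lin_dep_def[OF I(1)] by blast
    have one: "\<one>\<^bsub>R\<^esub> \<noteq> \<zero>\<^bsub>R\<^esub>"
    proof
      assume "\<one>\<^bsub>R\<^esub> = \<zero>\<^bsub>R\<^esub>"
      then have "carrier R = {\<zero>\<^bsub>R\<^esub>}" using R.one_zeroD by simp
      then show False using v A by (auto simp: Pi_iff)
    qed
    note ui = uinj[OF one]
    define A' where "A' = the_inv_into B ?e ` A"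
    have A': "finite A'" "A' \<subseteq> B" "?e ` A' = A"
    proof -
      show "finite A'" using A by (simp add: A'_def)
      show "A' \<subseteq> B" unfolding A'_def using the_inv_into_into[OF ui _ subset_refl] A by blast
      have "?e (the_inv_into B ?e w) = w" if "w \<in> A" for w using f_the_inv_into_f[OF ui] A that by blast
      then show "?e ` A' = A" unfolding A'_def image_image by simp
    qed
    define z where "z b = (if b \<in> A' then a (?e b) else \<zero>\<^bsub>R\<^esub>)" for b
    have zb: "{b. z b \<noteq> \<zero>\<^bsub>R\<^esub>} \<subseteq> A'" by (auto simp: z_def)
    have z: "z \<in> carrier ?F"
      using zb A' A(3) finite_subset[OF zb] by (auto simp: z_def Pi_iff)
    have "\<theta> z = LinearCombinations.module.lincomb ?I (\<lambda>v. z (the_inv_into B ?e v)) A"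
      using comb[OF one z A'(1) zb A'(2)] A'(3) by simp
    also have "\<dots> = LinearCombinations.module.lincomb ?I a A"
      unfolding LinearCombinations.module.lincomb_def[OF I(1)]
    proof (rule I.finsum_cong')
      fix w assume w: "w \<in> A"
      then have "?e (the_inv_into B ?e w) = w" using f_the_inv_into_f[OF ui] A by blast
      then show "z (the_inv_into B ?e w) \<odot>\<^bsub>?I\<^esub> w = a w \<odot>\<^bsub>?I\<^esub> w" using w by (simp add: z_def A'_def)
    next
      show "(\<lambda>w. a w \<odot>\<^bsub>?I\<^esub> w) \<in> A \<rightarrow> carrier ?I"
      proof
        fix w assume w: "w \<in> A"
        then obtain b where "b \<in> B" "w = ?e b" using A by blast
        then have "w \<in> carrier ?I" using e_carrier by simp
        then show "a w \<odot>\<^bsub>?I\<^esub> w \<in> carrier ?I" using A(3) w by (intro I.smult_closed) auto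
      qed
    qed simp
    finally have "\<theta> z = \<theta> \<zero>\<^bsub>?F\<^esub>" using l I(5) by simp
    then have "z = \<zero>\<^bsub>?F\<^esub>" using z F.zero_closed by (rule inj_onD[where f = \<theta>, OF \<theta>])
    then have "z b = \<zero>\<^bsub>R\<^esub>" for b by simp
    moreover obtain b where "b \<in> A'" "?e b = v" using A'(3) v by blast
    ultimately show False using v by (metis z_def)
  qed
  show "LinearCombinations.module.span R ?I (?e ` B) = carrier ?I"
  proof
    have sub: "?e ` B \<subseteq> carrier ?I" by (rule image_subsetI) (rule e_carrier)
    show "LinearCombinations.module.span R ?I (?e ` B) \<subseteq> carrier ?I"
      using LinearCombinations.module.span_is_subset2[OF I(1) sub] .
    show "carrier ?I \<subseteq> LinearCombinations.module.span R ?I (?e ` B)"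
    proof
      fix x assume "x \<in> carrier ?I"
      then obtain z where z: "z \<in> carrier ?F" "x = \<theta> z" using I(4) by blast
      show "x \<in> LinearCombinations.module.span R ?I (?e ` B)"
      proof (cases "\<one>\<^bsub>R\<^esub> = \<zero>\<^bsub>R\<^esub>")
        case True
        then have "carrier R = {\<zero>\<^bsub>R\<^esub>}" using R.one_zeroD by simp
        then have "z = \<zero>\<^bsub>?F\<^esub>" using z by (auto simp: fun_eq_iff)
        then have "x = LinearCombinations.module.lincomb ?I undefined {}"
          using z I(5) by (simp add: LinearCombinations.module.lincomb_def[OF I(1)])
        then show ?thesis unfolding LinearCombinations.module.span_def[OF I(1)] by blast
      next
        case False
        let ?A = "{b. z b \<noteq> \<zero>\<^bsub>R\<^esub>}"
        have A: "finite ?A" "?A \<subseteq> ?A" "?A \<subseteq> B" using z by auto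
        have "x = LinearCombinations.module.lincomb ?I (\<lambda>v. z (the_inv_into B ?e v)) (?e ` ?A)"
          using comb[OF False z(1) A] z(2) by simp
        moreover have "finite (?e ` ?A)" "?e ` ?A \<subseteq> ?e ` B" using A by auto
        moreover have "(\<lambda>v. z (the_inv_into B ?e v)) \<in> ?e ` ?A \<rightarrow> carrier R" using z by auto
        ultimately show ?thesis unfolding LinearCombinations.module.span_def[OF I(1)] by blast
      qed
    qed
  qed
qed

text \<open>The zero of the ring is the parameter \<open>z0\<close>, as the module record does not determine it.\<close>
definition free_eval :: "('a, 'b) module \<Rightarrow> 'a \<Rightarrow> ('b \<Rightarrow> 'a) \<Rightarrow> 'b"
  where "free_eval M z0 z = (\<Oplus>\<^bsub>M\<^esub> m\<in>{m. z m \<noteq> z0}. z m \<odot>\<^bsub>M\<^esub> m)"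

lemma free_eval_hom:
  assumes M: "Module.module R M"
  shows "free_eval M \<zero>\<^bsub>R\<^esub> \<in> LinearCombinations.module_hom R (free_on R (carrier M)) M"
    and "free_eval M \<zero>\<^bsub>R\<^esub> ` carrier (free_on R (carrier M)) = carrier M"
proof -
  interpret M: Module.module R M by fact
  let ?F = "free_on R (carrier M)" and ?ev = "free_eval M \<zero>\<^bsub>R\<^esub>"
  interpret F: Module.module R ?F by (rule free_on_module[OF M.R.is_cring])
  have sup: "?ev z = (\<Oplus>\<^bsub>M\<^esub> m\<in>A. z m \<odot>\<^bsub>M\<^esub> m)"
    if "z \<in> carrier ?F" "finite A" "{m. z m \<noteq> \<zero>\<^bsub>R\<^esub>} \<subseteq> A" "A \<subseteq> carrier M" for z A
    unfolding free_eval_def using that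
    by (intro M.add.finprod_mono_neutral_cong_left) auto
  have cl: "?ev z \<in> carrier M" if "z \<in> carrier ?F" for z
    unfolding free_eval_def using that by (intro M.finsum_closed) auto
  show "?ev \<in> LinearCombinations.module_hom R ?F M"
  proof (rule module_homI)
    show "?ev z \<in> carrier M" if "z \<in> carrier ?F" for z by (rule cl[OF that])
  next
    fix z w assume zw: "z \<in> carrier ?F" "w \<in> carrier ?F"
    let ?A = "{m. z m \<noteq> \<zero>\<^bsub>R\<^esub>} \<union> {m. w m \<noteq> \<zero>\<^bsub>R\<^esub>}"
    have A: "finite ?A" "?A \<subseteq> carrier M" using zw by auto
    have sm: "{m. (z \<oplus>\<^bsub>?F\<^esub> w) m \<noteq> \<zero>\<^bsub>R\<^esub>} \<subseteq> ?A" by auto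
    have "?ev (z \<oplus>\<^bsub>?F\<^esub> w) = (\<Oplus>\<^bsub>M\<^esub> m\<in>?A. (z \<oplus>\<^bsub>?F\<^esub> w) m \<odot>\<^bsub>M\<^esub> m)"
      by (rule sup[OF F.a_closed[OF zw] A(1) sm A(2)])
    also have "\<dots> = (\<Oplus>\<^bsub>M\<^esub> m\<in>?A. z m \<odot>\<^bsub>M\<^esub> m \<oplus>\<^bsub>M\<^esub> w m \<odot>\<^bsub>M\<^esub> m)"
      using zw by (intro M.finsum_cong') (auto simp: M.smult_l_distr)
    also have "\<dots> = (\<Oplus>\<^bsub>M\<^esub> m\<in>?A. z m \<odot>\<^bsub>M\<^esub> m) \<oplus>\<^bsub>M\<^esub> (\<Oplus>\<^bsub>M\<^esub> m\<in>?A. w m \<odot>\<^bsub>M\<^esub> m)"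
      using zw by (intro M.finsum_addf) auto
    also have "\<dots> = ?ev z \<oplus>\<^bsub>M\<^esub> ?ev w"
      using sup[OF zw(1) A(1) _ A(2)] sup[OF zw(2) A(1) _ A(2)] by simp
    finally show "?ev (z \<oplus>\<^bsub>?F\<^esub> w) = ?ev z \<oplus>\<^bsub>M\<^esub> ?ev w" .
  next
    fix a z assume a: "a \<in> carrier R" and z: "z \<in> carrier ?F"
    let ?A = "{m. z m \<noteq> \<zero>\<^bsub>R\<^esub>}"
    have A: "finite ?A" "?A \<subseteq> carrier M" using z by auto
    have sm: "{m. (a \<odot>\<^bsub>?F\<^esub> z) m \<noteq> \<zero>\<^bsub>R\<^esub>} \<subseteq> ?A" using a by auto
    have "?ev (a \<odot>\<^bsub>?F\<^esub> z) = (\<Oplus>\<^bsub>M\<^esub> m\<in>?A. (a \<odot>\<^bsub>?F\<^esub> z) m \<odot>\<^bsub>M\<^esub> m)"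
      by (rule sup[OF F.smult_closed[OF a z] A(1) sm A(2)])
    also have "\<dots> = (\<Oplus>\<^bsub>M\<^esub> m\<in>?A. a \<odot>\<^bsub>M\<^esub> (z m \<odot>\<^bsub>M\<^esub> m))"
      using z a by (intro M.finsum_cong') (auto simp: M.smult_assoc1)
    also have "\<dots> = a \<odot>\<^bsub>M\<^esub> (\<Oplus>\<^bsub>M\<^esub> m\<in>?A. z m \<odot>\<^bsub>M\<^esub> m)"
      using z a A by (intro M.finsum_smult_ldistr[symmetric]) auto
    finally show "?ev (a \<odot>\<^bsub>?F\<^esub> z) = a \<odot>\<^bsub>M\<^esub> ?ev z" by (simp add: free_eval_def)
  qed
  show "?ev ` carrier ?F = carrier M"
  proof
    show "?ev ` carrier ?F \<subseteq> carrier M" using cl by blast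
    show "carrier M \<subseteq> ?ev ` carrier ?F"
    proof
      fix m assume m: "m \<in> carrier M"
      have u: "unit_fun R m \<in> carrier ?F" by (rule unit_fun_carrier[OF M.R.is_cring m])
      have "?ev (unit_fun R m) = (\<Oplus>\<^bsub>M\<^esub> k\<in>{m}. unit_fun R m k \<odot>\<^bsub>M\<^esub> k)"
        using m by (intro sup[OF u]) (auto simp: unit_fun_def)
      also have "\<dots> = m" using m by (simp add: unit_fun_def)
      finally show "m \<in> ?ev ` carrier ?F" using u by (metis image_eqI)
    qed
  qed
qed

theorem free_cover:
  fixes M :: "('a, 'a set) module"
  assumes inf: "infinite (UNIV :: 'a set)" and M: "Module.module R M"
  shows "\<exists>(F :: ('a, 'a set) module) \<epsilon>. free_module R F \<and>
    \<epsilon> \<in> LinearCombinations.module_hom R F M \<and> \<epsilon> ` carrier F = carrier M"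
proof -
  have R: "cring R" using M by (simp add: Module.module_def)
  let ?F = "free_on R (carrier M)"
  have e: "inj (\<lambda>a::'a. {a})" by (simp add: inj_def)
  obtain \<theta> :: "('a set \<Rightarrow> 'a) \<Rightarrow> 'a set" where \<theta>0: "inj_on \<theta> {z. finite {k. z k \<noteq> \<zero>\<^bsub>R\<^esub>}}"
    using ex_inj_finite_support[OF inf e, of "\<zero>\<^bsub>R\<^esub>"] by (elim exE)
  have \<theta>: "inj_on \<theta> (carrier ?F)" using \<theta>0 by (rule inj_on_subset) auto
  note I = module_image[OF free_on_module[OF R] \<theta>]
  show ?thesis
  proof (intro exI conjI)
    show "free_module R (module_image \<theta> ?F)" by (rule free_module_image[OF R \<theta>])
    show "free_eval M \<zero>\<^bsub>R\<^esub> \<circ> the_inv_into (carrier ?F) \<theta> \<in> LinearCombinations.module_hom R (module_image \<theta> ?F) M"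
      by (rule module_hom_comp[OF I(3) free_eval_hom(1)[OF M]])
    have "the_inv_into (carrier ?F) \<theta> ` \<theta> ` carrier ?F = carrier ?F"
      using the_inv_into_f_f[OF \<theta>] by (simp add: image_image del: free_on_simps)
    then show "(free_eval M \<zero>\<^bsub>R\<^esub> \<circ> the_inv_into (carrier ?F) \<theta>) ` carrier (module_image \<theta> ?F) = carrier M"
      unfolding I(4) image_comp[symmetric] using free_eval_hom(2)[OF M] by simp
  qed
qed

text \<open>Cover by a free module, pass to the kernel, and repeat; all modules stay in the type \<open>'a set\<close>.\<close>
theorem free_resolution_exists:
  fixes N :: "('a, 'b) module" and c :: "'b \<Rightarrow> 'a set"
  assumes inf: "infinite (UNIV :: 'a set)" and N: "Module.module R N" and c: "inj_on c (carrier N)"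
  shows "\<exists>(F :: nat \<Rightarrow> ('a, 'a set) module) d \<epsilon>. free_resolution R N F d \<epsilon>"
proof -
  let ?N = "module_image c N"
  note I = module_image[OF N c]
  define cov :: "('a, 'a set) module \<Rightarrow> ('a, 'a set) module \<times> ('a set \<Rightarrow> 'a set)"
    where "cov Q = (SOME (F, \<epsilon>). free_module R F \<and>
      \<epsilon> \<in> LinearCombinations.module_hom R F Q \<and> \<epsilon> ` carrier F = carrier Q)" for Q
  define fr where "fr Q = fst (cov Q)" for Q
  define pr where "pr Q = snd (cov Q)" for Q
  define nxt where "nxt Q = (fr Q)\<lparr>carrier := a_kernel (fr Q) Q (pr Q)\<rparr>" for Q
  define Q where "Q n = (nxt ^^ n) ?N" for n
  have cov: "free_module R (fr P)" "pr P \<in> LinearCombinations.module_hom R (fr P) P" "pr P ` carrier (fr P) = carrier P"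
    if P: "Module.module R P" for P
  proof -
    obtain F :: "('a, 'a set) module" and \<epsilon> where "free_module R F"
      "\<epsilon> \<in> LinearCombinations.module_hom R F P" "\<epsilon> ` carrier F = carrier P"
      using free_cover[OF inf P] by blast
    then have "\<exists>p. case p of (F :: ('a, 'a set) module, \<epsilon>) \<Rightarrow> free_module R F \<and>
      \<epsilon> \<in> LinearCombinations.module_hom R F P \<and> \<epsilon> ` carrier F = carrier P"
      by (intro exI[of _ "(F, \<epsilon>)"]) simp
    from someI_ex[OF this] have "case cov P of (F, \<epsilon>) \<Rightarrow> free_module R F \<and>
      \<epsilon> \<in> LinearCombinations.module_hom R F P \<and> \<epsilon> ` carrier F = carrier P"
      unfolding cov_def .
    then show "free_module R (fr P)" "pr P \<in> LinearCombinations.module_hom R (fr P) P" "pr P ` carrier (fr P) = carrier P"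
      by (auto simp: fr_def pr_def split: prod.splits)
  qed
  have frm: "Module.module R (fr P)" if "Module.module R P" for P
    using cov(1)[OF that] by (simp add: free_module_def)
  have Q0: "Q 0 = ?N" and QS: "Q (Suc n) = nxt (Q n)" for n by (simp_all add: Q_def)
  have Qm: "Module.module R (Q n)" for n
  proof (induction n)
    case 0 then show ?case using I(1) by (simp add: Q0)
  next
    case (Suc n)
    show ?case unfolding QS nxt_def
      by (rule Module.submodule.submodule_is_module[OF module_hom_kernel_submodule[OF frm[OF Suc] Suc cov(2)[OF Suc]] frm[OF Suc]])
  qed
  have QSc: "carrier (Q (Suc n)) = a_kernel (fr (Q n)) (Q n) (pr (Q n))"
    "\<zero>\<^bsub>Q (Suc n)\<^esub> = \<zero>\<^bsub>fr (Q n)\<^esub>" "x \<oplus>\<^bsub>Q (Suc n)\<^esub> y = x \<oplus>\<^bsub>fr (Q n)\<^esub> y" "a \<odot>\<^bsub>Q (Suc n)\<^esub> x = a \<odot>\<^bsub>fr (Q n)\<^esub> x" for n a x y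
    by (simp_all add: QS nxt_def)
  define F where "F n = fr (Q n)" for n
  define d where "d n = pr (Q (Suc n))" for n
  define \<epsilon> where "\<epsilon> = the_inv_into (carrier N) c \<circ> pr (Q 0)"
  have "free_resolution R N F d \<epsilon>"
    unfolding free_resolution_def
  proof (intro conjI allI)
    show "free_module R (F n)" for n using cov(1)[OF Qm] by (simp add: F_def)
    show "\<epsilon> \<in> LinearCombinations.module_hom R (F 0) N"
      unfolding \<epsilon>_def F_def using module_hom_comp[OF cov(2)[OF Qm, of 0]] I(3) Q0 by metis
    show "\<epsilon> ` carrier (F 0) = carrier N"
      unfolding \<epsilon>_def F_def image_comp[symmetric] cov(3)[OF Qm] unfolding Q0 I(4)
      using the_inv_into_f_f[OF c] by (simp add: image_image)
    show "d n \<in> LinearCombinations.module_hom R (F (Suc n)) (F n)" for n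
      unfolding d_def F_def
      using module_homD[OF cov(2)[OF Qm[of "Suc n"]]]
      by (intro module_homI) (auto simp: QSc a_kernel_def')
    show "d 0 ` carrier (F 1) = a_kernel (F 0) N \<epsilon>"
    proof -
      have "\<epsilon> x = \<zero>\<^bsub>N\<^esub> \<longleftrightarrow> pr (Q 0) x = \<zero>\<^bsub>Q 0\<^esub>" if x: "x \<in> carrier (F 0)" for x
      proof -
        interpret N: Module.module R N by fact
        have "pr (Q 0) x \<in> c ` carrier N" using module_homD(1)[OF cov(2)[OF Qm[of 0]]] x I(4) by (auto simp: F_def Q0)
        then obtain m where m: "m \<in> carrier N" "pr (Q 0) x = c m" by blast
        then have "\<epsilon> x = m" using the_inv_into_f_f[OF c] by (simp add: \<epsilon>_def)
        then show ?thesis using m I(5) inj_on_eq_iff[OF c m(1) N.zero_closed] by (simp add: Q0)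
      qed
      then have "a_kernel (F 0) N \<epsilon> = a_kernel (fr (Q 0)) (Q 0) (pr (Q 0))" by (auto simp: a_kernel_def' F_def)
      then show ?thesis using cov(3)[OF Qm[of "Suc 0"]] by (simp add: d_def F_def QSc)
    qed
    show "d (Suc n) ` carrier (F (Suc (Suc n))) = a_kernel (F (Suc n)) (F n) (d n)" for n
      using cov(3)[OF Qm[of "Suc (Suc n)"]] by (simp add: d_def F_def QSc a_kernel_def')
  qed
  then show ?thesis by blast
qed

section \<open>Cohomology modules\<close>

lemma module_onto:
  assumes M: "Module.module R M" and surj: "q ` carrier M = carrier Q"
    and add: "\<And>x y. \<lbrakk>x \<in> carrier M; y \<in> carrier M\<rbrakk> \<Longrightarrow> q x \<oplus>\<^bsub>Q\<^esub> q y = q (x \<oplus>\<^bsub>M\<^esub> y)"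
    and smult: "\<And>a x. \<lbrakk>a \<in> carrier R; x \<in> carrier M\<rbrakk> \<Longrightarrow> a \<odot>\<^bsub>Q\<^esub> q x = q (a \<odot>\<^bsub>M\<^esub> x)"
    and zero: "\<zero>\<^bsub>Q\<^esub> = q \<zero>\<^bsub>M\<^esub>"
  shows "Module.module R Q"
proof -
  interpret M: Module.module R M by fact
  have "abelian_group Q"
  proof (rule abelian_groupI)
    fix x assume "x \<in> carrier Q"
    then obtain m where "m \<in> carrier M" "x = q m" using surj by blast
    then show "\<exists>y\<in>carrier Q. y \<oplus>\<^bsub>Q\<^esub> x = \<zero>\<^bsub>Q\<^esub>"
      using surj by (intro bexI[of _ "q (\<ominus>\<^bsub>M\<^esub> m)"]) (auto simp: add zero M.l_neg)
  qed (auto simp: surj[symmetric] add zero M.a_assoc, auto simp: M.a_comm)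
  then show ?thesis
    by (intro moduleI M.R.is_cring) (auto simp: surj[symmetric] add smult M.smult_l_distr M.smult_r_distr M.smult_assoc1)
qed

lemma quotient_module:
  assumes M: "Module.module R M" and N: "Module.submodule N R M"
  defines "q \<equiv> a_r_coset M N"
  shows "Module.module R (quotient_module M N)"
    and "carrier (quotient_module M N) = q ` carrier M"
    and "\<lbrakk>x \<in> carrier M; y \<in> carrier M\<rbrakk> \<Longrightarrow> q x \<oplus>\<^bsub>quotient_module M N\<^esub> q y = q (x \<oplus>\<^bsub>M\<^esub> y)"
    and "\<lbrakk>a \<in> carrier R; x \<in> carrier M\<rbrakk> \<Longrightarrow> a \<odot>\<^bsub>quotient_module M N\<^esub> q x = q (a \<odot>\<^bsub>M\<^esub> x)"
    and "x \<in> carrier M \<Longrightarrow> q x = \<zero>\<^bsub>quotient_module M N\<^esub> \<longleftrightarrow> x \<in> N"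
proof -
  interpret M: Module.module R M by fact
  have aN: "additive_subgroup N M" using N by (simp add: additive_subgroup_def Module.submodule_def)
  then interpret N: abelian_subgroup N M by (intro abelian_subgroupI3 M.abelian_group_axioms)
  note sm = M.submoduleE(4)[OF N]
  show carr: "carrier (quotient_module M N) = q ` carrier M"
    by (auto simp: quotient_module_def A_RCOSETS_def' q_def)
  show add: "\<lbrakk>x \<in> carrier M; y \<in> carrier M\<rbrakk> \<Longrightarrow> q x \<oplus>\<^bsub>quotient_module M N\<^esub> q y = q (x \<oplus>\<^bsub>M\<^esub> y)" for x y
    by (simp add: quotient_module_def q_def N.a_rcos_sum)
  show smult: "\<lbrakk>a \<in> carrier R; x \<in> carrier M\<rbrakk> \<Longrightarrow> a \<odot>\<^bsub>quotient_module M N\<^esub> q x = q (a \<odot>\<^bsub>M\<^esub> x)" for a x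
  proof -
    assume a: "a \<in> carrier R" and x: "x \<in> carrier M"
    have *: "N +>\<^bsub>M\<^esub> (a \<odot>\<^bsub>M\<^esub> y) = N +>\<^bsub>M\<^esub> (a \<odot>\<^bsub>M\<^esub> x)" if y: "y \<in> N +>\<^bsub>M\<^esub> x" for y
    proof -
      obtain n where n: "n \<in> N" "y = n \<oplus>\<^bsub>M\<^esub> x" using y by (auto simp: a_r_coset_def')
      then have "a \<odot>\<^bsub>M\<^esub> y = a \<odot>\<^bsub>M\<^esub> n \<oplus>\<^bsub>M\<^esub> a \<odot>\<^bsub>M\<^esub> x" using a x N.a_Hcarr by (simp add: M.smult_r_distr)
      then have "a \<odot>\<^bsub>M\<^esub> y \<in> N +>\<^bsub>M\<^esub> (a \<odot>\<^bsub>M\<^esub> x)" using sm[OF a n(1)] by (auto simp: a_r_coset_def')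
      then show ?thesis using a x by (metis M.smult_closed N.a_repr_independence')
    qed
    have "x \<in> N +>\<^bsub>M\<^esub> x" using x by (rule N.a_rcos_self)
    then have ne: "N +>\<^bsub>M\<^esub> x \<noteq> {}" by (rule_tac notI) simp
    have "(\<Union>y\<in>N +>\<^bsub>M\<^esub> x. N +>\<^bsub>M\<^esub> (a \<odot>\<^bsub>M\<^esub> y)) = (\<Union>y\<in>N +>\<^bsub>M\<^esub> x. N +>\<^bsub>M\<^esub> (a \<odot>\<^bsub>M\<^esub> x))"
      by (rule SUP_cong[OF refl *])
    also have "\<dots> = N +>\<^bsub>M\<^esub> (a \<odot>\<^bsub>M\<^esub> x)" using ne by (rule cSUP_const)
    finally show ?thesis by (simp add: quotient_module_def q_def)
  qed
  have qN: "q x = N \<longleftrightarrow> x \<in> N" if x: "x \<in> carrier M" for x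
  proof
    assume "q x = N"
    then show "x \<in> N" using N.a_rcos_self[OF x] by (simp add: q_def)
  next
    assume "x \<in> N"
    then show "q x = N" unfolding q_def by (rule M.a_coset_join2[OF x N.a_subgroup])
  qed
  have zero: "\<zero>\<^bsub>quotient_module M N\<^esub> = q \<zero>\<^bsub>M\<^esub>"
    using qN[OF M.zero_closed] N.zero_closed by (simp add: quotient_module_def)
  show "Module.module R (quotient_module M N)"
    by (rule module_onto[OF M carr[symmetric] add smult zero])
  show "x \<in> carrier M \<Longrightarrow> q x = \<zero>\<^bsub>quotient_module M N\<^esub> \<longleftrightarrow> x \<in> N" for x
    using qN by (simp add: quotient_module_def)
qed

context cochain_complex
begin

abbreviation (input) Zmod :: "nat \<Rightarrow> ('a, 'e) module"
  where "Zmod n \<equiv> (C n)\<lparr>carrier := a_kernel (C n) (C (Suc n)) (d n)\<rparr>"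

definition coh_class :: "nat \<Rightarrow> 'e \<Rightarrow> 'e set"
  where "coh_class n = a_r_coset (Zmod n) (coboundaries C d n)"

lemma cocycles_kernel: "a_kernel (C n) (C (Suc n)) (d n) = cocycles n"
  by (auto simp: cocycles_def a_kernel_def')

lemma Zmod_module: "Module.module R (Zmod n)"
  by (rule Module.submodule.submodule_is_module[OF module_hom_kernel_submodule[OF mod mod d_hom] mod])

lemma coboundaries_submodule: "Module.submodule (coboundaries C d n) R (Zmod n)"
proof (cases n)
  case 0
  interpret M: Module.module R "Zmod n" by (rule Zmod_module)
  have "\<ominus>\<^bsub>Zmod n\<^esub> \<zero>\<^bsub>Zmod n\<^esub> = \<zero>\<^bsub>Zmod n\<^esub>" by (rule M.minus_equality[OF M.l_zero[OF M.zero_closed] M.zero_closed M.zero_closed])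
  moreover have "a \<odot>\<^bsub>C 0\<^esub> \<zero>\<^bsub>C 0\<^esub> = \<zero>\<^bsub>C 0\<^esub>" if "a \<in> carrier R" for a
    using Module.module.smult_r_null[OF mod that, of 0] .
  moreover have "\<zero>\<^bsub>C 0\<^esub> \<oplus>\<^bsub>C 0\<^esub> \<zero>\<^bsub>C 0\<^esub> = \<zero>\<^bsub>C 0\<^esub>" using M.l_zero[of "\<zero>\<^bsub>Zmod n\<^esub>"] 0 M.zero_closed by simp
  ultimately show ?thesis using M.zero_closed 0 by (intro M.submoduleI) auto
next
  case (Suc k)
  have "d k \<in> LinearCombinations.module_hom R (C k) (Zmod n)"
    using dd by (intro module_homI) (auto simp: Suc a_kernel_def' d_add d_smult)
  then show ?thesis using module_hom_image_submodule[OF mod Zmod_module] Suc by simp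
qed

lemma cohomology_eq: "cohomology C d n = quotient_module (Zmod n) (coboundaries C d n)"
  by (simp add: cohomology_def)

lemma cohomology_module: "Module.module R (cohomology C d n)"
  unfolding cohomology_eq by (rule quotient_module(1)[OF Zmod_module coboundaries_submodule])

lemma cohomology_carrier: "carrier (cohomology C d n) = coh_class n ` cocycles n"
  unfolding cohomology_eq coh_class_def using quotient_module(2)[OF Zmod_module coboundaries_submodule]
  by (simp add: cocycles_kernel)

lemma coh_class_smult: "\<lbrakk>a \<in> carrier R; x \<in> cocycles n\<rbrakk> \<Longrightarrow> a \<odot>\<^bsub>cohomology C d n\<^esub> coh_class n x = coh_class n (a \<odot>\<^bsub>C n\<^esub> x)"
  unfolding cohomology_eq coh_class_def using quotient_module(4)[OF Zmod_module coboundaries_submodule, of a x]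
  by (simp add: cocycles_kernel)

lemma coh_class_zero: "x \<in> cocycles n \<Longrightarrow> coh_class n x = \<zero>\<^bsub>cohomology C d n\<^esub> \<longleftrightarrow> x \<in> coboundaries C d n"
  unfolding cohomology_eq coh_class_def using quotient_module(5)[OF Zmod_module coboundaries_submodule, of x]
  by (simp add: cocycles_kernel)

end

context top_symbols
begin

lemma cohomology_top_zero:
  assumes "\<And>m t. m \<in> carrier R \<Longrightarrow> zr m t"
  shows "carrier (cohomology C d r) = {\<zero>\<^bsub>cohomology C d r\<^esub>}"
proof -
  interpret H: Module.module R "cohomology C d r" by (rule cohomology_module)
  have "coh_class r x = \<zero>\<^bsub>cohomology C d r\<^esub>" if x: "x \<in> cocycles r" for x
  proof -
    obtain m t where "rep m t x" using rep_surj[OF x] by blast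
    then have "x \<in> coboundaries C d r" using rep_zero rep_closed assms by blast
    then show ?thesis using coh_class_zero[OF x] by simp
  qed
  then show ?thesis using H.zero_closed unfolding cohomology_carrier by auto
qed

lemma cohomology_top_socle:
  assumes v: "v \<in> carrier R" "\<not> zr v t" and \<eta>: "\<eta> \<subseteq> carrier R" "\<And>a. a \<in> \<eta> \<Longrightarrow> zr (a \<otimes> v) t"
  shows "\<exists>u \<in> carrier (cohomology C d r). u \<noteq> \<zero>\<^bsub>cohomology C d r\<^esub> \<and>
    (\<forall>a \<in> \<eta>. a \<odot>\<^bsub>cohomology C d r\<^esub> u = \<zero>\<^bsub>cohomology C d r\<^esub>)"
proof -
  obtain x where x: "rep v t x" using rep_ex[OF v(1)] by blast
  have xc: "x \<in> cocycles r" using rep_closed[OF x] by simp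
  have "x \<notin> coboundaries C d r" using rep_zero[OF x] v by simp
  moreover have "a \<odot>\<^bsub>cohomology C d r\<^esub> coh_class r x = \<zero>\<^bsub>cohomology C d r\<^esub>" if a: "a \<in> \<eta>" for a
  proof -
    have aR: "a \<in> carrier R" using a \<eta> by blast
    have ra: "rep (a \<otimes> v) t (a \<odot>\<^bsub>C r\<^esub> x)" by (rule rep_smult[OF x aR])
    have "a \<odot>\<^bsub>C r\<^esub> x \<in> coboundaries C d r" using rep_zero[OF ra] \<eta>(2)[OF a] by simp
    moreover have "a \<odot>\<^bsub>C r\<^esub> x \<in> cocycles r" using rep_closed[OF ra] by simp
    ultimately show ?thesis using coh_class_zero coh_class_smult[OF aR xc] by simp
  qed
  ultimately show ?thesis
    using xc coh_class_zero[OF xc] unfolding cohomology_carrier by (intro bexI[of _ "coh_class r x"]) auto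
qed

end

section \<open>Torsion with respect to powers of an ideal\<close>

text \<open>Products of \<open>n\<close> factors from \<open>G\<close>: they generate the \<open>n\<close>-th power of the ideal generated by \<open>G\<close>.\<close>
primrec gen_products :: "('a, 'r) ring_scheme \<Rightarrow> 'a set \<Rightarrow> nat \<Rightarrow> 'a set"
  where
    "gen_products R G 0 = {\<one>\<^bsub>R\<^esub>}"
  | "gen_products R G (Suc n) = {g \<otimes>\<^bsub>R\<^esub> w | g w. g \<in> G \<and> w \<in> gen_products R G n}"

context cring
begin

lemma ideal_pow_ideal: "ideal I R \<Longrightarrow> ideal (I [^]\<^bsub>ideals_set R\<^esub> (n::nat)) R"
proof -
  assume I: "ideal I R"
  interpret S: comm_monoid "ideals_set R" by (rule ideals_set_is_comm_monoid)
  have "I [^]\<^bsub>ideals_set R\<^esub> n \<in> carrier (ideals_set R)" using I by (intro S.nat_pow_closed) (simp add: ideals_set_def)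
  then show ?thesis by (simp add: ideals_set_def)
qed

lemma ideal_pow_Suc: "I [^]\<^bsub>ideals_set R\<^esub> Suc n = ideal_prod R (I [^]\<^bsub>ideals_set R\<^esub> n) I"
  "I [^]\<^bsub>ideals_set R\<^esub> (0::nat) = carrier R"
proof -
  interpret S: comm_monoid "ideals_set R" by (rule ideals_set_is_comm_monoid)
  show "I [^]\<^bsub>ideals_set R\<^esub> Suc n = ideal_prod R (I [^]\<^bsub>ideals_set R\<^esub> n) I" by (simp add: S.nat_pow_Suc) (simp add: ideals_set_def)
  show "I [^]\<^bsub>ideals_set R\<^esub> (0::nat) = carrier R" by (simp add: S.nat_pow_0) (simp add: ideals_set_def)
qed

lemma one_ideals_set: "\<one>\<^bsub>ideals_set R\<^esub> = carrier R"
  by (simp add: ideals_set_def)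

lemma pow_mem_ideal_pow: "ideal I R \<Longrightarrow> g \<in> I \<Longrightarrow> g [^] (n::nat) \<in> I [^]\<^bsub>ideals_set R\<^esub> n"
proof (induction n)
  case 0 then show ?case by (simp add: one_ideals_set)
next
  case (Suc n) then show ?case by (simp only: ideal_pow_Suc nat_pow_Suc ideal_prod.prod)
qed

text \<open>By induction on the exponent, with the factors replaced by generators one at a time.\<close>
lemma ideal_pow_generated:
  assumes G: "G \<subseteq> carrier R" and J: "ideal J R" and GJ: "gen_products R G n \<subseteq> J"
  shows "(Idl G) [^]\<^bsub>ideals_set R\<^esub> n \<subseteq> J"
  using J GJ
proof (induction n arbitrary: J)
  case 0
  interpret J: ideal J R by (rule 0)
  have "\<one> \<in> J" using 0(2) by simp
  then show ?case using J.one_imp_carrier by (simp add: one_ideals_set)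
next
  case (Suc n)
  interpret J: ideal J R by (rule Suc.prems)
  let ?P = "(Idl G) [^]\<^bsub>ideals_set R\<^esub> n"
  have Pi: "ideal ?P R" by (rule ideal_pow_ideal[OF genideal_ideal[OF G]])
  have colon: "ideal {r \<in> carrier R. \<forall>w \<in> X. r \<otimes> w \<in> J} R" if X: "X \<subseteq> carrier R" for X
  proof (rule idealI)
    show "ring R" by (rule ring_axioms)
    show "subgroup {r \<in> carrier R. \<forall>w \<in> X. r \<otimes> w \<in> J} (add_monoid R)"
      using X by (intro add.subgroupI) (auto simp: l_distr l_minus J.a_inv_closed[simplified] subset_iff intro: exI[of _ \<zero>])
  next
    fix a x assume "a \<in> {r \<in> carrier R. \<forall>w \<in> X. r \<otimes> w \<in> J}" "x \<in> carrier R"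
    then have ax: "a \<in> carrier R" "x \<in> carrier R" "\<And>w. w \<in> X \<Longrightarrow> a \<otimes> w \<in> J" by auto
    then have "x \<otimes> a \<otimes> w \<in> J" if "w \<in> X" for w
      using J.I_l_closed[OF ax(3)[OF that] ax(2)] X that by (simp add: m_assoc subset_iff)
    then have "x \<otimes> a \<in> {r \<in> carrier R. \<forall>w \<in> X. r \<otimes> w \<in> J}" "x \<otimes> a = a \<otimes> x"
      using ax by (auto simp: m_comm)
    then show "x \<otimes> a \<in> {r \<in> carrier R. \<forall>w \<in> X. r \<otimes> w \<in> J}" "a \<otimes> x \<in> {r \<in> carrier R. \<forall>w \<in> X. r \<otimes> w \<in> J}" by simp_all
  qed
  have GP: "gen_products R G k \<subseteq> carrier R" for k
  proof (rule subsetI)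
    show "w \<in> gen_products R G k \<Longrightarrow> w \<in> carrier R" for w using G by (induction k arbitrary: w) auto
  qed
  \<comment> \<open>first move the last generator, then the first \<open>n\<close> factors\<close>
  have "?P \<subseteq> {r \<in> carrier R. \<forall>g \<in> G. r \<otimes> g \<in> J}"
  proof (rule Suc.IH[OF colon[OF G]])
    show "gen_products R G n \<subseteq> {r \<in> carrier R. \<forall>g \<in> G. r \<otimes> g \<in> J}"
    proof (intro subsetI CollectI conjI ballI)
      show "w \<in> carrier R" if "w \<in> gen_products R G n" for w using that GP by blast
    next
      fix w g assume w: "w \<in> gen_products R G n" and g: "g \<in> G"
      then have "w \<in> carrier R" using GP by blast
      have "g \<otimes> w \<in> gen_products R G (Suc n)" using w g by auto
      then have "g \<otimes> w \<in> J" using Suc.prems(2) by blast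
      then show "w \<otimes> g \<in> J" using \<open>w \<in> carrier R\<close> g G by (simp add: m_comm subset_iff)
    qed
  qed
  then have PG: "w \<otimes> g \<in> J" if "w \<in> ?P" "g \<in> G" for w g using that by blast
  have "G \<subseteq> {r \<in> carrier R. \<forall>w \<in> ?P. r \<otimes> w \<in> J}"
  proof (intro subsetI CollectI conjI ballI)
    show "g \<in> carrier R" if "g \<in> G" for g using that G by blast
    show "g \<otimes> w \<in> J" if "g \<in> G" "w \<in> ?P" for g w
      using PG[OF that(2,1)] m_comm[of g w] that G ideal.Icarr[OF Pi that(2)] by auto
  qed
  then have IG: "Idl G \<subseteq> {r \<in> carrier R. \<forall>w \<in> ?P. r \<otimes> w \<in> J}"
    using colon[of ?P] ideal.Icarr[OF Pi] by (intro genideal_minimal) auto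
  show ?case
  proof
    fix x assume "x \<in> (Idl G) [^]\<^bsub>ideals_set R\<^esub> Suc n"
    then have "x \<in> ideal_prod R ?P (Idl G)" by (simp only: ideal_pow_Suc)
    then show "x \<in> J"
    proof induction
      case (prod i j)
      then have "j \<otimes> i \<in> J" "i \<in> carrier R" "j \<in> carrier R" using IG ideal.Icarr[OF Pi] by auto
      then show ?case by (simp add: m_comm)
    next
      case (sum s1 s2) then show ?case by (rule_tac J.a_closed)
    qed
  qed
qed

text \<open>By the pigeonhole principle, one of the factors occurs more than \<open>t\<close> times.\<close>
lemma gen_products_vanish:
  assumes J: "ideal J R"
  shows "\<lbrakk>finite G; G \<subseteq> carrier R; \<And>g. g \<in> G \<Longrightarrow> g [^] (t::nat) \<in> J; w \<in> gen_products R G n; card G * t < n\<rbrakk> \<Longrightarrow> w \<in> J"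
proof -
  assume G: "finite G" "G \<subseteq> carrier R" "\<And>g. g \<in> G \<Longrightarrow> g [^] t \<in> J" and w: "w \<in> gen_products R G n" and n: "card G * t < n"
  interpret J: ideal J R by (rule J)
  have "\<exists>k. (\<Sum>g\<in>G. k g) = n \<and> (\<forall>g\<in>G. \<exists>u \<in> carrier R. w = g [^] (k g :: nat) \<otimes> u)"
    using w
  proof (induction n arbitrary: w)
    case 0 then show ?case by (intro exI[of _ "\<lambda>_. 0"]) auto
  next
    case (Suc n gw)
    then obtain g w where gw: "gw = g \<otimes> w" "g \<in> G" "w \<in> gen_products R G n" by auto
    obtain k where k: "(\<Sum>g\<in>G. k g) = n" "\<And>g. g \<in> G \<Longrightarrow> \<exists>u \<in> carrier R. w = g [^] (k g :: nat) \<otimes> u"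
      using Suc.IH[OF gw(3)] by blast
    let ?k = "k(g := Suc (k g))"
    have "(\<Sum>h\<in>G. ?k h) = Suc n"
      using G(1) gw(2) k(1) by (simp add: sum.remove[of G g])
    moreover have "\<exists>u \<in> carrier R. gw = h [^] ?k h \<otimes> u" if h: "h \<in> G" for h
    proof -
      obtain u where u: "u \<in> carrier R" "w = h [^] k h \<otimes> u" using k(2)[OF h] by blast
      have gh: "g \<in> carrier R" "h \<in> carrier R" using gw(2) h G by auto
      show ?thesis
      proof (cases "h = g")
        case True then show ?thesis using u gh gw(1) by (intro bexI[of _ u]) (auto simp: m_ac)
      next
        case False then show ?thesis using u gh gw(1) by (intro bexI[of _ "g \<otimes> u"]) (auto simp: m_ac)
      qed
    qed
    ultimately show ?case by blast
  qed
  then obtain k where k: "(\<Sum>g\<in>G. k g) = n" "\<And>g. g \<in> G \<Longrightarrow> \<exists>u \<in> carrier R. w = g [^] (k g :: nat) \<otimes> u" by blast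
  have "\<exists>g\<in>G. t < k g"
  proof (rule ccontr)
    assume "\<not> ?thesis"
    then have "(\<Sum>g\<in>G. k g) \<le> (\<Sum>g\<in>G. t)" by (intro sum_mono) auto
    then show False using k n by simp
  qed
  then obtain g where g: "g \<in> G" "t < k g" by blast
  obtain u where u: "u \<in> carrier R" "w = g [^] k g \<otimes> u" using k(2)[OF g(1)] by blast
  have gR: "g \<in> carrier R" using g G by auto
  have "w = g [^] t \<otimes> (g [^] (k g - t) \<otimes> u)"
    using u gR g by (simp add: m_assoc[symmetric] nat_pow_mult)
  then show "w \<in> J" using G(3)[OF g(1)] u gR by (simp add: J.I_r_closed)
qed

text \<open>The powers of a finitely generated ideal and the ideals of powers of its generators are cofinal.\<close>
lemma torsion_eq_ptorsions:
  assumes M: "Module.module R M" and gs: "set gs \<subseteq> carrier R"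
  shows "torsion R (Idl (set gs)) M = ptorsions R gs M"
proof -
  interpret M: Module.module R M by fact
  have I: "ideal (Idl (set gs)) R" by (rule genideal_ideal[OF gs])
  have "(\<exists>n::nat. \<forall>a \<in> (Idl (set gs)) [^]\<^bsub>ideals_set R\<^esub> n. a \<odot>\<^bsub>M\<^esub> x = \<zero>\<^bsub>M\<^esub>) \<longleftrightarrow>
     (\<exists>t::nat. \<forall>g \<in> set gs. g [^] t \<odot>\<^bsub>M\<^esub> x = \<zero>\<^bsub>M\<^esub>)" if x: "x \<in> carrier M" for x
  proof
    assume "\<exists>n::nat. \<forall>a \<in> (Idl (set gs)) [^]\<^bsub>ideals_set R\<^esub> n. a \<odot>\<^bsub>M\<^esub> x = \<zero>\<^bsub>M\<^esub>"
    then obtain n where n: "\<And>a. a \<in> (Idl (set gs)) [^]\<^bsub>ideals_set R\<^esub> (n::nat) \<Longrightarrow> a \<odot>\<^bsub>M\<^esub> x = \<zero>\<^bsub>M\<^esub>" by blast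
    then show "\<exists>t::nat. \<forall>g \<in> set gs. g [^] t \<odot>\<^bsub>M\<^esub> x = \<zero>\<^bsub>M\<^esub>"
      using pow_mem_ideal_pow[OF I] genideal_self[OF gs] by (intro exI[of _ n]) blast
  next
    assume "\<exists>t::nat. \<forall>g \<in> set gs. g [^] t \<odot>\<^bsub>M\<^esub> x = \<zero>\<^bsub>M\<^esub>"
    then obtain t :: nat where t: "\<And>g. g \<in> set gs \<Longrightarrow> g [^] t \<odot>\<^bsub>M\<^esub> x = \<zero>\<^bsub>M\<^esub>" by blast
    let ?J = "{r \<in> carrier R. r \<odot>\<^bsub>M\<^esub> x = \<zero>\<^bsub>M\<^esub>}"
    have J: "ideal ?J R"
    proof (rule idealI)
      show "ring R" by (rule ring_axioms)
      show "subgroup ?J (add_monoid R)"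
        using x by (intro add.subgroupI) (auto simp: M.smult_l_distr M.smult_l_minus intro: exI[of _ \<zero>])
    next
      fix a r assume "a \<in> ?J" "r \<in> carrier R"
      then have ar: "a \<in> carrier R" "a \<odot>\<^bsub>M\<^esub> x = \<zero>\<^bsub>M\<^esub>" "r \<in> carrier R" by auto
      then show "r \<otimes> a \<in> ?J" using x by (simp add: M.smult_assoc1)
      then show "a \<otimes> r \<in> ?J" using ar by (simp add: m_comm)
    qed
    let ?n = "Suc (card (set gs) * t)"
    have "gen_products R (set gs) ?n \<subseteq> ?J"
    proof
      fix w assume w: "w \<in> gen_products R (set gs) ?n"
      have "g [^] t \<in> ?J" if "g \<in> set gs" for g using gs t[OF that] that by auto
      then show "w \<in> ?J" by (rule gen_products_vanish[OF J finite_set gs _ w]) simp_all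
    qed
    then have "(Idl (set gs)) [^]\<^bsub>ideals_set R\<^esub> ?n \<subseteq> ?J" by (rule ideal_pow_generated[OF gs J])
    then show "\<exists>n::nat. \<forall>a \<in> (Idl (set gs)) [^]\<^bsub>ideals_set R\<^esub> n. a \<odot>\<^bsub>M\<^esub> x = \<zero>\<^bsub>M\<^esub>" by blast
  qed
  then show ?thesis using ptorsions_carrier[OF M gs] unfolding torsion_def
    by (auto intro!: arg_cong[where f = "\<lambda>c. M\<lparr>carrier := c\<rparr>"])
qed

end


section \<open>The residue field and Ext in degree zero\<close>

lemma descend_smult:
  assumes smult_kernel: "\<And>a x. \<lbrakk>a \<in> carrier R; \<phi> a = \<zero>\<^bsub>K\<^esub>; x \<in> carrier V\<rbrakk> \<Longrightarrow> a \<odot>\<^bsub>V\<^esub> x = \<zero>\<^bsub>V\<^esub>"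
    and V: "Module.module R V" and K: "field K" and \<phi>: "\<phi> \<in> ring_hom R K"
    and a: "a \<in> carrier R" and x: "x \<in> carrier V"
  shows "\<phi> a \<odot>\<^bsub>descend R \<phi> V\<^esub> x = a \<odot>\<^bsub>V\<^esub> x"
proof -
  interpret V: Module.module R V by fact
  interpret K: field K by fact
  interpret h: ring_hom_ring R K \<phi> by (intro ring_hom_ringI2 \<phi> V.R.ring_axioms K.ring_axioms)
  have *: "b \<odot>\<^bsub>V\<^esub> x = a \<odot>\<^bsub>V\<^esub> x" if b: "b \<in> carrier R" "\<phi> b = \<phi> a" for b
  proof -
    have "\<phi> (b \<ominus>\<^bsub>R\<^esub> a) = \<zero>\<^bsub>K\<^esub>" using a b h.hom_closed by (simp add: V.R.minus_eq K.r_neg)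
    then have "(b \<ominus>\<^bsub>R\<^esub> a) \<odot>\<^bsub>V\<^esub> x = \<zero>\<^bsub>V\<^esub>" using a b x by (intro smult_kernel) auto
    then have "b \<odot>\<^bsub>V\<^esub> x \<oplus>\<^bsub>V\<^esub> \<ominus>\<^bsub>V\<^esub> (a \<odot>\<^bsub>V\<^esub> x) = \<zero>\<^bsub>V\<^esub>"
      using a b x by (simp add: V.R.minus_eq V.smult_l_distr V.smult_l_minus)
    then have "\<ominus>\<^bsub>V\<^esub> (\<ominus>\<^bsub>V\<^esub> (a \<odot>\<^bsub>V\<^esub> x)) = b \<odot>\<^bsub>V\<^esub> x" using a b x by (intro V.minus_equality) auto
    then show ?thesis using a x by simp
  qed
  have "(THE y. \<exists>b \<in> carrier R. \<phi> b = \<phi> a \<and> y = b \<odot>\<^bsub>V\<^esub> x) = a \<odot>\<^bsub>V\<^esub> x"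
  proof (rule the_equality)
    show "\<exists>b \<in> carrier R. \<phi> b = \<phi> a \<and> a \<odot>\<^bsub>V\<^esub> x = b \<odot>\<^bsub>V\<^esub> x"
      by (rule bexI[OF _ a]) simp
    show "y = a \<odot>\<^bsub>V\<^esub> x" if y: "\<exists>b \<in> carrier R. \<phi> b = \<phi> a \<and> y = b \<odot>\<^bsub>V\<^esub> x" for y
      using y by (elim bexE conjE) (simp only: *)
  qed
  then show ?thesis by (simp add: descend_def)
qed

lemma descend_vectorspace:
  assumes smult_kernel: "\<And>a x. \<lbrakk>a \<in> carrier R; \<phi> a = \<zero>\<^bsub>K\<^esub>; x \<in> carrier V\<rbrakk> \<Longrightarrow> a \<odot>\<^bsub>V\<^esub> x = \<zero>\<^bsub>V\<^esub>"
    and V: "Module.module R V" and K: "field K" and \<phi>: "\<phi> \<in> ring_hom R K"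
    and surj: "\<phi> ` carrier R = carrier K"
  shows "VectorSpace.vectorspace K (descend R \<phi> V)"
proof -
  interpret V: Module.module R V by fact
  interpret K: field K by fact
  interpret h: ring_hom_ring R K \<phi> by (intro ring_hom_ringI2 \<phi> V.R.ring_axioms K.ring_axioms)
  note sm = descend_smult[OF smult_kernel V K \<phi>]
  have pre: "\<exists>a \<in> carrier R. c = \<phi> a" if "c \<in> carrier K" for c using surj that by (auto simp flip: surj)
  have s [simp]: "carrier (descend R \<phi> V) = carrier V" "\<zero>\<^bsub>descend R \<phi> V\<^esub> = \<zero>\<^bsub>V\<^esub>"
    "x \<oplus>\<^bsub>descend R \<phi> V\<^esub> y = x \<oplus>\<^bsub>V\<^esub> y" for x y by (simp_all add: descend_def)
  have ag: "abelian_group (descend R \<phi> V)"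
  proof (rule abelian_groupI)
    fix x assume "x \<in> carrier (descend R \<phi> V)"
    then show "\<exists>y\<in>carrier (descend R \<phi> V). y \<oplus>\<^bsub>descend R \<phi> V\<^esub> x = \<zero>\<^bsub>descend R \<phi> V\<^esub>"
      by (intro bexI[of _ "\<ominus>\<^bsub>V\<^esub> x"]) (auto simp: V.l_neg)
  qed (auto simp: V.a_assoc, auto simp: V.a_comm)
  have "Module.module K (descend R \<phi> V)"
  proof (rule moduleI)
    show "cring K" by (rule K.is_cring)
    show "abelian_group (descend R \<phi> V)" by (rule ag)
  next
    fix c x assume "c \<in> carrier K" "x \<in> carrier (descend R \<phi> V)"
    then obtain a where a: "a \<in> carrier R" "c = \<phi> a" and x: "x \<in> carrier V" using pre s(1) by metis
    show "c \<odot>\<^bsub>descend R \<phi> V\<^esub> x \<in> carrier (descend R \<phi> V)" unfolding a(2) sm[OF _ _ _ a(1) x] using a x by (simp add: sm)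
  next
    fix c e x assume "c \<in> carrier K" "e \<in> carrier K" "x \<in> carrier (descend R \<phi> V)"
    then obtain a b where a: "a \<in> carrier R" "c = \<phi> a" and b: "b \<in> carrier R" "e = \<phi> b" and x: "x \<in> carrier V"
      using pre s(1) by metis
    have "\<phi> (a \<oplus>\<^bsub>R\<^esub> b) \<odot>\<^bsub>descend R \<phi> V\<^esub> x = (a \<oplus>\<^bsub>R\<^esub> b) \<odot>\<^bsub>V\<^esub> x" by (rule sm) (use a b x in auto)
    then show "(c \<oplus>\<^bsub>K\<^esub> e) \<odot>\<^bsub>descend R \<phi> V\<^esub> x = c \<odot>\<^bsub>descend R \<phi> V\<^esub> x \<oplus>\<^bsub>descend R \<phi> V\<^esub> e \<odot>\<^bsub>descend R \<phi> V\<^esub> x"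
      using a b x by (simp add: sm V.smult_l_distr)
    have "\<phi> (a \<otimes>\<^bsub>R\<^esub> b) \<odot>\<^bsub>descend R \<phi> V\<^esub> x = (a \<otimes>\<^bsub>R\<^esub> b) \<odot>\<^bsub>V\<^esub> x" by (rule sm) (use a b x in auto)
    then show "(c \<otimes>\<^bsub>K\<^esub> e) \<odot>\<^bsub>descend R \<phi> V\<^esub> x = c \<odot>\<^bsub>descend R \<phi> V\<^esub> (e \<odot>\<^bsub>descend R \<phi> V\<^esub> x)"
      using a b x by (simp add: sm V.smult_assoc1)
  next
    fix c x y assume "c \<in> carrier K" "x \<in> carrier (descend R \<phi> V)" "y \<in> carrier (descend R \<phi> V)"
    then obtain a where a: "a \<in> carrier R" "c = \<phi> a" and x: "x \<in> carrier V" "y \<in> carrier V" using pre s(1) by metis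
    then show "c \<odot>\<^bsub>descend R \<phi> V\<^esub> (x \<oplus>\<^bsub>descend R \<phi> V\<^esub> y) = c \<odot>\<^bsub>descend R \<phi> V\<^esub> x \<oplus>\<^bsub>descend R \<phi> V\<^esub> c \<odot>\<^bsub>descend R \<phi> V\<^esub> y"
      by (simp add: sm V.smult_r_distr)
  next
    fix x assume x: "x \<in> carrier (descend R \<phi> V)"
    have "\<phi> \<one>\<^bsub>R\<^esub> \<odot>\<^bsub>descend R \<phi> V\<^esub> x = \<one>\<^bsub>R\<^esub> \<odot>\<^bsub>V\<^esub> x" by (rule sm) (use x in auto)
    then show "\<one>\<^bsub>K\<^esub> \<odot>\<^bsub>descend R \<phi> V\<^esub> x = x" using x by simp
  qed
  then show ?thesis by (simp add: VectorSpace.vectorspace_def K)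
qed

lemma vdim_eq_0:
  assumes V: "VectorSpace.vectorspace K V"
  shows "vdim K V = 0 \<longleftrightarrow> carrier V = {\<zero>\<^bsub>V\<^esub>}"
proof -
  interpret V: VectorSpace.vectorspace K V by fact
  have sp: "V.span {} = {\<zero>\<^bsub>V\<^esub>}" unfolding V.span_def V.lincomb_def by auto
  show ?thesis
  proof
    assume "vdim K V = 0"
    then have fd: "V.fin_dim" "V.dim = 0" by (auto simp: vdim_def zero_enat_def split: if_splits)
    have "\<exists>n. \<exists>A. finite A \<and> card A = n \<and> A \<subseteq> carrier V \<and> V.gen_set A" using fd(1) unfolding V.fin_dim_def by blast
    from LeastI_ex[OF this] obtain A where "finite A" "card A = 0" "V.gen_set A"
      using fd(2) unfolding V.dim_def by auto
    then show "carrier V = {\<zero>\<^bsub>V\<^esub>}" using sp by simp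
  next
    assume c: "carrier V = {\<zero>\<^bsub>V\<^esub>}"
    have g: "finite {} \<and> card {} = 0 \<and> {} \<subseteq> carrier V \<and> V.gen_set {}" using sp c by simp
    then have "V.fin_dim" unfolding V.fin_dim_def by blast
    moreover have "V.dim = 0" unfolding V.dim_def by (rule Least_eq_0) (use g in blast)
    ultimately show "vdim K V = 0" by (simp add: vdim_def zero_enat_def)
  qed
qed

lemma hom_module_simps [simp]:
  "carrier (hom_module R M N) = LinearCombinations.module_hom R M N \<inter> extensional (carrier M)"
  "\<zero>\<^bsub>hom_module R M N\<^esub> = (\<lambda>x\<in>carrier M. \<zero>\<^bsub>N\<^esub>)"
  "f \<oplus>\<^bsub>hom_module R M N\<^esub> g = (\<lambda>x\<in>carrier M. f x \<oplus>\<^bsub>N\<^esub> g x)"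
  "a \<odot>\<^bsub>hom_module R M N\<^esub> f = (\<lambda>x\<in>carrier M. a \<odot>\<^bsub>N\<^esub> f x)"
  by (auto simp: hom_module_def)

lemma hom_module_module:
  assumes M: "Module.module R M" and N: "Module.module R N"
  shows "Module.module R (hom_module R M N)"
proof -
  interpret M: Module.module R M by fact
  interpret N: Module.module R N by fact
  note h = module_homD[of _ R M N]
  have comm: "a \<odot>\<^bsub>N\<^esub> (b \<odot>\<^bsub>N\<^esub> y) = b \<odot>\<^bsub>N\<^esub> (a \<odot>\<^bsub>N\<^esub> y)" if "a \<in> carrier R" "b \<in> carrier R" "y \<in> carrier N" for a b y
    using that by (simp add: N.smult_assoc1[symmetric] M.R.m_comm)
  have "abelian_group (hom_module R M N)"
  proof (rule abelian_groupI)
    fix f assume f: "f \<in> carrier (hom_module R M N)"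
    let ?g = "\<lambda>x\<in>carrier M. \<ominus>\<^bsub>N\<^esub> f x"
    have "?g \<in> carrier (hom_module R M N)"
      using f by (auto intro!: module_homI simp: h N.minus_add N.smult_r_minus)
    then show "\<exists>y\<in>carrier (hom_module R M N). y \<oplus>\<^bsub>hom_module R M N\<^esub> f = \<zero>\<^bsub>hom_module R M N\<^esub>"
      using f by (intro bexI[of _ ?g]) (auto simp: N.l_neg h cong: restrict_cong)
  qed (auto intro!: module_homI extensionalityI[of _ "carrier M"] simp: h N.a_ac N.smult_r_distr)
  then show ?thesis
    by (intro moduleI M.R.is_cring) (auto intro!: module_homI extensionalityI[of _ "carrier M"]
      simp: h N.smult_l_distr N.smult_r_distr N.smult_assoc1 comm)
qed

lemma hom_complex:
  assumes N: "Module.module R N" and F: "free_resolution R K F d \<epsilon>"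
  shows "cochain_complex R (\<lambda>n. hom_module R (F n) N) (\<lambda>n f. restrict (f \<circ> d n) (carrier (F (Suc n))))"
proof (intro cochain_complex.intro cochain_complex_axioms.intro)
  interpret N: Module.module R N by fact
  have Fm: "Module.module R (F n)" for n using F by (simp add: free_resolution_def free_module_def)
  have d: "d n \<in> LinearCombinations.module_hom R (F (Suc n)) (F n)" for n using F by (simp add: free_resolution_def)
  have ex: "d (Suc n) ` carrier (F (Suc (Suc n))) = a_kernel (F (Suc n)) (F n) (d n)" for n
    using F by (simp add: free_resolution_def)
  show "cring R" by (rule N.R.is_cring)
  show "Module.module R (hom_module R (F n) N)" for n by (rule hom_module_module[OF Fm N])
  show "(\<lambda>f. restrict (f \<circ> d n) (carrier (F (Suc n)))) \<in>
      LinearCombinations.module_hom R (hom_module R (F n) N) (hom_module R (F (Suc n)) N)" for n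
  proof -
    interpret F: Module.module R "F n" by (rule Fm)
    interpret F': Module.module R "F (Suc n)" by (rule Fm)
    show ?thesis
      by (rule module_homI)
        (auto intro!: module_homI extensionalityI[of _ "carrier (F (Suc n))"]
          simp: module_homD[OF d] module_homD[of _ R "F n" N])
  qed
  fix f n assume f: "f \<in> carrier (hom_module R (F n) N)"
  interpret F2: Module.module R "F (Suc (Suc n))" by (rule Fm)
  have "f (d n (d (Suc n) x)) = \<zero>\<^bsub>N\<^esub>" if x: "x \<in> carrier (F (Suc (Suc n)))" for x
  proof -
    have "d n (d (Suc n) x) = \<zero>\<^bsub>F n\<^esub>" using ex[of n] x by (auto simp: a_kernel_def')
    then show ?thesis using module_hom_zero[OF Fm N] f by simp
  qed
  then show "restrict (restrict (f \<circ> d n) (carrier (F (Suc n))) \<circ> d (Suc n)) (carrier (F (Suc (Suc n)))) =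
      \<zero>\<^bsub>hom_module R (F (Suc (Suc n))) N\<^esub>"
    using module_homD(1)[OF d] by (auto intro!: extensionalityI[of _ "carrier (F (Suc (Suc n)))"])
qed

text \<open>The cocycles in degree 0 are the homomorphisms \<open>F\<^sub>0 \<rightarrow> N\<close> that vanish on the kernel of \<open>F\<^sub>0 \<rightarrow> K\<close>, that is, the homomorphisms
  \<open>K \<rightarrow> N\<close>. Such a homomorphism is determined by the image of 1, an element that the kernel of \<open>\<phi>\<close> kills.\<close>
theorem dim_Ext_0:
  fixes R :: "('a, 'r) ring_scheme" and N :: "('a, 'b) module" and K :: "('k, 's) ring_scheme" and c :: "'k \<Rightarrow> 'a set"
  assumes inf: "infinite (UNIV :: 'a set)" and R: "cring R" and K: "field K" and \<phi>: "\<phi> \<in> ring_hom R K"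
    and surj: "\<phi> ` carrier R = carrier K" and c: "inj_on c (carrier K)" and N: "Module.module R N"
  shows "dim_Ext R \<phi> K N 0 = 0 \<longleftrightarrow>
    (\<forall>u \<in> carrier N. (\<forall>a \<in> carrier R. \<phi> a = \<zero>\<^bsub>K\<^esub> \<longrightarrow> a \<odot>\<^bsub>N\<^esub> u = \<zero>\<^bsub>N\<^esub>) \<longrightarrow> u = \<zero>\<^bsub>N\<^esub>)"
proof -
  interpret R: cring R by fact
  interpret K: field K by fact
  interpret N: Module.module R N by fact
  interpret h: ring_hom_ring R K \<phi> by (intro ring_hom_ringI2 \<phi> R.ring_axioms K.ring_axioms)
  let ?K = "module_via \<phi> K"
  note [simp] = R.self_module_simps
  have Km: "Module.module R ?K" by (rule module_via_module[OF R K.is_cring \<phi>])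
  have "inj_on c (carrier ?K)" using c by simp
  then have "\<exists>p. case p of (F :: nat \<Rightarrow> ('a, 'a set) module, d) \<Rightarrow> \<exists>\<epsilon>. free_resolution R ?K F d \<epsilon>"
    using free_resolution_exists[OF inf Km] by (metis case_prodI)
  from someI_ex[OF this] obtain F :: "nat \<Rightarrow> ('a, 'a set) module" and d \<epsilon>
    where Fd: "(SOME (F, d). \<exists>\<epsilon>. free_resolution R ?K F d \<epsilon>) = (F, d)" and fr: "free_resolution R ?K F d \<epsilon>"
    by (auto split: prod.splits)
  interpret C: cochain_complex R "\<lambda>n. hom_module R (F n) N" "\<lambda>n f. restrict (f \<circ> d n) (carrier (F (Suc n)))"
    by (rule hom_complex[OF N fr])
  let ?H = "cohomology (\<lambda>n. hom_module R (F n) N) (\<lambda>n f. restrict (f \<circ> d n) (carrier (F (Suc n)))) 0"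
  have E: "Ext R ?K N 0 = ?H" by (simp add: Ext_def Fd)
  have Fm: "Module.module R (F n)" for n using fr by (simp add: free_resolution_def free_module_def)
  interpret F0: Module.module R "F 0" by (rule Fm)
  interpret F1: Module.module R "F 1" by (rule Fm)
  have eps: "\<epsilon> \<in> LinearCombinations.module_hom R (F 0) ?K" "\<epsilon> ` carrier (F 0) = carrier K"
    and d: "d 0 \<in> LinearCombinations.module_hom R (F 1) (F 0)"
    and ker: "d 0 ` carrier (F 1) = {x \<in> carrier (F 0). \<epsilon> x = \<zero>\<^bsub>K\<^esub>}"
    using fr by (auto simp: free_resolution_def a_kernel_def')
  have z0: "f \<in> C.cocycles 0 \<longleftrightarrow> f \<in> LinearCombinations.module_hom R (F 0) N \<and> f \<in> extensional (carrier (F 0)) \<and>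
      (\<forall>x \<in> carrier (F 0). \<epsilon> x = \<zero>\<^bsub>K\<^esub> \<longrightarrow> f x = \<zero>\<^bsub>N\<^esub>)" for f
  proof -
    have "restrict (f \<circ> d 0) (carrier (F (Suc 0))) = (\<lambda>x\<in>carrier (F (Suc 0)). \<zero>\<^bsub>N\<^esub>) \<longleftrightarrow> (\<forall>y \<in> carrier (F 1). f (d 0 y) = \<zero>\<^bsub>N\<^esub>)"
      by (auto simp: fun_eq_iff restrict_def)
    also have "\<dots> \<longleftrightarrow> (\<forall>x \<in> d 0 ` carrier (F 1). f x = \<zero>\<^bsub>N\<^esub>)" by simp
    finally show ?thesis unfolding ker by (auto simp: C.cocycles_def)
  qed
  have smult_kernel: "a \<odot>\<^bsub>?H\<^esub> X = \<zero>\<^bsub>?H\<^esub>" if a: "a \<in> carrier R" "\<phi> a = \<zero>\<^bsub>K\<^esub>" and X: "X \<in> carrier ?H" for a X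
  proof -
    obtain f where f: "f \<in> C.cocycles 0" "X = C.coh_class 0 f" using X by (auto simp: C.cohomology_carrier)
    have "a \<odot>\<^bsub>hom_module R (F 0) N\<^esub> f = \<zero>\<^bsub>hom_module R (F 0) N\<^esub>"
    proof (rule extensionalityI[of _ "carrier (F 0)"])
      fix x assume x: "x \<in> carrier (F 0)"
      have "\<epsilon> (a \<odot>\<^bsub>F 0\<^esub> x) = \<zero>\<^bsub>K\<^esub>" using module_homD(3)[OF eps(1) a(1) x] module_homD(1)[OF eps(1) x] a by simp
      then have "f (a \<odot>\<^bsub>F 0\<^esub> x) = \<zero>\<^bsub>N\<^esub>" using f(1) a x by (simp add: z0)
      then show "(a \<odot>\<^bsub>hom_module R (F 0) N\<^esub> f) x = \<zero>\<^bsub>hom_module R (F 0) N\<^esub> x"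
        using f(1) a x by (simp add: z0 module_homD(3)[of f R "F 0" N])
    qed simp_all
    moreover have "\<zero>\<^bsub>hom_module R (F 0) N\<^esub> \<in> C.cocycles 0"
      unfolding z0 by (auto intro!: module_homI)
    ultimately show ?thesis using C.coh_class_smult[OF a(1) f(1)] C.coh_class_zero[of "\<zero>\<^bsub>hom_module R (F 0) N\<^esub>" 0] f(2) by simp
  qed
  have vs: "VectorSpace.vectorspace K (descend R \<phi> ?H)"
    by (rule descend_vectorspace[OF smult_kernel C.cohomology_module K \<phi> surj])
  have "dim_Ext R \<phi> K N 0 = 0 \<longleftrightarrow> carrier ?H = {\<zero>\<^bsub>?H\<^esub>}"
    using vdim_eq_0[OF vs] by (simp add: dim_Ext_def E descend_def)
  also have "\<dots> \<longleftrightarrow> (\<forall>f \<in> C.cocycles 0. f = \<zero>\<^bsub>hom_module R (F 0) N\<^esub>)"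
  proof
    assume c: "carrier ?H = {\<zero>\<^bsub>?H\<^esub>}"
    show "\<forall>f \<in> C.cocycles 0. f = \<zero>\<^bsub>hom_module R (F 0) N\<^esub>"
    proof
      fix f assume f: "f \<in> C.cocycles 0"
      then have "C.coh_class 0 f = \<zero>\<^bsub>?H\<^esub>" using c by (auto simp: C.cohomology_carrier)
      then show "f = \<zero>\<^bsub>hom_module R (F 0) N\<^esub>" using C.coh_class_zero[OF f] by simp
    qed
  next
    assume z: "\<forall>f \<in> C.cocycles 0. f = \<zero>\<^bsub>hom_module R (F 0) N\<^esub>"
    interpret H: Module.module R ?H by (rule C.cohomology_module)
    have "C.coh_class 0 f = \<zero>\<^bsub>?H\<^esub>" if f: "f \<in> C.cocycles 0" for f
    proof -
      have "f = \<zero>\<^bsub>hom_module R (F 0) N\<^esub>" using z f by blast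
      then have "f \<in> coboundaries (\<lambda>n. hom_module R (F n) N) (\<lambda>n f. restrict (f \<circ> d n) (carrier (F (Suc n)))) 0" by simp
      then show ?thesis using C.coh_class_zero[OF f] by blast
    qed
    then show "carrier ?H = {\<zero>\<^bsub>?H\<^esub>}" using H.zero_closed unfolding C.cohomology_carrier by auto
  qed
  also have "\<dots> \<longleftrightarrow> (\<forall>u \<in> carrier N. (\<forall>a \<in> carrier R. \<phi> a = \<zero>\<^bsub>K\<^esub> \<longrightarrow> a \<odot>\<^bsub>N\<^esub> u = \<zero>\<^bsub>N\<^esub>) \<longrightarrow> u = \<zero>\<^bsub>N\<^esub>)"
  proof (intro iffI ballI impI)
    fix u assume z: "\<forall>f \<in> C.cocycles 0. f = \<zero>\<^bsub>hom_module R (F 0) N\<^esub>" and u: "u \<in> carrier N"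
      and ann: "\<forall>a \<in> carrier R. \<phi> a = \<zero>\<^bsub>K\<^esub> \<longrightarrow> a \<odot>\<^bsub>N\<^esub> u = \<zero>\<^bsub>N\<^esub>"
    define l where "l k = (SOME a. a \<in> carrier R \<and> \<phi> a = k)" for k
    have l: "l k \<in> carrier R" "\<phi> (l k) = k" if "k \<in> carrier K" for k
    proof -
      have "k \<in> \<phi> ` carrier R" using surj that by simp
      then have "\<exists>a. a \<in> carrier R \<and> \<phi> a = k" by auto
      from someI_ex[OF this] show "l k \<in> carrier R" "\<phi> (l k) = k" by (simp_all add: l_def)
    qed
    have lu: "l (\<phi> a) \<odot>\<^bsub>N\<^esub> u = a \<odot>\<^bsub>N\<^esub> u" if a: "a \<in> carrier R" for a
    proof -
      have la: "l (\<phi> a) \<in> carrier R" "\<phi> (l (\<phi> a)) = \<phi> a" using l a h.hom_closed by auto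
      have "\<phi> (l (\<phi> a) \<ominus>\<^bsub>R\<^esub> a) = \<zero>\<^bsub>K\<^esub>" using la a h.hom_closed by (simp add: R.minus_eq K.r_neg)
      then have "(l (\<phi> a) \<ominus>\<^bsub>R\<^esub> a) \<odot>\<^bsub>N\<^esub> u = \<zero>\<^bsub>N\<^esub>" using ann la a by simp
      then have "l (\<phi> a) \<odot>\<^bsub>N\<^esub> u \<oplus>\<^bsub>N\<^esub> \<ominus>\<^bsub>N\<^esub> (a \<odot>\<^bsub>N\<^esub> u) = \<zero>\<^bsub>N\<^esub>"
        using a la u by (simp add: R.minus_eq N.smult_l_distr N.smult_l_minus)
      then have "\<ominus>\<^bsub>N\<^esub> (\<ominus>\<^bsub>N\<^esub> (a \<odot>\<^bsub>N\<^esub> u)) = l (\<phi> a) \<odot>\<^bsub>N\<^esub> u" using a la u by (intro N.minus_equality) auto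
      then show ?thesis using a u by simp
    qed
    define g where "g k = l k \<odot>\<^bsub>N\<^esub> u" for k
    have "g \<in> LinearCombinations.module_hom R ?K N"
    proof (rule module_homI)
      fix k assume "k \<in> carrier ?K" then show "g k \<in> carrier N" using l u by (simp add: g_def)
    next
      fix k m assume "k \<in> carrier ?K" "m \<in> carrier ?K"
      then have "k \<in> \<phi> ` carrier R" "m \<in> \<phi> ` carrier R" using surj by auto
      then obtain a b where ab: "a \<in> carrier R" "k = \<phi> a" "b \<in> carrier R" "m = \<phi> b" by blast
      have "g (\<phi> (a \<oplus>\<^bsub>R\<^esub> b)) = (a \<oplus>\<^bsub>R\<^esub> b) \<odot>\<^bsub>N\<^esub> u" unfolding g_def using ab by (intro lu) simp
      then show "g (k \<oplus>\<^bsub>?K\<^esub> m) = g k \<oplus>\<^bsub>N\<^esub> g m" using ab u by (simp add: g_def lu N.smult_l_distr)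
    next
      fix r k assume r: "r \<in> carrier R" and "k \<in> carrier ?K"
      then have "k \<in> \<phi> ` carrier R" using surj by auto
      then obtain a where a: "a \<in> carrier R" "k = \<phi> a" by blast
      have "g (\<phi> (r \<otimes>\<^bsub>R\<^esub> a)) = (r \<otimes>\<^bsub>R\<^esub> a) \<odot>\<^bsub>N\<^esub> u" unfolding g_def using a r by (intro lu) simp
      then show "g (r \<odot>\<^bsub>?K\<^esub> k) = r \<odot>\<^bsub>N\<^esub> g k" using a r u by (simp add: g_def lu N.smult_assoc1)
    qed
    from module_hom_comp[OF eps(1) this] have ge: "g \<circ> \<epsilon> \<in> LinearCombinations.module_hom R (F 0) N" .
    have g0: "g \<zero>\<^bsub>K\<^esub> = \<zero>\<^bsub>N\<^esub>" using lu[of "\<zero>\<^bsub>R\<^esub>"] u by (simp add: g_def)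
    have "restrict (g \<circ> \<epsilon>) (carrier (F 0)) \<in> C.cocycles 0"
      unfolding z0 using module_homD[OF ge] g0 by (auto intro!: module_homI)
    then have "restrict (g \<circ> \<epsilon>) (carrier (F 0)) = (\<lambda>x\<in>carrier (F 0). \<zero>\<^bsub>N\<^esub>)" using z by simp
    moreover obtain x where x: "x \<in> carrier (F 0)" "\<epsilon> x = \<one>\<^bsub>K\<^esub>" using eps(2) K.one_closed by (metis imageE)
    ultimately have "g \<one>\<^bsub>K\<^esub> = \<zero>\<^bsub>N\<^esub>" by (metis comp_apply restrict_apply')
    then show "u = \<zero>\<^bsub>N\<^esub>" using lu[of "\<one>\<^bsub>R\<^esub>"] u by (simp add: g_def)
  next
    fix f assume z: "\<forall>u \<in> carrier N. (\<forall>a \<in> carrier R. \<phi> a = \<zero>\<^bsub>K\<^esub> \<longrightarrow> a \<odot>\<^bsub>N\<^esub> u = \<zero>\<^bsub>N\<^esub>) \<longrightarrow> u = \<zero>\<^bsub>N\<^esub>"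
      and f: "f \<in> C.cocycles 0"
    have fh: "f \<in> LinearCombinations.module_hom R (F 0) N" "f \<in> extensional (carrier (F 0))"
      "\<And>x. x \<in> carrier (F 0) \<Longrightarrow> \<epsilon> x = \<zero>\<^bsub>K\<^esub> \<Longrightarrow> f x = \<zero>\<^bsub>N\<^esub>" using f by (auto simp: z0)
    have "f x = \<zero>\<^bsub>N\<^esub>" if x: "x \<in> carrier (F 0)" for x
    proof -
      have "a \<odot>\<^bsub>N\<^esub> f x = \<zero>\<^bsub>N\<^esub>" if a: "a \<in> carrier R" "\<phi> a = \<zero>\<^bsub>K\<^esub>" for a
      proof -
        have "\<epsilon> (a \<odot>\<^bsub>F 0\<^esub> x) = \<zero>\<^bsub>K\<^esub>" using module_homD(3)[OF eps(1) a(1) x] module_homD(1)[OF eps(1) x] a by simp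
        then show ?thesis using fh(3)[of "a \<odot>\<^bsub>F 0\<^esub> x"] module_homD(3)[OF fh(1) a(1) x] a x by simp
      qed
      then show ?thesis using z module_homD(1)[OF fh(1) x] by blast
    qed
    then show "f = \<zero>\<^bsub>hom_module R (F 0) N\<^esub>" using fh(2) by (intro extensionalityI[of _ "carrier (F 0)"]) auto
  qed
  finally show ?thesis .
qed

section \<open>Top local cohomology\<close>

text \<open>The definition of local cohomology selects some resolution; the symbols are available for every one of them.\<close>
theorem local_cohomology_top:
  fixes R :: "('a, 'r) ring_scheme"
  assumes inf: "infinite (UNIV :: 'a set)" and R: "cring R" and N: "noetherian_ring R"
    and gs: "set gs \<subseteq> carrier R"
  obtains C :: "nat \<Rightarrow> ('a, 'a set) module" and d rep
  where "top_symbols R C d (length gs) (lprod R gs) rep (symbol_zero R gs)"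
    "local_cohomology R (genideal R (set gs)) (self_module R) (int (length gs)) = cohomology C d (length gs)"
proof -
  interpret R: cring R by fact
  have i: "inj_on (\<lambda>a::'a. {a}) (carrier (self_module R))" by (simp add: inj_on_def)
  have "\<exists>p. case p of (E :: nat \<Rightarrow> ('a, 'a set) module, d) \<Rightarrow> \<exists>\<epsilon>. injective_resolution R (self_module R) E d \<epsilon>"
    using injective_resolution_exists[OF inf R R.self_module i] by (metis case_prodI)
  from someI_ex[OF this] obtain E :: "nat \<Rightarrow> ('a, 'a set) module" and d \<epsilon>
    where Ed: "(SOME (E, d). \<exists>\<epsilon>. injective_resolution R (self_module R) E d \<epsilon>) = (E, d)"
      and ir: "injective_resolution R (self_module R) E d \<epsilon>"
    by (auto split: prod.splits)
  have mods: "Module.module R (E n)" for n using ir by (auto simp: injective_resolution_def injective_module_def)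
  show thesis
  proof (rule that)
    show "top_symbols R (\<lambda>n. ptorsions R gs (E n)) d (length gs) (lprod R gs) (symbol R E d \<epsilon> gs) (symbol_zero R gs)"
      by (rule R.top_symbols_injective_resolution[OF N ir gs])
    show "local_cohomology R (genideal R (set gs)) (self_module R) (int (length gs)) =
      cohomology (\<lambda>n. ptorsions R gs (E n)) d (length gs)"
      by (simp add: local_cohomology_def Ed R.torsion_eq_ptorsions[OF mods gs])
  qed
qed

section \<open>Hilbert's basis theorem\<close>

text \<open>Ideals of a ring given as a type. Ring types are convenient for the polynomial rings below, where induction on the number of variables is a nesting of types.\<close>
definition tideal :: "'a::comm_ring_1 set \<Rightarrow> bool"
  where "tideal I \<longleftrightarrow> 0 \<in> I \<and> (\<forall>x\<in>I. \<forall>y\<in>I. x + y \<in> I) \<and> (\<forall>c. \<forall>x\<in>I. c * x \<in> I)"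

definition tnoetherian :: "'a::comm_ring_1 itself \<Rightarrow> bool"
  where "tnoetherian _ \<longleftrightarrow> (\<forall>I :: 'a set. tideal I \<longrightarrow>
    (\<exists>G. finite G \<and> G \<subseteq> I \<and> (\<forall>J. tideal J \<and> G \<subseteq> J \<longrightarrow> I \<subseteq> J)))"

lemma tidealD:
  assumes "tideal I"
  shows "0 \<in> I" "\<lbrakk>x \<in> I; y \<in> I\<rbrakk> \<Longrightarrow> x + y \<in> I" "x \<in> I \<Longrightarrow> c * x \<in> I" "x \<in> I \<Longrightarrow> - x \<in> I"
    "\<lbrakk>x \<in> I; y \<in> I\<rbrakk> \<Longrightarrow> x - y \<in> I"
proof -
  show a: "x \<in> I \<Longrightarrow> - x \<in> I" for x
    using assms unfolding tideal_def by (metis mult_minus1)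
  show "0 \<in> I" and b: "\<lbrakk>x \<in> I; y \<in> I\<rbrakk> \<Longrightarrow> x + y \<in> I" and "x \<in> I \<Longrightarrow> c * x \<in> I" for x y
    using assms by (auto simp: tideal_def)
  show "\<lbrakk>x \<in> I; y \<in> I\<rbrakk> \<Longrightarrow> x - y \<in> I" using b[of x "- y"] a[of y] by simp
qed

lemma tnoetherian_int: "tnoetherian TYPE(int)"
  unfolding tnoetherian_def
proof (intro allI impI)
  fix I :: "int set" assume I: "tideal I"
  show "\<exists>G. finite G \<and> G \<subseteq> I \<and> (\<forall>J. tideal J \<and> G \<subseteq> J \<longrightarrow> I \<subseteq> J)"
  proof (cases "\<exists>n::nat. 0 < n \<and> int n \<in> I")
    case False
    have "x = 0" if "x \<in> I" for x
    proof (rule ccontr)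
      assume "x \<noteq> 0"
      then have "0 < nat \<bar>x\<bar>" "int (nat \<bar>x\<bar>) \<in> I" using that tidealD(4)[OF I that] by (auto simp: abs_if)
      then show False using False by blast
    qed
    then show ?thesis using tidealD(1) by (intro exI[of _ "{}"]) auto
  next
    case True
    define n where "n = (LEAST n::nat. 0 < n \<and> int n \<in> I)"
    have n: "0 < n" "int n \<in> I" using LeastI_ex[OF True] by (auto simp: n_def)
    have least: "n \<le> m" if "0 < m" "int m \<in> I" for m using that by (auto simp: n_def intro: Least_le)
    have "int n dvd x" if x: "x \<in> I" for x
    proof -
      have "x mod int n = x - (x div int n) * int n" by (simp add: minus_div_mult_eq_mod)
      then have "x mod int n \<in> I" using tidealD(5)[OF I x tidealD(3)[OF I n(2)]] by metis
      moreover have "0 \<le> x mod int n" "x mod int n < int n" using n by auto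
      ultimately have "x mod int n = 0" using least[of "nat (x mod int n)"] by (cases "x mod int n = 0") auto
      then show ?thesis by auto
    qed
    then show ?thesis using n tidealD(3) by (intro exI[of _ "{int n}"]) (auto elim!: dvdE simp: mult.commute)
  qed
qed

text \<open>For \<open>I\<close> an ideal these sets form an ascending chain of ideals of the coefficient ring.\<close>
definition lead_coeffs :: "'a::comm_ring_1 poly set \<Rightarrow> nat \<Rightarrow> 'a set"
  where "lead_coeffs I n = {coeff p n | p. p \<in> I \<and> degree p \<le> n}"

lemma tideal_lead_coeffs: "tideal I \<Longrightarrow> tideal (lead_coeffs I n)"
  unfolding tideal_def[of "lead_coeffs I n"]
proof (intro conjI ballI allI)
  assume I: "tideal I"
  show "0 \<in> lead_coeffs I n" using tidealD(1)[OF I] by (force simp: lead_coeffs_def)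
  fix x y assume "x \<in> lead_coeffs I n" "y \<in> lead_coeffs I n"
  then obtain p q where p: "p \<in> I" "degree p \<le> n" "x = coeff p n" and q: "q \<in> I" "degree q \<le> n" "y = coeff q n"
    by (auto simp: lead_coeffs_def)
  then show "x + y \<in> lead_coeffs I n" using tidealD(2)[OF I p(1) q(1)] degree_add_le[OF p(2) q(2)]
    by (auto simp: lead_coeffs_def intro!: exI[of _ "p + q"])
next
  assume I: "tideal I"
  fix c x assume "x \<in> lead_coeffs I n"
  then obtain p where p: "p \<in> I" "degree p \<le> n" "x = coeff p n" by (auto simp: lead_coeffs_def)
  then show "c * x \<in> lead_coeffs I n"
    using tidealD(3)[OF I p(1), of "[:c:]"] order.trans[OF degree_smult_le[of c p] p(2)]
    by (auto simp: lead_coeffs_def intro!: exI[of _ "smult c p"])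
qed

text \<open>Generators of the union of the ideals of leading coefficients are leading coefficients of elements of bounded degree \<open>N\<close>.
  Together with polynomials for generators of \<open>lead_coeffs I n\<close>, \<open>n \<le> N\<close>, they suffice to cancel leading terms.\<close>
theorem hilbert_basis:
  assumes N: "tnoetherian TYPE('a::comm_ring_1)"
  shows "tnoetherian TYPE('a poly)"
  unfolding tnoetherian_def
proof (intro allI impI)
  fix I :: "'a poly set" assume I: "tideal I"
  let ?L = "lead_coeffs I"
  have mono: "?L n \<subseteq> ?L (n + k)" for n k
  proof
    fix x assume "x \<in> ?L n"
    then obtain p where p: "p \<in> I" "degree p \<le> n" "x = coeff p n" by (auto simp: lead_coeffs_def)
    have "coeff (monom 1 k * p) (n + k) = x" using p by (simp add: coeff_monom_mult)
    moreover have "degree (monom 1 k * p) \<le> n + k"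
      using degree_mult_le[of "monom (1::'a) k" p] degree_monom_le[of "1::'a" k] p by linarith
    ultimately show "x \<in> ?L (n + k)" using tidealD(3)[OF I p(1)] by (force simp: lead_coeffs_def)
  qed
  have "tideal (\<Union>n. ?L n)"
    unfolding tideal_def
  proof (intro conjI ballI allI)
    show "0 \<in> (\<Union>n. ?L n)" using tidealD(1)[OF tideal_lead_coeffs[OF I]] by blast
    fix x y assume "x \<in> (\<Union>n. ?L n)" "y \<in> (\<Union>n. ?L n)"
    then obtain m n where "x \<in> ?L m" "y \<in> ?L n" by blast
    then have "x \<in> ?L (m + n)" "y \<in> ?L (m + n)" using mono[of m n] mono[of n m] by (auto simp: add.commute)
    then show "x + y \<in> (\<Union>n. ?L n)" using tidealD(2)[OF tideal_lead_coeffs[OF I]] by blast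
  next
    fix c x assume "x \<in> (\<Union>n. ?L n)"
    then show "c * x \<in> (\<Union>n. ?L n)" using tidealD(3)[OF tideal_lead_coeffs[OF I]] by blast
  qed
  then obtain G where G: "finite G" "G \<subseteq> (\<Union>n. ?L n)" "\<And>J. tideal J \<Longrightarrow> G \<subseteq> J \<Longrightarrow> (\<Union>n. ?L n) \<subseteq> J"
    using N unfolding tnoetherian_def by metis
  have "\<exists>Gn. finite Gn \<and> Gn \<subseteq> ?L n \<and> (\<forall>J. tideal J \<and> Gn \<subseteq> J \<longrightarrow> ?L n \<subseteq> J)" for n
    using N tideal_lead_coeffs[OF I, of n] unfolding tnoetherian_def by blast
  then obtain Gn where Gn: "\<And>n. finite (Gn n)" "\<And>n. Gn n \<subseteq> ?L n"
    "\<And>n J. tideal J \<Longrightarrow> Gn n \<subseteq> J \<Longrightarrow> ?L n \<subseteq> J" by metis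
  have "\<forall>g\<in>G. \<exists>n p. p \<in> I \<and> degree p \<le> n \<and> g = coeff p n"
  proof
    fix g assume "g \<in> G"
    then obtain n where "g \<in> ?L n" using G(2) by blast
    then show "\<exists>n p. p \<in> I \<and> degree p \<le> n \<and> g = coeff p n" unfolding lead_coeffs_def by blast
  qed
  then obtain dg pg where pg: "\<And>g. g \<in> G \<Longrightarrow> pg g \<in> I \<and> degree (pg g) \<le> dg g \<and> g = coeff (pg g) (dg g)" by metis
  have "\<forall>n. \<forall>g\<in>Gn n. \<exists>p. p \<in> I \<and> degree p \<le> n \<and> g = coeff p n" using Gn(2) unfolding lead_coeffs_def by blast
  then obtain pn where pn: "\<And>n g. g \<in> Gn n \<Longrightarrow> pn n g \<in> I \<and> degree (pn n g) \<le> n \<and> g = coeff (pn n g) n" by metis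
  define N where "N = (\<Sum>g\<in>G. dg g)"
  have N: "dg g \<le> N" if "g \<in> G" for g unfolding N_def using that G(1) by (simp add: member_le_sum)
  define H where "H = pg ` G \<union> (\<Union>n\<le>N. pn n ` Gn n)"
  show "\<exists>G. finite G \<and> G \<subseteq> I \<and> (\<forall>J. tideal J \<and> G \<subseteq> J \<longrightarrow> I \<subseteq> J)"
  proof (intro exI conjI allI impI)
    show "finite H" using G(1) Gn(1) by (auto simp: H_def)
    show "H \<subseteq> I" using pg pn by (auto simp: H_def)
    fix J assume "tideal J \<and> H \<subseteq> J"
    then have J: "tideal J" "H \<subseteq> J" by auto
    have IJ: "tideal (J \<inter> I)" using I J(1) by (auto simp: tideal_def)
    have sub: "?L n \<subseteq> lead_coeffs (J \<inter> I) n" for n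
    proof (cases "n \<le> N")
      case True
      have "Gn n \<subseteq> lead_coeffs (J \<inter> I) n"
      proof
        fix g assume g: "g \<in> Gn n"
        then have "pn n g \<in> H" unfolding H_def using True by blast
        then have "pn n g \<in> J \<inter> I" using J(2) pn[OF g] by blast
        then show "g \<in> lead_coeffs (J \<inter> I) n" using pn[OF g] by (force simp: lead_coeffs_def)
      qed
      then show ?thesis by (rule Gn(3)[OF tideal_lead_coeffs[OF IJ]])
    next
      case False
      have "G \<subseteq> lead_coeffs (J \<inter> I) n"
      proof
        fix g assume g: "g \<in> G"
        then have p: "pg g \<in> J \<inter> I" using J(2) pg[OF g] by (auto simp: H_def)
        let ?k = "n - dg g"
        have k: "dg g + ?k = n" using N[OF g] False by simp
        have "coeff (monom 1 ?k * pg g) n = g" using pg[OF g] k by (simp add: coeff_monom_mult)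
        moreover have "degree (monom 1 ?k * pg g) \<le> n"
          using degree_mult_le[of "monom (1::'a) ?k" "pg g"] degree_monom_le[of "1::'a" ?k] pg[OF g] k by linarith
        ultimately show "g \<in> lead_coeffs (J \<inter> I) n"
          using tidealD(3)[OF IJ p, of "monom 1 ?k"] unfolding lead_coeffs_def mem_Collect_eq
          by (intro exI[of _ "monom 1 ?k * pg g"] conjI) simp_all
      qed
      then show ?thesis using G(3)[OF tideal_lead_coeffs[OF IJ]] by blast
    qed
    have "\<forall>p. p \<in> I \<and> degree p < n \<longrightarrow> p \<in> J" for n
    proof (induction n)
      case (Suc n)
      show ?case
      proof (intro allI impI)
        fix p assume "p \<in> I \<and> degree p < Suc n"
        then have p: "p \<in> I" "degree p \<le> n" by auto
        then have "coeff p n \<in> lead_coeffs (J \<inter> I) n" using sub by (auto simp: lead_coeffs_def)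
        then obtain p' where p': "p' \<in> J" "p' \<in> I" "degree p' \<le> n" "coeff p n = coeff p' n"
          by (auto simp: lead_coeffs_def)
        have "p - p' \<in> J"
        proof (cases "p - p' = 0")
          case True then show ?thesis using tidealD(1)[OF J(1)] by simp
        next
          case False
          have "degree (p - p') \<le> n" using p p' by (intro degree_diff_le)
          moreover have "degree (p - p') \<noteq> n"
            using False p'(4) by (metis coeff_diff leading_coeff_0_iff diff_self)
          ultimately show ?thesis using Suc tidealD(5)[OF I p(1) p'(2)] by auto
        qed
        then have "(p - p') + p' \<in> J" using p'(1) by (intro tidealD(2)[OF J(1)])
        then show "p \<in> J" by simp
      qed
    qed simp
    then show "I \<subseteq> J" by blast
  qed
qed

section \<open>Chains of primes and growth\<close>

definition tprime :: "'a::comm_ring_1 set \<Rightarrow> bool"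
  where "tprime P \<longleftrightarrow> tideal P \<and> 1 \<notin> P \<and> (\<forall>x y. x * y \<in> P \<longrightarrow> x \<in> P \<or> y \<in> P)"

fun monomial :: "(nat \<Rightarrow> 'a::comm_ring_1) \<Rightarrow> nat list \<Rightarrow> 'a" where
  "monomial y [] = 1"
| "monomial y (e # es) = y 0 ^ e * monomial (\<lambda>i. y (Suc i)) es"

lemma tprime_pow: "tprime P \<Longrightarrow> y \<notin> P \<Longrightarrow> y ^ e * x \<in> P \<Longrightarrow> x \<in> P"
  by (induction e) (auto simp: tprime_def mult.assoc)

lemma tideal_sum: "tideal I \<Longrightarrow> (\<And>x. x \<in> A \<Longrightarrow> f x \<in> I) \<Longrightarrow> sum f A \<in> I"
  by (induction A rule: infinite_finite_induct) (auto simp: tidealD)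

text \<open>The monomials with the least exponent of \<open>y\<^sub>0\<close> dominate: dividing by that power of \<open>y\<^sub>0 \<notin> P\<^sub>0\<close> puts the rest of the sum
  into \<open>P\<^sub>1\<close>, and the sum of these monomials, without \<open>y\<^sub>0\<close>, is not in \<open>P\<^sub>1\<close> by induction. Only units as
  coefficients are allowed, since they lie in no prime.\<close>
lemma chain_no_relation:
  fixes P :: "nat \<Rightarrow> 'a::comm_ring_1 set"
  assumes "\<And>i. i \<le> k \<Longrightarrow> tprime (P i)"
    and "\<And>i. i < k \<Longrightarrow> P i \<subseteq> P (Suc i) \<and> y i \<in> P (Suc i) \<and> y i \<notin> P i"
    and "finite D" "D \<noteq> {}" "\<And>m. m \<in> D \<Longrightarrow> length m = k" "\<And>m. m \<in> D \<Longrightarrow> \<epsilon> m = 1 \<or> \<epsilon> m = - 1"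
  shows "(\<Sum>m\<in>D. \<epsilon> m * monomial y m) \<notin> P 0"
  using assms
proof (induction k arbitrary: P y D \<epsilon>)
  case 0
  then have "D = {[]}" by auto
  moreover have "1 \<notin> P 0" "tideal (P 0)" using 0(1)[of 0] by (auto simp: tprime_def)
  moreover have "- 1 \<notin> P 0" using tidealD(4)[of "P 0" "- 1"] calculation by auto
  ultimately show ?case using 0(6)[of "[]"] by auto
next
  case (Suc k)
  let ?y = "\<lambda>i. y (Suc i)"
  have P: "tprime (P 0)" "tideal (P 0)" "tprime (P 1)" "tideal (P 1)" using Suc.prems(1) by (auto simp: tprime_def)
  have y0: "y 0 \<in> P 1" "y 0 \<notin> P 0" "P 0 \<subseteq> P 1" using Suc.prems(2)[of 0] by auto
  define e where "e = Min (hd ` D)"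
  have e: "e \<in> hd ` D" "\<And>m. m \<in> D \<Longrightarrow> e \<le> hd m" using Suc.prems(3,4) by (auto simp: e_def)
  define D' where "D' = {m \<in> D. hd m = e}"
  have split: "m = hd m # tl m" "length (tl m) = k" if "m \<in> D" for m using Suc.prems(5)[OF that] by (cases m; auto)+
  have mon: "monomial y m = y 0 ^ e * (y 0 ^ (hd m - e) * monomial ?y (tl m))" if "m \<in> D" for m
  proof -
    have "monomial y m = y 0 ^ hd m * monomial ?y (tl m)" by (subst split(1)[OF that]) simp
    moreover have "y 0 ^ hd m = y 0 ^ e * y 0 ^ (hd m - e)" using e(2)[OF that] by (simp flip: power_add)
    ultimately show ?thesis by (simp add: mult.assoc)
  qed
  show ?case
  proof
    assume "(\<Sum>m\<in>D. \<epsilon> m * monomial y m) \<in> P 0"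
    moreover have "(\<Sum>m\<in>D. \<epsilon> m * monomial y m) = y 0 ^ e * (\<Sum>m\<in>D. \<epsilon> m * (y 0 ^ (hd m - e) * monomial ?y (tl m)))"
      unfolding sum_distrib_left by (rule sum.cong) (simp_all add: mon mult.left_commute)
    ultimately have "(\<Sum>m\<in>D. \<epsilon> m * (y 0 ^ (hd m - e) * monomial ?y (tl m))) \<in> P 1"
      using tprime_pow[OF P(1) y0(2)] y0(3) by auto
    moreover have "(\<Sum>m\<in>D. \<epsilon> m * (y 0 ^ (hd m - e) * monomial ?y (tl m))) =
        (\<Sum>m\<in>D'. \<epsilon> m * monomial ?y (tl m)) + (\<Sum>m\<in>D - D'. \<epsilon> m * (y 0 ^ (hd m - e) * monomial ?y (tl m)))"
    proof -
      have e: "(\<Sum>m\<in>D'. \<epsilon> m * monomial ?y (tl m)) = (\<Sum>m\<in>D'. \<epsilon> m * (y 0 ^ (hd m - e) * monomial ?y (tl m)))"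
        by (rule sum.cong) (auto simp: D'_def)
      have s: "sum g D = sum g (D - D') + sum g D'" for g :: "nat list \<Rightarrow> 'a"
        by (rule sum.subset_diff) (use Suc.prems(3) in \<open>auto simp: D'_def\<close>)
      show ?thesis unfolding e s by (rule add.commute)
    qed
    moreover have "(\<Sum>m\<in>D - D'. \<epsilon> m * (y 0 ^ (hd m - e) * monomial ?y (tl m))) \<in> P 1"
    proof (rule tideal_sum[OF P(4)])
      fix m assume "m \<in> D - D'"
      then have "hd m - e = Suc (hd m - e - 1)" using e(2)[of m] by (auto simp: D'_def)
      then have "y 0 ^ (hd m - e) = y 0 * y 0 ^ (hd m - e - 1)" by (metis power_Suc)
      then have "\<epsilon> m * (y 0 ^ (hd m - e) * monomial ?y (tl m)) = (\<epsilon> m * (y 0 ^ (hd m - e - 1) * monomial ?y (tl m))) * y 0"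
        by (simp add: mult_ac)
      then show "\<epsilon> m * (y 0 ^ (hd m - e) * monomial ?y (tl m)) \<in> P 1" using tidealD(3)[OF P(4) y0(1)] by metis
    qed
    ultimately have "(\<Sum>m\<in>D'. \<epsilon> m * monomial ?y (tl m)) + (\<Sum>m\<in>D - D'. \<epsilon> m * (y 0 ^ (hd m - e) * monomial ?y (tl m))) \<in> P 1"
      and "(\<Sum>m\<in>D - D'. \<epsilon> m * (y 0 ^ (hd m - e) * monomial ?y (tl m))) \<in> P 1" by simp_all
    from tidealD(5)[OF P(4) this] have "(\<Sum>m\<in>D'. \<epsilon> m * monomial ?y (tl m)) \<in> P 1" by simp
    moreover have "(\<Sum>m\<in>D'. \<epsilon> m * monomial ?y (tl m)) = (\<Sum>m\<in>tl ` D'. \<epsilon> (e # m) * monomial ?y m)"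
    proof -
      have inj: "inj_on tl D'"
      proof (rule inj_onI)
        fix m m' assume "m \<in> D'" "m' \<in> D'" and t: "tl m = tl m'"
        then have "m = e # tl m" "m' = e # tl m'" using split(1)[of m] split(1)[of m'] by (auto simp: D'_def)
        then show "m = m'" using t by metis
      qed
      show ?thesis unfolding sum.reindex[OF inj] o_def
      proof (rule sum.cong)
        fix m assume "m \<in> D'"
        then have "e # tl m = m" using split(1)[of m] by (auto simp: D'_def)
        then show "\<epsilon> m * monomial ?y (tl m) = \<epsilon> (e # tl m) * monomial ?y (tl m)" by simp
      qed simp
    qed
    moreover have "(\<Sum>m\<in>tl ` D'. \<epsilon> (e # m) * monomial ?y m) \<notin> P (Suc 0)"
    proof (rule Suc.IH[of "\<lambda>i. P (Suc i)" ?y])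
      show "tl ` D' \<noteq> {}" using e(1) by (auto simp: D'_def)
      show "length m = k" if "m \<in> tl ` D'" for m using that split(2) by (auto simp: D'_def)
      show "\<epsilon> (e # m) = 1 \<or> \<epsilon> (e # m) = - 1" if "m \<in> tl ` D'" for m
      proof -
        obtain m' where m': "m' \<in> D" "hd m' = e" "m = tl m'" using \<open>m \<in> tl ` D'\<close> by (auto simp: D'_def)
        then have "e # m = m'" using split(1)[of m'] by metis
        then show ?thesis using Suc.prems(6) m'(1) by auto
      qed
    qed (use Suc.prems in \<open>auto simp: D'_def\<close>)
    ultimately show False by simp
  qed
qed

text \<open>The sets \<open>E n b\<close> are to be thought of as the elements of degree at most \<open>n\<close> and norm at most \<open>b\<close>, with a subadditive and submultiplicative
  norm. Their number bounds the Krull dimension by \<open>d + 1\<close>; for the integers, the degree is absent and \<open>d = 0\<close>.\<close>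
definition growth :: "nat \<Rightarrow> (nat \<Rightarrow> nat \<Rightarrow> 'a::comm_ring_1 set) \<Rightarrow> bool"
  where "growth d E \<longleftrightarrow>
    (\<forall>n b. finite (E n b) \<and> card (E n b) \<le> (2 * b + 1) ^ ((n + 1) ^ d)) \<and>
    (\<forall>n b. 0 \<in> E n b) \<and> 1 \<in> E 0 1 \<and>
    (\<forall>n b b' x y. x \<in> E n b \<longrightarrow> y \<in> E n b' \<longrightarrow> x + y \<in> E n (b + b')) \<and>
    (\<forall>n n' b b' x y. x \<in> E n b \<longrightarrow> y \<in> E n' b' \<longrightarrow> x * y \<in> E (n + n') (b * b')) \<and>
    (\<forall>n n' b b' x. x \<in> E n b \<longrightarrow> n \<le> n' \<longrightarrow> b \<le> b' \<longrightarrow> x \<in> E n' b') \<and>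
    (\<forall>x. \<exists>n b. x \<in> E n b)"

lemma growthD:
  assumes "growth d E"
  shows "finite (E n b)" "card (E n b) \<le> (2 * b + 1) ^ ((n + 1) ^ d)" "0 \<in> E n b" "1 \<in> E 0 1"
    "x \<in> E n b \<Longrightarrow> y \<in> E n b' \<Longrightarrow> x + y \<in> E n (b + b')"
    "x \<in> E n b \<Longrightarrow> y \<in> E n' b' \<Longrightarrow> x * y \<in> E (n + n') (b * b')"
    "x \<in> E n b \<Longrightarrow> n \<le> n' \<Longrightarrow> b \<le> b' \<Longrightarrow> x \<in> E n' b'"
    "\<exists>n b. x \<in> E n b"
proof -
  note g = assms[unfolded growth_def]
  note g1 = g[THEN conjunct1] and g2 = g[THEN conjunct2, THEN conjunct1] and g' = g[THEN conjunct2, THEN conjunct2]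
  note g3 = g'[THEN conjunct1] and g4 = g'[THEN conjunct2, THEN conjunct1] and g'' = g'[THEN conjunct2, THEN conjunct2]
  note g5 = g''[THEN conjunct1] and g6 = g''[THEN conjunct2, THEN conjunct1] and g7 = g''[THEN conjunct2, THEN conjunct2]
  show "finite (E n b)" "card (E n b) \<le> (2 * b + 1) ^ ((n + 1) ^ d)" using g1 by simp_all
  show "0 \<in> E n b" using g2 by simp
  show "1 \<in> E 0 1" by (rule g3)
  show "x \<in> E n b \<Longrightarrow> y \<in> E n b' \<Longrightarrow> x + y \<in> E n (b + b')" using g4 by simp
  show "x \<in> E n b \<Longrightarrow> y \<in> E n' b' \<Longrightarrow> x * y \<in> E (n + n') (b * b')" using g5 by simp
  show "x \<in> E n b \<Longrightarrow> n \<le> n' \<Longrightarrow> b \<le> b' \<Longrightarrow> x \<in> E n' b'" using g6 by blast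
  show "\<exists>n b. x \<in> E n b" using g7 by simp
qed

lemma growth_sum:
  assumes "growth d E" "finite A" "\<And>i. i \<in> A \<Longrightarrow> f i \<in> E n (\<beta> i)"
  shows "sum f A \<in> E n (sum \<beta> A)"
  using assms(2,3) by (induction A rule: finite_induct) (auto intro: growthD[OF assms(1)])

lemma growth_int: "growth 0 (\<lambda>n b. {- int b..int b})"
  unfolding growth_def
proof (intro conjI allI impI)
  fix b b' :: nat and x y :: int
  assume "x \<in> {- int b..int b}" "y \<in> {- int b'..int b'}"
  then have "\<bar>x\<bar> \<le> int b" "\<bar>y\<bar> \<le> int b'" by auto
  then have "\<bar>x * y\<bar> \<le> int (b * b')" by (simp add: abs_mult mult_mono)
  then show "x * y \<in> {- int (b * b')..int (b * b')}" by auto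
next
  fix x :: int
  have "x \<in> {- int (nat \<bar>x\<bar>)..int (nat \<bar>x\<bar>)}" by auto
  then show "\<exists>n b. x \<in> {- int b..int b}" by blast
qed auto

text \<open>The norm of a polynomial is the sum of the norms of its coefficients. The bound on the cardinality is that of one
  coefficient to the power \<open>n + 1\<close>.\<close>
theorem growth_poly:
  fixes E :: "nat \<Rightarrow> nat \<Rightarrow> 'a::comm_ring_1 set"
  assumes E: "growth d E"
  shows "growth (Suc d) (\<lambda>n b. {f. degree f \<le> n \<and> (\<exists>\<beta>. (\<forall>i. coeff f i \<in> E n (\<beta> i)) \<and> (\<Sum>i\<le>n. \<beta> i) \<le> b)})"
    (is "growth _ ?E")
  unfolding growth_def
proof (intro conjI allI impI)
  fix n b
  let ?S = "PiE {..n} (\<lambda>_. E n b)"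
  have sub: "(\<lambda>f. restrict (coeff f) {..n}) ` ?E n b \<subseteq> ?S"
  proof (intro subsetI)
    fix h assume "h \<in> (\<lambda>f. restrict (coeff f) {..n}) ` ?E n b"
    then obtain f \<beta> where f: "h = restrict (coeff f) {..n}" "\<And>i. coeff f i \<in> E n (\<beta> i)" "(\<Sum>i\<le>n. \<beta> i) \<le> b" by auto
    have "coeff f i \<in> E n b" if "i \<le> n" for i
    proof (rule growthD(7)[OF E f(2)[of i]])
      have "\<beta> i \<le> (\<Sum>i\<le>n. \<beta> i)" using that by (intro member_le_sum) auto
      then show "\<beta> i \<le> b" using f(3) by simp
    qed simp
    then show "h \<in> ?S" unfolding f(1) by auto
  qed
  have inj: "inj_on (\<lambda>f. restrict (coeff f) {..n}) (?E n b)"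
  proof (rule inj_onI)
    fix f g assume "f \<in> ?E n b" "g \<in> ?E n b" and e: "restrict (coeff f) {..n} = restrict (coeff g) {..n}"
    then have "degree f \<le> n" "degree g \<le> n" by auto
    then show "f = g" using fun_cong[OF e]
      by (intro poly_eqI) (metis atMost_iff coeff_eq_0 le_less_trans not_le restrict_apply')
  qed
  have fin: "finite ?S" by (intro finite_PiE) (auto intro: growthD(1)[OF E])
  show "finite (?E n b)" using finite_imageD[OF finite_subset[OF sub fin] inj] .
  have "card (?E n b) \<le> card ?S" using card_inj_on_le[OF inj sub fin] .
  also have "\<dots> = card (E n b) ^ (n + 1)" by (simp add: card_PiE)
  also have "\<dots> \<le> ((2 * b + 1) ^ ((n + 1) ^ d)) ^ (n + 1)" by (intro power_mono growthD(2)[OF E]) simp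
  also have "\<dots> = (2 * b + 1) ^ ((n + 1) ^ Suc d)" by (simp only: power_mult[symmetric] power_Suc mult.commute)
  finally show "card (?E n b) \<le> (2 * b + 1) ^ ((n + 1) ^ Suc d)" .
next
  show "0 \<in> ?E n b" for n b using growthD(3)[OF E] by (auto intro!: exI[of _ "\<lambda>_. 0"])
  show "1 \<in> ?E 0 1"
    using growthD(3,4)[OF E] by (auto intro!: exI[of _ "\<lambda>i. if i = 0 then 1 else 0"])
next
  fix n b b' f g assume "f \<in> ?E n b" "g \<in> ?E n b'"
  then obtain \<beta> \<beta>' where f: "degree f \<le> n" "\<And>i. coeff f i \<in> E n (\<beta> i)" "(\<Sum>i\<le>n. \<beta> i) \<le> b"
    and g: "degree g \<le> n" "\<And>i. coeff g i \<in> E n (\<beta>' i)" "(\<Sum>i\<le>n. \<beta>' i) \<le> b'" by auto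
  then show "f + g \<in> ?E n (b + b')"
    using growthD(5)[OF E f(2) g(2)] by (auto intro!: degree_add_le exI[of _ "\<lambda>i. \<beta> i + \<beta>' i"] simp: sum.distrib)
next
  fix n n' b b' f g assume "f \<in> ?E n b" "g \<in> ?E n' b'"
  then obtain \<beta> \<beta>' where f: "degree f \<le> n" "\<And>i. coeff f i \<in> E n (\<beta> i)" "(\<Sum>i\<le>n. \<beta> i) \<le> b"
    and g: "degree g \<le> n'" "\<And>i. coeff g i \<in> E n' (\<beta>' i)" "(\<Sum>i\<le>n'. \<beta>' i) \<le> b'" by auto
  define \<gamma> where "\<gamma> i = (if i \<le> n then \<beta> i else 0)" for i
  define \<gamma>' where "\<gamma>' i = (if i \<le> n' then \<beta>' i else 0)" for i
  have \<gamma>: "coeff f i \<in> E n (\<gamma> i)" "coeff g i \<in> E n' (\<gamma>' i)" for i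
    using f(1) f(2)[of i] g(1) g(2)[of i] growthD(3)[OF E] by (auto simp: \<gamma>_def \<gamma>'_def coeff_eq_0)
  have "coeff (f * g) k \<in> E (n + n') (\<Sum>i\<le>k. \<gamma> i * \<gamma>' (k - i))" for k
    unfolding coeff_mult by (intro growth_sum[OF E] growthD(6)[OF E] \<gamma>) simp
  moreover have "(\<Sum>k\<le>n + n'. \<Sum>i\<le>k. \<gamma> i * \<gamma>' (k - i)) \<le> b * b'"
  proof -
    have "(\<Sum>k\<le>n + n'. \<Sum>i\<le>k. \<gamma> i * \<gamma>' (k - i)) = (\<Sum>(i, j)\<in>{(i, j). i + j \<le> n + n'}. \<gamma> i * \<gamma>' j)"
      by (rule sum.triangle_reindex_eq[symmetric])
    also have "\<dots> = (\<Sum>(i, j)\<in>{..n} \<times> {..n'}. \<gamma> i * \<gamma>' j)"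
    proof (rule sum.mono_neutral_right)
      show "finite {(i, j). i + j \<le> n + n'}" by (rule finite_subset[of _ "{..n + n'} \<times> {..n + n'}"]) auto
    qed (auto simp: \<gamma>_def \<gamma>'_def split: if_splits)
    also have "\<dots> = (\<Sum>i\<le>n. \<gamma> i) * (\<Sum>j\<le>n'. \<gamma>' j)" by (simp add: sum_product sum.cartesian_product)
    also have "\<dots> \<le> b * b'" using f(3) g(3) by (intro mult_mono) (auto simp: \<gamma>_def \<gamma>'_def)
    finally show ?thesis .
  qed
  moreover have "degree (f * g) \<le> n + n'" using degree_mult_le[of f g] f(1) g(1) by linarith
  ultimately show "f * g \<in> ?E (n + n') (b * b')"
    by (intro CollectI conjI exI[of _ "\<lambda>k. \<Sum>i\<le>k. \<gamma> i * \<gamma>' (k - i)"]) auto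
next
  fix n n' b b' f assume fE: "f \<in> ?E n b" and n: "n \<le> n'" and b: "b \<le> b'"
  show "f \<in> ?E n' b'"
  proof -
    from fE obtain \<beta> where f: "degree f \<le> n" "\<And>i. coeff f i \<in> E n (\<beta> i)" "(\<Sum>i\<le>n. \<beta> i) \<le> b" by auto
    define \<gamma> where "\<gamma> i = (if i \<le> n then \<beta> i else 0)" for i
    have "coeff f i \<in> E n' (\<gamma> i)" for i
      using f(1) growthD(7)[OF E f(2)[of i] n order.refl] growthD(3)[OF E] by (auto simp: \<gamma>_def coeff_eq_0)
    moreover have "(\<Sum>i\<le>n'. \<gamma> i) = (\<Sum>i\<le>n. \<gamma> i)" using n by (intro sum.mono_neutral_right) (auto simp: \<gamma>_def)
    then have "(\<Sum>i\<le>n'. \<gamma> i) \<le> b'" using f(3) b by (simp add: \<gamma>_def)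
    ultimately show "f \<in> ?E n' b'" using f(1) n by auto
  qed
next
  fix f :: "'a poly"
  have "\<forall>i. \<exists>n b. coeff f i \<in> E n b" using growthD(8)[OF E] by blast
  then obtain n \<beta> where n: "\<And>i. coeff f i \<in> E (n i) (\<beta> i)" by metis
  define N where "N = degree f + (\<Sum>i\<le>degree f. n i)"
  have "coeff f i \<in> E N (\<beta> i)" for i
  proof (cases "i \<le> degree f")
    case True
    then have "n i \<le> (\<Sum>i\<le>degree f. n i)" by (intro member_le_sum) auto
    then show ?thesis by (intro growthD(7)[OF E n[of i]]) (auto simp: N_def)
  next
    case False then show ?thesis using growthD(3)[OF E] by (simp add: coeff_eq_0)
  qed
  then have "f \<in> ?E N (\<Sum>i\<le>N. \<beta> i)" by (auto simp: N_def)
  then show "\<exists>n b. f \<in> ?E n b" by blast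
qed

lemma growth_pow:
  assumes E: "growth d E" and y: "y \<in> E D B"
  shows "y ^ e \<in> E (D * e) (B ^ e)"
proof (induction e)
  case 0 show ?case using growthD(4)[OF E] by simp
next
  case (Suc e)
  from growthD(6)[OF E y Suc] show ?case by simp
qed

lemma growth_monomial:
  assumes E: "growth d E" and y: "\<And>i. y i \<in> E D B" and B: "B \<ge> 1"
  shows "set m \<subseteq> {..<L} \<Longrightarrow> monomial y m \<in> E (D * L * length m) (B ^ (L * length m))"
  using y
proof (induction m arbitrary: y)
  case Nil show ?case using growthD(4)[OF E] by simp
next
  case (Cons e m)
  have "e \<le> L" using Cons.prems(1) by auto
  then have "y 0 ^ e \<in> E (D * L) (B ^ L)"
    using B by (intro growthD(7)[OF E growth_pow[OF E Cons.prems(2)]]) (auto intro: power_increasing)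
  moreover have "monomial (\<lambda>i. y (Suc i)) m \<in> E (D * L * length m) (B ^ (L * length m))"
    using Cons.prems by (intro Cons.IH) auto
  ultimately have "monomial y (e # m) \<in> E (D * L + D * L * length m) (B ^ L * B ^ (L * length m))"
    using growthD(6)[OF E] by simp
  then show ?case by (simp add: power_add algebra_simps)
qed

text \<open>Choose \<open>y\<^sub>i \<in> P\<^sub>i\<^sub>+\<^sub>1 - P\<^sub>i\<close> for \<open>i < d + 2\<close>. There are \<open>2 ^ (L ^ (d + 2))\<close> sums of distinct monomials in the \<open>y\<^sub>i\<close> with exponents below \<open>L\<close>, but their
  values lie in a set of at most \<open>2 ^ (C * L ^ (d + 1))\<close> elements. For \<open>L > C\<close> two of the sums agree. Their difference is a relation with
  coefficients \<open>1\<close> and \<open>-1\<close>, which contradicts \<open>chain_no_relation\<close>.\<close>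
theorem growth_chain_bound:
  fixes P :: "nat \<Rightarrow> 'a::comm_ring_1 set" and E :: "nat \<Rightarrow> nat \<Rightarrow> 'a set"
  assumes E: "growth d E" and prime: "\<And>i. i \<le> n \<Longrightarrow> tprime (P i)" and chain: "\<And>i. i < n \<Longrightarrow> P i \<subset> P (Suc i)"
  shows "n \<le> Suc d"
proof (rule ccontr)
  assume "\<not> n \<le> Suc d"
  define k where "k = Suc (Suc d)"
  have k: "k \<le> n" using \<open>\<not> n \<le> Suc d\<close> by (simp add: k_def)
  have "\<forall>i. \<exists>z. i < k \<longrightarrow> z \<in> P (Suc i) - P i"
  proof
    fix i
    show "\<exists>z. i < k \<longrightarrow> z \<in> P (Suc i) - P i"
    proof (cases "i < k")
      case True
      then have "P i \<subset> P (Suc i)" using chain[of i] k by simp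
      then show ?thesis by blast
    qed simp
  qed
  then obtain y0 where y0: "\<And>i. i < k \<Longrightarrow> y0 i \<in> P (Suc i) - P i" by metis
  define y where "y i = (if i < k then y0 i else 0)" for i
  have "\<forall>i. \<exists>n b. y i \<in> E n b" using growthD(8)[OF E] by blast
  then obtain dd bb where db: "\<And>i. y i \<in> E (dd i) (bb i)" by metis
  define D where "D = (\<Sum>i<k. dd i)"
  define b where "b = (\<Sum>i<k. bb i)"
  have yE: "y i \<in> E D (2 ^ b)" for i
  proof (cases "i < k")
    case True
    then have "dd i \<le> D" "bb i \<le> b" unfolding D_def b_def by (auto intro!: member_le_sum)
    moreover have "b \<le> 2 ^ b" by (rule less_imp_le[OF less_exp])
    ultimately have "dd i \<le> D" "bb i \<le> 2 ^ b" by linarith+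
    then show ?thesis by (rule growthD(7)[OF E db[of i]])
  next
    case False then show ?thesis using growthD(3)[OF E] by (simp add: y_def)
  qed
  \<comment> \<open>The number of values is at most \<open>2 ^ (C * L ^ (d + 1))\<close> for every \<open>L\<close>.\<close>
  define C where "C = (2 + k + b * k) * (D * k + 1) ^ d"
  define L where "L = Suc C"
  define M where "M = {m. set m \<subseteq> {..<L} \<and> length m = k}"
  have M: "finite M" "card M = L ^ k"
    unfolding M_def by (auto simp: finite_lists_length_eq card_lists_length_eq)
  let ?s = "\<lambda>T. \<Sum>m\<in>T. monomial y m"
  let ?b = "L ^ k * (2 ^ b) ^ (L * k)" and ?n = "D * L * k"
  have sE: "?s ` Pow M \<subseteq> E ?n ?b"
  proof (intro subsetI, elim imageE)
    fix x T assume x: "x = ?s T" and "T \<in> Pow M"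
    then have T: "T \<subseteq> M" by simp
    have "x \<in> E ?n (\<Sum>m\<in>T. (2 ^ b) ^ (L * k))"
      unfolding x using T finite_subset[OF T M(1)] growth_monomial[OF E yE]
      by (intro growth_sum[OF E]) (auto simp: M_def subset_iff)
    moreover have "(\<Sum>m\<in>T. (2 ^ b) ^ (L * k)) \<le> ?b"
      using card_mono[OF M(1) T] M(2) by simp
    ultimately show "x \<in> E ?n ?b" by (rule growthD(7)[OF E _ order.refl])
  qed
  have "card (E ?n ?b) < card (Pow M)"
  proof -
    have L1: "1 \<le> L" by (simp add: L_def)
    have "?b \<le> 2 ^ (L * k) * (2 ^ b) ^ (L * k)"
      using power_mono[OF less_imp_le[OF less_exp[of L]], of k] by (simp add: power_mult)
    also have "\<dots> = 2 ^ (L * k + b * (L * k))" by (simp add: power_add power_mult)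
    finally have "2 * ?b + 1 \<le> 2 * 2 ^ (L * k + b * (L * k)) + 2 ^ (L * k + b * (L * k))" by (intro add_mono mult_left_mono) auto
    also have "\<dots> \<le> 2 ^ (2 + (L * k + b * (L * k)))" by simp
    also have "\<dots> \<le> 2 ^ ((2 + k + b * k) * L)"
      using L1 by (intro power_increasing) (auto simp: algebra_simps)
    finally have b2: "2 * ?b + 1 \<le> 2 ^ ((2 + k + b * k) * L)" .
    have n1: "(?n + 1) ^ d \<le> (D * k + 1) ^ d * L ^ d"
      using L1 by (simp only: power_mult_distrib[symmetric]) (intro power_mono, auto simp: algebra_simps)
    have "card (E ?n ?b) \<le> (2 * ?b + 1) ^ ((?n + 1) ^ d)" by (rule growthD(2)[OF E])
    also have "\<dots> \<le> (2 ^ ((2 + k + b * k) * L)) ^ ((D * k + 1) ^ d * L ^ d)"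
      using b2 n1 by (intro order.trans[OF power_mono[OF b2] power_increasing[OF n1]]) auto
    also have "\<dots> = 2 ^ (C * L ^ Suc d)" by (simp only: C_def power_mult[symmetric] power_Suc mult_ac)
    also have "\<dots> < 2 ^ (L * L ^ Suc d)" by (intro power_strict_increasing) (auto simp: L_def)
    also have "\<dots> = card (Pow M)" using M by (simp add: card_Pow k_def)
    finally show ?thesis .
  qed
  then have "card (?s ` Pow M) < card (Pow M)" using card_mono[OF growthD(1)[OF E] sE] by linarith
  then have "\<not> inj_on ?s (Pow M)" by (metis card_image less_irrefl)
  then obtain T U where TU: "T \<subseteq> M" "U \<subseteq> M" "T \<noteq> U" "?s T = ?s U" unfolding inj_on_def by blast
  have fin: "finite T" "finite U" using TU M(1) finite_subset by auto
  define \<epsilon> :: "nat list \<Rightarrow> 'a" where "\<epsilon> m = (if m \<in> T then 1 else - 1)" for m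
  have "(\<Sum>m\<in>(T - U) \<union> (U - T). \<epsilon> m * monomial y m) = (\<Sum>m\<in>T - U. \<epsilon> m * monomial y m) + (\<Sum>m\<in>U - T. \<epsilon> m * monomial y m)"
    using fin by (intro sum.union_disjoint) auto
  also have "\<dots> = ?s (T - U) - ?s (U - T)"
    by (simp add: \<epsilon>_def sum_negf)
  also have "\<dots> = 0"
    using TU(4) sum.Int_Diff[OF fin(1), of "monomial y" U] sum.Int_Diff[OF fin(2), of "monomial y" T]
    by (simp add: Int_commute)
  finally have "(\<Sum>m\<in>(T - U) \<union> (U - T). \<epsilon> m * monomial y m) \<in> P 0"
    using prime[of 0] tidealD(1) by (auto simp: tprime_def)
  moreover have "(\<Sum>m\<in>(T - U) \<union> (U - T). \<epsilon> m * monomial y m) \<notin> P 0"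
  proof (rule chain_no_relation[where k = k])
    show "P i \<subseteq> P (Suc i) \<and> y i \<in> P (Suc i) \<and> y i \<notin> P i" if "i < k" for i
      using y0[OF that] chain[of i] that k by (auto simp: y_def)
    show "length m = k" if "m \<in> (T - U) \<union> (U - T)" for m using that TU by (auto simp: M_def)
  qed (use TU fin prime k in \<open>auto simp: \<epsilon>_def\<close>)
  ultimately show False by simp
qed

section \<open>Four cubics and the powers of their product\<close>

text \<open>The ideal generated by \<open>2\<^sup>\<alpha>\<close> and the \<open>\<beta>\<close>-th powers of \<open>g\<^sub>0, \<dots>, g\<^sub>N\<^sub>-\<^sub>1\<close>.\<close>
definition pow_ideal :: "(nat \<Rightarrow> 'a::comm_ring_1) \<Rightarrow> nat \<Rightarrow> nat \<Rightarrow> nat \<Rightarrow> 'a set"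
  where "pow_ideal g N \<alpha> \<beta> = {2 ^ \<alpha> * w + (\<Sum>i<N. g i ^ \<beta> * u i) | w u. True}"

lemma pow_idealI: "x = 2 ^ \<alpha> * w + (\<Sum>i<N. g i ^ \<beta> * u i) \<Longrightarrow> x \<in> pow_ideal g N \<alpha> \<beta>"
  unfolding pow_ideal_def mem_Collect_eq by (rule exI[of _ w], rule exI[of _ u]) simp

lemma pow_ideal_add: "x \<in> pow_ideal g N \<alpha> \<beta> \<Longrightarrow> y \<in> pow_ideal g N \<alpha> \<beta> \<Longrightarrow> x + y \<in> pow_ideal g N \<alpha> \<beta>"
proof -
  assume "x \<in> pow_ideal g N \<alpha> \<beta>" "y \<in> pow_ideal g N \<alpha> \<beta>"
  then obtain w u w' u' where "x = 2 ^ \<alpha> * w + (\<Sum>i<N. g i ^ \<beta> * u i)" "y = 2 ^ \<alpha> * w' + (\<Sum>i<N. g i ^ \<beta> * u' i)"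
    by (auto simp: pow_ideal_def)
  then have "x + y = 2 ^ \<alpha> * (w + w') + (\<Sum>i<N. g i ^ \<beta> * (u i + u' i))"
    by (simp add: distrib_left sum.distrib)
  then show ?thesis by (rule pow_idealI)
qed

lemma pow_ideal_mult: "x \<in> pow_ideal g N \<alpha> \<beta> \<Longrightarrow> c * x \<in> pow_ideal g N \<alpha> \<beta>"
proof -
  assume "x \<in> pow_ideal g N \<alpha> \<beta>"
  then obtain w u where "x = 2 ^ \<alpha> * w + (\<Sum>i<N. g i ^ \<beta> * u i)" by (auto simp: pow_ideal_def)
  then have "c * x = 2 ^ \<alpha> * (c * w) + (\<Sum>i<N. g i ^ \<beta> * (c * u i))"
    by (simp add: distrib_left sum_distrib_left mult.left_commute)
  then show ?thesis by (rule pow_idealI)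
qed

lemma pow_ideal_two: "2 ^ \<alpha> * c \<in> pow_ideal g N \<alpha> \<beta>"
proof -
  have "2 ^ \<alpha> * c = 2 ^ \<alpha> * c + (\<Sum>i<N. g i ^ \<beta> * 0)" by simp
  then show ?thesis by (rule pow_idealI)
qed

lemma pow_ideal_gen: "i < N \<Longrightarrow> g i ^ \<beta> * c \<in> pow_ideal g N \<alpha> \<beta>"
proof -
  assume "i < N"
  then have "g i ^ \<beta> * c = 2 ^ \<alpha> * 0 + (\<Sum>j<N. g j ^ \<beta> * (if j = i then c else 0))"
    by (simp add: if_distrib cong: if_cong)
  then show ?thesis by (rule pow_idealI)
qed

lemma pow_ideal_zero: "0 \<in> pow_ideal g N \<alpha> \<beta>"
  using pow_ideal_two[of \<alpha> 0] by simp

lemma pow_ideal_diff: "x \<in> pow_ideal g N \<alpha> \<beta> \<Longrightarrow> y \<in> pow_ideal g N \<alpha> \<beta> \<Longrightarrow> x - y \<in> pow_ideal g N \<alpha> \<beta>"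
  using pow_ideal_add[of x g N \<alpha> \<beta> "- 1 * y"] pow_ideal_mult[of y g N \<alpha> \<beta> "- 1"] by simp

lemma pow_ideal_sum: "(\<And>i. i \<in> A \<Longrightarrow> f i \<in> pow_ideal g N \<alpha> \<beta>) \<Longrightarrow> sum f A \<in> pow_ideal g N \<alpha> \<beta>"
  by (induction A rule: infinite_finite_induct) (auto intro: pow_ideal_zero pow_ideal_add)

lemma pow_ideal_minimal:
  assumes x: "x \<in> pow_ideal g N \<alpha> \<beta>" and two: "\<And>w. e * (2 ^ \<alpha> * w) \<in> pow_ideal g' N' \<alpha>' \<beta>'"
    and gen: "\<And>i u. i < N \<Longrightarrow> e * (g i ^ \<beta> * u) \<in> pow_ideal g' N' \<alpha>' \<beta>'"
  shows "e * x \<in> pow_ideal g' N' \<alpha>' \<beta>'"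
proof -
  obtain w u where "x = 2 ^ \<alpha> * w + (\<Sum>i<N. g i ^ \<beta> * u i)" using x by (auto simp: pow_ideal_def)
  then have "e * x = e * (2 ^ \<alpha> * w) + (\<Sum>i<N. e * (g i ^ \<beta> * u i))" by (simp add: distrib_left sum_distrib_left)
  then show ?thesis by (simp only:) (intro pow_ideal_add pow_ideal_sum two gen, auto)
qed

lemma sum_square_mod2: "\<exists>z. (\<Sum>i<N. t i)\<^sup>2 = (\<Sum>i<N. (t i)\<^sup>2) + 2 * (z::'a::comm_ring_1)" for N :: nat
proof (induction N)
  case (Suc N)
  then obtain z where z: "(\<Sum>i<N. t i)\<^sup>2 = (\<Sum>i<N. (t i)\<^sup>2) + 2 * z" by blast
  have "(\<Sum>i<Suc N. t i)\<^sup>2 = (\<Sum>i<N. t i)\<^sup>2 + (t N)\<^sup>2 + 2 * ((\<Sum>i<N. t i) * t N)"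
    by (simp add: power2_sum algebra_simps)
  then have "(\<Sum>i<Suc N. t i)\<^sup>2 = (\<Sum>i<Suc N. (t i)\<^sup>2) + 2 * (z + (\<Sum>i<N. t i) * t N)"
    unfolding z by (simp add: algebra_simps)
  then show ?case by blast
qed (auto intro: exI[of _ 0])

lemma pow_ideal_square:
  assumes "x \<in> pow_ideal g N 1 \<beta>"
  shows "x\<^sup>2 \<in> pow_ideal g N 1 (2 * \<beta>)"
proof -
  obtain w u where x: "x = 2 * w + (\<Sum>i<N. g i ^ \<beta> * u i)" using assms by (auto simp: pow_ideal_def)
  obtain z where z: "(\<Sum>i<N. g i ^ \<beta> * u i)\<^sup>2 = (\<Sum>i<N. (g i ^ \<beta> * u i)\<^sup>2) + 2 * z" using sum_square_mod2 by blast
  have "x\<^sup>2 = 2 * (2 * w\<^sup>2 + 2 * (w * (\<Sum>i<N. g i ^ \<beta> * u i))) + (\<Sum>i<N. g i ^ \<beta> * u i)\<^sup>2"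
    unfolding x by (simp add: power2_sum power2_eq_square algebra_simps)
  then have "x\<^sup>2 = 2 ^ 1 * (2 * w\<^sup>2 + 2 * (w * (\<Sum>i<N. g i ^ \<beta> * u i)) + z) + (\<Sum>i<N. g i ^ (2 * \<beta>) * (u i)\<^sup>2)"
    unfolding z by (simp add: power_mult_distrib power_mult[symmetric] algebra_simps)
  then show ?thesis by (rule pow_idealI)
qed

lemma pow_ideal_frobenius: "x \<in> pow_ideal g N 1 \<beta> \<Longrightarrow> x ^ (2 ^ e) \<in> pow_ideal g N 1 (2 ^ e * \<beta>)"
proof (induction e)
  case (Suc e)
  then show ?case using pow_ideal_square[of "x ^ 2 ^ e" g N "2 ^ e * \<beta>"]
    by (simp add: power_mult[symmetric] mult.commute mult.left_commute)
qed simp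

lemma freshman3: "\<exists>h. (x + y + z) ^ (2 ^ e) = x ^ (2 ^ e) + y ^ (2 ^ e) + z ^ (2 ^ e) + 2 * (h::'a::comm_ring_1)"
proof (induction e)
  case 0 show ?case by (intro exI[of _ 0]) simp
next
  case (Suc e)
  then obtain h where h: "(x + y + z) ^ (2 ^ e) = x ^ (2 ^ e) + y ^ (2 ^ e) + z ^ (2 ^ e) + 2 * h" by blast
  let ?x = "x ^ 2 ^ e" and ?y = "y ^ 2 ^ e" and ?z = "z ^ 2 ^ e"
  have sq: "u ^ (2 ^ Suc e) = (u ^ 2 ^ e)\<^sup>2" for u :: 'a by (simp add: power_mult[symmetric] mult.commute)
  have "(?x + ?y + ?z + 2 * h)\<^sup>2 = ?x\<^sup>2 + ?y\<^sup>2 + ?z\<^sup>2 + 2 * (2 * h\<^sup>2 + 2 * h * (?x + ?y + ?z) + ?x * ?y + ?x * ?z + ?y * ?z)"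
    by (simp add: power2_eq_square algebra_simps)
  then show ?case unfolding sq h by blast
qed

lemma prod_mod2: "\<exists>H. (\<Prod>i<N. r i + 2 * h i) = (\<Prod>i<N. r i) + 2 * (H::'a::comm_ring_1)" for N :: nat
proof (induction N)
  case 0 show ?case by (intro exI[of _ 0]) simp
next
  case (Suc N)
  then obtain H where H: "(\<Prod>i<N. r i + 2 * h i) = (\<Prod>i<N. r i) + 2 * H" by blast
  have "(\<Prod>i<Suc N. r i + 2 * h i) = (\<Prod>i<Suc N. r i) + 2 * (H * r N + (\<Prod>i<N. r i) * h N + 2 * H * h N)"
    by (simp only: prod.lessThan_Suc H) (simp add: algebra_simps)
  then show ?case by blast
qed

text \<open>Multiply the equation by \<open>\<Prod> p\<^sub>i\<close>: each summand becomes a multiple of \<open>p\<^sub>i\<^sup>2\<close>, which is \<open>g\<^sub>i\<^sup>2\<^sup>Q\<close> modulo 4, and \<open>2 \<Prod> p\<^sub>i\<close> is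
  \<open>2 \<Prod> g\<^sub>i\<^sup>Q\<close> modulo 4.\<close>
lemma twice_prod_pow:
  assumes V: "2 * V = (\<Sum>i<N. p i * u i)" and p: "\<And>i. i < N \<Longrightarrow> p i = g i ^ Q + 2 * h i"
  shows "2 * (\<Prod>i<N. g i) ^ Q * V \<in> pow_ideal g N 2 (2 * Q)"
proof -
  obtain H where H: "(\<Prod>i<N. g i ^ Q + 2 * h i) = (\<Prod>i<N. g i ^ Q) + 2 * H" using prod_mod2[of "\<lambda>i. g i ^ Q" h N] by blast
  have pH: "(\<Prod>i<N. p i) = (\<Prod>i<N. g i) ^ Q + 2 * H"
    using H p by (simp add: prod_power_distrib)
  have "(\<Prod>i<N. p i) * (p i * u i) \<in> pow_ideal g N 2 (2 * Q)" if i: "i < N" for i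
  proof -
    have r: "(\<Prod>i<N. p i) = p i * (\<Prod>j\<in>{..<N} - {i}. p j)" using i by (intro prod.remove) auto
    have e: "(\<Prod>i<N. p i) * (p i * u i) = ((\<Prod>j\<in>{..<N} - {i}. p j) * u i) * (p i)\<^sup>2"
      unfolding r by (simp add: power2_eq_square mult_ac)
    have s: "(p i)\<^sup>2 = g i ^ (2 * Q) * 1 + 2 ^ 2 * (h i * (g i ^ Q + h i))"
    proof -
      have "(x + 2 * y)\<^sup>2 = x\<^sup>2 * 1 + 2 ^ 2 * (y * (x + y))" for x y :: 'a
        by (simp add: power2_eq_square algebra_simps)
      moreover have "g i ^ (2 * Q) = (g i ^ Q)\<^sup>2" by (simp only: power_mult[symmetric] mult.commute)
      ultimately show ?thesis unfolding p[OF i] by simp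
    qed
    have "(p i)\<^sup>2 \<in> pow_ideal g N 2 (2 * Q)"
      unfolding s by (intro pow_ideal_add pow_ideal_gen pow_ideal_two i)
    then show ?thesis unfolding e by (rule pow_ideal_mult)
  qed
  then have "(\<Sum>i<N. (\<Prod>i<N. p i) * (p i * u i)) - 2 ^ 2 * (H * V) \<in> pow_ideal g N 2 (2 * Q)"
    by (intro pow_ideal_diff pow_ideal_sum pow_ideal_two) auto
  moreover have "(\<Sum>i<N. (\<Prod>i<N. p i) * (p i * u i)) = (\<Prod>i<N. p i) * (2 * V)"
    by (simp add: V sum_distrib_left)
  moreover have "(\<Prod>i<N. p i) * (2 * V) - 2 ^ 2 * (H * V) = 2 * (\<Prod>i<N. g i) ^ Q * V"
    by (simp add: pH algebra_simps)
  ultimately show ?thesis by simp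
qed

text \<open>The sums over the orbits of the rotation \<open>a \<rightarrow> b \<rightarrow> c \<rightarrow> a\<close>, \<open>A \<rightarrow> B \<rightarrow> C \<rightarrow> A\<close> on the ten minimal nonfaces of the six-vertex projective plane.\<close>
definition cubic :: "'a::comm_ring_1 \<Rightarrow> 'a \<Rightarrow> 'a \<Rightarrow> 'a \<Rightarrow> 'a \<Rightarrow> 'a \<Rightarrow> nat \<Rightarrow> 'a"
  where "cubic a b c A B C i = [a * b * c, b * c * A + c * a * B + a * b * C, a * C * A + b * A * B + c * B * C,
    a * A * B + b * B * C + c * C * A] ! i"

lemma less4: "i < 4 \<longleftrightarrow> i = 0 \<or> i = 1 \<or> i = 2 \<or> i = (3::nat)" by auto

lemma cubic_simps:
  "cubic a b c A B C 0 = a * b * c" "cubic a b c A B C 1 = b * c * A + c * a * B + a * b * C"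
  "cubic a b c A B C (Suc 0) = b * c * A + c * a * B + a * b * C"
  "cubic a b c A B C 2 = a * C * A + b * A * B + c * B * C" "cubic a b c A B C 3 = a * A * B + b * B * C + c * C * A"
  by (simp_all add: cubic_def eval_nat_numeral)

lemma sum4: "(\<Sum>i<4. f i) = f 0 + f 1 + f 2 + f (3::nat)" for f :: "nat \<Rightarrow> 'a::comm_monoid_add"
  by (simp add: eval_nat_numeral)

lemma prod4: "(\<Prod>i<4. f i) = f 0 * f 1 * f 2 * f (3::nat)" for f :: "nat \<Rightarrow> 'a::comm_monoid_mult"
  by (simp add: eval_nat_numeral)

lemma cubic_rotate: "cubic b c a B C A i = cubic a b c A B C i" if "i < 4"
  using that unfolding less4 by (auto simp: cubic_simps algebra_simps)

text \<open>An explicit identity over the integers; modulo 2 the monomial is not in the ideal (\<open>socle_monomial_nonmember\<close>).\<close>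
lemma twice_socle_monomial:
  fixes a b c A B C :: "'a::comm_ring_1"
  shows "2 * (b\<^sup>2 * c\<^sup>2 * B * C) =
    (\<Sum>i<4. cubic a b c A B C i *
      [c * C\<^sup>2 - 2 * c * A * B + b * B\<^sup>2 - 2 * b * A * C + 2 * a * B * C - a * A\<^sup>2,
       a\<^sup>2 * A - b\<^sup>2 * B - c\<^sup>2 * C, b\<^sup>2 * c + a * c\<^sup>2 - a\<^sup>2 * b, b * c\<^sup>2 + a * b\<^sup>2 - a\<^sup>2 * c] ! i)"
  unfolding sum4 cubic_simps by (simp add: eval_nat_numeral algebra_simps)

lemma cubic_pow:
  "i < 4 \<Longrightarrow> \<exists>h. cubic (a ^ 2 ^ e) (b ^ 2 ^ e) (c ^ 2 ^ e) (A ^ 2 ^ e) (B ^ 2 ^ e) (C ^ 2 ^ e) i = cubic a b c A B C i ^ 2 ^ e + 2 * h"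
proof -
  assume i: "i < 4"
  have m: "(x * y * z) ^ 2 ^ e = x ^ 2 ^ e * y ^ 2 ^ e * z ^ 2 ^ e" for x y z :: 'a by (simp add: power_mult_distrib)
  have f: "\<exists>h. x ^ 2 ^ e + y ^ 2 ^ e + z ^ 2 ^ e = (x + y + z) ^ 2 ^ e + 2 * h" for x y z :: 'a
  proof -
    obtain h where "(x + y + z) ^ (2 ^ e) = x ^ (2 ^ e) + y ^ (2 ^ e) + z ^ (2 ^ e) + 2 * h" using freshman3 by blast
    then show ?thesis by (intro exI[of _ "- h"]) simp
  qed
  from i consider "i = 0" | "i = 1" | "i = 2" | "i = 3" by linarith
  then show ?thesis
  proof cases
    case 1 then show ?thesis by (intro exI[of _ 0]) (simp add: cubic_simps m)
  qed (simp_all only: cubic_simps m[symmetric] f)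
qed

text \<open>The identity for \<open>2 b\<^sup>2c\<^sup>2BC\<close> at the \<open>2\<^sup>e\<close>-th powers of the variables.\<close>
lemma twice_socle_monomial_pow:
  fixes a b c A B C :: "'a::comm_ring_1"
  shows "2 * (\<Prod>i<4. cubic a b c A B C i) ^ 2 ^ e * (b\<^sup>2 * c\<^sup>2 * B * C) ^ 2 ^ e
    \<in> pow_ideal (cubic a b c A B C) 4 2 (2 * 2 ^ e)"
proof -
  have "\<forall>i. \<exists>h. i < 4 \<longrightarrow> cubic (a ^ 2 ^ e) (b ^ 2 ^ e) (c ^ 2 ^ e) (A ^ 2 ^ e) (B ^ 2 ^ e) (C ^ 2 ^ e) i = cubic a b c A B C i ^ 2 ^ e + 2 * h"
    using cubic_pow by blast
  then obtain h where h: "\<And>i. i < 4 \<Longrightarrow> cubic (a ^ 2 ^ e) (b ^ 2 ^ e) (c ^ 2 ^ e) (A ^ 2 ^ e) (B ^ 2 ^ e) (C ^ 2 ^ e) i = cubic a b c A B C i ^ 2 ^ e + 2 * h i"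
    by metis
  have e: "(b\<^sup>2 * c\<^sup>2 * B * C) ^ 2 ^ e = (b ^ 2 ^ e)\<^sup>2 * (c ^ 2 ^ e)\<^sup>2 * B ^ 2 ^ e * C ^ 2 ^ e"
    by (simp add: power_mult_distrib power_mult[symmetric] mult.commute)
  show ?thesis
    unfolding e by (rule twice_prod_pow[OF twice_socle_monomial h])
qed

text \<open>The three products are what remains of the last three cubics when \<open>a\<close> is set to 0. The coefficients are a solution of a linear system over the field with two
  elements, found by computer; \<open>E\<close> makes up the difference over the integers.\<close>
lemma cube_mod_fourth_powers:
  fixes a b c A B C :: "'a::comm_ring_1"
  shows "\<exists>r c0 c1 c2 E. ((b * c * A) * (B * (b * A + c * C)) * (C * (b * B + c * A))) ^ 3 =
    r * (b * c * B * C) ^ 4 + c0 * (b * c * A) ^ 4 + c1 * (B * (b * A + c * C)) ^ 4 + c2 * (C * (b * B + c * A)) ^ 4 + 2 * E"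
proof -
  define X Y where XY: "X = b * A + c * C" "Y = b * B + c * A"
  define r where "r = b^4*A^3*B^2 + b^3*c*A^4*B + b^3*c*A^2*B^2*C + b^3*c*B^3*C^2 + b^2*c^2*A^5 + b^2*c^2*A^3*B*C + b^2*c^2*A*B^2*C^2 + b*c^3*A^4*C + b*c^3*A^2*B*C^2 + b*c^3*B^2*C^3 + c^4*A^3*C^2"
  define s where "s = b^4*B^2 + b^3*c*A*B + b^2*c^2*A^2 + b*c^3*A*C + c^4*C^2"
  define E where "E = b^5*c*A^5*B^2 - b^5*c*A^3*B^3*C + b^4*c^2*A^6*B + 4*b^4*c^2*A^4*B^2*C - 2*b^4*c^2*A^2*B^3*C^2 - b^4*c^2*B^4*C^3 + 4*b^3*c^3*A^5*B*C + 4*b^3*c^3*A^3*B^2*C^2 - 4*b^3*c^3*A*B^3*C^3 + b^2*c^4*A^6*C + 4*b^2*c^4*A^4*B*C^2 - 2*b^2*c^4*A^2*B^2*C^3 - b^2*c^4*B^3*C^4 + b*c^5*A^5*C^2 - b*c^5*A^3*B*C^3"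
  \<comment> \<open>The identity divided by the monomial \<open>K\<close>.\<close>
  define K where "K = b ^ 3 * c ^ 3 * A ^ 2 * B ^ 3 * C ^ 3"
  have core: "A * (X * Y) ^ 3 = r * (b * c * B * C) + s * (b * c * A ^ 5) + b ^ 2 * B ^ 3 * X ^ 4 + c ^ 2 * C ^ 3 * Y ^ 4 + 2 * E"
    unfolding XY r_def s_def E_def by (simp add: eval_nat_numeral algebra_simps)
  have "(b * c * A * (B * X) * (C * Y)) ^ 3 = K * (A * (X * Y) ^ 3)"
    by (simp add: K_def power_mult_distrib eval_nat_numeral mult_ac)
  also have "\<dots> = (A ^ 2 * r) * (b * c * B * C) ^ 4 + (A ^ 3 * B ^ 3 * C ^ 3 * s) * (b * c * A) ^ 4
      + (b ^ 5 * c ^ 3 * A ^ 2 * B ^ 2 * C ^ 3) * (B * X) ^ 4 + (b ^ 3 * c ^ 5 * A ^ 2 * B ^ 3 * C ^ 2) * (C * Y) ^ 4 + 2 * (K * E)"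
    unfolding core K_def distrib_left by (simp add: power_mult_distrib eval_nat_numeral mult_ac)
  finally show ?thesis unfolding XY by blast
qed

lemma pow4_shift: "\<exists>z. (x - a * y) ^ 4 = x ^ 4 + a * (z::'a::idom)"
  by (intro exI[of _ "- 4 * x ^ 3 * y + 6 * x\<^sup>2 * a * y\<^sup>2 - 4 * x * a\<^sup>2 * y ^ 3 + a ^ 3 * y ^ 4"])
    (simp add: eval_nat_numeral algebra_simps)

lemma cube_shift: "\<exists>z. ((x + a * x') * (y + a * y') * (w + a * w')) ^ 3 = (x * y * w) ^ 3 + a * (z::'a::idom)"
proof -
  obtain k where k: "(x + a * x') * (y + a * y') * (w + a * w') = x * y * w + a * k"
  proof
    show "(x + a * x') * (y + a * y') * (w + a * w') = x * y * w + a * (x' * y * w + x * y' * w + x * y * w'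
      + a * (x' * y' * w + x' * y * w' + x * y' * w') + a * a * x' * y' * w')" by (simp add: algebra_simps)
  qed
  show ?thesis unfolding k
    by (intro exI[of _ "3 * (x * y * w)\<^sup>2 * k + 3 * (x * y * w) * a * k\<^sup>2 + a\<^sup>2 * k ^ 3"])
      (simp add: eval_nat_numeral algebra_simps)
qed

text \<open>Since \<open>q\<^sub>0\<^sup>3 b c\<close> times a multiple of \<open>a\<close> is a multiple of \<open>q\<^sub>0\<^sup>4\<close>, the other cubics may be replaced by their values at \<open>a = 0\<close>.\<close>
lemma prod_cube_mod_fourth_powers:
  fixes a b c A B C :: "'a::idom"
  shows "\<exists>w r u. b * c * (\<Prod>i<4. cubic a b c A B C i) ^ 3 = 2 * w + r * (b\<^sup>2 * c\<^sup>2 * B * C) ^ 4 + (\<Sum>i<4. cubic a b c A B C i ^ 4 * u i)"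
proof -
  let ?q = "cubic a b c A B C"
  define m1 m2 m3 where m: "m1 = b * c * A" "m2 = B * (b * A + c * C)" "m3 = C * (b * B + c * A)"
  obtain r c0 c1 c2 E where link: "(m1 * m2 * m3) ^ 3 = r * (b * c * B * C) ^ 4 + c0 * m1 ^ 4 + c1 * m2 ^ 4 + c2 * m3 ^ 4 + 2 * E"
    unfolding m using cube_mod_fourth_powers by blast
  have q: "?q 1 = m1 + a * (c * B + b * C)" "?q 2 = m2 + a * (C * A)" "?q 3 = m3 + a * (A * B)"
    by (simp_all add: cubic_simps m algebra_simps)
  obtain z where z: "(?q 1 * ?q 2 * ?q 3) ^ 3 = (m1 * m2 * m3) ^ 3 + a * z"
    unfolding q using cube_shift by blast
  have s1: "m1 = ?q 1 - a * (c * B + b * C)" unfolding q by simp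
  obtain z1 where z1: "m1 ^ 4 = ?q 1 ^ 4 + a * z1"
    using pow4_shift[of "?q 1" a "c * B + b * C"] unfolding s1[symmetric] by blast
  have s2: "m2 = ?q 2 - a * (C * A)" unfolding q by simp
  obtain z2 where z2: "m2 ^ 4 = ?q 2 ^ 4 + a * z2"
    using pow4_shift[of "?q 2" a "C * A"] unfolding s2[symmetric] by blast
  have s3: "m3 = ?q 3 - a * (A * B)" unfolding q by simp
  obtain z3 where z3: "m3 ^ 4 = ?q 3 ^ 4 + a * z3"
    using pow4_shift[of "?q 3" a "A * B"] unfolding s3[symmetric] by blast
  \<comment> \<open>The factor \<open>b c (a b c)\<^sup>3\<close> turns every multiple of \<open>a\<close> into a multiple of \<open>(a b c)\<^sup>4\<close>.\<close>
  let ?k = "b * c * (a * b * c) ^ 3"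
  have "b * c * (\<Prod>i<4. ?q i) ^ 3 = ?k * (?q 1 * ?q 2 * ?q 3) ^ 3"
    by (simp add: prod4 cubic_simps(1) power_mult_distrib mult_ac)
  also have "\<dots> = ?k * (r * (b * c * B * C) ^ 4 + c0 * (?q 1 ^ 4 + a * z1) + c1 * (?q 2 ^ 4 + a * z2) + c2 * (?q 3 ^ 4 + a * z3) + 2 * E + a * z)"
    unfolding z link z1 z2 z3 ..
  also have "\<dots> = 2 * (?k * E) + (a ^ 3 * r) * (b\<^sup>2 * c\<^sup>2 * B * C) ^ 4
      + ((a * b * c) ^ 4 * (c0 * z1 + c1 * z2 + c2 * z3 + z) + ?q 1 ^ 4 * (?k * c0) + ?q 2 ^ 4 * (?k * c1) + ?q 3 ^ 4 * (?k * c2))"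
  proof -
    define x y w where xyw: "x = ?q 1 ^ 4" "y = ?q 2 ^ 4" "w = ?q 3 ^ 4"
    show ?thesis unfolding xyw[symmetric] by (simp add: eval_nat_numeral algebra_simps)
  qed
  also have "\<dots> = 2 * (?k * E) + (a ^ 3 * r) * (b\<^sup>2 * c\<^sup>2 * B * C) ^ 4
      + (\<Sum>i<4. ?q i ^ 4 * [c0 * z1 + c1 * z2 + c2 * z3 + z, ?k * c0, ?k * c1, ?k * c2] ! i)"
    by (simp add: sum4 cubic_simps(1))
  finally show ?thesis by blast
qed

definition cubics_and_monomials :: "'a::idom \<Rightarrow> 'a \<Rightarrow> 'a \<Rightarrow> 'a \<Rightarrow> 'a \<Rightarrow> 'a \<Rightarrow> nat \<Rightarrow> 'a"
  where "cubics_and_monomials a b c A B C i = (if i < 4 then cubic a b c A B C i else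
    [b\<^sup>2 * c\<^sup>2 * B * C, c\<^sup>2 * a\<^sup>2 * C * A, a\<^sup>2 * b\<^sup>2 * A * B] ! (i - 4))"

text \<open>Let \<open>F\<close> be the product of the cubics. It is a combination of \<open>b\<^sup>2c\<^sup>2\<close>, \<open>c\<^sup>2a\<^sup>2\<close> and \<open>a\<^sup>2b\<^sup>2\<close>, and \<open>b\<^sup>2c\<^sup>2 F\<^sup>6 = (b c F\<^sup>3)\<^sup>2\<close>; the element \<open>b c F\<^sup>3\<close> is covered by
  \<open>prod_cube_mod_fourth_powers\<close>, and squaring modulo 2 doubles the exponents.\<close>
lemma prod_power7:
  fixes a b c A B C :: "'a::idom"
  shows "(\<Prod>i<4. cubic a b c A B C i) ^ 7 \<in> pow_ideal (cubics_and_monomials a b c A B C) 7 1 8"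
proof -
  let ?q = "cubic a b c A B C" and ?g = "cubics_and_monomials a b c A B C" and ?F = "\<Prod>i<4. cubic a b c A B C i"
  have F: "?F = b * c * (b * c * a * A * ?q 2 * ?q 3) + c * a * (c * a * b * B * ?q 2 * ?q 3) + a * b * (a * b * c * C * ?q 2 * ?q 3)"
    by (simp add: prod4 cubic_simps algebra_simps)
  have rot: "(\<Prod>i<4. cubic b c a B C A i) = ?F" "(\<Prod>i<4. cubic c a b C A B i) = ?F"
    using cubic_rotate[of _ b c a B C A] cubic_rotate[of _ a b c A B C] by simp_all
  have rots: "(\<Sum>i<4. cubic b c a B C A i ^ 4 * u i) = (\<Sum>i<4. ?q i ^ 4 * u i)"
    "(\<Sum>i<4. cubic c a b C A B i ^ 4 * u i) = (\<Sum>i<4. ?q i ^ 4 * u i)" for u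
    using cubic_rotate[of _ b c a B C A] cubic_rotate[of _ a b c A B C] by simp_all
  have mem: "2 * w + r * v ^ 4 + (\<Sum>i<4. ?q i ^ 4 * u i) \<in> pow_ideal ?g 7 1 4" if "v = ?g j" "j < 7" for w r v u j
  proof -
    have "?q i ^ 4 * u i \<in> pow_ideal ?g 7 1 4" if "i < 4" for i
      using pow_ideal_gen[of i 7 ?g 4] that by (simp add: cubics_and_monomials_def)
    moreover have "r * v ^ 4 \<in> pow_ideal ?g 7 1 4" using pow_ideal_gen[of j 7 ?g 4 r] that by (simp add: mult.commute)
    moreover have "2 * w \<in> pow_ideal ?g 7 1 4" using pow_ideal_two[of 1 w] by simp
    ultimately show ?thesis by (intro pow_ideal_add pow_ideal_sum) auto
  qed
  have g: "b\<^sup>2 * c\<^sup>2 * B * C = ?g 4" "c\<^sup>2 * a\<^sup>2 * C * A = ?g 5" "a\<^sup>2 * b\<^sup>2 * A * B = ?g 6"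
    by (simp_all add: cubics_and_monomials_def)
  have "b * c * ?F ^ 3 \<in> pow_ideal ?g 7 1 4"
    using prod_cube_mod_fourth_powers[of b c a A B C] mem[OF g(1)] by auto
  moreover have "c * a * ?F ^ 3 \<in> pow_ideal ?g 7 1 4"
    using prod_cube_mod_fourth_powers[of c a b B C A] mem[OF g(2)] unfolding rot rots by auto
  moreover have "a * b * ?F ^ 3 \<in> pow_ideal ?g 7 1 4"
    using prod_cube_mod_fourth_powers[of a b c C A B] mem[OF g(3)] unfolding rot rots by auto
  moreover have "y\<^sup>2 \<in> pow_ideal ?g 7 1 8" if "y \<in> pow_ideal ?g 7 1 4" for y
    using pow_ideal_square[OF that] by simp
  ultimately have sq: "(b * c * ?F ^ 3)\<^sup>2 \<in> pow_ideal ?g 7 1 8" "(c * a * ?F ^ 3)\<^sup>2 \<in> pow_ideal ?g 7 1 8"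
    "(a * b * ?F ^ 3)\<^sup>2 \<in> pow_ideal ?g 7 1 8" by blast+
  have "?F ^ 7 = ?F * ?F ^ 6" by (simp add: eval_nat_numeral)
  also have "\<dots> = (a * A * ?q 2 * ?q 3) * (b * c * ?F ^ 3)\<^sup>2 + (b * B * ?q 2 * ?q 3) * (c * a * ?F ^ 3)\<^sup>2 + (c * C * ?q 2 * ?q 3) * (a * b * ?F ^ 3)\<^sup>2"
    by (subst (1) F) (simp add: eval_nat_numeral algebra_simps)
  finally show ?thesis using sq by (auto intro!: pow_ideal_add pow_ideal_mult)
qed

text \<open>The exponent is \<open>15 = 8 + 7\<close>: the product \<open>2 F\<^sup>8\<^sup>Q F\<^sup>7\<^sup>Q\<close> is evaluated with \<open>prod_power7\<close> for \<open>F\<^sup>7\<^sup>Q\<close>, and the terms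
  \<open>2 F\<^sup>8\<^sup>Q v\<^sup>8\<^sup>Q\<close> that arise are in the ideal by \<open>twice_socle_monomial_pow\<close>.\<close>
lemma twice_prod_pow_gain:
  fixes a b c A B C :: "'a::idom" and e :: nat
  defines "q \<equiv> cubic a b c A B C" and "Q \<equiv> 2 ^ e :: nat"
  shows "2 * (\<Prod>i<4. q i) ^ (15 * Q) \<in> pow_ideal q 4 2 (16 * Q)"
proof -
  let ?g = "cubics_and_monomials a b c A B C" and ?F = "\<Prod>i<4. q i"
  have "(?F ^ 7) ^ Q \<in> pow_ideal ?g 7 1 (Q * 8)"
    unfolding Q_def q_def by (rule pow_ideal_frobenius[OF prod_power7])
  then have F: "?F ^ (7 * Q) \<in> pow_ideal ?g 7 1 (8 * Q)" by (simp add: power_mult[symmetric] mult.commute)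
  have v: "2 * ?F ^ (8 * Q) * ?g i ^ (8 * Q) \<in> pow_ideal q 4 2 (16 * Q)" if "i \<in> {4, 5, 6}" for i
  proof -
    have rot: "(\<Prod>i<4. cubic b c a B C A i) = ?F" "(\<Prod>i<4. cubic c a b C A B i) = ?F"
      "pow_ideal (cubic b c a B C A) 4 = pow_ideal q 4" "pow_ideal (cubic c a b C A B) 4 = pow_ideal q 4"
      using cubic_rotate[of _ b c a B C A] cubic_rotate[of _ a b c A B C] by (auto simp: q_def pow_ideal_def fun_eq_iff)
    have e: "2 ^ (e + 3) = 8 * Q" "2 * (8 * Q) = 16 * Q" by (simp_all add: Q_def power_add)
    have "i = 4 \<or> i = 5 \<or> i = 6" using that by auto
    then show ?thesis
      using twice_socle_monomial_pow[of a b c A B C "e + 3"] twice_socle_monomial_pow[of b c a B C A "e + 3"]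
        twice_socle_monomial_pow[of c a b C A B "e + 3"]
      unfolding rot e q_def[symmetric] by (auto simp: cubics_and_monomials_def)
  qed
  have "2 * ?F ^ (8 * Q) * ?F ^ (7 * Q) \<in> pow_ideal q 4 2 (16 * Q)"
  proof (rule pow_ideal_minimal[OF F])
    fix w show "2 * ?F ^ (8 * Q) * (2 ^ 1 * w) \<in> pow_ideal q 4 2 (16 * Q)"
      using pow_ideal_two[of 2 "?F ^ (8 * Q) * w"] by (simp add: mult_ac)
  next
    fix i u assume i: "i < (7::nat)"
    show "2 * ?F ^ (8 * Q) * (?g i ^ (8 * Q) * u) \<in> pow_ideal q 4 2 (16 * Q)"
    proof (cases "i < 4")
      case True
      then have "?F = q i * (\<Prod>j\<in>{..<4} - {i}. q j)" by (intro prod.remove) auto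
      then have "2 * ?F ^ (8 * Q) * (?g i ^ (8 * Q) * u) = q i ^ (16 * Q) * (2 * (\<Prod>j\<in>{..<4} - {i}. q j) ^ (8 * Q) * u)"
        using True by (simp add: cubics_and_monomials_def q_def[symmetric] power_mult_distrib mult_ac flip: power_add)
      then show ?thesis using pow_ideal_gen[OF True] by metis
    next
      case False
      then have "i \<in> {4, 5, 6}" using i by auto
      from pow_ideal_mult[OF v[OF this], of u] show ?thesis by (simp add: mult_ac)
    qed
  qed
  moreover have "2 * ?F ^ (8 * Q) * ?F ^ (7 * Q) = 2 * ?F ^ (15 * Q)"
    by (simp add: mult.assoc flip: power_add)
  ultimately show ?thesis by simp
qed

lemma cubics_colon_four:
  fixes a b c A B C :: "'a::idom"
  defines "q \<equiv> cubic a b c A B C"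
  shows "\<exists>s>0. 2 * (\<Prod>i<4. q i) ^ s \<in> pow_ideal q 4 2 (\<beta> + s)"
  proof (intro exI conjI)
    let ?Q = "2 ^ \<beta> :: nat"
    show "0 < 15 * ?Q" by simp
    have b: "\<beta> \<le> ?Q" by (rule less_imp_le[OF less_exp])
    have "1 * (2 * (\<Prod>i<4. q i) ^ (15 * ?Q)) \<in> pow_ideal q 4 2 (\<beta> + 15 * ?Q)"
    proof (rule pow_ideal_minimal[OF twice_prod_pow_gain[of a b c A B C \<beta>, folded q_def]])
      show "1 * (2\<^sup>2 * w) \<in> pow_ideal q 4 2 (\<beta> + 15 * ?Q)" for w using pow_ideal_two[of 2 w] by simp
      fix i u assume i: "i < (4::nat)"
      have "16 * ?Q = (\<beta> + 15 * ?Q) + (?Q - \<beta>)" using b by simp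
      then have "1 * (q i ^ (16 * ?Q) * u) = q i ^ (\<beta> + 15 * ?Q) * (q i ^ (?Q - \<beta>) * u)"
        by (simp only: power_add mult.assoc mult_1)
      then show "1 * (q i ^ (16 * ?Q) * u) \<in> pow_ideal q 4 2 (\<beta> + 15 * ?Q)" using pow_ideal_gen[OF i] by metis
    qed
    then show "2 * (\<Prod>i<4. q i) ^ (15 * ?Q) \<in> pow_ideal q 4 2 (\<beta> + 15 * ?Q)" by simp
  qed

text \<open>Writing \<open>2 F\<^sup>s = 4 w + \<dots>\<close> and multiplying by a further power of \<open>F\<close>, the factor \<open>2\<close> of \<open>4 w\<close> is again subject to the induction hypothesis;
  each step gains one power of 2.\<close>
theorem cubics_colon:
  fixes a b c A B C :: "'a::idom"
  defines "q \<equiv> cubic a b c A B C"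
  shows "\<exists>s>0. 2 * (\<Prod>i<4. q i) ^ s \<in> pow_ideal q 4 (Suc \<alpha>) (\<beta> + s)"
proof (induction \<alpha> arbitrary: \<beta>)
  let ?F = "\<Prod>i<4. q i"
  case 0
  obtain s where s: "s > 0" "2 * ?F ^ s \<in> pow_ideal q 4 2 (\<beta> + s)" using cubics_colon_four[of a b c A B C \<beta>] unfolding q_def by blast
  have "1 * (2 * ?F ^ s) \<in> pow_ideal q 4 (Suc 0) (\<beta> + s)"
  proof (rule pow_ideal_minimal[OF s(2)])
    show "1 * (2\<^sup>2 * w) \<in> pow_ideal q 4 (Suc 0) (\<beta> + s)" for w
      using pow_ideal_two[of "Suc 0" "2 * w"] by (simp add: power2_eq_square mult.assoc)
    show "1 * (q i ^ (\<beta> + s) * u) \<in> pow_ideal q 4 (Suc 0) (\<beta> + s)" if "i < 4" for i u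
      using pow_ideal_gen[OF that, of q "\<beta> + s" u] by simp
  qed
  then show ?case using s by auto
next
  case (Suc \<alpha>)
  let ?F = "\<Prod>i<4. q i"
  have Fi: "?F ^ n * q i ^ m = q i ^ (n + m) * (\<Prod>j\<in>{..<4} - {i}. q j) ^ n" if "i < 4" for i n m
  proof -
    have "?F = q i * (\<Prod>j\<in>{..<4} - {i}. q j)" using that by (intro prod.remove) auto
    then show ?thesis by (simp add: power_mult_distrib power_add mult_ac)
  qed
  obtain s1 where s1: "s1 > 0" "2 * ?F ^ s1 \<in> pow_ideal q 4 2 (\<beta> + s1)" using cubics_colon_four[of a b c A B C \<beta>] unfolding q_def by blast
  obtain s2 where s2: "s2 > 0" "2 * ?F ^ s2 \<in> pow_ideal q 4 (Suc \<alpha>) (\<beta> + s1 + s2)" using Suc by blast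
  have "?F ^ s2 * (2 * ?F ^ s1) \<in> pow_ideal q 4 (Suc (Suc \<alpha>)) (\<beta> + (s1 + s2))"
  proof (rule pow_ideal_minimal[OF s1(2)])
    fix w
    have "2 * w * (2 * ?F ^ s2) \<in> pow_ideal q 4 (Suc (Suc \<alpha>)) (\<beta> + (s1 + s2))"
    proof (rule pow_ideal_minimal[OF s2(2)])
      show "2 * w * (2 ^ Suc \<alpha> * u) \<in> pow_ideal q 4 (Suc (Suc \<alpha>)) (\<beta> + (s1 + s2))" for u
        using pow_ideal_two[of "Suc (Suc \<alpha>)" "w * u"] by (simp add: mult_ac)
      show "2 * w * (q i ^ (\<beta> + s1 + s2) * u) \<in> pow_ideal q 4 (Suc (Suc \<alpha>)) (\<beta> + (s1 + s2))" if "i < 4" for i u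
        using pow_ideal_gen[OF that, of q "\<beta> + (s1 + s2)" "2 * w * u"] by (simp add: mult_ac add_ac)
    qed
    then show "?F ^ s2 * (2\<^sup>2 * w) \<in> pow_ideal q 4 (Suc (Suc \<alpha>)) (\<beta> + (s1 + s2))"
      by (simp add: power2_eq_square mult_ac)
  next
    fix i u assume i: "i < (4::nat)"
    have "?F ^ s2 * (q i ^ (\<beta> + s1) * u) = q i ^ (\<beta> + (s1 + s2)) * ((\<Prod>j\<in>{..<4} - {i}. q j) ^ s2 * u)"
      using Fi[OF i, of s2 "\<beta> + s1"] by (simp add: mult.assoc[symmetric] add_ac)
    then show "?F ^ s2 * (q i ^ (\<beta> + s1) * u) \<in> pow_ideal q 4 (Suc (Suc \<alpha>)) (\<beta> + (s1 + s2))"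
      using pow_ideal_gen[OF i] by metis
  qed
  then have "2 * ?F ^ (s1 + s2) \<in> pow_ideal q 4 (Suc (Suc \<alpha>)) (\<beta> + (s1 + s2))"
    by (simp add: power_add mult_ac)
  then show ?case using s1(1) by (intro exI[of _ "s1 + s2"]) auto
qed

text \<open>Explicit certificates for the six variables, found by linear algebra modulo 2.\<close>
lemma socle_monomial_annihilated:
  fixes a b c A B C :: "'a::idom"
  assumes "x \<in> {a, b, c, A, B, C}"
  shows "\<exists>w u. x * (b\<^sup>2 * c\<^sup>2 * B * C) = 2 * w + (\<Sum>i<4. cubic a b c A B C i * u i)"
proof -
  have ex: "\<exists>w u. y = 2 * w + (\<Sum>i<4. cubic a b c A B C i * u i)"
    if "y = 2 * w + cubic a b c A B C 0 * u0 + cubic a b c A B C 1 * u1 + cubic a b c A B C 2 * u2 + cubic a b c A B C 3 * u3" for y w u0 u1 u2 u3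
  proof -
    have "[u0, u1, u2, u3] ! 0 = u0" "[u0, u1, u2, u3] ! 1 = u1" "[u0, u1, u2, u3] ! 2 = u2" "[u0, u1, u2, u3] ! 3 = u3" by simp_all
    then have "y = 2 * w + (\<Sum>i<4. cubic a b c A B C i * [u0, u1, u2, u3] ! i)" by (simp only: that sum4 add.assoc)
    then show ?thesis by blast
  qed
  from assms consider "x = a" | "x = b" | "x = c" | "x = A" | "x = B" | "x = C" by blast
  then show ?thesis
  proof cases
    case 1 show ?thesis unfolding 1
      by (rule ex[of _ 0 "b*c*B*C" 0 0 0]) (unfold cubic_simps, simp add: eval_nat_numeral algebra_simps)
  next
    case 2 show ?thesis unfolding 2
      by (rule ex[of _ "-a*b^2*c^2*A*B - a*b^2*c^2*C^2 - a*b*c^3*B*C - b^2*c^3*A*C" "b*c*A*B + b*c*C^2 + c^2*B*C" "b*c^2*C" 0 "b^2*c^2"])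
        (unfold cubic_simps, simp add: eval_nat_numeral algebra_simps)
  next
    case 3 show ?thesis unfolding 3
      by (rule ex[of _ "-a*b^3*c*B*C - a*b^2*c^2*A*C - a*b^2*c^2*B^2 - b^3*c^2*A*B" "b^2*B*C + b*c*A*C + b*c*B^2" "b^2*c*B" "b^2*c^2" 0])
        (unfold cubic_simps, simp add: eval_nat_numeral algebra_simps)
  next
    case 4 show ?thesis unfolding 4
      by (rule ex[of _ "-a*b^2*c*B*C^2 - a*b*c^2*B^2*C" "b*B*C^2 + c*B^2*C" "b*c*B*C" 0 0])
        (unfold cubic_simps, simp add: eval_nat_numeral algebra_simps)
  next
    case 5 show ?thesis unfolding 5
      by (rule ex[of _ "-a*b^2*c*A*B*C - a*b*c^2*A^2*C - a*b*c^2*A*B^2 - b^2*c^2*A^2*B - b*c^3*A*B*C" "b*A*B*C + c*A^2*C" "b*c*A*B" "b*c^2*A" "b*c^2*B"])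
        (unfold cubic_simps, simp add: eval_nat_numeral algebra_simps)
  next
    case 6 show ?thesis unfolding 6
      by (rule ex[of _ "-a*b^2*c*A^2*B - a*b^2*c*A*C^2 - a*b*c^2*A*B*C - b^3*c*A*B*C - b^2*c^2*A^2*C" "b*A^2*B + c*A*B*C" "b*c*A*C" "b^2*c*C" "b^2*c*A"])
        (unfold cubic_simps, simp add: eval_nat_numeral algebra_simps)
  qed
qed

section \<open>A trace for the Frobenius map in characteristic 2\<close>

unbundle fps_syntax

text \<open>A left inverse, up to scaling, of the Frobenius map in characteristic 2: additive and linear over the squares.\<close>
definition frobenius_trace :: "('a::comm_ring_1 \<Rightarrow> 'a) \<Rightarrow> bool"
  where "frobenius_trace T \<longleftrightarrow> (\<forall>x y. T (x + y) = T x + T y) \<and> (\<forall>x y. T (x\<^sup>2 * y) = x * T y)"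

definition odd_part :: "('a \<Rightarrow> 'a) \<Rightarrow> 'a::comm_ring_1 fps \<Rightarrow> 'a fps"
  where "odd_part T f = Abs_fps (\<lambda>n. T (f $ (2 * n + 1)))"

lemma fps_square_char2:
  fixes f :: "'a::comm_ring_1 fps"
  assumes two: "(2::'a) = 0"
  shows "f\<^sup>2 $ n = (if even n then (f $ (n div 2))\<^sup>2 else 0)"
proof -
  let ?t = "\<lambda>i. f $ i * f $ (n - i)"
  have split: "(\<Sum>i=0..n. ?t i) = (\<Sum>i\<in>{i. 2 * i < n}. ?t i) + (\<Sum>i\<in>{i. i \<le> n \<and> 2 * i = n}. ?t i) + (\<Sum>i\<in>{i. i \<le> n \<and> n < 2 * i}. ?t i)"
  proof -
    have e: "{0..n} = ({i. 2 * i < n} \<union> {i. i \<le> n \<and> 2 * i = n}) \<union> {i. i \<le> n \<and> n < 2 * i}" by auto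
    have fin: "finite {i. 2 * i < n}" by (rule finite_subset[of _ "{..n}"]) auto
    have fin2: "finite {i. i \<le> n \<and> P i}" for P by (rule finite_subset[of _ "{..n}"]) auto
    show ?thesis unfolding e using fin fin2 by (subst sum.union_disjoint; auto)+
  qed
  have refl: "(\<Sum>i\<in>{i. i \<le> n \<and> n < 2 * i}. ?t i) = (\<Sum>i\<in>{i. 2 * i < n}. ?t i)"
    by (rule sum.reindex_bij_witness[of _ "\<lambda>i. n - i" "\<lambda>i. n - i"]) (auto simp: mult.commute)
  have mid: "(\<Sum>i\<in>{i. i \<le> n \<and> 2 * i = n}. ?t i) = (if even n then (f $ (n div 2))\<^sup>2 else 0)"
  proof (cases "even n")
    case True
    then have "{i. i \<le> n \<and> 2 * i = n} = {n div 2}" by auto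
    moreover have "n - n div 2 = n div 2" using True by (auto elim: evenE)
    ultimately show ?thesis using True by (simp add: power2_eq_square)
  next
    case False
    then have none: "{i. i \<le> n \<and> 2 * i = n} = {}" by auto
    show ?thesis unfolding none using False by simp
  qed
  have dbl: "x + x = 0" for x :: 'a using two by (metis mult_2 mult_zero_left)
  have "f\<^sup>2 $ n = (\<Sum>i=0..n. ?t i)" by (simp add: power2_eq_square fps_mult_nth)
  also have "\<dots> = (if even n then (f $ (n div 2))\<^sup>2 else 0)"
    unfolding split refl mid using dbl[of "\<Sum>i\<in>{i. 2 * i < n}. ?t i"] by (simp add: algebra_simps)
  finally show ?thesis .
qed

lemma frobenius_trace_sum:
  assumes "frobenius_trace T"
  shows "T 0 = 0" "T (sum h A) = (\<Sum>i\<in>A. T (h i))"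
proof -
  have add: "T (x + y) = T x + T y" for x y using assms by (simp add: frobenius_trace_def)
  show zero: "T 0 = 0" using add[of 0 0] by simp
  show "T (sum h A) = (\<Sum>i\<in>A. T (h i))"
    by (induction A rule: infinite_finite_induct) (auto simp: zero add)
qed

theorem frobenius_trace_odd_part:
  fixes T :: "'a::comm_ring_1 \<Rightarrow> 'a"
  assumes T: "frobenius_trace T" and two: "(2::'a) = 0"
  shows "frobenius_trace (odd_part T)"
  unfolding frobenius_trace_def
proof (intro conjI allI)
  have add: "T (x + y) = T x + T y" and lin: "T (x\<^sup>2 * y) = x * T y" for x y using T by (auto simp: frobenius_trace_def)
  show "odd_part T (f + g) = odd_part T f + odd_part T g" for f g
    by (rule fps_ext) (simp add: odd_part_def add)
  fix f g :: "'a fps"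
  show "odd_part T (f\<^sup>2 * g) = f * odd_part T g"
  proof (rule fps_ext)
    fix n
    have "(f\<^sup>2 * g) $ (2 * n + 1) = (\<Sum>i=0..2 * n + 1. (if even i then (f $ (i div 2))\<^sup>2 else 0) * g $ (2 * n + 1 - i))"
      by (simp only: fps_mult_nth fps_square_char2[OF two])
    also have "\<dots> = (\<Sum>i\<in>(\<lambda>i. 2 * i) ` {0..n}. (if even i then (f $ (i div 2))\<^sup>2 else 0) * g $ (2 * n + 1 - i))"
      by (rule sum.mono_neutral_right) (auto elim!: evenE)
    also have "\<dots> = (\<Sum>i=0..n. (f $ i)\<^sup>2 * g $ (2 * n + 1 - 2 * i))"
      by (subst sum.reindex) (auto simp: inj_on_def)
    also have "\<dots> = (\<Sum>i=0..n. (f $ i)\<^sup>2 * g $ (2 * (n - i) + 1))"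
      by (rule sum.cong) (auto simp: algebra_simps Suc_diff_le)
    finally have "T ((f\<^sup>2 * g) $ (2 * n + 1)) = (\<Sum>i=0..n. f $ i * T (g $ (2 * (n - i) + 1)))"
      by (simp only: frobenius_trace_sum(2)[OF T] lin)
    then show "odd_part T (f\<^sup>2 * g) $ n = (f * odd_part T g) $ n"
      by (simp add: odd_part_def fps_mult_nth)
  qed
qed

lemma odd_part_monomials:
  assumes "T 0 = 0"
  shows "odd_part T (fps_const s) = 0" "odd_part T 1 = 0" "odd_part T (fps_X * fps_const s) = fps_const (T s)"
    "odd_part T fps_X = fps_const (T 1)"
  using assms by (auto simp: odd_part_def fps_eq_iff)

text \<open>With \<open>F\<close> the product of the \<open>q\<^sub>i\<close>: applying \<open>T\<close> to \<open>F\<^sup>2\<^sup>Q\<^sup>-\<^sup>1v = (F\<^sup>Q\<^sup>-\<^sup>1)\<^sup>2 F v \<in> (q\<^sub>i\<^sup>2\<^sup>Q)\<close> gives \<open>F\<^sup>Q\<^sup>-\<^sup>1v \<in> (q\<^sub>i\<^sup>Q)\<close>, hence the claim for the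
  exponents \<open>2\<^sup>e - 1\<close>. An arbitrary exponent can be raised to one of these.\<close>
theorem trace_nonmember:
  fixes T :: "'a::comm_ring_1 \<Rightarrow> 'a" and N :: nat
  assumes T: "frobenius_trace T" and v: "T ((\<Prod>i<N. q i) * v) = v"
    and base: "\<And>u. v \<noteq> (\<Sum>i<N. q i * u i)"
  shows "(\<Prod>i<N. q i) ^ s * v \<noteq> (\<Sum>i<N. q i ^ Suc s * u i)"
proof -
  let ?F = "\<Prod>i<N. q i"
  have lin: "T (x\<^sup>2 * y) = x * T y" for x y using T by (auto simp: frobenius_trace_def)
  have pow2: "?F ^ (2 ^ e - 1) * v \<noteq> (\<Sum>i<N. q i ^ 2 ^ e * u i)" for e u
  proof (induction e arbitrary: u)
    case (Suc e)
    show ?case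
    proof
      assume e: "?F ^ (2 ^ Suc e - 1) * v = (\<Sum>i<N. q i ^ 2 ^ Suc e * u i)"
      have "(1::nat) \<le> 2 ^ e" by simp
      then have "(2::nat) ^ Suc e - 1 = 2 * (2 ^ e - 1) + 1" unfolding power_Suc by arith
      then have "?F ^ (2 ^ Suc e - 1) * v = (?F ^ (2 ^ e - 1))\<^sup>2 * (?F * v)"
        by (simp only: power_add power_mult[symmetric] mult.commute[of 2] power_one_right mult.assoc)
      moreover have "q i ^ 2 ^ Suc e * u i = (q i ^ 2 ^ e)\<^sup>2 * u i" for i
        by (simp add: power_mult[symmetric] mult.commute)
      ultimately have "T ((?F ^ (2 ^ e - 1))\<^sup>2 * (?F * v)) = T (\<Sum>i<N. (q i ^ 2 ^ e)\<^sup>2 * u i)" using e by simp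
      then have "?F ^ (2 ^ e - 1) * v = (\<Sum>i<N. q i ^ 2 ^ e * T (u i))"
        by (simp only: frobenius_trace_sum(2)[OF T] lin v)
      then show False using Suc[of "\<lambda>i. T (u i)"] by blast
    qed
  qed (use base in simp)
  show ?thesis
  proof
    assume e: "?F ^ s * v = (\<Sum>i<N. q i ^ Suc s * u i)"
    define k where "k = 2 ^ s - Suc s"
    have "Suc s \<le> 2 ^ s" using less_exp[of s] by (simp only: Suc_le_eq)
    then have k: "2 ^ s = Suc s + k" by (simp add: k_def)
    have "?F ^ (2 ^ s - 1) * v = ?F ^ k * (\<Sum>i<N. q i ^ Suc s * u i)"
      unfolding e[symmetric] k by (simp add: power_add mult_ac)
    also have "\<dots> = (\<Sum>i<N. q i ^ 2 ^ s * ((\<Prod>j\<in>{..<N} - {i}. q j) ^ k * u i))"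
      unfolding sum_distrib_left
    proof (rule sum.cong)
      fix i assume "i \<in> {..<N}"
      then have F: "?F = q i * (\<Prod>j\<in>{..<N} - {i}. q j)" by (intro prod.remove) auto
      show "?F ^ k * (q i ^ Suc s * u i) = q i ^ 2 ^ s * ((\<Prod>j\<in>{..<N} - {i}. q j) ^ k * u i)"
        unfolding k F by (simp add: power_mult_distrib power_add mult_ac)
    qed simp
    finally show False using pow2[of s "\<lambda>i. (\<Prod>j\<in>{..<N} - {i}. q j) ^ k * u i"] by blast
  qed
qed

text \<open>Power series rather than polynomials: the denominators of the localization become units, and it is not
  necessary to decompose into homogeneous parts.\<close>
type_synonym series = "bit fps fps fps fps fps fps"

definition series_vars :: "series \<times> series \<times> series \<times> series \<times> series \<times> series"
  where "series_vars = (fps_X, fps_const fps_X, fps_const (fps_const fps_X), fps_const (fps_const (fps_const fps_X)),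
    fps_const (fps_const (fps_const (fps_const fps_X))), fps_const (fps_const (fps_const (fps_const (fps_const fps_X)))))"

lemma fps_two_eq_0: "(2::'a::comm_ring_1) = 0 \<Longrightarrow> (2::'a fps) = 0"
  by (simp add: numeral_fps_const)

lemma series_two: "(2::series) = 0"
  by (intro fps_two_eq_0) simp

definition series_trace :: "series \<Rightarrow> series"
  where "series_trace = odd_part (odd_part (odd_part (odd_part (odd_part (odd_part id)))))"

lemma frobenius_trace_series: "frobenius_trace series_trace"
proof -
  have "frobenius_trace (id :: bit \<Rightarrow> bit)" by (simp add: frobenius_trace_def power2_eq_square)
  then show ?thesis unfolding series_trace_def by (intro frobenius_trace_odd_part fps_two_eq_0) simp_all
qed

text \<open>\<open>F v\<close> is a sum of products of a square with a squarefree monomial, up to \<open>4\<close> times a polynomial. The trace of a squarefree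
  monomial is 0 unless it is \<open>abcABC\<close>, so only the summand \<open>v\<^sup>2 abcABC\<close> survives.\<close>
lemma prod_socle_monomial_squares:
  fixes a b c A B C :: "'a::comm_ring_1"
  shows "(\<Prod>i<4. cubic a b c A B C i) * (b\<^sup>2 * c\<^sup>2 * B * C) =
      (a*b^2*c^2*A*B*C)\<^sup>2 * (a*A) + (a*b^3*c*B*C + a*b^2*c^2*A*C)\<^sup>2 * (c*A*B*C)
    + (a*b^2*c^2*A*B + a*b*c^3*B*C)\<^sup>2 * (b*A*B*C) + (a*b^2*c^2*A*C^2 + b^3*c^2*A*B*C)\<^sup>2 * (a*B)
    + (a*b^2*c*B*C^2 + a*b*c^2*B^2*C + b^2*c^2*A*B*C)\<^sup>2 * (a*b*c*A)
    + (b^2*c^2*B*C)\<^sup>2 * (a*b*c*A*B*C) + (a*b^2*c^2*A*B^2 + b^2*c^3*A*B*C)\<^sup>2 * (a*C)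
    + (a^2*b*c^2*A*B*C + a*b^2*c^2*B*C^2)\<^sup>2 * (b*B) + (a*b*c^2*A*B*C)\<^sup>2 * (a*b*c*C)
    + (a*b^2*c^2*B^2*C)\<^sup>2 * (b*A) + (a^2*b^2*c*A*B*C + a*b^2*c^2*B^2*C)\<^sup>2 * (c*C)
    + (a*b^2*c*A*B*C)\<^sup>2 * (a*b*c*B) + (a*b^2*c^2*B*C^2)\<^sup>2 * (c*A) + 2 * (-2*a^3*b^4*c^4*A*B^3*C^3 - 2*a^2*b^5*c^4*A^2*B^2*C^3 - 2*a^2*b^4*c^5*A^2*B^3*C^2)"
  unfolding prod4 cubic_simps by (simp add: eval_nat_numeral algebra_simps)

text \<open>The sum of the coefficients at \<open>b\<^sup>2c\<^sup>2BC\<close>, its rotations, and six further monomials. Modulo 2 it vanishes on the ideal of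
  the cubics, because each cofactor monomial contributes to an even number of them.\<close>
definition socle_functional :: "'k::comm_ring_1 fps fps fps fps fps fps \<Rightarrow> 'k"
  where "socle_functional f =
    f $ 0 $ 2 $ 2 $ 0 $ 1 $ 1 + f $ 2 $ 0 $ 2 $ 1 $ 0 $ 1 + f $ 2 $ 2 $ 0 $ 1 $ 1 $ 0
    + f $ 0 $ 1 $ 3 $ 1 $ 0 $ 1 + f $ 0 $ 3 $ 1 $ 1 $ 1 $ 0 + f $ 1 $ 0 $ 3 $ 0 $ 1 $ 1
    + f $ 1 $ 3 $ 0 $ 0 $ 1 $ 1 + f $ 3 $ 0 $ 1 $ 1 $ 1 $ 0 + f $ 3 $ 1 $ 0 $ 1 $ 0 $ 1"

lemma socle_monomial_nonmember:
  fixes u :: "nat \<Rightarrow> 'k::comm_ring_1 fps fps fps fps fps fps"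
  defines "a \<equiv> fps_X" and "b \<equiv> fps_const fps_X" and "c \<equiv> fps_const (fps_const fps_X)"
    and "A \<equiv> fps_const (fps_const (fps_const fps_X))" and "B \<equiv> fps_const (fps_const (fps_const (fps_const fps_X)))"
    and "C \<equiv> fps_const (fps_const (fps_const (fps_const (fps_const fps_X))))"
  assumes two: "(2::'k) = 0"
  shows "b\<^sup>2 * c\<^sup>2 * B * C \<noteq> (\<Sum>i<4. cubic a b c A B C i * u i)"
proof -
  have dbl: "x + x = 0" "x + (x + y) = y" for x y :: 'k
    using two by (metis mult_2 mult_zero_left, metis add.assoc add_0_left mult_2 mult_zero_left)
  have add: "socle_functional (f + g) = socle_functional f + socle_functional g" for f g :: "'k fps fps fps fps fps fps"
    by (simp only: socle_functional_def fps_add_nth ac_simps)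
  note vars = a_def b_def c_def A_def B_def C_def
  have m: "socle_functional (x * f + y * f + z * f) = 0"
    if "socle_functional (x * f) + socle_functional (y * f) + socle_functional (z * f) = 0" for x y z f :: "'k fps fps fps fps fps fps"
    using that by (simp only: add)
  have q: "socle_functional (cubic a b c A B C i * f) = 0" if i: "i < 4" for i f
  proof -
    from i consider "i = 0" | "i = 1" | "i = 2" | "i = 3" by linarith
    then show ?thesis
    proof cases
      case 1 show ?thesis unfolding 1 cubic_simps
        by (simp add: vars socle_functional_def mult.assoc dbl del: fps_const_mult)
    next
      case 2 show ?thesis unfolding 2 cubic_simps distrib_right
        by (rule m) (simp add: vars socle_functional_def mult.assoc add_ac dbl del: fps_const_mult)
    next
      case 3 show ?thesis unfolding 3 cubic_simps distrib_right
        by (rule m) (simp add: vars socle_functional_def mult.assoc add_ac dbl del: fps_const_mult)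
    next
      case 4 show ?thesis unfolding 4 cubic_simps distrib_right
        by (rule m) (simp add: vars socle_functional_def mult.assoc add_ac dbl del: fps_const_mult)
    qed
  qed
  have "socle_functional (b\<^sup>2 * c\<^sup>2 * B * C * 1) = 1"
    by (simp add: vars socle_functional_def power2_eq_square mult.assoc del: fps_const_mult mult_1_right)
  moreover have "socle_functional (\<Sum>i<4. cubic a b c A B C i * u i) = 0"
    unfolding sum4 add using q by simp
  ultimately show ?thesis by auto
qed

lemma series_nonmember:
  fixes u :: "nat \<Rightarrow> series"
  assumes "series_vars = (a, b, c, A, B, C)"
  shows "(\<Prod>i<4. cubic a b c A B C i) ^ s * (b\<^sup>2 * c\<^sup>2 * B * C) \<noteq> (\<Sum>i<4. cubic a b c A B C i ^ Suc s * u i)"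
proof (rule trace_nonmember[OF frobenius_trace_series])
  have vars: "a = fps_X" "b = fps_const fps_X" "c = fps_const (fps_const fps_X)" "A = fps_const (fps_const (fps_const fps_X))"
    "B = fps_const (fps_const (fps_const (fps_const fps_X)))" "C = fps_const (fps_const (fps_const (fps_const (fps_const fps_X))))"
    using assms by (auto simp: series_vars_def)
  have add: "series_trace (x + y) = series_trace x + series_trace y" and lin: "series_trace (x\<^sup>2 * y) = x * series_trace y" for x y
    using frobenius_trace_series by (auto simp: frobenius_trace_def)
  have dbl: "x + x = 0" for x :: series using series_two by (metis mult_2 mult_zero_left)
  have z: "odd_part id 0 = 0" "\<And>T. T 0 = 0 \<Longrightarrow> odd_part T 0 = 0" by (auto simp: odd_part_def fps_eq_iff)
  have zs: "odd_part id (0::bit fps) = 0" "odd_part (odd_part id) (0::bit fps fps) = 0"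
    "odd_part (odd_part (odd_part id)) (0::bit fps fps fps) = 0"
    "odd_part (odd_part (odd_part (odd_part id))) (0::bit fps fps fps fps) = 0"
    "odd_part (odd_part (odd_part (odd_part (odd_part id)))) (0::bit fps fps fps fps fps) = 0" by (simp_all add: z)
  have full: "series_trace (a * b * c * A * B * C) = 1"
    by (simp add: vars series_trace_def odd_part_monomials zs mult.assoc)
  have part: "series_trace (a * A) = 0" "series_trace (c * A * B * C) = 0" "series_trace (b * A * B * C) = 0"
    "series_trace (a * B) = 0" "series_trace (a * b * c * A) = 0" "series_trace (a * C) = 0" "series_trace (b * B) = 0"
    "series_trace (a * b * c * C) = 0" "series_trace (b * A) = 0" "series_trace (c * C) = 0" "series_trace (a * b * c * B) = 0"
    "series_trace (c * A) = 0"
    by (simp_all add: vars series_trace_def odd_part_monomials zs mult.assoc)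
  note prod_socle_monomial_squares[of a b c A B C]
  then have "series_trace ((\<Prod>i<4. cubic a b c A B C i) * (b\<^sup>2 * c\<^sup>2 * B * C)) = b^2*c^2*B*C"
    by (simp only: series_two add lin full part mult_zero_left mult_zero_right add_0_left add_0_right mult_1_right)
  then show "series_trace ((\<Prod>i<4. cubic a b c A B C i) * (b\<^sup>2 * c\<^sup>2 * B * C)) = b\<^sup>2 * c\<^sup>2 * B * C" by simp
  fix u
  show "b\<^sup>2 * c\<^sup>2 * B * C \<noteq> (\<Sum>i<4. cubic a b c A B C i * u i)"
    unfolding vars by (rule socle_monomial_nonmember) simp
qed

section \<open>Localization at a prime\<close>

text \<open>The ring elements of the statement are sets of natural numbers, so the ring structure has to be transported along an injection \<open>f\<close>.\<close>
definition transport_ring :: "('a::comm_ring_1 \<Rightarrow> 'b) \<Rightarrow> 'a set \<Rightarrow> 'b ring"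
  where "transport_ring f X =
    \<lparr>carrier = f ` X, monoid.mult = (\<lambda>x y. f (inv_into UNIV f x * inv_into UNIV f y)), monoid.one = f 1,
     ring.zero = f 0, ring.add = (\<lambda>x y. f (inv_into UNIV f x + inv_into UNIV f y))\<rparr>"

text \<open>Fractions with numerator in \<open>I\<close> and denominator outside \<open>p\<close>; for \<open>I = UNIV\<close> this is the localization itself.\<close>
definition extend_ideal :: "'a::idom set \<Rightarrow> 'a set \<Rightarrow> 'a fract set"
  where "extend_ideal p I = {x. \<exists>g\<in>I. \<exists>h. h \<notin> p \<and> x * to_fract h = to_fract g}"

definition tgenerated :: "'a::comm_ring_1 set \<Rightarrow> 'a set \<Rightarrow> bool"
  where "tgenerated I G \<longleftrightarrow> tideal I \<and> G \<subseteq> I \<and> (\<forall>J. tideal J \<and> G \<subseteq> J \<longrightarrow> I \<subseteq> J)"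

lemma tgeneratedD: "tgenerated I G \<Longrightarrow> tideal J \<Longrightarrow> G \<subseteq> J \<Longrightarrow> I \<subseteq> J"
  by (auto simp: tgenerated_def)

lemma tideal_UNIV [simp]: "tideal UNIV" by (simp add: tideal_def)

locale localization =
  fixes p :: "'a::idom set" and f :: "'a fract \<Rightarrow> 'b"
  assumes p: "tprime p" and f: "inj f"
begin

definition S :: "'b ring" where "S = transport_ring f (extend_ideal p UNIV)"
definition ext :: "'a set \<Rightarrow> 'b set" where "ext I = f ` extend_ideal p I"
definition incl :: "'a \<Rightarrow> 'b" where "incl g = f (to_fract g)"
definition con :: "'b set \<Rightarrow> 'a set" where "con J = {g. incl g \<in> J}"

lemma denominators: "1 \<notin> p" "h \<notin> p \<Longrightarrow> h' \<notin> p \<Longrightarrow> h * h' \<notin> p" "h \<notin> p \<Longrightarrow> to_fract h \<noteq> 0" "tideal p"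
  using p by (auto simp: tprime_def tideal_def)

lemma S_simps:
  "carrier S = f ` extend_ideal p UNIV" "\<one>\<^bsub>S\<^esub> = f 1" "\<zero>\<^bsub>S\<^esub> = f 0" "f x \<otimes>\<^bsub>S\<^esub> f y = f (x * y)" "f x \<oplus>\<^bsub>S\<^esub> f y = f (x + y)"
  using f by (simp_all add: S_def transport_ring_def)

lemma f_mem [simp]: "f x \<in> f ` Y \<longleftrightarrow> x \<in> Y" using f by (auto simp: inj_on_def)

lemma extend_add: "tideal I \<Longrightarrow> x \<in> extend_ideal p I \<Longrightarrow> y \<in> extend_ideal p I \<Longrightarrow> x + y \<in> extend_ideal p I"
proof -
  assume I: "tideal I" and "x \<in> extend_ideal p I" "y \<in> extend_ideal p I"
  then obtain g h g' h' where gh: "g \<in> I" "h \<notin> p" "x * to_fract h = to_fract g" "g' \<in> I" "h' \<notin> p" "y * to_fract h' = to_fract g'"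
    by (auto simp: extend_ideal_def)
  have "(x + y) * to_fract (h * h') = (x * to_fract h) * to_fract h' + (y * to_fract h') * to_fract h"
    by (simp add: algebra_simps)
  then have "(x + y) * to_fract (h * h') = to_fract (h' * g + h * g')" by (simp add: gh mult.commute)
  moreover have "h' * g + h * g' \<in> I" using gh by (intro tidealD[OF I])
  ultimately show ?thesis using denominators(2)[OF gh(2,5)] unfolding extend_ideal_def by blast
qed

lemma extend_mult: "tideal I \<Longrightarrow> c \<in> extend_ideal p UNIV \<Longrightarrow> x \<in> extend_ideal p I \<Longrightarrow> c * x \<in> extend_ideal p I"
proof -
  assume I: "tideal I" and "c \<in> extend_ideal p UNIV" "x \<in> extend_ideal p I"
  then obtain g h g' h' where gh: "g \<in> I" "h \<notin> p" "x * to_fract h = to_fract g" "h' \<notin> p" "c * to_fract h' = to_fract g'"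
    by (auto simp: extend_ideal_def)
  have "(c * x) * to_fract (h' * h) = (c * to_fract h') * (x * to_fract h)" by (simp add: algebra_simps)
  then have "(c * x) * to_fract (h' * h) = to_fract (g' * g)" by (simp add: gh)
  moreover have "g' * g \<in> I" using gh by (intro tidealD[OF I])
  ultimately show ?thesis using denominators(2)[OF gh(4,2)] unfolding extend_ideal_def by blast
qed

lemma extend_incl: "g \<in> I \<Longrightarrow> to_fract g \<in> extend_ideal p I"
proof -
  assume "g \<in> I"
  moreover have "to_fract g * to_fract 1 = to_fract g" by simp
  ultimately show ?thesis using denominators(1) unfolding extend_ideal_def by blast
qed

lemma extend_inverse: "h \<notin> p \<Longrightarrow> inverse (to_fract h) \<in> extend_ideal p UNIV"
proof -
  assume h: "h \<notin> p"
  then have "inverse (to_fract h) * to_fract h = to_fract 1" using denominators(3) by simp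
  then show ?thesis using h unfolding extend_ideal_def by blast
qed

lemma extend_minus: "x \<in> extend_ideal p UNIV \<Longrightarrow> - x \<in> extend_ideal p UNIV"
  using extend_mult[of UNIV "to_fract (- 1)" x] extend_incl[of "- 1" UNIV] by simp

lemma incl_simps:
  "incl g \<in> carrier S" "incl 1 = \<one>\<^bsub>S\<^esub>" "incl 0 = \<zero>\<^bsub>S\<^esub>" "incl (g * g') = incl g \<otimes>\<^bsub>S\<^esub> incl g'" "incl (g + g') = incl g \<oplus>\<^bsub>S\<^esub> incl g'"
  "incl g = incl g' \<longleftrightarrow> g = g'"
  using extend_incl[of g UNIV] f by (auto simp: incl_def S_simps inj_eq)

lemma cring_S: "cring S"
proof (rule cringI)
  note zero = extend_incl[of 0 UNIV, simplified] and one = extend_incl[of 1 UNIV, simplified]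
  show "abelian_group S"
  proof (rule abelian_groupI)
    fix x y z assume "x \<in> carrier S" "y \<in> carrier S"
    then show "x \<oplus>\<^bsub>S\<^esub> y \<in> carrier S" "x \<oplus>\<^bsub>S\<^esub> y = y \<oplus>\<^bsub>S\<^esub> x"
      by (auto simp: S_simps add.commute intro!: imageI extend_add)
    assume "z \<in> carrier S"
    then show "x \<oplus>\<^bsub>S\<^esub> y \<oplus>\<^bsub>S\<^esub> z = x \<oplus>\<^bsub>S\<^esub> (y \<oplus>\<^bsub>S\<^esub> z)"
      using \<open>x \<in> carrier S\<close> \<open>y \<in> carrier S\<close> by (auto simp: S_simps add.assoc)
  next
    fix x assume "x \<in> carrier S"
    then obtain x' where x: "x = f x'" "x' \<in> extend_ideal p UNIV" by (auto simp: S_simps)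
    show "\<zero>\<^bsub>S\<^esub> \<oplus>\<^bsub>S\<^esub> x = x" by (simp add: S_simps x)
    show "\<exists>y\<in>carrier S. y \<oplus>\<^bsub>S\<^esub> x = \<zero>\<^bsub>S\<^esub>"
      by (rule bexI[of _ "f (- x')"]) (simp_all add: S_simps x extend_minus)
  qed (simp add: S_simps zero)
  show "comm_monoid S"
  proof (rule comm_monoidI)
    fix x y z assume "x \<in> carrier S" "y \<in> carrier S"
    then show "x \<otimes>\<^bsub>S\<^esub> y \<in> carrier S" "x \<otimes>\<^bsub>S\<^esub> y = y \<otimes>\<^bsub>S\<^esub> x"
      by (auto simp: S_simps mult.commute intro!: imageI extend_mult)
    assume "z \<in> carrier S"
    then show "x \<otimes>\<^bsub>S\<^esub> y \<otimes>\<^bsub>S\<^esub> z = x \<otimes>\<^bsub>S\<^esub> (y \<otimes>\<^bsub>S\<^esub> z)"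
      using \<open>x \<in> carrier S\<close> \<open>y \<in> carrier S\<close> by (auto simp: S_simps mult.assoc)
  next
    fix x assume "x \<in> carrier S"
    then show "\<one>\<^bsub>S\<^esub> \<otimes>\<^bsub>S\<^esub> x = x" by (auto simp: S_simps)
  qed (simp add: S_simps one)
  fix x y z assume "x \<in> carrier S" "y \<in> carrier S" "z \<in> carrier S"
  then show "(x \<oplus>\<^bsub>S\<^esub> y) \<otimes>\<^bsub>S\<^esub> z = x \<otimes>\<^bsub>S\<^esub> z \<oplus>\<^bsub>S\<^esub> y \<otimes>\<^bsub>S\<^esub> z"
    by (auto simp: S_simps distrib_right)
qed

sublocale S: cring S by (rule cring_S)

lemma S_minus: "x \<in> extend_ideal p UNIV \<Longrightarrow> \<ominus>\<^bsub>S\<^esub> f x = f (- x)"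
  by (rule S.minus_equality) (auto simp: S_simps extend_minus)

lemma incl_pow: "incl (g ^ n) = incl g [^]\<^bsub>S\<^esub> n"
proof (induction n)
  case 0 show ?case by (simp add: incl_simps)
next
  case (Suc n) then show ?case by (simp only: power_Suc2 incl_simps S.nat_pow_Suc)
qed

lemma incl_of_nat: "incl (of_nat n) = [n] \<cdot>\<^bsub>S\<^esub> \<one>\<^bsub>S\<^esub>"
proof (induction n)
  case 0 show ?case by (simp add: incl_simps)
next
  case (Suc n)
  have "incl (of_nat (Suc n)) = incl (of_nat n + 1)" by (simp add: add.commute)
  then have "incl (of_nat (Suc n)) = incl (of_nat n) \<oplus>\<^bsub>S\<^esub> \<one>\<^bsub>S\<^esub>" unfolding incl_simps(5,2) .
  then show ?case by (simp add: Suc S.add.nat_pow_Suc)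
qed

lemma ideal_ext:
  assumes I: "tideal I"
  shows "ideal (ext I) S"
proof (rule idealI)
  have sub: "extend_ideal p I \<subseteq> extend_ideal p UNIV" by (auto simp: extend_ideal_def)
  show "ring S" by (rule S.ring_axioms)
  show "subgroup (ext I) (add_monoid S)"
  proof (rule subgroup.intro)
    show "ext I \<subseteq> carrier (add_monoid S)" using sub by (auto simp: ext_def S_simps)
    show "x \<otimes>\<^bsub>add_monoid S\<^esub> y \<in> ext I" if "x \<in> ext I" "y \<in> ext I" for x y
      using that I by (auto simp: ext_def S_simps intro: extend_add)
    show "\<one>\<^bsub>add_monoid S\<^esub> \<in> ext I" using extend_incl[OF tidealD(1)[OF I]] by (simp add: ext_def S_simps)
    fix x assume "x \<in> ext I"
    then obtain x' where x: "x = f x'" "x' \<in> extend_ideal p I" by (auto simp: ext_def)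
    then have "- x' \<in> extend_ideal p I" using extend_mult[OF I, of "to_fract (- 1)" x'] extend_incl[of "- 1" UNIV] by simp
    moreover have "inv\<^bsub>add_monoid S\<^esub> x = f (- x')"
      using S_minus[of x'] sub x by (auto simp: a_inv_def)
    ultimately show "inv\<^bsub>add_monoid S\<^esub> x \<in> ext I" by (simp add: ext_def)
  qed
  fix x c assume "x \<in> ext I" "c \<in> carrier S"
  then obtain x' c' where xc: "x = f x'" "x' \<in> extend_ideal p I" "c = f c'" "c' \<in> extend_ideal p UNIV"
    by (auto simp: ext_def S_simps)
  show "c \<otimes>\<^bsub>S\<^esub> x \<in> ext I" "x \<otimes>\<^bsub>S\<^esub> c \<in> ext I"
    using extend_mult[OF I xc(4,2)] by (simp_all add: ext_def S_simps xc(1,3) mult.commute[of x'])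
qed

lemma con_iff: "g \<in> con J \<longleftrightarrow> incl g \<in> J"
  by (simp add: con_def)

lemma tideal_con:
  assumes J: "ideal J S"
  shows "tideal (con J)"
proof -
  interpret J: ideal J S by fact
  show ?thesis unfolding tideal_def con_def
    by (auto simp: incl_simps J.I_l_closed)
qed

text \<open>Every ideal of a localization is extended from its contraction, because denominators are units.\<close>
lemma ext_con:
  assumes J: "ideal J S"
  shows "ext (con J) = J"
proof -
  interpret J: ideal J S by fact
  show ?thesis
  proof (intro equalityI subsetI)
    fix y assume "y \<in> ext (con J)"
    then obtain x g h where x: "y = f x" "incl g \<in> J" "h \<notin> p" "x * to_fract h = to_fract g"
      by (auto simp: ext_def extend_ideal_def con_def)
    then have "x = inverse (to_fract h) * to_fract g" using denominators(3)[of h] by (simp flip: x(4))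
    then have "y = f (inverse (to_fract h)) \<otimes>\<^bsub>S\<^esub> incl g" by (simp add: x(1) incl_def S_simps)
    moreover have "f (inverse (to_fract h)) \<in> carrier S" using extend_inverse[OF x(3)] by (simp add: S_simps)
    ultimately show "y \<in> J" using x(2) J.I_l_closed by simp
  next
    fix y assume y: "y \<in> J"
    then obtain x where x: "y = f x" "x \<in> extend_ideal p UNIV" using J.a_subset by (auto simp: S_simps)
    then obtain g h where gh: "h \<notin> p" "x * to_fract h = to_fract g" by (auto simp: extend_ideal_def)
    then have "incl g = y \<otimes>\<^bsub>S\<^esub> incl h" by (simp add: incl_def x(1) S_simps)
    then have "g \<in> con J" using J.I_r_closed[OF y incl_simps(1)] by (simp add: con_def)
    then show "y \<in> ext (con J)" using gh x(1) by (auto simp: ext_def extend_ideal_def)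
  qed
qed

lemma ext_mono: "I \<subseteq> J \<Longrightarrow> ext I \<subseteq> ext J" by (auto simp: ext_def extend_ideal_def)

lemma con_ext: "tprime q \<Longrightarrow> q \<subseteq> p \<Longrightarrow> con (ext q) = q"
proof (intro equalityI subsetI)
  assume q: "tprime q" "q \<subseteq> p"
  fix g
  show "g \<in> q \<Longrightarrow> g \<in> con (ext q)" using extend_incl by (auto simp: con_def incl_def ext_def)
  assume "g \<in> con (ext q)"
  then obtain g' h where "g' \<in> q" "h \<notin> p" "to_fract (g * h) = to_fract g'" by (auto simp: con_def incl_def ext_def extend_ideal_def)
  then have "g * h \<in> q" by (simp only: to_fract_eq_iff)
  then show "g \<in> q" using q \<open>h \<notin> p\<close> by (auto simp: tprime_def)
qed

lemma primeideal_con: "primeideal P S \<Longrightarrow> tprime (con P)"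
proof -
  assume P: "primeideal P S"
  interpret P: primeideal P S by fact
  have "incl 1 \<notin> P" using P.I_notcarr P.one_imp_carrier by (auto simp: incl_simps)
  then show ?thesis unfolding tprime_def using tideal_con[OF P.is_ideal] P.I_prime by (auto simp: con_def incl_simps)
qed

lemma primeideal_ext:
  assumes q: "tprime q" "q \<subseteq> p"
  shows "primeideal (ext q) S"
proof (rule primeidealI)
  have qi: "tideal q" using q by (simp add: tprime_def)
  show "ideal (ext q) S" by (rule ideal_ext[OF qi])
  show "cring S" by (rule cring_S)
  have "1 \<notin> con (ext q)" unfolding con_ext[OF q] using q by (simp add: tprime_def)
  then show "carrier S \<noteq> ext q" using incl_simps(1)[of 1] by (auto simp: con_def)
  fix x y assume "x \<in> carrier S" "y \<in> carrier S" and xy: "x \<otimes>\<^bsub>S\<^esub> y \<in> ext q"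
  then obtain x' y' g h g' h' where x: "x = f x'" "h \<notin> p" "x' * to_fract h = to_fract g"
    and y: "y = f y'" "h' \<notin> p" "y' * to_fract h' = to_fract g'" by (auto simp: S_simps extend_ideal_def)
  have "incl (g * g') = incl (h * h') \<otimes>\<^bsub>S\<^esub> (x \<otimes>\<^bsub>S\<^esub> y)"
    by (simp add: incl_def x(1) y(1) S_simps flip: x(3) y(3)) (simp add: mult_ac)
  then have "incl (g * g') \<in> ext q" using ideal.I_l_closed[OF ideal_ext[OF qi] xy incl_simps(1)] by simp
  then have "g * g' \<in> q" using con_ext[OF q] by (auto simp: con_def)
  then have "g \<in> q \<or> g' \<in> q" using q(1) by (auto simp: tprime_def)
  then show "x \<in> ext q \<or> y \<in> ext q" using x y by (auto simp: ext_def extend_ideal_def)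
qed

lemma ext_genideal:
  assumes G: "tgenerated I G"
  shows "ext I = genideal S (incl ` G)"
proof
  have I: "tideal I" "G \<subseteq> I" "\<And>J. tideal J \<Longrightarrow> G \<subseteq> J \<Longrightarrow> I \<subseteq> J" using G by (auto simp: tgenerated_def)
  have sub: "incl ` G \<subseteq> carrier S" by (auto simp: incl_simps)
  have "G \<subseteq> con (genideal S (incl ` G))" using S.genideal_self[OF sub] by (auto simp: con_def)
  from ext_mono[OF I(3)[OF tideal_con[OF S.genideal_ideal[OF sub]] this]]
  show "ext I \<subseteq> genideal S (incl ` G)" by (simp add: ext_con[OF S.genideal_ideal[OF sub]])
  show "genideal S (incl ` G) \<subseteq> ext I"
    using I(2) extend_incl by (intro S.genideal_minimal[OF ideal_ext[OF I(1)]]) (auto simp: ext_def incl_def)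
qed

lemma noetherian_S:
  assumes N: "tnoetherian TYPE('a)"
  shows "noetherian_ring S"
proof (rule S.noetherian_ringI)
  fix J assume J: "ideal J S"
  obtain G where "finite G" "tgenerated (con J) G"
    using N tideal_con[OF J] unfolding tnoetherian_def tgenerated_def by meson
  then show "\<exists>A\<subseteq>carrier S. finite A \<and> J = genideal S A"
    using ext_genideal[of "con J" G] ext_con[OF J] by (intro exI[of _ "incl ` G"]) (auto simp: incl_simps)
qed

text \<open>An element outside the extension of \<open>p\<close> is a fraction whose numerator is a possible denominator, hence a unit.\<close>
lemma proper_ideal_sub:
  assumes J: "ideal J S" and nsub: "\<not> J \<subseteq> ext p"
  shows "J = carrier S"
proof -
  interpret J: ideal J S by fact
  obtain y where y: "y \<in> J" "y \<notin> ext p" using nsub by blast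
  then obtain x where "y = f x" using J.a_subset by (auto simp: S_simps)
  then have x: "f x \<in> J" "x \<notin> extend_ideal p p" using y by (auto simp: ext_def)
  have "f x \<in> f ` extend_ideal p UNIV" using J.a_subset x(1) unfolding S_simps(1) by blast
  then have "x \<in> extend_ideal p UNIV" by (simp only: f_mem)
  then obtain g h where gh: "h \<notin> p" "x * to_fract h = to_fract g" by (auto simp: extend_ideal_def)
  then have g: "g \<notin> p" using x(2) by (auto simp: extend_ideal_def)
  let ?u = "to_fract h * inverse (to_fract g)"
  have "?u \<in> extend_ideal p UNIV" by (intro extend_mult extend_incl extend_inverse g) auto
  then have "f ?u \<in> carrier S" by (simp add: S_simps)
  moreover have "x * ?u = 1" using gh(2) denominators(3)[OF g] by (simp add: mult.assoc[symmetric])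
  then have "f x \<otimes>\<^bsub>S\<^esub> f ?u = \<one>\<^bsub>S\<^esub>" by (simp add: S_simps)
  ultimately show ?thesis using J.I_r_closed[OF x(1)] J.one_imp_carrier by metis
qed

lemma local_ring_S: "local_ring S (ext p)"
  unfolding local_ring_def
proof (intro conjI allI impI)
  have prime: "primeideal (ext p) S" by (rule primeideal_ext[OF p order.refl])
  interpret P: primeideal "ext p" S by fact
  show max: "maximalideal (ext p) S"
    by (rule maximalidealI[OF P.is_ideal P.I_notcarr]) (use proper_ideal_sub in blast)
  fix J assume J: "maximalideal J S"
  interpret J: maximalideal J S by fact
  have "J \<subseteq> ext p" using proper_ideal_sub[OF J.is_ideal] J.I_notcarr by blast
  then show "J = ext p" using J.I_maximal[OF P.is_ideal _ P.a_subset] P.I_notcarr by auto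
qed (rule cring_S)

text \<open>Primes of the localization contract to primes of the given ring, strictly along a chain, and the primes below \<open>p\<close> extend.\<close>
lemma krull_dim_S:
  fixes E :: "nat \<Rightarrow> nat \<Rightarrow> 'a set" and P :: "nat \<Rightarrow> 'a set"
  assumes E: "growth d E" and chain: "\<And>i. i \<le> Suc d \<Longrightarrow> tprime (P i)" "\<And>i. i < Suc d \<Longrightarrow> P i \<subset> P (Suc i)" "P (Suc d) = p"
  shows "krull_dim S = enat (Suc d)"
  unfolding krull_dim_def
proof (rule Sup_eqI)
  fix y assume "y \<in> {enat n |n. \<exists>P. (\<forall>i\<le>n. primeideal (P i) S) \<and> (\<forall>i<n. P i \<subset> P (Suc i))}"
  then obtain n Q where Q: "y = enat n" "\<And>i. i \<le> n \<Longrightarrow> primeideal (Q i) S" "\<And>i. i < n \<Longrightarrow> Q i \<subset> Q (Suc i)" by blast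
  have "n \<le> Suc d"
  proof (rule growth_chain_bound[OF E, of n "\<lambda>i. con (Q i)"])
    show "tprime (con (Q i))" if "i \<le> n" for i using Q(2)[OF that] by (rule primeideal_con)
    fix i assume i: "i < n"
    have e: "ext (con (Q i)) = Q i" "ext (con (Q (Suc i))) = Q (Suc i)"
      using i by (simp_all add: ext_con primeideal.axioms(1) Q(2))
    have "con (Q i) \<noteq> con (Q (Suc i))"
    proof
      assume "con (Q i) = con (Q (Suc i))"
      then have "ext (con (Q i)) = ext (con (Q (Suc i)))" by (rule arg_cong)
      then show False unfolding e using Q(3)[OF i] by blast
    qed
    moreover have "con (Q i) \<subseteq> con (Q (Suc i))" using Q(3)[OF i] unfolding con_def by blast
    ultimately show "con (Q i) \<subset> con (Q (Suc i))" by blast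
  qed
  then show "y \<le> enat (Suc d)" by (simp add: Q(1))
next
  fix y assume y: "\<And>z. z \<in> {enat n |n. \<exists>P. (\<forall>i\<le>n. primeideal (P i) S) \<and> (\<forall>i<n. P i \<subset> P (Suc i))} \<Longrightarrow> z \<le> y"
  have sub: "P i \<subseteq> p" if "i \<le> Suc d" for i
    using that
  proof (induction i rule: inc_induct)
    case base then show ?case by (simp add: chain(3))
  next
    case (step i) then show ?case using chain(2)[of i] by auto
  qed
  have "\<exists>P. (\<forall>i\<le>Suc d. primeideal (P i) S) \<and> (\<forall>i<Suc d. P i \<subset> P (Suc i))"
  proof (intro exI[of _ "\<lambda>i. ext (P i)"] conjI allI impI)
    show "primeideal (ext (P i)) S" if "i \<le> Suc d" for i by (rule primeideal_ext[OF chain(1)[OF that] sub[OF that]])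
    fix i assume i: "i < Suc d"
    have e: "con (ext (P i)) = P i" "con (ext (P (Suc i))) = P (Suc i)"
      using i by (simp_all add: con_ext chain(1) sub)
    have "ext (P i) \<noteq> ext (P (Suc i))"
    proof
      assume "ext (P i) = ext (P (Suc i))"
      then have "con (ext (P i)) = con (ext (P (Suc i)))" by (rule arg_cong)
      then show False unfolding e using chain(2)[OF i] by blast
    qed
    moreover have "ext (P i) \<subseteq> ext (P (Suc i))" by (rule ext_mono) (use chain(2)[OF i] in blast)
    ultimately show "ext (P i) \<subset> ext (P (Suc i))" by blast
  qed
  then show "enat (Suc d) \<le> y" by (intro y) blast
qed

end

section \<open>Polynomial rings\<close>

lemma tprime_zero: "tprime {0::'a::idom}" by (auto simp: tprime_def tideal_def)

lemma tprime_coeff_0: "tprime P \<Longrightarrow> tprime {g. coeff g 0 \<in> P}"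
  by (auto simp: tprime_def tideal_def coeff_mult_0)

definition prime_chain :: "nat \<Rightarrow> (nat \<Rightarrow> 'a::idom set) \<Rightarrow> bool"
  where "prime_chain n P \<longleftrightarrow> P 0 = {0} \<and> (\<forall>i\<le>n. tprime (P i)) \<and> (\<forall>i<n. P i \<subset> P (Suc i))"

definition poly_chain :: "(nat \<Rightarrow> 'a::idom set) \<Rightarrow> nat \<Rightarrow> 'a poly set"
  where "poly_chain P i = (case i of 0 \<Rightarrow> {0} | Suc j \<Rightarrow> {g. coeff g 0 \<in> P j})"

lemma prime_chain_poly:
  assumes P: "prime_chain n P"
  shows "prime_chain (Suc n) (poly_chain P)"
  unfolding prime_chain_def
proof (intro conjI allI impI)
  show "poly_chain P 0 = {0}" by (simp add: poly_chain_def)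
  show "tprime (poly_chain P i)" if "i \<le> Suc n" for i
    using that P by (cases i) (auto simp: poly_chain_def tprime_zero prime_chain_def intro: tprime_coeff_0)
  fix i assume i: "i < Suc n"
  show "poly_chain P i \<subset> poly_chain P (Suc i)"
  proof (cases i)
    case 0
    have "[:0, 1:] \<in> poly_chain P (Suc i)" "[:0, 1:] \<notin> poly_chain P i" "poly_chain P i \<subseteq> poly_chain P (Suc i)"
      using P by (auto simp: 0 poly_chain_def prime_chain_def)
    then show ?thesis by blast
  next
    case (Suc j)
    then have "P j \<subset> P (Suc j)" using P i by (auto simp: prime_chain_def)
    then obtain z where "z \<in> P (Suc j)" "z \<notin> P j" "P j \<subseteq> P (Suc j)" by blast
    then have "[:z:] \<in> poly_chain P (Suc i)" "[:z:] \<notin> poly_chain P i" "poly_chain P i \<subseteq> poly_chain P (Suc i)"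
      by (auto simp: Suc poly_chain_def)
    then show ?thesis by blast
  qed
qed

lemma prime_chain_int: "prime_chain 1 (\<lambda>i. if i = 0 then {0} else {k::int. even k})"
proof -
  have "(2::int) \<in> {k. even k}" "(2::int) \<notin> {0}" by auto
  then have "{0} \<subset> {k::int. even k}" by blast
  moreover have "tprime {k::int. even k}" by (auto simp: tprime_def tideal_def)
  ultimately show ?thesis by (auto simp: prime_chain_def tprime_zero)
qed

lemma tgenerated_poly:
  assumes G: "tgenerated I G"
  shows "tgenerated {g. coeff g 0 \<in> I} (insert [:0, 1:] ((\<lambda>c. [:c:]) ` G))"
  unfolding tgenerated_def
proof (intro conjI allI impI)
  have I: "tideal I" "G \<subseteq> I" "\<And>J. tideal J \<Longrightarrow> G \<subseteq> J \<Longrightarrow> I \<subseteq> J" using G by (auto simp: tgenerated_def)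
  show "tideal {g. coeff g 0 \<in> I}" using I(1) by (auto simp: tideal_def coeff_mult_0)
  show "insert [:0, 1:] ((\<lambda>c. [:c:]) ` G) \<subseteq> {g. coeff g 0 \<in> I}" using I(2) tidealD(1)[OF I(1)] by auto
  fix J assume "tideal J \<and> insert [:0, 1:] ((\<lambda>c. [:c:]) ` G) \<subseteq> J"
  then have J: "tideal J" "[:0, 1:] \<in> J" "\<And>c. c \<in> G \<Longrightarrow> [:c:] \<in> J" by auto
  have "tideal {c. [:c:] \<in> J}"
    unfolding tideal_def
  proof (intro conjI ballI allI)
    show "0 \<in> {c. [:c:] \<in> J}" using tidealD(1)[OF J(1)] by simp
    fix x assume x: "x \<in> {c. [:c:] \<in> J}"
    show "x + y \<in> {c. [:c:] \<in> J}" if "y \<in> {c. [:c:] \<in> J}" for y using tidealD(2)[OF J(1), of "[:x:]" "[:y:]"] x that by simp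
    show "c * x \<in> {c. [:c:] \<in> J}" for c using tidealD(3)[OF J(1), of "[:x:]" "[:c:]"] x by (simp add: mult.commute)
  qed
  then have IJ: "I \<subseteq> {c. [:c:] \<in> J}" using J(3) by (intro I(3)) auto
  show "{g. coeff g 0 \<in> I} \<subseteq> J"
  proof
    fix g assume g: "g \<in> {g. coeff g 0 \<in> I}"
    obtain c g' where c: "g = pCons c g'" by (cases g)
    have "g = [:c:] + g' * [:0, 1:]" by (simp add: c)
    moreover have "[:c:] \<in> J" using IJ g by (auto simp: c)
    ultimately show "g \<in> J" using tidealD(2,3)[OF J(1)] J(2) by metis
  qed
qed

lemma card_poly_generators:
  "finite G \<Longrightarrow> card (insert [:0, 1:] ((\<lambda>c. [:c:]) ` G)) = Suc (card G)" for G :: "'a::comm_ring_1 set"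
  by (subst card_insert_disjoint) (auto simp: card_image inj_on_def)

lemma tgenerated_even: "tgenerated {k::int. even k} {2}"
  by (auto simp: tgenerated_def tideal_def elim!: evenE) (metis mult.commute)

definition unital_hom :: "('a::comm_ring_1 \<Rightarrow> 'b::comm_ring_1) \<Rightarrow> bool"
  where "unital_hom \<phi> \<longleftrightarrow> \<phi> 1 = 1 \<and> (\<forall>x y. \<phi> (x + y) = \<phi> x + \<phi> y) \<and> (\<forall>x y. \<phi> (x * y) = \<phi> x * \<phi> y)"

lemma unital_homD:
  assumes "unital_hom \<phi>"
  shows "\<phi> 1 = 1" "\<phi> 0 = 0" "\<phi> (x + y) = \<phi> x + \<phi> y" "\<phi> (x * y) = \<phi> x * \<phi> y" "\<phi> (x ^ n) = \<phi> x ^ n" "\<phi> (sum h A) = (\<Sum>i\<in>A. \<phi> (h i))"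
    "\<phi> (prod h A) = (\<Prod>i\<in>A. \<phi> (h i))" "\<phi> 2 = 2"
proof -
  show one: "\<phi> 1 = 1" and add: "\<phi> (x + y) = \<phi> x + \<phi> y" and mult: "\<phi> (x * y) = \<phi> x * \<phi> y" for x y
    using assms by (auto simp: unital_hom_def)
  show zero: "\<phi> 0 = 0" using add[of 0 0] by simp
  show "\<phi> (x ^ n) = \<phi> x ^ n" by (induction n) (auto simp: one mult)
  show "\<phi> (sum h A) = (\<Sum>i\<in>A. \<phi> (h i))" by (induction A rule: infinite_finite_induct) (auto simp: zero add)
  show "\<phi> (prod h A) = (\<Prod>i\<in>A. \<phi> (h i))" by (induction A rule: infinite_finite_induct) (auto simp: one mult)
  show "\<phi> 2 = 2" using add[of 1 1] by (simp add: one)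
qed

definition to_series :: "('a \<Rightarrow> 'b) \<Rightarrow> 'a::comm_ring_1 poly \<Rightarrow> 'b::comm_ring_1 fps"
  where "to_series \<phi> g = Abs_fps (\<lambda>n. \<phi> (coeff g n))"

lemma unital_hom_to_series: "unital_hom \<phi> \<Longrightarrow> unital_hom (to_series \<phi>)"
  unfolding unital_hom_def[of "to_series \<phi>"]
  by (auto simp: to_series_def fps_eq_iff fps_one_nth fps_mult_nth coeff_mult unital_homD atMost_atLeast0)

lemma to_series_simps:
  assumes "unital_hom \<phi>"
  shows "to_series \<phi> [:0, 1:] = fps_X" "to_series \<phi> [:c:] = fps_const (\<phi> c)" "to_series \<phi> g $ 0 = \<phi> (coeff g 0)"
  using unital_homD(1,2)[OF assms] by (auto simp: to_series_def fps_eq_iff coeff_pCons split: nat.splits)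

lemma fps_unit:
  fixes g :: "'a::comm_ring_1 fps"
  shows "\<exists>z. g $ 0 * z = 1 \<Longrightarrow> \<exists>z. g * z = 1"
  using fps_right_inverse by blast

lemma unital_hom_of_int_bit: "unital_hom (of_int :: int \<Rightarrow> bit)"
  by (simp add: unital_hom_def)

lemma of_int_bit_odd: "odd k \<Longrightarrow> (of_int k :: bit) = 1"
proof -
  assume "odd k"
  then obtain m where "k = 2 * m + 1" by (elim oddE)
  then show ?thesis by (simp add: unital_homD[OF unital_hom_of_int_bit] del: of_int_add of_int_mult)
qed

section \<open>The regular local ring\<close>

type_synonym six_poly = "int poly poly poly poly poly poly"

definition const_term :: "six_poly \<Rightarrow> int"
  where "const_term g = coeff (coeff (coeff (coeff (coeff (coeff g 0) 0) 0) 0) 0) 0"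

text \<open>The prime \<open>(2, a, b, c, A, B, C)\<close>.\<close>
definition m_ideal :: "six_poly set" where "m_ideal = {g. even (const_term g)}"

definition va :: six_poly where "va = [:0, 1:]"
definition vb :: six_poly where "vb = [:[:0, 1:]:]"
definition vc :: six_poly where "vc = [:[:[:0, 1:]:]:]"
definition vA :: six_poly where "vA = [:[:[:[:0, 1:]:]:]:]"
definition vB :: six_poly where "vB = [:[:[:[:[:0, 1:]:]:]:]:]"
definition vC :: six_poly where "vC = [:[:[:[:[:[:0, 1:]:]:]:]:]:]"

definition cubic_poly :: "nat \<Rightarrow> six_poly" where "cubic_poly = cubic va vb vc vA vB vC"
definition socle_elt :: six_poly where "socle_elt = vb\<^sup>2 * vc\<^sup>2 * vB * vC"

lemma m_ideal_chain: "\<exists>P. prime_chain 7 P \<and> P 7 = m_ideal"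
proof -
  let ?P0 = "\<lambda>i::nat. if i = 0 then {0} else {k::int. even k}"
  let ?P = "poly_chain (poly_chain (poly_chain (poly_chain (poly_chain (poly_chain ?P0)))))"
  have "prime_chain (Suc (Suc (Suc (Suc (Suc (Suc 1)))))) ?P"
    by (intro prime_chain_poly prime_chain_int)
  then have "prime_chain 7 ?P" by (simp add: eval_nat_numeral)
  moreover have "?P 7 = m_ideal" by (simp add: poly_chain_def m_ideal_def const_term_def eval_nat_numeral)
  ultimately show ?thesis by blast
qed

lemma tprime_m_ideal: "tprime m_ideal"
  using m_ideal_chain by (auto simp: prime_chain_def)

lemma m_ideal_generators:
  "tgenerated m_ideal {va, vb, vc, vA, vB, vC, 2}" "card {va, vb, vc, vA, vB, vC, 2} = 7"
proof -
  let ?c = "\<lambda>G. insert [:0, 1:] ((\<lambda>c. [:c:]) ` G)"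
  have e: "?c (?c (?c (?c (?c (?c {2}))))) = {va, vb, vc, vA, vB, vC, 2}"
    by (simp add: va_def vb_def vc_def vA_def vB_def vC_def numeral_poly)
  have "tgenerated {g. coeff g 0 \<in> {g. coeff g 0 \<in> {g. coeff g 0 \<in> {g. coeff g 0 \<in> {g. coeff g 0 \<in> {g. coeff g 0 \<in> {k::int. even k}}}}}}}
      (?c (?c (?c (?c (?c (?c {2}))))))"
    by (intro tgenerated_poly tgenerated_even)
  moreover have "{g. coeff g 0 \<in> {g. coeff g 0 \<in> {g. coeff g 0 \<in> {g. coeff g 0 \<in> {g. coeff g 0 \<in> {g. coeff g 0 \<in> {k::int. even k}}}}}}} = m_ideal"
    by (simp add: m_ideal_def const_term_def)
  ultimately show "tgenerated m_ideal {va, vb, vc, vA, vB, vC, 2}" by (simp only: e)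
  have "card (?c (?c (?c (?c (?c (?c {2::int})))))) = Suc (Suc (Suc (Suc (Suc (Suc 1)))))"
    by (simp add: card_poly_generators del: image_insert image_empty)
  then show "card {va, vb, vc, vA, vB, vC, 2} = 7" by (simp only: e)
qed

text \<open>Reduction modulo 2. Evenness of the constant term is the obstruction to being a unit afterwards.\<close>
definition reduce :: "six_poly \<Rightarrow> series"
  where "reduce = to_series (to_series (to_series (to_series (to_series (to_series of_int)))))"

lemma unital_hom_reduce: "unital_hom reduce"
  unfolding reduce_def by (intro unital_hom_to_series unital_hom_of_int_bit)

lemma reduce_unit: "g \<notin> m_ideal \<Longrightarrow> \<exists>z. reduce g * z = 1"
proof -
  assume g: "g \<notin> m_ideal"
  have s: "to_series \<phi> x $ 0 = \<phi> (coeff x 0)" for \<phi> :: "'a::comm_ring_1 \<Rightarrow> 'b::comm_ring_1" and x by (simp add: to_series_def)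
  have "of_int (const_term g) * (1::bit) = 1" using g of_int_bit_odd by (simp add: m_ideal_def)
  then show ?thesis unfolding reduce_def
    by (intro fps_unit) (auto simp: s const_term_def intro!: exI[of _ "1::bit"])
qed

lemma reduce_vars: "series_vars = (reduce va, reduce vb, reduce vc, reduce vA, reduce vB, reduce vC)"
  by (simp add: series_vars_def reduce_def va_def vb_def vc_def vA_def vB_def vC_def
      to_series_simps unital_hom_to_series unital_hom_of_int_bit)

lemma reduce_cubic: "i < 4 \<Longrightarrow> reduce (cubic_poly i) = cubic (reduce va) (reduce vb) (reduce vc) (reduce vA) (reduce vB) (reduce vC) i"
  unfolding less4 by (auto simp: cubic_poly_def cubic_simps unital_homD[OF unital_hom_reduce])

text \<open>The factor \<open>h\<close> stems from the denominators of the localization.\<close>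
lemma socle_elt_nonmember:
  assumes h: "h \<notin> m_ideal"
  shows "h * ((\<Prod>i<4. cubic_poly i) ^ s * socle_elt) \<noteq> (\<Sum>i<4. cubic_poly i ^ Suc s * u i) + 2 * w"
proof
  note r = unital_homD[OF unital_hom_reduce]
  assume "h * ((\<Prod>i<4. cubic_poly i) ^ s * socle_elt) = (\<Sum>i<4. cubic_poly i ^ Suc s * u i) + 2 * w"
  then have "reduce (h * ((\<Prod>i<4. cubic_poly i) ^ s * socle_elt)) = reduce ((\<Sum>i<4. cubic_poly i ^ Suc s * u i) + 2 * w)" by simp
  then have e: "reduce h * (reduce (\<Prod>i<4. cubic_poly i) ^ s * reduce socle_elt) = (\<Sum>i<4. reduce (cubic_poly i) ^ Suc s * reduce (u i))"
    by (simp only: r(3-6,8) series_two mult_zero_left add_0_right)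
  obtain z where z: "reduce h * z = 1" using reduce_unit[OF h] by blast
  have "reduce (\<Prod>i<4. cubic_poly i) ^ s * reduce socle_elt = (reduce h * z) * (reduce (\<Prod>i<4. cubic_poly i) ^ s * reduce socle_elt)" by (simp add: z)
  also have "\<dots> = z * (\<Sum>i<4. reduce (cubic_poly i) ^ Suc s * reduce (u i))" unfolding e[symmetric] by (simp only: mult_ac)
  also have "\<dots> = (\<Sum>i<4. reduce (cubic_poly i) ^ Suc s * (z * reduce (u i)))" by (simp add: sum_distrib_left mult.left_commute)
  finally have "(\<Prod>i<4. reduce (cubic_poly i)) ^ s * reduce socle_elt = (\<Sum>i<4. reduce (cubic_poly i) ^ Suc s * (z * reduce (u i)))"
    by (simp only: r(7))
  moreover have "reduce socle_elt = (reduce vb)\<^sup>2 * (reduce vc)\<^sup>2 * reduce vB * reduce vC" by (simp add: socle_elt_def r)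
  ultimately show False
    using series_nonmember[OF reduce_vars, of s "\<lambda>i. z * reduce (u i)"] by (simp add: reduce_cubic)
qed

lemma growth_poly_ex:
  "\<exists>E :: nat \<Rightarrow> nat \<Rightarrow> 'a::comm_ring_1 set. growth d E \<Longrightarrow> \<exists>E :: nat \<Rightarrow> nat \<Rightarrow> 'a poly set. growth (Suc d) E"
  using growth_poly by blast

lemma growth_six_poly: "\<exists>E :: nat \<Rightarrow> nat \<Rightarrow> six_poly set. growth 6 E"
proof -
  have "\<exists>E :: nat \<Rightarrow> nat \<Rightarrow> int set. growth 0 E" using growth_int by blast
  then have "\<exists>E :: nat \<Rightarrow> nat \<Rightarrow> six_poly set. growth (Suc (Suc (Suc (Suc (Suc (Suc 0)))))) E"
    by (intro growth_poly_ex)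
  then show ?thesis by (simp add: eval_nat_numeral)
qed

lemma tnoetherian_six_poly: "tnoetherian TYPE(six_poly)"
  by (intro hilbert_basis tnoetherian_int)

lemma inj_poly_code: "inj (c :: 'a::zero \<Rightarrow> nat) \<Longrightarrow> \<exists>c' :: 'a poly \<Rightarrow> nat. inj c'"
proof -
  assume c: "inj c"
  have "inj (\<lambda>g. to_nat (map c (coeffs g)))"
    using c by (auto simp: inj_def coeffs_eq_iff inj_map_eq_map)
  then show ?thesis by (rule exI[of inj])
qed

text \<open>The fraction field is countable: a fraction is coded by a numerator and a denominator.\<close>
lemma inj_fract_code: "\<exists>f :: six_poly fract \<Rightarrow> nat set. inj f"
proof -
  have "inj (to_nat :: int \<Rightarrow> nat)" by simp
  from inj_poly_code[OF this] obtain c1 :: "int poly \<Rightarrow> nat" where c1: "inj c1" by blast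
  from inj_poly_code[OF this] obtain c2 :: "int poly poly \<Rightarrow> nat" where c2: "inj c2" by blast
  from inj_poly_code[OF this] obtain c3 :: "int poly poly poly \<Rightarrow> nat" where c3: "inj c3" by blast
  from inj_poly_code[OF this] obtain c4 :: "int poly poly poly poly \<Rightarrow> nat" where c4: "inj c4" by blast
  from inj_poly_code[OF this] obtain c5 :: "int poly poly poly poly poly \<Rightarrow> nat" where c5: "inj c5" by blast
  from inj_poly_code[OF this] obtain c :: "six_poly \<Rightarrow> nat" where c: "inj c" by blast
  have "\<exists>g h. x * to_fract h = to_fract g \<and> h \<noteq> 0" for x :: "six_poly fract"
  proof (cases x)
    case (Fract g h)
    then have "x * to_fract h = to_fract g \<and> h \<noteq> 0" by (simp add: to_fract_def eq_fract)
    then show ?thesis by blast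
  qed
  then obtain n d where nd: "\<And>x :: six_poly fract. x * to_fract (d x) = to_fract (n x)" "\<And>x. d x \<noteq> 0" by metis
  have "inj (\<lambda>x. {prod_encode (c (n x), c (d x))})"
  proof (rule injI)
    fix x y assume "{prod_encode (c (n x), c (d x))} = {prod_encode (c (n y), c (d y))}"
    then have e: "n x = n y" "d x = d y" using c by (auto simp: inj_eq)
    have "x * to_fract (d x) = y * to_fract (d x)" using nd(1)[of x] nd(1)[of y] e by simp
    then show "x = y" using nd(2)[of x] by simp
  qed
  then show ?thesis by blast
qed

locale example = localization m_ideal f for f :: "six_poly fract \<Rightarrow> nat set"
begin

lemma regular_S: "regular_local_ring S (ext m_ideal)"
  unfolding regular_local_ring_def
proof (intro conjI exI[of _ "incl ` {va, vb, vc, vA, vB, vC, 2}"])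
  show "noetherian_ring S" by (rule noetherian_S[OF tnoetherian_six_poly])
  show "local_ring S (ext m_ideal)" by (rule local_ring_S)
  show "incl ` {va, vb, vc, vA, vB, vC, 2} \<subseteq> carrier S" by (auto simp: incl_simps)
  show "ext m_ideal = genideal S (incl ` {va, vb, vc, vA, vB, vC, 2})"
    by (rule ext_genideal[OF m_ideal_generators(1)])
  obtain E :: "nat \<Rightarrow> nat \<Rightarrow> six_poly set" where E: "growth 6 E" using growth_six_poly by blast
  obtain P where P: "prime_chain 7 P" "P 7 = m_ideal" using m_ideal_chain by blast
  have "krull_dim S = enat (Suc 6)"
    using P by (intro krull_dim_S[OF E, of P]) (auto simp: prime_chain_def)
  moreover have "card (incl ` {va, vb, vc, vA, vB, vC, 2}) = 7"
    using m_ideal_generators(2) by (subst card_image) (auto simp: inj_on_def incl_simps)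
  ultimately show "enat (card (incl ` {va, vb, vc, vA, vB, vC, 2})) = krull_dim S" by simp
qed simp

lemma two_mem: "[(2::nat)] \<cdot>\<^bsub>S\<^esub> \<one>\<^bsub>S\<^esub> = incl 2"
  using incl_of_nat[of 2] by simp

lemma of_nat_six_poly: "of_nat n = (0::six_poly) \<longleftrightarrow> n = 0"
  by (simp add: of_nat_poly)

lemma const_term_simps: "const_term (g * h) = const_term g * const_term h" "const_term 2 = 2" "const_term 1 = 1"
  "const_term (g + h) = const_term g + const_term h" "const_term 0 = 0" "const_term (of_nat n) = int n"
  by (simp_all add: const_term_def coeff_mult_0 numeral_poly of_nat_poly)

text \<open>The square of the maximal ideal is contained in the ideal of the fractions whose numerator has a constant term divisible
  by 4, and 2 is not of this form.\<close>
lemma unramified_S: "unramified_mixed_char S (ext m_ideal) 2"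
  unfolding unramified_mixed_char_def
proof (intro conjI)
  interpret M: ideal "ext m_ideal" S using ideal_ext tprime_m_ideal by (simp add: tprime_def)
  have con: "con (ext m_ideal) = m_ideal" by (rule con_ext[OF tprime_m_ideal order.refl])
  have "[n] \<cdot>\<^bsub>S\<^esub> \<one>\<^bsub>S\<^esub> \<noteq> \<zero>\<^bsub>S\<^esub>" if "0 < n" for n :: nat
    using that incl_of_nat[of n] incl_simps(3,6) of_nat_six_poly[of n] by (metis less_irrefl)
  then show "ring_char S = 0" by (auto simp: ring_char_def)
  interpret Q: ring "S Quot ext m_ideal" by (rule M.quotient_is_ring)
  interpret q: ring_hom_ring S "S Quot ext m_ideal" "a_r_coset S (ext m_ideal)" by (rule M.rcos_ring_hom_ring)
  have Qn: "[n] \<cdot>\<^bsub>S Quot ext m_ideal\<^esub> \<one>\<^bsub>S Quot ext m_ideal\<^esub> = ext m_ideal +>\<^bsub>S\<^esub> incl (of_nat n)" for n :: nat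
  proof (induction n)
    case 0 show ?case using q.hom_zero by (simp add: incl_simps)
  next
    case (Suc n)
    have "incl (of_nat (Suc n)) = incl (of_nat n) \<oplus>\<^bsub>S\<^esub> \<one>\<^bsub>S\<^esub>"
      by (simp add: incl_simps(2)[symmetric] incl_simps(5)[symmetric] add.commute)
    then show ?case using q.hom_add[of "incl (of_nat n)" "\<one>\<^bsub>S\<^esub>"] incl_simps(1) by (simp add: Suc Q.add.nat_pow_Suc)
  qed
  have zero: "[n] \<cdot>\<^bsub>S Quot ext m_ideal\<^esub> \<one>\<^bsub>S Quot ext m_ideal\<^esub> = \<zero>\<^bsub>S Quot ext m_ideal\<^esub> \<longleftrightarrow> even n" for n :: nat
  proof -
    have "ext m_ideal +>\<^bsub>S\<^esub> incl (of_nat n) = ext m_ideal \<longleftrightarrow> incl (of_nat n) \<in> ext m_ideal"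
      using S.a_rcos_zero[OF M.is_ideal] M.rcos_const_imp_mem incl_simps(1) by metis
    also have "\<dots> \<longleftrightarrow> of_nat n \<in> con (ext m_ideal)" by (simp only: con_iff)
    also have "\<dots> \<longleftrightarrow> even n" unfolding con by (simp add: m_ideal_def const_term_simps)
    finally have e: "ext m_ideal +>\<^bsub>S\<^esub> incl (of_nat n) = ext m_ideal \<longleftrightarrow> even n" .
    have "\<zero>\<^bsub>S Quot ext m_ideal\<^esub> = ext m_ideal" unfolding FactRing_def ring_record_simps ..
    then show ?thesis unfolding Qn using e by (rule ssubst)
  qed
  have "(LEAST n::nat. 0 < n \<and> even n) = 2"
    by (rule Least_equality) (auto elim!: evenE)
  then show "ring_char (S Quot ext m_ideal) = 2"
    unfolding ring_char_def zero by (auto intro: exI[of _ 2])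
  show "0 < (2::nat)" by simp
  define q4 where "q4 = {g. 4 dvd const_term g}"
  have q4: "tideal q4" by (auto simp: tideal_def q4_def const_term_simps)
  interpret W: ideal "ext q4" S by (rule ideal_ext[OF q4])
  have "ideal_prod S (ext m_ideal) (ext m_ideal) \<subseteq> ext q4"
  proof
    fix s assume "s \<in> ideal_prod S (ext m_ideal) (ext m_ideal)"
    then show "s \<in> ext q4"
    proof (induction rule: ideal_prod.induct)
      case (prod i j)
      then obtain x y g h g' h' where i: "i = f x" "g \<in> m_ideal" "h \<notin> m_ideal" "x * to_fract h = to_fract g"
        and j: "j = f y" "g' \<in> m_ideal" "h' \<notin> m_ideal" "y * to_fract h' = to_fract g'"
        by (auto simp: ext_def extend_ideal_def)
      have "(x * y) * to_fract (h * h') = (x * to_fract h) * (y * to_fract h')" by (simp add: mult_ac)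
      then have "(x * y) * to_fract (h * h') = to_fract (g * g')" by (simp add: i j)
      moreover have "g * g' \<in> q4" using i j mult_dvd_mono[of 2 "const_term g" 2 "const_term g'"]
        by (simp add: q4_def m_ideal_def const_term_simps)
      ultimately have "x * y \<in> extend_ideal m_ideal q4"
        using denominators(2)[OF i(3) j(3)] unfolding extend_ideal_def by blast
      then show ?case by (simp add: i j S_simps ext_def)
    qed (rule W.a_closed)
  qed
  moreover have "incl 2 \<notin> ext q4"
  proof
    assume "incl 2 \<in> ext q4"
    then obtain g h where gh: "g \<in> q4" "h \<notin> m_ideal" "to_fract (2 * h) = to_fract g"
      by (auto simp: incl_def ext_def extend_ideal_def simp del: to_fract_eq_iff)
    then have "2 * h = g" by (simp only: to_fract_eq_iff)
    then have "2 * h \<in> q4" using gh(1) by simp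
    then have "4 dvd 2 * const_term h" "odd (const_term h)" using gh(2) by (simp_all add: q4_def m_ideal_def const_term_simps)
    then show False by presburger
  qed
  ultimately show "[(2::nat)] \<cdot>\<^bsub>S\<^esub> \<one>\<^bsub>S\<^esub> \<notin> ideal_prod S (ext m_ideal) (ext m_ideal)" unfolding two_mem by blast
qed

end

section \<open>The two local cohomology modules\<close>

lemma tideal_pow_ideal: "tideal (pow_ideal g N \<alpha> \<beta>)"
  unfolding tideal_def using pow_ideal_zero pow_ideal_add pow_ideal_mult by blast

lemma tideal_colon: "tideal J \<Longrightarrow> tideal {g. g * v \<in> J}"
  by (auto simp: tideal_def distrib_right mult.assoc)

lemma pideal_image:
  assumes h: "ring_hom_ring R B h" and surj: "h ` carrier R = carrier B" and R: "cring R" "cring B"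
  shows "set gs \<subseteq> carrier R \<Longrightarrow> pideal B (map h gs) n \<subseteq> h ` pideal R gs n"
proof (induction gs)
  case Nil
  interpret h: ring_hom_ring R B h by fact
  show ?case by simp
next
  case (Cons g gs)
  interpret h: ring_hom_ring R B h by fact
  interpret R: cring R by fact
  have g: "g \<in> carrier R" "set gs \<subseteq> carrier R" using Cons.prems by auto
  show ?case
  proof
    fix y assume "y \<in> pideal B (map h (g # gs)) n"
    then obtain z c where y: "y = z \<oplus>\<^bsub>B\<^esub> h g [^]\<^bsub>B\<^esub> n \<otimes>\<^bsub>B\<^esub> c" "z \<in> pideal B (map h gs) n" "c \<in> carrier B" by auto
    then obtain z' c' where z: "z = h z'" "z' \<in> pideal R gs n" "c = h c'" "c' \<in> carrier R"
      using Cons.IH[OF g(2)] surj by blast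
    have "z' \<in> carrier R" using ideal.Icarr[OF R.pideal_ideal[OF g(2)] z(2)] .
    then have "y = h (z' \<oplus>\<^bsub>R\<^esub> g [^]\<^bsub>R\<^esub> n \<otimes>\<^bsub>R\<^esub> c')" using z g(1) by (simp add: y(1) h.hom_nat_pow)
    then show "y \<in> h ` pideal R (g # gs) n" using z by auto
  qed
qed

declare pideal.simps [simp del] symbol_zero.simps [simp del]

lemma noetherian_image:
  assumes h: "ring_hom_ring R B h" and surj: "h ` carrier R = carrier B" and N: "noetherian_ring R"
  shows "noetherian_ring B"
proof -
  interpret h: ring_hom_ring R B h by fact
  interpret R: noetherian_ring R by fact
  have vimage: "ideal {r \<in> carrier R. h r \<in> J} R" if "ideal J B" for J
    using h.ideal_vimage[OF that] .
  show ?thesis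
  proof (rule h.S.noetherian_ringI)
    fix J assume J: "ideal J B"
    obtain G where G: "G \<subseteq> carrier R" "finite G" "{r \<in> carrier R. h r \<in> J} = genideal R G"
      using R.finetely_gen[OF vimage[OF J]] by blast
    have hG: "h ` G \<subseteq> carrier B" using G(1) by auto
    have GJ: "h ` G \<subseteq> J" using h.R.genideal_self[OF G(1)] unfolding G(3)[symmetric] by auto
    have "genideal R G \<subseteq> {r \<in> carrier R. h r \<in> genideal B (h ` G)}"
      using h.S.genideal_self[OF hG] G(1) by (intro h.R.genideal_minimal vimage h.S.genideal_ideal hG) auto
    then have "J \<subseteq> genideal B (h ` G)"
    proof (intro subsetI)
      fix y assume y: "y \<in> J" and s: "genideal R G \<subseteq> {r \<in> carrier R. h r \<in> genideal B (h ` G)}"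
      obtain r where r: "r \<in> carrier R" "y = h r" using surj ideal.Icarr[OF J y] by blast
      then have "r \<in> genideal R G" using y unfolding G(3)[symmetric] by simp
      then show "y \<in> genideal B (h ` G)" using s r(2) by auto
    qed
    then have "J = genideal B (h ` G)" using h.S.genideal_minimal[OF J GJ] by auto
    then show "\<exists>A\<subseteq>carrier B. finite A \<and> J = genideal B A" using hG G(2) by blast
  qed
qed

text \<open>The residue map of \<open>R/J\<close>, expressed with cosets of \<open>I\<close> in \<open>R\<close>.\<close>
lemma coset_of_coset:
  assumes R: "ring R" and I: "ideal I R" "ideal J R" "J \<subseteq> I" and s: "s \<in> carrier R"
  shows "I <+>\<^bsub>R\<^esub> (J +>\<^bsub>R\<^esub> s) = I +>\<^bsub>R\<^esub> s"
proof -
  interpret ring R by fact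
  interpret I: ideal I R by fact
  interpret J: ideal J R by fact
  show ?thesis
  proof (intro equalityI subsetI)
    fix y assume "y \<in> I <+>\<^bsub>R\<^esub> (J +>\<^bsub>R\<^esub> s)"
    then obtain x z where xz: "x \<in> I" "z \<in> J" "y = x \<oplus>\<^bsub>R\<^esub> (z \<oplus>\<^bsub>R\<^esub> s)"
      by (auto simp: set_add_def' a_r_coset_def')
    then have "y = (x \<oplus>\<^bsub>R\<^esub> z) \<oplus>\<^bsub>R\<^esub> s" using s by (simp add: a_assoc I.Icarr J.Icarr)
    moreover have "x \<oplus>\<^bsub>R\<^esub> z \<in> I" using xz I(3) by blast
    ultimately show "y \<in> I +>\<^bsub>R\<^esub> s" by (auto simp: a_r_coset_def')
  next
    fix y assume "y \<in> I +>\<^bsub>R\<^esub> s"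
    then obtain x where x: "x \<in> I" "y = x \<oplus>\<^bsub>R\<^esub> s" by (auto simp: a_r_coset_def')
    then have "y = x \<oplus>\<^bsub>R\<^esub> (\<zero>\<^bsub>R\<^esub> \<oplus>\<^bsub>R\<^esub> s)" using s by simp
    moreover have "\<zero>\<^bsub>R\<^esub> \<oplus>\<^bsub>R\<^esub> s \<in> J +>\<^bsub>R\<^esub> s" using J.zero_closed by (auto simp: a_r_coset_def')
    ultimately show "y \<in> I <+>\<^bsub>R\<^esub> (J +>\<^bsub>R\<^esub> s)" using x(1) by (auto simp: set_add_def')
  qed
qed

lemma infinite_nat_sets: "infinite (UNIV :: nat set set)" "infinite (UNIV :: nat set set set)"
  by (metis Pow_UNIV finite_Pow_iff infinite_UNIV_nat)+

context example
begin

definition "\<eta> = ext m_ideal"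
definition "cubs = map incl [cubic_poly 0, cubic_poly 1, cubic_poly 2, cubic_poly 3]"
definition "pS = cgenideal S (incl 2)"
definition "A = S Quot pS"
definition "K = S Quot \<eta>"
definition "\<pi> = a_r_coset S pS"

lemma cubs_closed: "set cubs \<subseteq> carrier S" "set (incl 2 # cubs) \<subseteq> carrier S"
  by (auto simp: cubs_def incl_simps)

lemma cubs_mem: "i < 4 \<Longrightarrow> incl (cubic_poly i) \<in> set cubs"
  unfolding less4 by (auto simp: cubs_def)

lemma lprod_cubs: "lprod S cubs = incl (\<Prod>i<4. cubic_poly i)"
proof -
  have "lprod S cubs = incl (1 * cubic_poly 3 * cubic_poly 2 * cubic_poly 1 * cubic_poly 0)"
    by (simp only: cubs_def list.map lprod.simps incl_simps)
  also have "1 * cubic_poly 3 * cubic_poly 2 * cubic_poly 1 * cubic_poly 0 = (\<Prod>i<4. cubic_poly i)" by (simp add: prod4 mult_ac)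
  finally show ?thesis .
qed

text \<open>\<open>cubics_colon\<close> supplies \<open>2 F\<^sup>s\<close>; the missing power \<open>2\<^sup>s\<^sup>-\<^sup>1\<close> raises \<open>2\<^sup>t\<^sup>+\<^sup>1\<close> to \<open>2\<^sup>t\<^sup>+\<^sup>s\<close>.\<close>
lemma symbols_vanish:
  assumes m: "m \<in> carrier S"
  shows "symbol_zero S (incl 2 # cubs) m t"
proof -
  let ?F = "\<Prod>i<4. cubic_poly i"
  obtain s where s: "s > 0" "2 * ?F ^ s \<in> pow_ideal cubic_poly 4 (Suc t) (t + s)"
    using cubics_colon[of va vb vc vA vB vC t t] unfolding cubic_poly_def by blast
  let ?I = "pideal S (incl 2 # cubs) (t + s)"
  interpret I: ideal ?I S by (rule S.pideal_ideal[OF cubs_closed(2)])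
  have tI: "tideal (con ?I)" by (rule tideal_con[OF I.is_ideal])
  have pow: "x ^ (t + s) \<in> con ?I" if "incl x \<in> set (incl 2 # cubs)" for x
    using S.pideal_pow_mem[OF cubs_closed(2) that, of "t + s"] by (simp only: con_iff incl_pow)
  obtain w u where wu: "2 * ?F ^ s = 2 ^ Suc t * w + (\<Sum>i<4. cubic_poly i ^ (t + s) * u i)"
    using s(2) unfolding pow_ideal_def by blast
  have "2 * (2 ^ (s - 1)) = (2::six_poly) ^ s" using s(1) by (cases s) auto
  then have "(?F * 2) ^ s = ?F ^ s * (2 * 2 ^ (s - 1))" by (simp only: power_mult_distrib)
  then have "(?F * 2) ^ s = 2 ^ (s - 1) * (2 * ?F ^ s)" by (simp only: mult_ac)
  also have "\<dots> = w * 2 ^ (t + s) + (\<Sum>i<4. (2 ^ (s - 1) * u i) * cubic_poly i ^ (t + s))"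
  proof -
    have "2 ^ (s - 1) * (2 ^ Suc t * w) = w * 2 ^ (t + s)"
      using s(1) by (cases s) (simp_all add: power_add mult_ac)
    then show ?thesis unfolding wu distrib_left sum_distrib_left by (simp add: mult_ac)
  qed
  also have "\<dots> \<in> con ?I"
    using pow cubs_mem by (intro tidealD(2)[OF tI] tideal_sum[OF tI] tidealD(3)[OF tI]) auto
  finally have "incl ((?F * 2) ^ s) \<in> ?I" by (simp only: con_iff)
  moreover have "lprod S (incl 2 # cubs) [^]\<^bsub>S\<^esub> s = incl ((?F * 2) ^ s)"
    by (simp only: lprod.simps lprod_cubs incl_pow incl_simps)
  ultimately have "lprod S (incl 2 # cubs) [^]\<^bsub>S\<^esub> s \<otimes>\<^bsub>S\<^esub> m \<in> ?I" using I.I_r_closed m by simp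
  then show ?thesis using S.symbol_zero_iff[OF cubs_closed(2) m] by blast
qed

lemma ideal_\<eta>: "ideal \<eta> S" and ideal_pS: "ideal pS S" and pS_sub: "pS \<subseteq> \<eta>" and two_pS: "incl 2 \<in> pS"
proof -
  show i: "ideal \<eta> S" using ideal_ext tprime_m_ideal by (simp add: tprime_def \<eta>_def)
  show "ideal pS S" unfolding pS_def by (rule S.cgenideal_ideal[OF incl_simps(1)])
  show "incl 2 \<in> pS" unfolding pS_def by (rule S.cgenideal_self[OF incl_simps(1)])
  have "2 \<in> m_ideal" by (simp add: m_ideal_def const_term_simps)
  then have "incl 2 \<in> \<eta>" using extend_incl by (auto simp: \<eta>_def ext_def incl_def)
  then show "pS \<subseteq> \<eta>" unfolding pS_def by (rule S.cgenideal_minimal[OF i])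
qed

lemma \<pi>_hom: "ring_hom_ring S A \<pi>" and \<pi>_surj: "\<pi> ` carrier S = carrier A" and cring_A: "cring A"
  and \<pi>_eq: "\<lbrakk>x \<in> carrier S; y \<in> carrier S; \<pi> x = \<pi> y\<rbrakk> \<Longrightarrow> x \<ominus>\<^bsub>S\<^esub> y \<in> pS"
  and \<pi>_zero: "x \<in> pS \<Longrightarrow> \<pi> x = \<zero>\<^bsub>A\<^esub>"
proof -
  interpret P: ideal pS S by (rule ideal_pS)
  show h: "ring_hom_ring S A \<pi>" unfolding A_def \<pi>_def by (rule P.rcos_ring_hom_ring)
  show "\<pi> ` carrier S = carrier A" by (auto simp: A_def \<pi>_def FactRing_def A_RCOSETS_def')
  show "cring A" unfolding A_def by (rule P.quotient_is_cring[OF cring_S])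
  interpret h: ring_hom_ring S A \<pi> by (rule h)
  show z: "\<pi> x = \<zero>\<^bsub>A\<^esub>" if "x \<in> pS" for x
    using S.a_rcos_zero[OF ideal_pS that] by (simp add: \<pi>_def A_def FactRing_def)
  assume xy: "x \<in> carrier S" "y \<in> carrier S" "\<pi> x = \<pi> y"
  then have "\<pi> (x \<ominus>\<^bsub>S\<^esub> y) = \<zero>\<^bsub>A\<^esub>" by (simp add: a_minus_def h.hom_a_inv h.S.r_neg)
  then have "pS +>\<^bsub>S\<^esub> (x \<ominus>\<^bsub>S\<^esub> y) = pS" by (simp add: \<pi>_def A_def FactRing_def)
  then show "x \<ominus>\<^bsub>S\<^esub> y \<in> pS" using P.rcos_const_imp_mem[of "x \<ominus>\<^bsub>S\<^esub> y"] xy by simp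
qed

text \<open>A relation over the quotient lifts to a relation modulo 2 over \<open>S\<close>, and after clearing denominators it is one between polynomials.\<close>
lemma socle_symbol_nonzero: "\<not> symbol_zero A (map \<pi> cubs) (\<pi> (incl socle_elt)) 1"
proof
  interpret h: ring_hom_ring S A \<pi> by (rule \<pi>_hom)
  interpret A: cring A by (rule cring_A)
  let ?F = "\<Prod>i<4. cubic_poly i"
  have gs: "set (map \<pi> cubs) \<subseteq> carrier A" using cubs_closed(1) by auto
  have lprod: "set gs \<subseteq> carrier S \<Longrightarrow> lprod A (map \<pi> gs) = \<pi> (lprod S gs)" for gs
    by (induction gs) (auto simp: S.lprod_closed)
  assume "symbol_zero A (map \<pi> cubs) (\<pi> (incl socle_elt)) 1"
  then obtain s where "lprod A (map \<pi> cubs) [^]\<^bsub>A\<^esub> s \<otimes>\<^bsub>A\<^esub> \<pi> (incl socle_elt) \<in> pideal A (map \<pi> cubs) (1 + s)"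
    using A.symbol_zero_iff[OF gs] h.hom_closed[OF incl_simps(1)] by blast
  moreover have "lprod A (map \<pi> cubs) [^]\<^bsub>A\<^esub> s \<otimes>\<^bsub>A\<^esub> \<pi> (incl socle_elt) = \<pi> (incl (?F ^ s * socle_elt))"
    unfolding lprod[OF cubs_closed(1)] lprod_cubs
    by (simp add: incl_simps incl_pow h.hom_nat_pow)
  ultimately obtain y where y: "y \<in> pideal S cubs (1 + s)" "\<pi> (incl (?F ^ s * socle_elt)) = \<pi> y"
    using pideal_image[OF \<pi>_hom \<pi>_surj cring_S cring_A cubs_closed(1)] by blast
  let ?I = "pow_ideal cubic_poly 4 1 (Suc s)"
  have I: "ideal (ext ?I) S" by (rule ideal_ext[OF tideal_pow_ideal])
  interpret I: ideal "ext ?I" S by (rule I)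
  have mem: "incl g \<in> ext ?I" if "g \<in> ?I" for g using extend_incl[OF that] by (auto simp: ext_def incl_def)
  have "pideal S cubs (1 + s) \<subseteq> ext ?I"
  proof (rule S.pideal_minimal[OF I])
    fix g assume "g \<in> set cubs"
    then have "g \<in> (\<lambda>i. incl (cubic_poly i)) ` {0, 1, 2, 3}" unfolding cubs_def by auto
    then obtain i where "g = incl (cubic_poly i)" "i \<in> {0, 1, 2, 3::nat}" by blast
    then have g: "g = incl (cubic_poly i)" and i: "i < 4" by auto
    then show "g [^]\<^bsub>S\<^esub> (1 + s) \<in> ext ?I"
      using mem[OF pow_ideal_gen[OF i, of cubic_poly "Suc s" 1]] by (simp only: g incl_pow[symmetric] mult_1_right plus_1_eq_Suc)
  qed
  then have yI: "y \<in> ext ?I" using y(1) by blast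
  have "pS \<subseteq> ext ?I"
    unfolding pS_def using mem[OF pow_ideal_two[of 1 1]] by (intro S.cgenideal_minimal[OF I]) simp
  moreover have yc: "y \<in> carrier S" using yI I.Icarr by blast
  ultimately have d: "incl (?F ^ s * socle_elt) \<ominus>\<^bsub>S\<^esub> y \<in> ext ?I" using \<pi>_eq[OF incl_simps(1) yc y(2)] by blast
  have "incl (?F ^ s * socle_elt) = (incl (?F ^ s * socle_elt) \<ominus>\<^bsub>S\<^esub> y) \<oplus>\<^bsub>S\<^esub> y"
    using yc incl_simps(1) by (simp add: a_minus_def S.a_assoc S.l_neg)
  then have "incl (?F ^ s * socle_elt) \<in> ext ?I" using I.a_closed[OF d yI] by simp
  then obtain g h where gh: "g \<in> ?I" "h \<notin> m_ideal" "to_fract (?F ^ s * socle_elt * h) = to_fract g"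
    by (auto simp: ext_def incl_def extend_ideal_def simp del: to_fract_eq_iff)
  then have "h * (?F ^ s * socle_elt) = g" by (simp only: to_fract_eq_iff mult.commute)
  then show False using gh(1) socle_elt_nonmember[OF gh(2), of s] by (auto simp: pow_ideal_def add.commute)
qed

text \<open>The elements \<open>g\<close> with \<open>g v \<in> (2, q\<^sub>0, \<dots>, q\<^sub>3)\<close> form an ideal, which contains the generators of the maximal ideal.\<close>
lemma socle_symbol_annihilated:
  assumes a: "a \<in> \<eta>"
  shows "symbol_zero A (map \<pi> cubs) (\<pi> a \<otimes>\<^bsub>A\<^esub> \<pi> (incl socle_elt)) 1"
proof -
  interpret h: ring_hom_ring S A \<pi> by (rule \<pi>_hom)
  interpret A: cring A by (rule cring_A)
  have gs: "set (map \<pi> cubs) \<subseteq> carrier A" using cubs_closed(1) by auto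
  let ?I = "pideal A (map \<pi> cubs) 1" and ?J = "{r \<in> carrier S. \<pi> r \<in> pideal A (map \<pi> cubs) 1}"
  interpret I: ideal ?I A by (rule A.pideal_ideal[OF gs])
  have J: "ideal ?J S" using h.ideal_vimage[OF I.is_ideal] .
  interpret J: ideal ?J S by (rule J)
  have tJ: "tideal (con ?J)" by (rule tideal_con[OF J])
  have "incl 2 \<in> ?J" using incl_simps(1) I.zero_closed by (simp only: mem_Collect_eq \<pi>_zero[OF two_pS])
  then have two: "2 \<in> con ?J" by (simp only: con_iff)
  have cubic_poly: "cubic_poly i \<in> con ?J" if "i < 4" for i
  proof -
    have "\<pi> (incl (cubic_poly i)) \<in> set (map \<pi> cubs)" unfolding set_map using cubs_mem[OF that] by (rule imageI)
    then have "\<pi> (incl (cubic_poly i)) [^]\<^bsub>A\<^esub> (1::nat) \<in> ?I" by (rule A.pideal_pow_mem[OF gs])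
    then have "\<pi> (incl (cubic_poly i)) \<in> ?I" 
      by (simp only: One_nat_def h.S.nat_pow_Suc h.S.nat_pow_0 h.S.l_one[OF h.hom_closed[OF incl_simps(1)]])
    then show ?thesis using incl_simps(1) by (simp only: con_iff mem_Collect_eq)
  qed
  have vars: "x * socle_elt \<in> con ?J" if xv: "x \<in> {va, vb, vc, vA, vB, vC}" for x
  proof -
    obtain w u where e: "x * socle_elt = 2 * w + (\<Sum>i<4. cubic_poly i * u i)"
      using socle_monomial_annihilated[OF xv] unfolding socle_elt_def cubic_poly_def by blast
    have "x * socle_elt = w * 2 + (\<Sum>i<4. u i * cubic_poly i)" unfolding e by (simp only: mult.commute)
    also have "\<dots> \<in> con ?J" 
      by (rule tidealD(2)[OF tJ tidealD(3)[OF tJ two] tideal_sum[OF tJ]], rule tidealD(3)[OF tJ], rule cubic_poly) (simp only: lessThan_iff)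
    finally show ?thesis .
  qed
  have "socle_elt * 2 \<in> con ?J" by (rule tidealD(3)[OF tJ two])
  then have "2 * socle_elt \<in> con ?J" by (simp only: mult.commute)
  then have "{va, vb, vc, vA, vB, vC, 2} \<subseteq> {g. g * socle_elt \<in> con ?J}" using vars by blast
  from tgeneratedD[OF m_ideal_generators(1) tideal_colon[OF tJ] this]
  have sub: "g * socle_elt \<in> con ?J" if "g \<in> m_ideal" for g using that by blast
  obtain x g h where x: "a = f x" "g \<in> m_ideal" "h \<notin> m_ideal" "x * to_fract h = to_fract g"
    using a by (auto simp: \<eta>_def ext_def extend_ideal_def)
  have g: "incl (g * socle_elt) \<in> ?J" using sub[OF x(2)] by (simp only: con_iff)
  have "x = inverse (to_fract h) * to_fract g" using denominators(3)[OF x(3)] by (simp flip: x(4))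
  then have e: "a \<otimes>\<^bsub>S\<^esub> incl socle_elt = f (inverse (to_fract h)) \<otimes>\<^bsub>S\<^esub> incl (g * socle_elt)" by (simp add: x(1) incl_def S_simps mult.assoc)
  have "f (inverse (to_fract h)) \<in> carrier S" using extend_inverse[OF x(3)] by (simp add: S_simps)
  then have "a \<otimes>\<^bsub>S\<^esub> incl socle_elt \<in> ?J" unfolding e by (rule J.I_l_closed[OF g])
  then have "\<pi> (a \<otimes>\<^bsub>S\<^esub> incl socle_elt) \<in> ?I" by blast
  moreover have ac: "a \<in> carrier S" using a ideal.Icarr[OF ideal_\<eta>] by blast
  ultimately have mem: "\<pi> a \<otimes>\<^bsub>A\<^esub> \<pi> (incl socle_elt) \<in> ?I" by (simp only: h.hom_mult[OF ac incl_simps(1)])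
  have c: "\<pi> a \<otimes>\<^bsub>A\<^esub> \<pi> (incl socle_elt) \<in> carrier A"
    by (rule h.S.m_closed[OF h.hom_closed[OF ac] h.hom_closed[OF incl_simps(1)]])
  have "lprod A (map \<pi> cubs) [^]\<^bsub>A\<^esub> (0::nat) \<otimes>\<^bsub>A\<^esub> (\<pi> a \<otimes>\<^bsub>A\<^esub> \<pi> (incl socle_elt)) \<in> pideal A (map \<pi> cubs) (1 + 0)"
    using mem by (simp only: h.S.nat_pow_0 h.S.l_one[OF c] add_0_right)
  then show ?thesis using A.symbol_zero_iff[OF gs c] by blast
qed

lemma field_K: "field K"
  unfolding K_def using local_ring_S maximalideal.quotient_is_field[OF _ cring_S] by (auto simp: local_ring_def \<eta>_def)

lemma K_hom: "a_r_coset S \<eta> \<in> ring_hom S K" and K_surj: "a_r_coset S \<eta> ` carrier S = carrier K"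
  using ideal.rcos_ring_hom[OF ideal_\<eta>] by (auto simp: K_def FactRing_def A_RCOSETS_def')

lemma AK: "s \<in> carrier S \<Longrightarrow> \<eta> <+>\<^bsub>S\<^esub> \<pi> s = \<eta> +>\<^bsub>S\<^esub> s"
  unfolding \<pi>_def by (rule coset_of_coset[OF S.ring_axioms ideal_\<eta> ideal_pS pS_sub])

lemma AK_hom: "(\<lambda>c. \<eta> <+>\<^bsub>S\<^esub> c) \<in> ring_hom A K" and AK_surj: "(\<lambda>c. \<eta> <+>\<^bsub>S\<^esub> c) ` carrier A = carrier K"
proof -
  interpret h: ring_hom_ring S A \<pi> by (rule \<pi>_hom)
  note m = ring_hom_closed[OF K_hom] ring_hom_mult[OF K_hom] ring_hom_add[OF K_hom] ring_hom_one[OF K_hom]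
  show "(\<lambda>c. \<eta> <+>\<^bsub>S\<^esub> c) \<in> ring_hom A K"
  proof (rule ring_hom_memI)
    fix x y assume "x \<in> carrier A" "y \<in> carrier A"
    then obtain s t where st: "x = \<pi> s" "s \<in> carrier S" "y = \<pi> t" "t \<in> carrier S" unfolding \<pi>_surj[symmetric] by blast
    show "\<eta> <+>\<^bsub>S\<^esub> x \<in> carrier K" using m(1) st by (simp add: AK)
    show "\<eta> <+>\<^bsub>S\<^esub> (x \<otimes>\<^bsub>A\<^esub> y) = (\<eta> <+>\<^bsub>S\<^esub> x) \<otimes>\<^bsub>K\<^esub> (\<eta> <+>\<^bsub>S\<^esub> y)"
      using AK[of "s \<otimes>\<^bsub>S\<^esub> t"] m(2)[of s t] st by (simp add: AK)
    show "\<eta> <+>\<^bsub>S\<^esub> (x \<oplus>\<^bsub>A\<^esub> y) = (\<eta> <+>\<^bsub>S\<^esub> x) \<oplus>\<^bsub>K\<^esub> (\<eta> <+>\<^bsub>S\<^esub> y)"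
      using AK[of "s \<oplus>\<^bsub>S\<^esub> t"] m(3)[of s t] st by (simp add: AK)
  next
    show "\<eta> <+>\<^bsub>S\<^esub> \<one>\<^bsub>A\<^esub> = \<one>\<^bsub>K\<^esub>" using AK[of "\<one>\<^bsub>S\<^esub>"] m(4) by simp
  qed
  show "(\<lambda>c. \<eta> <+>\<^bsub>S\<^esub> c) ` carrier A = carrier K"
    unfolding \<pi>_surj[symmetric] K_surj[symmetric] image_image using AK by (intro image_cong) auto
qed

definition "I = genideal S (set (incl 2 # cubs))"

text \<open>The generator 2 of \<open>I\<close> becomes zero.\<close>
lemma genideal_image: "genideal A (\<pi> ` I) = genideal A (set (map \<pi> cubs))"
proof -
  interpret h: ring_hom_ring S A \<pi> by (rule \<pi>_hom)
  have gs: "set (map \<pi> cubs) \<subseteq> carrier A" using cubs_closed(1) by auto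
  have I: "ideal I S" unfolding I_def by (rule S.genideal_ideal[OF cubs_closed(2)])
  have cI: "set (incl 2 # cubs) \<subseteq> I" unfolding I_def by (rule S.genideal_self[OF cubs_closed(2)])
  have sub: "\<pi> ` I \<subseteq> carrier A" using ideal.Icarr[OF I] by auto
  let ?G = "genideal A (set (map \<pi> cubs))"
  have G: "ideal ?G A" by (rule h.S.genideal_ideal[OF gs])
  interpret G: ideal ?G A by (rule G)
  have "I \<subseteq> {r \<in> carrier S. \<pi> r \<in> ?G}"
    unfolding I_def
  proof (rule S.genideal_minimal[OF h.ideal_vimage[OF G]])
    show "set (incl 2 # cubs) \<subseteq> {r \<in> carrier S. \<pi> r \<in> ?G}"
      using cubs_closed(2) \<pi>_zero[OF two_pS] G.zero_closed h.S.genideal_self[OF gs] by auto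
  qed
  then show ?thesis
    using cI h.S.genideal_self[OF sub]
    by (intro equalityI h.S.genideal_minimal G h.S.genideal_ideal sub) auto
qed

lemma dim_Ext_S: "dim_Ext S (a_r_coset S \<eta>) K (local_cohomology S I (self_module S) (int 5)) 0 = 0"
proof -
  obtain C :: "nat \<Rightarrow> (nat set, nat set set) module" and d rep
    where t: "top_symbols S C d (length (incl 2 # cubs)) (lprod S (incl 2 # cubs)) rep (symbol_zero S (incl 2 # cubs))"
      and lc: "local_cohomology S I (self_module S) (int (length (incl 2 # cubs))) = cohomology C d (length (incl 2 # cubs))"
    unfolding I_def
    by (rule local_cohomology_top[OF infinite_nat_sets(1) cring_S noetherian_S[OF tnoetherian_six_poly] cubs_closed(2)])
  have l: "length (incl 2 # cubs) = 5" by (simp add: cubs_def)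
  interpret T: top_symbols S C d 5 "lprod S (incl 2 # cubs)" rep "symbol_zero S (incl 2 # cubs)" using t unfolding l .
  have zero: "carrier (cohomology C d 5) = {\<zero>\<^bsub>cohomology C d 5\<^esub>}"
    by (rule T.cohomology_top_zero) (rule symbols_vanish)
  show ?thesis
    unfolding lc[unfolded l] dim_Ext_0[OF infinite_nat_sets(1) cring_S field_K K_hom K_surj inj_on_id T.cohomology_module]
    using zero by blast
qed

lemma dim_Ext_A: "dim_Ext A (\<lambda>c. \<eta> <+>\<^bsub>S\<^esub> c) K (local_cohomology A (genideal A (\<pi> ` I)) (self_module A) (int 4)) 0 \<noteq> 0"
proof -
  interpret h: ring_hom_ring S A \<pi> by (rule \<pi>_hom)
  have gs: "set (map \<pi> cubs) \<subseteq> carrier A" using cubs_closed(1) by auto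
  have NA: "noetherian_ring A" by (rule noetherian_image[OF \<pi>_hom \<pi>_surj noetherian_S[OF tnoetherian_six_poly]])
  obtain C :: "nat \<Rightarrow> (nat set set, nat set set set) module" and d rep
    where t: "top_symbols A C d (length (map \<pi> cubs)) (lprod A (map \<pi> cubs)) rep (symbol_zero A (map \<pi> cubs))"
      and lc: "local_cohomology A (genideal A (set (map \<pi> cubs))) (self_module A) (int (length (map \<pi> cubs))) = cohomology C d (length (map \<pi> cubs))"
    by (rule local_cohomology_top[OF infinite_nat_sets(2) cring_A NA gs])
  have l: "length (map \<pi> cubs) = 4" by (simp add: cubs_def)
  interpret T: top_symbols A C d 4 "lprod A (map \<pi> cubs)" rep "symbol_zero A (map \<pi> cubs)" using t unfolding l .
  let ?k = "{a \<in> carrier A. \<eta> <+>\<^bsub>S\<^esub> a = \<zero>\<^bsub>K\<^esub>}"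
  have "symbol_zero A (map \<pi> cubs) (a \<otimes>\<^bsub>A\<^esub> \<pi> (incl socle_elt)) 1" if "a \<in> ?k" for a
  proof -
    have a: "a \<in> carrier A" "\<eta> <+>\<^bsub>S\<^esub> a = \<zero>\<^bsub>K\<^esub>" using that by blast+
    then have "a \<in> \<pi> ` carrier S" by (simp only: \<pi>_surj)
    then obtain s where s: "s \<in> carrier S" "a = \<pi> s" by blast
    have "\<zero>\<^bsub>K\<^esub> = \<eta>" unfolding K_def FactRing_def ring_record_simps ..
    then have "\<eta> +>\<^bsub>S\<^esub> s = \<eta>" using a(2) AK[OF s(1)] unfolding s(2) by metis
    then have "s \<in> \<eta>" using ideal.rcos_const_imp_mem[OF ideal_\<eta> s(1)] by simp
    then show ?thesis unfolding s(2) by (rule socle_symbol_annihilated)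
  qed
  then have "\<exists>u\<in>carrier (cohomology C d 4). u \<noteq> \<zero>\<^bsub>cohomology C d 4\<^esub> \<and> (\<forall>a\<in>?k. a \<odot>\<^bsub>cohomology C d 4\<^esub> u = \<zero>\<^bsub>cohomology C d 4\<^esub>)"
    using h.hom_closed[OF incl_simps(1)] socle_symbol_nonzero by (intro T.cohomology_top_socle[of "\<pi> (incl socle_elt)" 1]) auto
  moreover have inj: "inj_on (\<lambda>x. {x}) (carrier K)" by (simp add: inj_on_def)
  ultimately show ?thesis
    unfolding genideal_image lc[unfolded l] dim_Ext_0[OF infinite_nat_sets(2) cring_A field_K AK_hom AK_surj inj T.cohomology_module]
    by blast
qed

end

theorem theorem6p10:
  shows "\<exists>(S :: ring_elt ring) \<eta> p I.
    regular_local_ring S \<eta> \<and> unramified_mixed_char S \<eta> p \<and>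
    ideal I S \<and> [p] \<cdot>\<^bsub>S\<^esub> \<one>\<^bsub>S\<^esub> \<in> I \<and>
    (let K = S Quot \<eta>;
         pS = cgenideal S ([p] \<cdot>\<^bsub>S\<^esub> \<one>\<^bsub>S\<^esub>);
         A = S Quot pS;
         IA = genideal A ((\<lambda>s. pS +>\<^bsub>S\<^esub> s) ` I)
     in \<exists>i j :: nat.
          dim_Ext S (\<lambda>s. \<eta> +>\<^bsub>S\<^esub> s) K (local_cohomology S I (self_module S) (int i)) j \<noteq>
          dim_Ext A (\<lambda>c. \<eta> <+>\<^bsub>S\<^esub> c) K (local_cohomology A IA (self_module A) (int i - 1)) j)"
proof -
  obtain f :: "six_poly fract \<Rightarrow> nat set" where "inj f" using inj_fract_code by blast
  then interpret example f
    by (intro example.intro localization.intro tprime_m_ideal)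
  have I: "ideal I S" "incl 2 \<in> I"
    unfolding I_def using S.genideal_ideal[OF cubs_closed(2)] S.genideal_self[OF cubs_closed(2)] by auto
  show ?thesis
  proof (rule exI[of _ S], rule exI[of _ \<eta>], rule exI[of _ 2], rule exI[of _ I], unfold Let_def two_mem, intro conjI)
    show "regular_local_ring S \<eta>" unfolding \<eta>_def by (rule regular_S)
    show "unramified_mixed_char S \<eta> 2" unfolding \<eta>_def by (rule unramified_S)
    show "ideal I S" "incl 2 \<in> I" by (fact I)+
    have four: "int 5 - 1 = int 4" by simp
    show "\<exists>i j :: nat.
          dim_Ext S (\<lambda>s. \<eta> +>\<^bsub>S\<^esub> s) (S Quot \<eta>) (local_cohomology S I (self_module S) (int i)) j \<noteq>
          dim_Ext (S Quot cgenideal S (incl 2)) (\<lambda>c. \<eta> <+>\<^bsub>S\<^esub> c) (S Quot \<eta>)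
            (local_cohomology (S Quot cgenideal S (incl 2))
              (genideal (S Quot cgenideal S (incl 2)) ((\<lambda>s. cgenideal S (incl 2) +>\<^bsub>S\<^esub> s) ` I))
              (self_module (S Quot cgenideal S (incl 2))) (int i - 1)) j"
    proof (rule exI[of _ 5], rule exI[of _ 0])
      show "dim_Ext S (\<lambda>s. \<eta> +>\<^bsub>S\<^esub> s) (S Quot \<eta>) (local_cohomology S I (self_module S) (int 5)) 0 \<noteq>
          dim_Ext (S Quot cgenideal S (incl 2)) (\<lambda>c. \<eta> <+>\<^bsub>S\<^esub> c) (S Quot \<eta>)
            (local_cohomology (S Quot cgenideal S (incl 2))
              (genideal (S Quot cgenideal S (incl 2)) ((\<lambda>s. cgenideal S (incl 2) +>\<^bsub>S\<^esub> s) ` I))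
              (self_module (S Quot cgenideal S (incl 2))) (int 5 - 1)) 0"
        unfolding four using dim_Ext_S dim_Ext_A unfolding A_def K_def \<pi>_def pS_def by metis
    qed
  qed
qed

end
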